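(* Let $\mathbb{k}$ be a field, $S = \mathbb{k}[x_0,\ldots,x_r]$ be a (standard graded) polynomial ring, $>$ be a monomial order on $S$, and $R = S[t]$. Let $I \subset S$ be a homogeneous ideal and assume that the initial ideal $\mathrm{in}_>(I)$ is square-free. Let $\hom_\omega(I) \subset R$ be a homogenization with special fiber equal to $\mathrm{in}_>(I)$ (where $\omega\in\mathbb{Z}_+^{r+1}$ is a weight vector with $\mathrm{in}_\omega(I)=\mathrm{in}_>(I)$). Let $Z \subset \mathbb{P}_{\mathbb{k}}^r$ be the closed subscheme given by $Z = \mathrm{Proj}(S/I)$. Let $\mathbf{h} = (h_0,\ldots,h_{r})$ be the tuple of functions $\mathbb{Z}\to\mathbb{N}$ given by $h_i(\nu) := \dim_{\mathbb{k}} \left(\mathrm{H}^i(Z, \mathcal{O}_Z(\nu))\right)$. For each $\alpha \in \mathbb{k}$, let $Z_\alpha \subset \mathbb{P}_{\mathbb{k}}^r$ be the closed subscheme given by $$Z_\alpha = \mathrm{Proj}\left(R/\hom_\omega(I) \otimes_{\mathbb{k}[t]} \mathbb{k}[t]/(t-\alpha)\right).$$ Then $Z_\alpha$ corresponds with a point in $\mathrm{Fib}_{\mathbb{P}_{\mathbb{k}}^{r}/\mathbb{k}}^{\mathbf{h}}$ for all $\alpha \in \mathbb{k}$.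
   Context: For a weight vector $\omega=(\omega_0,\ldots,\omega_r)\in\mathbb{Z}_+^{r+1}$, the $\omega$-degree of a monomial $x_0^{\alpha_0}\cdots x_r^{\alpha_r}$ is $\alpha_0\omega_0+\cdots+\alpha_r\omega_r$. For $f=\sum_j\lambda_j\mathbf{x}^{\alpha_j}\in S$ (with nonzero $\lambda_j\in\mathbb{k}$ and distinct monomials), $\deg_\omega(f)$ is the maximum $\omega$-degree of its terms, $\mathrm{in}_\omega(f)$ is the sum of its terms of maximal $\omega$-degree, and $\hom_\omega(f)=\sum_j\lambda_j\mathbf{x}^{\alpha_j}t^{\deg_\omega(f)-\deg_\omega(\mathbf{x}^{\alpha_j})}\in R$. For an ideal $I\subset S$, $\mathrm{in}_\omega(I)$ (resp. $\hom_\omega(I)\subset R$) is the ideal generated by $\mathrm{in}_\omega(f)$ (resp. $\hom_\omega(f)$) for all $f\in I$. A weight vector with $\mathrm{in}_\omega(I)=\mathrm{in}_>(I)$ always exists, and then the special fiber is $R/\hom_\omega(I)\otimes_{\mathbb{k}[t]}\mathbb{k}[t]/(t)\cong S/\mathrm{in}_>(I)$. The ring $R$ is graded with $\deg(x_i)=1$, $\deg(t)=0$ when taking $\mathrm{Proj}$. For a tuple $\mathbf{h}=(h_0,\ldots,h_r)$ of functions $\mathbb{Z}\to\mathbb{N}$ with $\sum_i(-1)^ih_i$ a numerical polynomial, the fiber-full scheme $\mathrm{Fib}^{\mathbf{h}}_{\mathbb{P}^r_{\mathbb{k}}/\mathbb{k}}$ is the $\mathbb{k}$-scheme representing the functor that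 sends a locally Noetherian $\mathbb{k}$-scheme $T$ to the set of closed subschemes $Y\subset\mathbb{P}^r_T$ such that, with $f_{(T)}:\mathbb{P}^r_T\to T$ the projection, $R^if_{(T)*}(\mathcal{O}_Y(\nu))$ is locally free over $T$ and $\dim_{\kappa(t)}\mathrm{H}^i(Y_t,\mathcal{O}_{Y_t}(\nu))=h_i(\nu)$ for all $0\le i\le r$, $\nu\in\mathbb{Z}$, $t\in T$ (with $Y_t$ the fiber over $t$ and $\kappa(t)$ its residue field). *)

theory Defs
  imports
    "HOL-Library.Poly_Mapping"
    "HOL-Library.FuncSet"
    "HOL-Library.Cardinality"
    "HOL-Computational_Algebra.Polynomial"
    "HOL-Analysis.Abstract_Topology"
    "HOL-Algebra.Module"
begin

section \<open>Polynomial rings, ideals and gradings\<close>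

text \<open>
  The polynomial ring \<open>S = k[x\<^sub>0, \<dots>, x\<^sub>r]\<close> is the monoid algebra of the monomials
  \<^typ>\<open>'n \<Rightarrow>\<^sub>0 nat\<close> over the field \<^typ>\<open>'k\<close>; the variables are indexed by a finite type
  \<^typ>\<open>'n\<close> with \<open>CARD('n) = r + 1\<close>.  The ring \<open>R = S[t]\<close> is the type of univariate polynomials
  over \<open>S\<close>.
\<close>

type_synonym 'n mon = "'n \<Rightarrow>\<^sub>0 nat"
type_synonym ('n, 'k) mpol = "'n mon \<Rightarrow>\<^sub>0 'k"

abbreviation ideal_gen :: "'a::comm_ring_1 set \<Rightarrow> 'a set"
  where "ideal_gen \<equiv> Modules.module.span (*)"

abbreviation is_ideal :: "'a::comm_ring_1 set \<Rightarrow> bool"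
  where "is_ideal \<equiv> Modules.module.subspace (*)"

definition prime_ideal :: "'a::comm_ring_1 set \<Rightarrow> bool"
  where "prime_ideal P \<longleftrightarrow>
    is_ideal P \<and> 1 \<notin> P \<and> (\<forall>a b. a * b \<in> P \<longrightarrow> a \<in> P \<or> b \<in> P)"

abbreviation const_pol :: "'k::zero \<Rightarrow> ('n, 'k) mpol"
  where "const_pol c \<equiv> Poly_Mapping.single 0 c"

definition mon_weight :: "('n::finite \<Rightarrow> nat) \<Rightarrow> 'n mon \<Rightarrow> nat"
  where "mon_weight w m = (\<Sum>i\<in>UNIV. w i * Poly_Mapping.lookup m i)"

abbreviation mon_degree :: "'n::finite mon \<Rightarrow> nat"
  where "mon_degree \<equiv> mon_weight (\<lambda>_. 1)"

text \<open>Degrees are integers, so that the only form of negative degree is \<open>0\<close>.\<close>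

definition homogeneous :: "int \<Rightarrow> ('n::finite, 'k::zero) mpol \<Rightarrow> bool"
  where "homogeneous e f \<longleftrightarrow> (\<forall>m\<in>Poly_Mapping.keys f. int (mon_degree m) = e)"

definition homogeneous_ideal :: "('n::finite, 'k::field) mpol set \<Rightarrow> bool"
  where "homogeneous_ideal J \<longleftrightarrow> (\<exists>G. (\<forall>g\<in>G. \<exists>e. homogeneous e g) \<and> J = ideal_gen G)"

definition irrelevant_ideal :: "('n, 'k::field) mpol set"
  where "irrelevant_ideal = {f. Poly_Mapping.lookup f 0 = 0}"


section \<open>Initial ideals and homogenizations\<close>

definition monomial_order :: "('n mon \<Rightarrow> 'n mon \<Rightarrow> bool) \<Rightarrow> bool"
  where "monomial_order mle \<longleftrightarrow>
    class.linorder mle (\<lambda>a b. mle a b \<and> a \<noteq> b) \<and>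
    (\<forall>a. mle 0 a) \<and> (\<forall>a b c. mle a b \<longrightarrow> mle (a + c) (b + c))"

definition initial_ideal ::
    "('n mon \<Rightarrow> 'n mon \<Rightarrow> bool) \<Rightarrow> ('n, 'k::field) mpol set \<Rightarrow> ('n, 'k) mpol set"
  where "initial_ideal mle I = ideal_gen
    {Poly_Mapping.single m (Poly_Mapping.lookup f m) | f m. f \<in> I \<and> m \<in> Poly_Mapping.keys f \<and> (\<forall>m'\<in>Poly_Mapping.keys f. mle m' m)}"

definition squarefree_monomial_ideal :: "('n, 'k::field) mpol set \<Rightarrow> bool"
  where "squarefree_monomial_ideal J \<longleftrightarrow>
    (\<exists>M :: 'n mon set. (\<forall>m\<in>M. \<forall>i. Poly_Mapping.lookup m i \<le> 1) \<and>
       J = ideal_gen ((\<lambda>m. Poly_Mapping.single m 1) ` M))"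

text \<open>
  The \<open>\<omega>\<close>-degree is only meaningful for nonzero \<open>f\<close>; for \<open>f = 0\<close> the two sums below are empty.
\<close>

definition weight_degree :: "('n::finite \<Rightarrow> nat) \<Rightarrow> ('n, 'k::zero) mpol \<Rightarrow> nat"
  where "weight_degree w f = Max (mon_weight w ` Poly_Mapping.keys f)"

definition weight_initial_form ::
    "('n::finite \<Rightarrow> nat) \<Rightarrow> ('n, 'k::field) mpol \<Rightarrow> ('n, 'k) mpol"
  where "weight_initial_form w f =
    (\<Sum>m\<in>{m \<in> Poly_Mapping.keys f. mon_weight w m = weight_degree w f}. Poly_Mapping.single m (Poly_Mapping.lookup f m))"

definition weight_initial_ideal ::
    "('n::finite \<Rightarrow> nat) \<Rightarrow> ('n, 'k::field) mpol set \<Rightarrow> ('n, 'k) mpol set"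
  where "weight_initial_ideal w I = ideal_gen (weight_initial_form w ` I)"

definition weight_homogenization ::
    "('n::finite \<Rightarrow> nat) \<Rightarrow> ('n, 'k::field) mpol \<Rightarrow> ('n, 'k) mpol poly"
  where "weight_homogenization w f =
    (\<Sum>m\<in>Poly_Mapping.keys f. Polynomial.monom (Poly_Mapping.single m (Poly_Mapping.lookup f m))
                     (weight_degree w f - mon_weight w m))"

definition hom_ideal ::
    "('n::finite \<Rightarrow> nat) \<Rightarrow> ('n, 'k::field) mpol set \<Rightarrow> ('n, 'k) mpol poly set"
  where "hom_ideal w I = ideal_gen (weight_homogenization w ` I)"

text \<open>
  \<open>R/hom\<^sub>\<omega>(I) \<otimes>\<^bsub>k[t]\<^esub> k[t]/(t - \<alpha>)\<close> is the quotient \<open>R/(hom\<^sub>\<omega>(I) + (t - \<alpha>))\<close>.  The inclusion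
  \<open>S \<subseteq> R\<close> maps onto it, and the kernel of this surjection is the homogeneous ideal of \<open>S\<close> that
  cuts out \<open>Z\<^sub>\<alpha>\<close> in projective space.
\<close>

definition fiber_ideal ::
    "('n::finite \<Rightarrow> nat) \<Rightarrow> ('n, 'k::field) mpol set \<Rightarrow> 'k \<Rightarrow> ('n, 'k) mpol set"
  where "fiber_ideal w I \<alpha> =
    {f. [:f:] \<in> ideal_gen (hom_ideal w I \<union> {[:- const_pol \<alpha>, 1:]})}"


section \<open>Sheaves of vector spaces and their cohomology\<close>

definition scalar_ring :: "'k::field ring"
  where "scalar_ring = \<lparr>carrier = UNIV, mult = (*), one = 1, zero = 0, add = (+)\<rparr>"

definition linear_hom ::
    "('k::field, 'a) module \<Rightarrow> ('k, 'b) module \<Rightarrow> ('a \<Rightarrow> 'b) \<Rightarrow> bool"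
  where "linear_hom M N \<phi> \<longleftrightarrow>
    \<phi> \<in> carrier M \<rightarrow> carrier N \<and>
    (\<forall>x\<in>carrier M. \<forall>y\<in>carrier M. \<phi> (x \<oplus>\<^bsub>M\<^esub> y) = \<phi> x \<oplus>\<^bsub>N\<^esub> \<phi> y) \<and>
    (\<forall>c. \<forall>x\<in>carrier M. \<phi> (c \<odot>\<^bsub>M\<^esub> x) = c \<odot>\<^bsub>N\<^esub> \<phi> x)"

record ('p, 'k, 'v) sheaf_data =
  sections :: "'p set \<Rightarrow> ('k, 'v) module"
  restr :: "'p set \<Rightarrow> 'p set \<Rightarrow> 'v \<Rightarrow> 'v"

definition presheaf :: "'p topology \<Rightarrow> ('p, 'k::field, 'v) sheaf_data \<Rightarrow> bool"
  where "presheaf X F \<longleftrightarrow>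
    (\<forall>U. openin X U \<longrightarrow> Module.module scalar_ring (sections F U)) \<and>
    (\<forall>U V. openin X U \<and> openin X V \<and> V \<subseteq> U \<longrightarrow>
       linear_hom (sections F U) (sections F V) (restr F U V)) \<and>
    (\<forall>U. openin X U \<longrightarrow> (\<forall>s\<in>carrier (sections F U). restr F U U s = s)) \<and>
    (\<forall>U V W. openin X U \<and> openin X V \<and> openin X W \<and> W \<subseteq> V \<and> V \<subseteq> U \<longrightarrow>
       (\<forall>s\<in>carrier (sections F U). restr F V W (restr F U V s) = restr F U W s))"

definition sheaf :: "'p topology \<Rightarrow> ('p, 'k::field, 'v) sheaf_data \<Rightarrow> bool"
  where "sheaf X F \<longleftrightarrow> presheaf X F \<and>
    (\<forall>\<U> s. (\<forall>V\<in>\<U>. openin X V \<and> s V \<in> carrier (sections F V)) \<and>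
       (\<forall>V\<in>\<U>. \<forall>W\<in>\<U>. restr F V (V \<inter> W) (s V) = restr F W (V \<inter> W) (s W)) \<longrightarrow>
       (\<exists>!a. a \<in> carrier (sections F (\<Union>\<U>)) \<and> (\<forall>V\<in>\<U>. restr F (\<Union>\<U>) V a = s V)))"

definition flasque :: "'p topology \<Rightarrow> ('p, 'k::field, 'v) sheaf_data \<Rightarrow> bool"
  where "flasque X F \<longleftrightarrow> sheaf X F \<and>
    (\<forall>U V. openin X U \<and> openin X V \<and> V \<subseteq> U \<longrightarrow>
       restr F U V ` carrier (sections F U) = carrier (sections F V))"

definition sheaf_hom :: "'p topology \<Rightarrow> ('p, 'k::field, 'v) sheaf_data \<Rightarrow>
    ('p, 'k, 'w) sheaf_data \<Rightarrow> ('p set \<Rightarrow> 'v \<Rightarrow> 'w) \<Rightarrow> bool"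
  where "sheaf_hom X F G \<phi> \<longleftrightarrow>
    (\<forall>U. openin X U \<longrightarrow> linear_hom (sections F U) (sections G U) (\<phi> U)) \<and>
    (\<forall>U V. openin X U \<and> openin X V \<and> V \<subseteq> U \<longrightarrow>
       (\<forall>s\<in>carrier (sections F U). \<phi> V (restr F U V s) = restr G U V (\<phi> U s)))"

text \<open>
  Exactness of \<open>F \<rightarrow> G \<rightarrow> H\<close> at \<open>G\<close> as sheaves: the kernel consists of the sections that lie
  locally in the image.
\<close>

definition sheaf_exact :: "'p topology \<Rightarrow>
    ('p, 'k::field, 'u) sheaf_data \<Rightarrow> ('p set \<Rightarrow> 'u \<Rightarrow> 'v) \<Rightarrow>
    ('p, 'k, 'v) sheaf_data \<Rightarrow> ('p set \<Rightarrow> 'v \<Rightarrow> 'w) \<Rightarrow>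
    ('p, 'k, 'w) sheaf_data \<Rightarrow> bool"
  where "sheaf_exact X F \<phi> G \<psi> H \<longleftrightarrow>
    (\<forall>U s. openin X U \<and> s \<in> carrier (sections G U) \<longrightarrow>
       (\<psi> U s = \<zero>\<^bsub>sections H U\<^esub> \<longleftrightarrow>
        (\<forall>x\<in>U. \<exists>V. openin X V \<and> x \<in> V \<and> V \<subseteq> U \<and>
           (\<exists>a\<in>carrier (sections F V). \<phi> V a = restr G U V s))))"

definition flasque_resolution :: "'p topology \<Rightarrow> ('p, 'k::field, 'v) sheaf_data \<Rightarrow>
    ('p set \<Rightarrow> 'v \<Rightarrow> 'w) \<Rightarrow> (nat \<Rightarrow> ('p, 'k, 'w) sheaf_data) \<Rightarrow>
    (nat \<Rightarrow> 'p set \<Rightarrow> 'w \<Rightarrow> 'w) \<Rightarrow> bool"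
  where "flasque_resolution X F \<epsilon> I \<delta> \<longleftrightarrow>
    sheaf X F \<and> (\<forall>n. flasque X (I n)) \<and>
    sheaf_hom X F (I 0) \<epsilon> \<and> (\<forall>n. sheaf_hom X (I n) (I (Suc n)) (\<delta> n)) \<and>
    (\<forall>U. openin X U \<longrightarrow> inj_on (\<epsilon> U) (carrier (sections F U))) \<and>
    sheaf_exact X F \<epsilon> (I 0) (\<delta> 0) (I 1) \<and>
    (\<forall>n. sheaf_exact X (I n) (\<delta> n) (I (Suc n)) (\<delta> (Suc n)) (I (Suc (Suc n))))"

text \<open>
  For subspaces \<open>B \<subseteq> Z\<close> of \<open>M\<close>: the quotient \<open>Z/B\<close> has a basis of \<open>d\<close> elements (the classes of the
  \<open>b j\<close>).  In particular, it is finite-dimensional.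
\<close>

definition quotient_has_dim ::
    "('k::field, 'v) module \<Rightarrow> 'v set \<Rightarrow> 'v set \<Rightarrow> nat \<Rightarrow> bool"
  where "quotient_has_dim M Z B d \<longleftrightarrow>
    (\<exists>b. (\<forall>j<d. b j \<in> Z) \<and>
       (\<forall>z\<in>Z. \<exists>!c. c \<in> {..<d} \<rightarrow>\<^sub>E UNIV \<and>
          z \<ominus>\<^bsub>M\<^esub> (\<Oplus>\<^bsub>M\<^esub>j\<in>{..<d}. c j \<odot>\<^bsub>M\<^esub> b j) \<in> B))"

definition cocycles :: "'p topology \<Rightarrow> (nat \<Rightarrow> ('p, 'k::field, 'v) sheaf_data) \<Rightarrow>
    (nat \<Rightarrow> 'p set \<Rightarrow> 'v \<Rightarrow> 'v) \<Rightarrow> nat \<Rightarrow> 'v set"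
  where "cocycles X I \<delta> i =
    {s \<in> carrier (sections (I i) (topspace X)).
       \<delta> i (topspace X) s = \<zero>\<^bsub>sections (I (Suc i)) (topspace X)\<^esub>}"

fun coboundaries :: "'p topology \<Rightarrow> (nat \<Rightarrow> ('p, 'k::field, 'v) sheaf_data) \<Rightarrow>
    (nat \<Rightarrow> 'p set \<Rightarrow> 'v \<Rightarrow> 'v) \<Rightarrow> nat \<Rightarrow> 'v set"
  where
    "coboundaries X I \<delta> 0 = {\<zero>\<^bsub>sections (I 0) (topspace X)\<^esub>}"
  | "coboundaries X I \<delta> (Suc i) =
       \<delta> i (topspace X) ` carrier (sections (I i) (topspace X))"

text \<open>
  \<open>H\<^sup>i(X, F)\<close> has (finite) dimension \<open>d\<close>.  Sheaf cohomology is the cohomology of the global sections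
  of a flasque resolution.  HOL cannot quantify over the types in which the terms of a resolution
  take their values, so one type is fixed that has room for the canonical (Godement) resolution of
  \<open>F\<close>.  A section over \<open>U\<close> of the sheaf of discontinuous sections of a sheaf with values in
  \<open>W = 'p list \<Rightarrow> 'p set \<times> 'v\<close> is a map from \<open>U\<close> to germs, and a germ is represented by a pair in
  \<open>'p set \<times> W\<close>; the maps \<open>'p \<Rightarrow> 'p set \<times> W\<close> embed into \<open>W\<close>.  All flasque resolutions have the
  same cohomology, so \<open>d\<close> does not depend on the choice.
\<close>

definition has_cohomology_dim ::
    "'p topology \<Rightarrow> ('p, 'k::field, 'v) sheaf_data \<Rightarrow> nat \<Rightarrow> nat \<Rightarrow> bool"
  where "has_cohomology_dim X F i d \<longleftrightarrow>
    (\<exists>\<epsilon> (I :: nat \<Rightarrow> ('p, 'k, 'p list \<Rightarrow> 'p set \<times> 'v) sheaf_data) \<delta>.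
       flasque_resolution X F \<epsilon> I \<delta> \<and>
       quotient_has_dim (sections (I i) (topspace X)) (cocycles X I \<delta> i) (coboundaries X I \<delta> i) d)"

definition cohomology_dim :: "'p topology \<Rightarrow> ('p, 'k::field, 'v) sheaf_data \<Rightarrow> nat \<Rightarrow> nat"
  where "cohomology_dim X F i = (THE d. has_cohomology_dim X F i d)"


section \<open>Closed subschemes of projective space\<close>

text \<open>
  For a homogeneous ideal \<open>J\<close> of \<open>S\<close>, the homogeneous primes of \<open>S/J\<close> are identified with the
  homogeneous primes of \<open>S\<close> containing \<open>J\<close>.
\<close>

type_synonym ('n, 'k) proj_point = "('n, 'k) mpol set"

definition proj_points :: "('n::finite, 'k::field) mpol set \<Rightarrow> ('n, 'k) proj_point set"
  where "proj_points J =
    {P. homogeneous_ideal P \<and> prime_ideal P \<and> J \<subseteq> P \<and> \<not> irrelevant_ideal \<subseteq> P}"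

definition proj_open :: "('n::finite, 'k::field) mpol set \<Rightarrow> ('n, 'k) proj_point set \<Rightarrow> bool"
  where "proj_open J U \<longleftrightarrow>
    (\<exists>E. (\<forall>f\<in>E. \<exists>e. homogeneous e f) \<and> U = {P \<in> proj_points J. \<not> E \<subseteq> P})"

definition proj_top :: "('n::finite, 'k::field) mpol set \<Rightarrow> ('n, 'k) proj_point topology"
  where "proj_top J = topology (proj_open J)"

lemma istopology_proj_open: "istopology (proj_open (J :: ('n::finite, 'k::field) mpol set))"
proof -
  have hom_mult: "\<exists>e. homogeneous e (f * g)"
    if "homogeneous a f" "homogeneous b g" for a b and f g :: "('n, 'k) mpol"
  proof -
    have "homogeneous (a + b) (f * g)"
      unfolding homogeneous_def
    proof
      fix m assume "m \<in> Poly_Mapping.keys (f * g)"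
      then obtain p q where "m = p + q" "p \<in> Poly_Mapping.keys f" "q \<in> Poly_Mapping.keys g"
        using keys_mult[of f g] by blast
      then show "int (mon_degree m) = a + b"
        using that by (simp add: homogeneous_def mon_weight_def lookup_add sum.distrib)
    qed
    then show ?thesis ..
  qed
  have mult_mem: "x * y \<in> P" if "prime_ideal P" "x \<in> P \<or> y \<in> P" for x y and P :: "('n, 'k) mpol set"
  proof -
    have "Modules.module ((*) :: ('n, 'k) mpol \<Rightarrow> _)"
      by unfold_locales (simp_all add: algebra_simps)
    then show ?thesis
      using that unfolding prime_ideal_def
      by (metis Modules.module.subspace_scale mult.commute)
  qed
  show ?thesis
    unfolding istopology_def
  proof (intro conjI allI impI)
    fix U V assume "proj_open J U" "proj_open J V"
    then obtain E F where E: "\<forall>f\<in>E. \<exists>e. homogeneous e f" "U = {P \<in> proj_points J. \<not> E \<subseteq> P}"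
      and F: "\<forall>f\<in>F. \<exists>e. homogeneous e f" "V = {P \<in> proj_points J. \<not> F \<subseteq> P}"
      unfolding proj_open_def by blast
    let ?G = "{f * g | f g. f \<in> E \<and> g \<in> F}"
    have "\<forall>f\<in>?G. \<exists>e. homogeneous e f"
      using E(1) F(1) hom_mult by blast
    moreover have "U \<inter> V = {P \<in> proj_points J. \<not> ?G \<subseteq> P}"
    proof (rule Set.set_eqI)
      fix P
      have "\<not> ?G \<subseteq> P \<longleftrightarrow> \<not> E \<subseteq> P \<and> \<not> F \<subseteq> P" if "prime_ideal P"
      proof -
        have "x * y \<in> P \<longleftrightarrow> x \<in> P \<or> y \<in> P" for x y
          using that mult_mem[OF that] unfolding prime_ideal_def by blast
        then show ?thesis by blast
      qed
      then show "P \<in> U \<inter> V \<longleftrightarrow> P \<in> {P \<in> proj_points J. \<not> ?G \<subseteq> P}"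
        unfolding E(2) F(2) proj_points_def by blast
    qed
    ultimately show "proj_open J (U \<inter> V)"
      unfolding proj_open_def by blast
  next
    fix \<K> :: "('n, 'k) proj_point set set" assume K: "\<forall>U\<in>\<K>. proj_open J U"
    let ?E = "\<Union>{E. (\<forall>f\<in>E. \<exists>e. homogeneous e f) \<and> {P \<in> proj_points J. \<not> E \<subseteq> P} \<in> \<K>}"
    have "\<forall>f\<in>?E. \<exists>e. homogeneous e f" by blast
    moreover have "\<Union>\<K> = {P \<in> proj_points J. \<not> ?E \<subseteq> P}"
    proof (intro equalityI subsetI)
      fix P assume "P \<in> \<Union>\<K>"
      then obtain U where U: "U \<in> \<K>" "P \<in> U" by blast
      obtain E where E: "\<forall>f\<in>E. \<exists>e. homogeneous e f" "U = {P \<in> proj_points J. \<not> E \<subseteq> P}"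
        using K U(1) unfolding proj_open_def by blast
      then have "E \<subseteq> ?E" using U(1) by blast
      then show "P \<in> {P \<in> proj_points J. \<not> ?E \<subseteq> P}" using U(2) E(2) by blast
    next
      fix P assume "P \<in> {P \<in> proj_points J. \<not> ?E \<subseteq> P}"
      then show "P \<in> \<Union>\<K>" by blast
    qed
    ultimately show "proj_open J (\<Union>\<K>)"
      unfolding proj_open_def by blast
  qed
qed

lemma openin_proj_top: "openin (proj_top J) = proj_open J"
  by (simp add: proj_top_def istopology_proj_open)

lemma topspace_proj_top: "topspace (proj_top J) = proj_points J"
proof -
  have "proj_open J (proj_points J)"
    unfolding proj_open_def
  proof (intro exI conjI)
    show "\<forall>f\<in>{1}. \<exists>e. homogeneous e f"
      by (auto simp: homogeneous_def mon_weight_def)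
    show "proj_points J = {P \<in> proj_points J. \<not> {1} \<subseteq> P}"
      by (auto simp: proj_points_def prime_ideal_def)
  qed
  moreover have "U \<subseteq> proj_points J" if "proj_open J U" for U
    using that by (auto simp: proj_open_def)
  ultimately show ?thesis
    unfolding topspace_def openin_proj_top by blast
qed

text \<open>
  The localization at \<open>P\<close>.  The pair \<open>(a, f)\<close> stands for the fraction \<open>a/f\<close> of degree \<open>\<nu>\<close> over
  \<open>S/J\<close>, where \<open>a\<close> and \<open>f\<close> are homogeneous and \<open>f \<notin> P\<close>; the set \<open>frac J \<nu> P a f\<close> is its class,
  an element of the stalk \<open>(S/J)(\<nu>)\<^bsub>(P)\<^esub>\<close>.
\<close>

definition fraction_pairs ::
    "int \<Rightarrow> ('n::finite, 'k::field) proj_point \<Rightarrow> (('n, 'k) mpol \<times> ('n, 'k) mpol) set"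
  where "fraction_pairs \<nu> P = {(a, f). f \<notin> P \<and> (\<exists>e. homogeneous e f \<and> homogeneous (e + \<nu>) a)}"

definition frac :: "('n::finite, 'k::field) mpol set \<Rightarrow> int \<Rightarrow> ('n, 'k) proj_point \<Rightarrow>
    ('n, 'k) mpol \<Rightarrow> ('n, 'k) mpol \<Rightarrow> (('n, 'k) mpol \<times> ('n, 'k) mpol) set"
  where "frac J \<nu> P a f =
    {(b, g) \<in> fraction_pairs \<nu> P.
       \<exists>u. u \<notin> P \<and> (\<exists>e. homogeneous e u) \<and> u * (a * g - b * f) \<in> J}"

type_synonym ('n, 'k) proj_section =
  "('n, 'k) proj_point \<Rightarrow> (('n, 'k) mpol \<times> ('n, 'k) mpol) set"

text \<open>
  The sheaf \<open>O\<^sub>Y(\<nu>)\<close> on \<open>Y = Proj(S/J)\<close>, that is, the sheaf associated with \<open>(S/J)(\<nu>)\<close>.  The fields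
  \<open>mult\<close> and \<open>one\<close> play no role for a module.
\<close>

definition twisted_sections ::
    "('n::finite, 'k::field) mpol set \<Rightarrow> int \<Rightarrow> ('n, 'k) proj_point set \<Rightarrow> ('n, 'k) proj_section set"
  where "twisted_sections J \<nu> U =
    {s \<in> extensional U. \<forall>P\<in>U. \<exists>V a f. openin (proj_top J) V \<and> P \<in> V \<and> V \<subseteq> U \<and>
       (\<forall>Q\<in>V. (a, f) \<in> fraction_pairs \<nu> Q \<and> s Q = frac J \<nu> Q a f)}"

definition twisted_sheaf :: "('n::finite, 'k::field) mpol set \<Rightarrow> int \<Rightarrow>
    (('n, 'k) proj_point, 'k, ('n, 'k) proj_section) sheaf_data"
  where "twisted_sheaf J \<nu> =
    \<lparr>sections = (\<lambda>U.
       \<lparr>carrier = twisted_sections J \<nu> U,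
        mult = undefined,
        one = undefined,
        zero = (\<lambda>P\<in>U. frac J \<nu> P 0 1),
        add = (\<lambda>s s'. \<lambda>P\<in>U. \<Union>(a, f)\<in>s P. \<Union>(b, g)\<in>s' P. frac J \<nu> P (a * g + b * f) (f * g)),
        smult = (\<lambda>c s. \<lambda>P\<in>U. \<Union>(a, f)\<in>s P. frac J \<nu> P (const_pol c * a) f)\<rparr>),
     restr = (\<lambda>U V s. restrict s V)\<rparr>"


section \<open>Points of the fiber-full scheme\<close>

text \<open>
  The \<open>k\<close>-rational points of the fiber-full scheme of \<open>P\<^sup>r\<close> over \<open>k\<close> are, by the universal property,
  the values of the fiber-full functor on \<open>Spec k\<close>: the closed subschemes \<open>Y\<close> of \<open>P\<^sup>r\<close> with
  \<open>dim H\<^sup>i(Y, O\<^sub>Y(\<nu>)) = h i \<nu>\<close> for \<open>0 \<le> i \<le> r\<close> and all \<open>\<nu>\<close>.  (Over \<open>Spec k\<close> the higher direct images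
  are these vector spaces, which are free, and \<open>Y\<close> is its own only fiber.)  A closed subscheme is
  given by a homogeneous ideal \<open>J\<close> with \<open>Y = Proj(S/J)\<close>.
\<close>

definition fiber_full_points :: "(nat \<Rightarrow> int \<Rightarrow> nat) \<Rightarrow> ('n::finite, 'k::field) mpol set set"
  where "fiber_full_points h =
    {J. homogeneous_ideal J \<and>
        (\<forall>i<CARD('n). \<forall>\<nu>. has_cohomology_dim (proj_top J) (twisted_sheaf J \<nu>) i (h i \<nu>))}"

end

theory Submission
 imports Defs "HOL-Library.Function_Algebras"
begin

abbreviation "single \<equiv> Poly_Mapping.single"
abbreviation "lookup \<equiv> Poly_Mapping.lookup"
abbreviation "keys \<equiv> Poly_Mapping.keys"
abbreviation madd ("_ +[_] _" [65, 0, 66] 65) where "x +[M] y \<equiv> x \<oplus>\<^bsub>M\<^esub> y"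
abbreviation mdiff ("_ -[_] _" [65, 0, 66] 65) where "x -[M] y \<equiv> x \<ominus>\<^bsub>M\<^esub> y"
abbreviation mscale ("_ *[_] _" [70, 0, 71] 70) where "c *[M] x \<equiv> c \<odot>\<^bsub>M\<^esub> x"
abbreviation mzero ("0[_]") where "0[M] \<equiv> \<zero>\<^bsub>M\<^esub>"

text \<open>
 The ideal of every fiber \<open>Z_alpha\<close> is homogeneous with the same square-free initial ideal \<open>J\<close>, so it
 suffices that the cohomology of \<open>Proj (S/I)\<close> depends on \<open>I\<close> only through \<open>J\<close>. It is computed by the
 Cech complex of the standard cover, which is the union of the complexes of fractions with denominators
 \<open>x_s^N\<close>. Membership of a monomial in \<open>J\<close> depends only on its support, so the complex of \<open>S/J\<close> is
 contractible in the multidegrees with a positive entry and independent of \<open>N\<close> in the others. This lets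
 cocycles of \<open>S/J\<close> be lifted to cocycles of \<open>S/I\<close> by descent on the weight, and comparing
 dimensions weight by weight shows that \<open>S/I\<close> and \<open>S/J\<close> have the same Cech cohomology.

 The cohomology defined by flasque resolutions is the Cech cohomology by dimension shifting: flasque
 sheaves are Cech-acyclic, the twisted sheaves are so on principal open sets, and Cartan's criterion
 passes this on to the kernels of a resolution. Godement's construction provides a resolution.
\<close>

text \<open>In general the cohomology of \<open>S/J\<close> may be larger than that of
  \<open>S/I\<close>, because a cocycle modulo \<open>J\<close> need not be the top part of a
  cocycle modulo \<open>I\<close>. In a multidegree \<le> 0 all variables of a numerator occur in
  its denominator, so the obstruction to lifting is divisible by a high power of a monomial
  \<open>xl\<close> of \<open>J\<close>. Modulo \<open>I\<close> this monomial is a form of smaller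
  weight, so its M-th power lets the weight fall by at least M. The multidegrees \<le> 0 of sum nu
  have weights in an interval whose length is bounded by nu and the weight vector; below it every
  multidegree has a positive entry and the complex is exact modulo \<open>I\<close>. Once M exceeds
  that length, the obstruction becomes a coboundary that does not touch the top part.

  For this reason one exponent N is fixed: it provides M, and it makes the cochain spaces
  finite-dimensional. The bound on N does not involve \<open>I\<close>, so one N serves all fibers.
  Changes of denominators and connecting homomorphisms are defined only up to coboundaries, so
  dimensions are transported along linear relations rather than maps.\<close>

interpretation ideal: Modules.module "(*) :: 'a::comm_ring_1 => 'a => 'a"
 by unfold_locales (simp_all add: algebra_simps)

declare ideal.scale_scale [simp del]

lemma ideal_mult_right: "is_ideal J ==> x \<in> J ==> x * y \<in> J" for x :: "'a::comm_ring_1"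
 using ideal.subspace_scale[of J x y] by (simp add: mult.commute)

section \<open>Coefficients and truncations of polynomials\<close>

lemma lookup_single_mult:
 fixes f :: "('n, 'k::field) mpol"
 shows "lookup (single m c * f) (m + k) = c * lookup f k"
proof -
 have "lookup (single m c * f) (m + k) =
   (\<Sum>l. lookup (single m c) l * (\<Sum>q. lookup f q when m + k = l + q))"
  by (simp add: lookup_mult)
 also have "... = (\<Sum>l. (c * (\<Sum>q. lookup f q when m + k = m + q)) when m = l)"
  by (intro Sum_any.cong) (auto simp: lookup_single when_def)
 also have "... = c * (\<Sum>q. lookup f q when k = q)" by simp
 finally show ?thesis by simp
qed

lemma lookup_single_mult_eq_0:
 fixes f :: "('n, 'k::field) mpol"
 assumes "!!k. n ~= m + k"
 shows "lookup (single m c * f) n = 0"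
proof -
 have "lookup (single m c * f) n =
   (\<Sum>l. lookup (single m c) l * (\<Sum>q. lookup f q when n = l + q))"
  by (simp add: lookup_mult)
 also have "... = (\<Sum>l. (c * (\<Sum>q. lookup f q when n = m + q)) when m = l)"
  by (intro Sum_any.cong) (auto simp: lookup_single when_def)
 finally show ?thesis using assms by simp
qed

lemma lookup_const_pol_mult [simp]:
 "lookup (const_pol c * f) k = c * lookup f k" for f :: "('n, 'k::field) mpol"
 using lookup_single_mult[of 0 c f k] by simp

lemma const_pol_simps:
 "const_pol (1::'k::field) = (1 :: ('n, 'k) mpol)"
 "const_pol (a * b) = (const_pol a * const_pol b :: ('n, 'k) mpol)"
 by (simp_all add: mult_single)

text \<open>Homogeneous components, weight-initial forms and the multidegree pieces of a cochain are
  all truncations to a set of monomials, so their linearity is proved once here.\<close>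

definition part :: "('m => bool) => ('m \<Rightarrow>\<^sub>0 'k::zero) => 'm \<Rightarrow>\<^sub>0 'k"
 where "part P f = Abs_poly_mapping (%m. if P m then lookup f m else 0)"

lemma lookup_part: "lookup (part P f) m = (if P m then lookup f m else 0)"
proof -
 have "finite {m. (if P m then lookup f m else 0) ~= 0}"
  by (rule finite_subset[OF _ finite_keys[of f]]) (metis (mono_tags, lifting) in_keys_iff mem_Collect_eq subsetI)
 then show ?thesis unfolding part_def by (simp add: lookup_Abs_poly_mapping)
qed

lemma part_add: "part P (f + g) = part P f + part P g"
 for f :: "'m \<Rightarrow>\<^sub>0 'k::monoid_add"
 by (rule poly_mapping_eqI) (simp add: lookup_part lookup_add)

lemma part_diff: "part P (f - g) = part P f - part P g"
 for f :: "'m \<Rightarrow>\<^sub>0 'k::ab_group_add"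
 by (rule poly_mapping_eqI) (simp add: lookup_part lookup_minus)

lemma part_zero [simp]: "part P 0 = 0"
 by (rule poly_mapping_eqI) (simp add: lookup_part)

lemma part_sum: "part P (\<Sum>i\<in>A. f i) = (\<Sum>i\<in>A. part P (f i))"
 for f :: "'i => 'm \<Rightarrow>\<^sub>0 'k::comm_monoid_add"
 by (induction A rule: infinite_finite_induct) (simp_all add: part_add)

lemma part_part: "part P (part Q f) = part (%m. P m & Q m) f"
 by (rule poly_mapping_eqI) (simp add: lookup_part)

lemma keys_part: "keys (part P f) = {m \<in> keys f. P m}"
 by (auto simp: in_keys_iff lookup_part split: if_splits)

lemma part_eq_0: "(!!m. m \<in> keys f ==> \<not> P m) ==> part P f = 0"
 by (rule poly_mapping_eqI) (auto simp: lookup_part in_keys_iff)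

lemma part_eq_self: "(!!m. m \<in> keys f ==> P m) ==> part P f = f"
 by (rule poly_mapping_eqI) (auto simp: lookup_part in_keys_iff)

lemma part_cong: "(!!m. m \<in> keys f ==> P m = Q m) ==> part P f = part Q f"
 by (rule poly_mapping_eqI) (auto simp: lookup_part in_keys_iff)

lemma part_split: "f = part P f + part (%m. \<not> P m) f" for f :: "'m \<Rightarrow>\<^sub>0 'k::monoid_add"
 by (rule poly_mapping_eqI) (simp add: lookup_part lookup_add)

lemma part_single: "part P (single m c) = (if P m then single m c else 0)"
 by (rule poly_mapping_eqI) (auto simp: lookup_part lookup_single when_def)

lemma part_single_mult:
 fixes f :: "('n, 'k::field) mpol"
 shows "part P (single m c * f) = single m c * part (%k. P (m + k)) f"
proof (rule poly_mapping_eqI)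
 fix n show "lookup (part P (single m c * f)) n =
   lookup (single m c * part (%k. P (m + k)) f) n"
 proof (cases "\<exists>k. n = m + k")
  case True
  then show ?thesis by (auto simp: lookup_part lookup_single_mult)
 next
  case False
  then have "!!k. n ~= m + k" by blast
  then show ?thesis by (simp add: lookup_part lookup_single_mult_eq_0)
 qed
qed

lemma sum_singles: "(\<Sum>m\<in>keys f. single m (lookup f m)) = f"
 for f :: "'m \<Rightarrow>\<^sub>0 'k::comm_monoid_add"
proof (rule poly_mapping_eqI)
 fix k
 have "lookup (\<Sum>m\<in>keys f. single m (lookup f m)) k
   = (\<Sum>m\<in>keys f. if m = k then lookup f k else 0)"
  by (auto simp: lookup_sum lookup_single when_def intro!: sum.cong)
 also have "... = lookup f k"
  by (simp add: in_keys_iff)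
 finally show "lookup (\<Sum>m\<in>keys f. single m (lookup f m)) k
   = lookup f k" .
qed

lemma poly_mapping_sum_part:
 fixes f :: "'m \<Rightarrow>\<^sub>0 'k::comm_monoid_add"
 assumes "finite A" "!!m. m \<in> keys f ==> g m \<in> A"
 shows "f = (\<Sum>a\<in>A. part (%m. g m = a) f)"
proof (rule poly_mapping_eqI)
 fix k show "lookup f k = lookup (\<Sum>a\<in>A. part (%m. g m = a) f) k"
 proof (cases "k \<in> keys f")
  case True
  then show ?thesis using assms by (simp add: lookup_sum lookup_part)
 next
  case False
  then show ?thesis by (simp add: lookup_sum lookup_part in_keys_iff cong: if_cong)
 qed
qed

text \<open>Multiplication by a polynomial is a finite sum of multiplications by its terms. The sets
  to which this is applied are described by weights or by supports, and there the effect of a single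
  term is easy to follow.\<close>

lemma monomial_module_is_ideal:
 fixes V :: "('n, 'k::field) mpol set"
 assumes "0 \<in> V" "!!f g. f \<in> V ==> g \<in> V ==> f + g \<in> V"
  and "!!m c f. f \<in> V ==> single m c * f \<in> V"
 shows "is_ideal V"
proof (rule ideal.subspaceI)
 fix h f assume "f \<in> V"
 have "(\<Sum>m\<in>A. single m (lookup h m) * f) \<in> V" if "finite A" for A
  using that by induction (auto intro: assms \<open>f \<in> V\<close>)
 from this[OF finite_keys[of h]] show "h * f \<in> V"
  by (simp flip: sum_distrib_right add: sum_singles)
qed (use assms in auto)

lemma mon_weight_0 [simp]: "mon_weight w 0 = 0"
 by (simp add: mon_weight_def)

lemma mon_weight_add: "mon_weight w (a + b) = mon_weight w a + mon_weight w b"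
 by (simp add: mon_weight_def lookup_add algebra_simps sum.distrib)

lemma mon_weight_single [simp]: "mon_weight w (single j n) = w j * n"
proof -
 have "(\<Sum>i\<in>UNIV. w i * (n when j = i)) = (\<Sum>i\<in>UNIV. if i = j then w j * n else 0)"
  by (intro sum.cong refl) (simp add: when_def)
 then show ?thesis by (simp add: mon_weight_def lookup_single when_def)
qed

subsection \<open>Homogeneous components\<close>

definition hcomp :: "int => ('n::finite, 'k::zero) mpol => ('n, 'k) mpol"
 where "hcomp e = part (%m. int (mon_degree m) = e)"

lemma homog_iff_hcomp: "homogeneous e f \<longleftrightarrow> hcomp e f = f"
 unfolding hcomp_def homogeneous_def
 by (metis (mono_tags, lifting) keys_part mem_Collect_eq part_eq_self)

lemma homog_hcomp [simp]: "homogeneous e (hcomp e f)"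
 by (auto simp: homogeneous_def hcomp_def keys_part)

lemma homog_zero [simp]: "homogeneous e 0"
 by (simp add: homogeneous_def)

lemma homog_add: "homogeneous e f ==> homogeneous e g ==> homogeneous e (f + g)"
 for f :: "('n::finite, 'k::monoid_add) mpol"
 by (simp add: homog_iff_hcomp hcomp_def part_add)

lemma homog_diff: "homogeneous e f ==> homogeneous e g ==> homogeneous e (f - g)"
 for f :: "('n::finite, 'k::ab_group_add) mpol"
 by (simp add: homog_iff_hcomp hcomp_def part_diff)

lemma homog_sum: "(!!i. i \<in> A ==> homogeneous e (f i)) ==> homogeneous e (\<Sum>i\<in>A. f i)"
 for f :: "'i => ('n::finite, 'k::comm_monoid_add) mpol"
 by (induction A rule: infinite_finite_induct) (auto intro: homog_add)

lemma homog_mult: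
 fixes f g :: "('n::finite, 'k::field) mpol"
 assumes "homogeneous a f" "homogeneous b g"
 shows "homogeneous (a + b) (f * g)"
 unfolding homogeneous_def
proof
 fix m assume "m \<in> keys (f * g)"
 then obtain p q where "m = p + q" "p \<in> keys f" "q \<in> keys g"
  using keys_mult[of f g] by blast
 then show "int (mon_degree m) = a + b"
  using assms by (simp add: homogeneous_def mon_weight_add)
qed

lemma homog_single: "int (mon_degree m) = e ==> homogeneous e (single m c)"
 by (simp add: homogeneous_def)

lemma homog_const [simp]: "homogeneous 0 (const_pol c)"
 by (simp add: homog_single)

lemma homog_one [simp]: "homogeneous 0 (1 :: ('n::finite, 'k::field) mpol)"
 by (simp flip: single_one)

lemma homog_power:
 fixes f :: "('n::finite, 'k::field) mpol"
 assumes "homogeneous a f" shows "homogeneous (a * int n) (f ^ n)"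
proof (induction n)
 case (Suc n)
 then show ?case using homog_mult[OF assms Suc] by (simp add: algebra_simps)
qed simp

lemma homog_nonneg: "homogeneous e f ==> f ~= 0 ==> e \<ge> 0"
 for f :: "('n::finite, 'k::zero) mpol"
proof -
 assume *: "homogeneous e f" "f ~= 0"
 then obtain m where "m \<in> keys f"
  by (metis all_not_in_conv in_keys_iff lookup_zero poly_mapping_eqI)
 then show "0 \<le> e" using * by (auto simp: homogeneous_def)
qed

lemma hcomp_add: "hcomp e (f + g) = hcomp e f + hcomp e g"
 for f :: "('n::finite, 'k::monoid_add) mpol"
 by (simp add: hcomp_def part_add)

lemma hcomp_diff: "hcomp e (f - g) = hcomp e f - hcomp e g"
 for f :: "('n::finite, 'k::ab_group_add) mpol"
 by (simp add: hcomp_def part_diff)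

lemma hcomp_zero [simp]: "hcomp e 0 = 0"
 by (simp add: hcomp_def)

lemma hcomp_homogeneous: "homogeneous a f ==> hcomp e f = (if e = a then f else 0)"
 by (auto simp: hcomp_def homogeneous_def intro!: part_eq_self part_eq_0)

lemma sum_hcomp:
 fixes f :: "('n::finite, 'k::comm_monoid_add) mpol"
 shows "f = (\<Sum>e\<in>(%m. int (mon_degree m)) ` keys f. hcomp e f)"
 unfolding hcomp_def by (rule poly_mapping_sum_part) auto

lemma hcomp_mult_homogeneous:
 fixes f g :: "('n::finite, 'k::field) mpol"
 assumes "homogeneous a g"
 shows "hcomp e (f * g) = hcomp (e - a) f * g"
proof -
 let ?E = "(%m. int (mon_degree m)) ` keys f"
 have "hcomp e (f * g) = hcomp e (\<Sum>i\<in>?E. hcomp i f * g)"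
  using sum_hcomp[of f] by (simp flip: sum_distrib_right)
 also have "... = (\<Sum>i\<in>?E. hcomp e (hcomp i f * g))"
  by (simp add: hcomp_def part_sum)
 also have "... = (\<Sum>i\<in>?E. if i = e - a then hcomp (e - a) f * g else 0)"
  by (intro sum.cong refl)
    (auto simp: hcomp_homogeneous[OF homog_mult[OF homog_hcomp assms]])
 also have "... = hcomp (e - a) f * g"
 proof (cases "e - a \<in> ?E")
  case False
  then have "hcomp (e - a) f = 0"
   unfolding hcomp_def by (intro part_eq_0) (force simp: image_iff)
  then show ?thesis by simp
 qed simp
 finally show ?thesis .
qed

lemma homogeneous_ideal_is_ideal: "homogeneous_ideal J ==> is_ideal J"
 by (auto simp: homogeneous_ideal_def)

text \<open>A component of \<open>h * g\<close> is a combination of components of \<open>g\<close>,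
  with components of \<open>h\<close> as coefficients. The generators may be inhomogeneous; those of
  a fiber ideal are.\<close>

lemma hcomp_closed_generated:
 fixes G :: "('n::finite, 'k::field) mpol set"
 assumes "!!g e. g \<in> G ==> hcomp e g \<in> ideal_gen G"
  and "f \<in> ideal_gen G"
 shows "hcomp e f \<in> ideal_gen G"
proof -
 have hom: "hcomp e (h * g) \<in> ideal_gen G" if "g \<in> G" for h g e
 proof -
  let ?E = "(%m. int (mon_degree m)) ` keys g"
  have "hcomp e (h * g) = hcomp e (\<Sum>i\<in>?E. h * hcomp i g)"
   by (subst sum_hcomp[of g]) (simp add: sum_distrib_left)
  also have "... = (\<Sum>i\<in>?E. hcomp e (h * hcomp i g))"
   by (simp add: hcomp_def part_sum)
  also have "... = (\<Sum>i\<in>?E. hcomp (e - i) h * hcomp i g)"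
   by (simp add: hcomp_mult_homogeneous[OF homog_hcomp])
  also have "... \<in> ideal_gen G"
   by (intro ideal.span_sum ideal.span_scale assms(1) that)
  finally show ?thesis .
 qed
 have "\<forall>e. hcomp e f \<in> ideal_gen G"
  using assms(2)
 proof (induction rule: ideal.span_induct_alt)
  case base
  show ?case by (simp add: ideal.span_zero)
 next
  case (step c x y)
  then show ?case by (simp add: hcomp_add hom ideal.span_add)
 qed
 then show ?thesis ..
qed

lemma homogeneous_ideal_hcomp:
 assumes "homogeneous_ideal J" "f \<in> J"
 shows "hcomp e f \<in> J"
proof -
 obtain G where G: "\<forall>g\<in>G. \<exists>e. homogeneous e g" "J = ideal_gen G"
  using assms(1) by (auto simp: homogeneous_ideal_def)
 have "hcomp e g \<in> ideal_gen G" if g: "g \<in> G" for g e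
 proof -
  obtain a where a: "homogeneous a g" using G(1) g by blast
  show ?thesis
   using ideal.span_base[OF g] ideal.span_zero[of G]
   by (simp only: hcomp_homogeneous[OF a] split: if_split) simp
 qed
 then show ?thesis using hcomp_closed_generated[of G f e] assms(2) G(2) by blast
qed

lemma homogeneous_idealI:
 assumes "is_ideal J" "!!f e. f \<in> J ==> hcomp e f \<in> J"
 shows "homogeneous_ideal J"
 unfolding homogeneous_ideal_def
proof (intro exI conjI)
 let ?G = "{g \<in> J. \<exists>e. homogeneous e g}"
 show "\<forall>g\<in>?G. \<exists>e. homogeneous e g" by blast
 show "J = ideal_gen ?G"
 proof
  show "ideal_gen ?G <= J" by (rule ideal.span_minimal) (use assms(1) in auto)
  show "J <= ideal_gen ?G"
  proof
   fix f assume f: "f \<in> J"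
   have "(\<Sum>e\<in>(%m. int (mon_degree m)) ` keys f. hcomp e f) \<in> ideal_gen ?G"
    by (intro ideal.span_sum ideal.span_base) (use assms(2)[OF f] homog_hcomp in blast)
   then show "f \<in> ideal_gen ?G" using sum_hcomp[of f] by simp
  qed
 qed
qed

section \<open>The Cech complex of fractions, written by numerators\<close>

definition mon :: "('n::finite => nat) => 'n mon"
 where "mon g = Abs_poly_mapping g"

lemma lookup_mon [simp]: "lookup (mon g) = g"
 by (simp add: mon_def)

lemma mon_lookup [simp]: "mon (lookup m) = m"
 by (rule poly_mapping_eqI) simp

definition xv :: "'n => ('n, 'k::field) mpol"
 where "xv j = single (single j 1) 1"

lemma xv_power: "xv j ^ n = single (single j n) 1"
 by (induction n) (simp_all add: xv_def mult_single flip: single_add)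

text \<open>Unfolding the recursion gives the alternating sum of the products of
  \<open>xv j ^ N\<close>, for an entry j of the list, with the value of \<open>c\<close> at the
  list without that entry. It is the numerator of the Cech differential over the common denominator.
  Lists may repeat entries and come in every order, so no alternating condition or reordering sign
  occurs.\<close>

fun kdiff :: "nat => ('n list => ('n, 'k::field) mpol) => 'n list => ('n, 'k) mpol"
 where
  "kdiff N c [] = 0"
 | "kdiff N c (j # xs) = xv j ^ N * c xs - kdiff N (%ys. c (j # ys)) xs"

lemma kdiff_mult: "kdiff N (%ys. f * c ys) xs = f * kdiff N c xs"
proof (induction N c xs rule: kdiff.induct)
 case (2 N c j xs)
 then show ?case by (simp add: right_diff_distrib mult.left_commute)
qed simp

lemma kdiff_add: "kdiff N (c + c') = kdiff N c + kdiff N c'"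
proof
 fix xs show "kdiff N (c + c') xs = (kdiff N c + kdiff N c') xs"
  by (induction xs arbitrary: c c') (simp_all add: algebra_simps plus_fun_def)
qed

lemma kdiff_diff: "kdiff N (c - c') = kdiff N c - kdiff N c'"
proof
 fix xs show "kdiff N (c - c') xs = (kdiff N c - kdiff N c') xs"
  by (induction xs arbitrary: c c') (simp_all add: algebra_simps fun_diff_def)
qed

lemma kdiff_zero [simp]: "kdiff N 0 = 0"
 using kdiff_diff[of N 0 0] by simp

text \<open>At \<open>j # xs\<close> the term \<open>xv j ^ N * kdiff N c xs\<close> cancels against
  the first half of the inner difference; what remains is the same claim for the cochain
  \<open>%ys. c (j # ys)\<close>.\<close>

lemma kdiff_kdiff: "kdiff N (kdiff N c) = 0"
proof
 fix xs show "kdiff N (kdiff N c) xs = 0 xs"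
 proof (induction xs arbitrary: c)
  case (Cons j xs)
  have "kdiff N (%ys. kdiff N c (j # ys)) =
    kdiff N ((%ys. xv j ^ N * c ys) - kdiff N (%ys. c (j # ys)))"
   by (simp add: fun_diff_def)
  then show ?case using Cons[of "%ys. c (j # ys)"] by (simp add: kdiff_diff kdiff_mult)
 qed simp
qed

lemma kdiff_in:
 assumes "is_ideal I" "!!ys. Suc (length ys) = length xs ==> c ys \<in> I"
 shows "kdiff N c xs \<in> I"
 using assms(2)
proof (induction N c xs rule: kdiff.induct)
 case (1 N c)
 show ?case by (simp add: assms(1) ideal.subspace_0)
next
 case (2 N c j xs)
 have "xv j ^ N * c xs \<in> I" using 2(2) by (intro ideal.subspace_scale assms(1)) simp
 moreover have "kdiff N (%ys. c (j # ys)) xs \<in> I" by (rule 2(1)) (rule 2(2), simp)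
 ultimately show ?case by (simp add: ideal.subspace_diff[OF assms(1)])
qed

lemma kdiff_eq_0: "(!!ys. Suc (length ys) = length xs ==> c ys = 0) ==> kdiff N c xs = 0"
 using kdiff_in[of "{0}" xs c N] by (simp add: ideal.subspace_single_0)

text \<open>
 A value \<open>c xs\<close> of a cochain stands for the fraction \<open>c xs / xl xs ^ N\<close>; \<open>mdeg N xs m\<close> is the
 multidegree of \<open>x\<^sup>m / xl xs ^ N\<close>, and \<open>cf N a c xs\<close> the coefficient in multidegree \<open>a\<close>.
\<close>

definition mdeg :: "nat => 'n list => 'n::finite mon => 'n => int"
 where "mdeg N xs m j = int (lookup m j) - int N * int (count_list xs j)"

text \<open>The multidegrees that occur over the denominator \<open>xl xs ^ N\<close>. For these
  \<open>amon\<close> inverts \<open>mdeg\<close>; for all others \<open>nat\<close> truncates and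
  \<open>amon\<close> has no meaning, which is why \<open>cf\<close> tests the condition
  first.\<close>

definition integral_at :: "nat => ('n => int) => 'n list => bool"
 where "integral_at N a xs \<longleftrightarrow> (\<forall>j. a j + int N * int (count_list xs j) \<ge> 0)"

definition amon :: "nat => ('n::finite => int) => 'n list => 'n mon"
 where "amon N a xs = mon (%j. nat (a j + int N * int (count_list xs j)))"

definition cf :: "nat => ('n::finite => int) => ('n list => ('n, 'k::field) mpol) => 'n list => 'k"
 where "cf N a c xs = (if integral_at N a xs then lookup (c xs) (amon N a xs) else 0)"

lemma amon_mdeg [simp]: "amon N (mdeg N xs m) xs = m"
 by (rule poly_mapping_eqI) (simp add: amon_def mdeg_def)

lemma integral_at_mdeg [simp]: "integral_at N (mdeg N xs m) xs"
 by (simp add: integral_at_def mdeg_def)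

lemma mdeg_amon: "integral_at N a xs ==> mdeg N xs (amon N a xs) = a"
 by (rule ext) (simp add: amon_def mdeg_def integral_at_def)

lemma cf_mdeg [simp]: "cf N (mdeg N xs m) c xs = lookup (c xs) m"
 by (simp add: cf_def)

lemma cf_eqI: "(!!a xs. cf N a c xs = cf N a c' xs) ==> c = c'"
proof (rule ext, rule poly_mapping_eqI)
 fix xs m assume "!!a xs. cf N a c xs = cf N a c' xs"
 from this[of "mdeg N xs m" xs]
 show "lookup (c xs) m = lookup (c' xs) m" by simp
qed

lemma cf_add: "cf N a (c + c') = cf N a c + cf N a c'"
 by (rule ext) (simp add: cf_def lookup_add)

lemma cf_diff: "cf N a (c - c') = cf N a c - cf N a c'"
 by (rule ext) (simp add: cf_def lookup_minus)

lemma cf_zero [simp]: "cf N a 0 = 0"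
 by (rule ext) (simp add: cf_def)

fun sdiff :: "('n list => 'k::ab_group_add) => 'n list => 'k"
 where
  "sdiff c [] = 0"
 | "sdiff c (j # xs) = c xs - sdiff (%ys. c (j # ys)) xs"

lemma shift_Cons:
 "a i + int N * int (count_list (j # xs) i) = a i + (if i = j then int N else 0) + int N * int (count_list xs i)"
 by (simp add: algebra_simps)

lemma cf_Cons:
 "cf N a c (j # ys) = cf N (%i. a i + (if i = j then int N else 0)) (%ys. c (j # ys)) ys"
 unfolding cf_def integral_at_def amon_def shift_Cons ..

lemma integral_at_Cons: "integral_at N a xs ==> integral_at N a (j # xs)"
 unfolding integral_at_def shift_Cons by (smt (verit) of_nat_0_le_iff)

lemma amon_Cons:
 assumes "integral_at N a xs"
 shows "amon N a (j # xs) = single j N + amon N a xs"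
proof (rule poly_mapping_eqI)
 fix i
 have "a i + int N * int (count_list xs i) \<ge> 0" using assms by (simp add: integral_at_def)
 then show "lookup (amon N a (j # xs)) i =
   lookup (single j N + amon N a xs) i"
  unfolding amon_def lookup_mon shift_Cons lookup_add lookup_single when_def by auto
qed

text \<open>The summand \<open>xv j ^ N * c xs\<close> of the differential belongs to the list
  \<open>j # xs\<close>; \<open>tl\<close> makes it a cochain in its own right. The factor
  \<open>xv j ^ N\<close> is exactly offset by the additional entry of the denominator.\<close>

lemma cf_mult_xv:
 "cf N a (%ys. xv j ^ N * c (tl ys)) (j # xs) = cf N a c xs"
proof (cases "integral_at N a xs")
 case True
 then show ?thesis
  using integral_at_Cons[OF True, of j] amon_Cons[OF True, of j]
  by (simp add: cf_def xv_power lookup_single_mult)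
next
 case False
 have "lookup (xv j ^ N * c xs) (amon N a (j # xs)) = 0" if *: "integral_at N a (j # xs)"
  unfolding xv_power
 proof (rule lookup_single_mult_eq_0)
  fix k show "amon N a (j # xs) ~= single j N + k"
  proof
   assume eq: "amon N a (j # xs) = single j N + k"
   have "a i + int N * int (count_list xs i) = int (lookup k i)" for i
    using arg_cong[OF eq, of "%m. lookup m i"] *
    unfolding integral_at_def amon_def lookup_mon shift_Cons lookup_add lookup_single when_def
    by (smt (verit) int_nat_eq of_nat_add of_nat_0)
   then show False using False by (simp add: integral_at_def)
  qed
 qed
 then show ?thesis using False by (simp add: cf_def)
qed

text \<open>In a fixed multidegree the powers of the variables disappear and a complex of scalars
  remains. The exponent \<open>N\<close> only decides which of its entries may be nonzero.\<close>

lemma cf_kdiff: "cf N a (kdiff N c) xs = sdiff (cf N a c) xs"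
proof (induction xs arbitrary: a c)
 case Nil
 show ?case by (simp add: cf_def)
next
 case (Cons j xs)
 let ?a = "%i. a i + (if i = j then int N else 0)"
 have "cf N a (kdiff N c) (j # xs) =
   cf N a ((%ys. xv j ^ N * c (tl ys)) - (%ys. kdiff N (%zs. c (j # zs)) (tl ys))) (j # xs)"
  by (simp add: cf_def fun_diff_def)
 also have "... = cf N a c xs - cf N a (%ys. kdiff N (%zs. c (j # zs)) (tl ys)) (j # xs)"
  by (simp add: cf_diff cf_mult_xv)
 also have "cf N a (%ys. kdiff N (%zs. c (j # zs)) (tl ys)) (j # xs) = cf N ?a (kdiff N (%zs. c (j # zs))) xs"
  by (subst cf_Cons) (simp only: list.sel)
 also have "... = sdiff (cf N ?a (%zs. c (j # zs))) xs" by (rule Cons)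
 also have "cf N ?a (%zs. c (j # zs)) = (%ys. cf N a c (j # ys))"
  by (rule ext) (rule cf_Cons[symmetric])
 finally show ?case by simp
qed

definition cpart :: "nat => (('n => int) => bool) => ('n::finite list => ('n, 'k::field) mpol) =>
  'n list => ('n, 'k) mpol"
 where "cpart N Q c xs = part (%m. Q (mdeg N xs m)) (c xs)"

lemma cf_cpart: "cf N a (cpart N Q c) xs = (if Q a then cf N a c xs else 0)"
 by (simp add: cf_def cpart_def lookup_part mdeg_amon)

definition cin :: "nat => (('n => int) => bool) => ('n::finite list => ('n, 'k::field) mpol) => bool"
 where "cin N Q c \<longleftrightarrow> (\<forall>a xs. cf N a c xs ~= 0 --> Q a)"

lemma cin_keys: "cin N Q c \<longleftrightarrow> (\<forall>xs. \<forall>m\<in>keys (c xs). Q (mdeg N xs m))"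
 unfolding cin_def
 by (metis (no_types, opaque_lifting) cf_def cf_mdeg in_keys_iff mdeg_amon)

lemma sdiff_eq_0: "(!!ys. c ys = 0) ==> sdiff c xs = 0"
 by (induction c xs rule: sdiff.induct) simp_all

lemma cin_kdiff: "cin N Q c ==> cin N Q (kdiff N c)"
 unfolding cin_def cf_kdiff using sdiff_eq_0 by metis

lemma kdiff_cpart: "kdiff N (cpart N Q c) = cpart N Q (kdiff N c)"
proof (rule cf_eqI)
 fix a xs
 have "cf N a (cpart N Q c) = (if Q a then cf N a c else (%_. 0))"
  by (rule ext) (simp add: cf_cpart)
 then show "cf N a (kdiff N (cpart N Q c)) xs = cf N a (cpart N Q (kdiff N c)) xs"
  by (simp add: cf_kdiff cf_cpart sdiff_eq_0)
qed

lemma cpart_add: "cpart N Q (c + c') = cpart N Q c + cpart N Q c'"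
 by (rule ext) (simp add: cpart_def part_add)

lemma cpart_diff: "cpart N Q (c - c') = cpart N Q c - cpart N Q c'"
 by (rule ext) (simp add: cpart_def part_diff)

lemma cin_add: "cin N Q c ==> cin N Q c' ==> cin N Q (c + c')"
 unfolding cin_def cf_add by (metis add.left_neutral plus_fun_apply)

lemma cin_diff: "cin N Q c ==> cin N Q c' ==> cin N Q (c - c')"
 unfolding cin_def cf_diff by (metis diff_0_right fun_diff_def)

lemma cin_zero [simp]: "cin N Q 0"
 by (simp add: cin_def)

lemma cin_cpart: "cin N P c ==> cin N P (cpart N Q c)"
 by (auto simp: cin_def cf_cpart)

lemma cin_cpart_self: "cin N Q (cpart N Q c)"
 by (auto simp: cin_def cf_cpart)

lemma cpart_eq_self: "cin N Q c ==> cpart N Q c = c"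
 by (rule cf_eqI[of N]) (auto simp: cin_def cf_cpart)

lemma cin_mono: "cin N P c ==> (!!a. P a ==> Q a) ==> cin N Q c"
 by (auto simp: cin_def)

text \<open>The contracting homotopy in the multidegrees with a positive entry.\<close>

definition hmt :: "nat => ('n::finite list => ('n, 'k::field) mpol) => 'n list => ('n, 'k) mpol"
 where "hmt N c xs = Abs_poly_mapping (%m. let a = mdeg N xs m in
   if \<exists>j. a j > 0 then cf N a c ((SOME j. a j > 0) # xs) else 0)"

lemma lookup_hmt:
 "lookup (hmt N c xs) m = (let a = mdeg N xs m in
   if \<exists>j. a j > 0 then cf N a c ((SOME j. a j > 0) # xs) else 0)"
proof -
 let ?f = "%m. let a = mdeg N xs m in
   if \<exists>j. a j > 0 then cf N a c ((SOME j. a j > 0) # xs) else 0"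
 \<comment> \<open>The index put in front varies with \<open>m\<close>, but there are only finitely
   many indices, and for each of them \<open>m\<close> is recovered from
   \<open>m + single j N\<close>.\<close>
 have "{m. ?f m ~= 0} <= (\<Union>j. (%m. m + single j N) -` keys (c (j # xs)))"
 proof
  fix m assume "m \<in> {m. ?f m ~= 0}"
  then obtain j where "cf N (mdeg N xs m) c (j # xs) ~= 0"
   by (auto simp: Let_def split: if_splits)
  then have "lookup (c (j # xs)) (amon N (mdeg N xs m) (j # xs)) ~= 0"
   by (auto simp: cf_def split: if_splits)
  moreover have "amon N (mdeg N xs m) (j # xs) = m + single j N"
   by (simp add: amon_Cons add.commute)
  ultimately show "m \<in> (\<Union>j. (%m. m + single j N) -` keys (c (j # xs)))"
   by (auto simp: in_keys_iff)
 qed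
 moreover have "finite (\<Union>j. (%m. m + single j N) -` keys (c (j # xs)))"
  by (intro finite_UN_I finite_vimageI) (auto intro: injI)
 ultimately have "finite {m. ?f m ~= 0}" by (rule finite_subset)
 then show ?thesis by (simp add: hmt_def)
qed

lemma cf_hmt:
 "cf N a (hmt N c) xs = (if \<exists>j. a j > 0 then cf N a c ((SOME j. a j > 0) # xs) else 0)"
proof (cases "integral_at N a xs")
 case True
 then show ?thesis by (simp add: cf_def[of N a "hmt N c"] lookup_hmt mdeg_amon Let_def)
next
 case False
 \<comment> \<open>The entry that violates integrality at \<open>xs\<close> sits at an index other
   than \<open>j\<close>, so putting \<open>j\<close> in front does not repair it.\<close>
 have "\<not> integral_at N a (j # xs)" if "a j > 0" for j
 proof -
  obtain i where i: "a i + int N * int (count_list xs i) < 0"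
   using False by (auto simp: integral_at_def not_le)
  then have "i ~= j" using that by (smt (verit) of_nat_0_le_iff zero_le_mult_iff)
  then show ?thesis using i by (auto simp: integral_at_def not_le intro!: exI[of _ i])
 qed
 then have "cf N a c ((SOME j. a j > 0) # xs) = 0" if "\<exists>j. a j > 0"
  using someI_ex[OF that] by (simp add: cf_def)
 then show ?thesis using False by (simp add: cf_def)
qed

lemma cin_hmt: "cin N Q c ==> cin N Q (hmt N c)"
 by (auto simp: cin_def cf_hmt split: if_splits)

text \<open>The chosen index depends on the multidegree alone, so it is the same for a list and all
  its faces. The recursion of \<open>sdiff\<close> at a list that starts with this index is then the
  homotopy formula itself.\<close>

lemma hmt_homotopy:
 "cf N a (c - kdiff N (hmt N c)) xs =
  (if \<exists>j. a j > 0 then cf N a (kdiff N c) ((SOME j. a j > 0) # xs) else cf N a c xs)"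
proof (cases "\<exists>j. a j > 0")
 case True
 then have "cf N a (hmt N c) = (%ys. cf N a c ((SOME j. a j > 0) # ys))"
  by (intro ext) (simp add: cf_hmt)
 then show ?thesis using True by (simp add: cf_diff cf_kdiff)
next
 case False
 then have "cf N a (hmt N c) = (%ys. 0)"
  by (intro ext) (simp add: cf_hmt)
 then show ?thesis using False by (simp add: cf_diff cf_kdiff sdiff_eq_0)
qed

subsection \<open>Raising the exponent of the denominators\<close>

definition mcount :: "'n list => 'n::finite mon"
 where "mcount xs = mon (count_list xs)"

definition xl :: "'n list => ('n::finite, 'k::field) mpol"
 where "xl xs = single (mcount xs) 1"

lemma mcount_Nil: "mcount [] = 0"
 by (rule poly_mapping_eqI) (simp add: mcount_def)

lemma xl_Nil [simp]: "xl [] = 1"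
 by (simp add: xl_def mcount_Nil)

lemma xl_Cons [simp]: "xl (j # xs) = xv j * xl xs"
proof -
 have "mcount (j # xs) = single j 1 + mcount xs"
  by (rule poly_mapping_eqI) (simp add: mcount_def lookup_add lookup_single when_def)
 then show ?thesis by (simp add: xl_def xv_def mult_single)
qed

text \<open>Expands every fraction \<open>c xs / xl xs ^ N\<close> by \<open>xl xs\<close>. The
  fraction is the same over the exponent \<open>Suc N\<close>, as \<open>cf_tr\<close>
  expresses.\<close>

definition tr :: "('n::finite list => ('n, 'k::field) mpol) => 'n list => ('n, 'k) mpol"
 where "tr c xs = xl xs * c xs"

lemma tr_add: "tr (c + c') = tr c + tr c'"
 by (rule ext) (simp add: tr_def algebra_simps)

lemma tr_diff: "tr (c - c') = tr c - tr c'"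
 by (rule ext) (simp add: tr_def algebra_simps)

lemma kdiff_tr: "kdiff (Suc N) (tr c) = tr (kdiff N c)"
proof
 fix xs show "kdiff (Suc N) (tr c) xs = tr (kdiff N c) xs"
 proof (induction xs arbitrary: c)
  case (Cons j xs)
  have "(%ys. tr c (j # ys)) = (%ys. xv j * tr (%ys. c (j # ys)) ys)"
   by (rule ext) (simp only: tr_def xl_Cons mult.assoc)
  then have "kdiff (Suc N) (%ys. tr c (j # ys)) xs =
    kdiff (Suc N) (%ys. xv j * tr (%ys. c (j # ys)) ys) xs"
   by (rule arg_cong)
  also have "... = xv j * kdiff (Suc N) (tr (%ys. c (j # ys))) xs"
   by (rule kdiff_mult)
  also have "... = xv j * tr (kdiff N (%ys. c (j # ys))) xs"
   by (subst Cons) (rule refl)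
  finally have "kdiff (Suc N) (%ys. tr c (j # ys)) xs = xv j * tr (kdiff N (%ys. c (j # ys))) xs" .
  then have "kdiff (Suc N) (tr c) (j # xs) =
    xv j ^ Suc N * (xl xs * c xs) - xv j * (xl xs * kdiff N (%ys. c (j # ys)) xs)"
   unfolding kdiff.simps(2) tr_def by (rule arg_cong)
  also have "... = xv j * xl xs * (xv j ^ N * c xs - kdiff N (%ys. c (j # ys)) xs)"
   unfolding power_Suc by (simp only: right_diff_distrib mult.assoc mult.left_commute)
  finally show ?case
   unfolding tr_def kdiff.simps(2) xl_Cons .
 qed (simp add: tr_def)
qed

lemma shift_Suc:
 "a i + int (Suc N) * int (count_list xs i) = a i + int N * int (count_list xs i) + int (count_list xs i)"
 by (simp add: algebra_simps)

lemma cf_tr: "cf (Suc N) a (tr c) xs = cf N a c xs"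
proof (cases "integral_at N a xs")
 case True
 then have "integral_at (Suc N) a xs"
  unfolding integral_at_def shift_Suc by (smt (verit) of_nat_0_le_iff)
 moreover have "amon (Suc N) a xs = mcount xs + amon N a xs"
 proof (rule poly_mapping_eqI)
  fix i
  have "a i + int N * int (count_list xs i) \<ge> 0" using True by (simp add: integral_at_def)
  then show "lookup (amon (Suc N) a xs) i = lookup (mcount xs + amon N a xs) i"
   unfolding amon_def lookup_mon shift_Suc lookup_add mcount_def by auto
 qed
 ultimately show ?thesis
  using True by (simp add: cf_def tr_def xl_def lookup_single_mult)
next
 case False
 have "lookup (xl xs * c xs) (amon (Suc N) a xs) = 0" if *: "integral_at (Suc N) a xs"
  unfolding xl_def
 proof (rule lookup_single_mult_eq_0)
  fix k show "amon (Suc N) a xs ~= mcount xs + k"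
  proof
   assume eq: "amon (Suc N) a xs = mcount xs + k"
   have "a i + int N * int (count_list xs i) = int (lookup k i)" for i
    using arg_cong[OF eq, of "%m. lookup m i"] *
    unfolding integral_at_def amon_def lookup_mon shift_Suc lookup_add mcount_def
    by (smt (verit) int_nat_eq of_nat_add)
   then show False using False by (simp add: integral_at_def)
  qed
 qed
 then show ?thesis using False by (simp add: cf_def tr_def)
qed

lemma cin_tr: "cin (Suc N) Q (tr c) = cin N Q c"
 by (simp add: cin_def cf_tr)

lemma cpart_tr: "cpart (Suc N) Q (tr c) = tr (cpart N Q c)"
 by (rule cf_eqI[of "Suc N"]) (simp add: cf_cpart cf_tr)

section \<open>Dimensions of quotients and of filtered subspaces\<close>

locale vector_space_quotient = vector_space
begin

text \<open>The classes of the \<open>b j\<close> form a basis of Z/B. In contrast to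
  \<open>quotient_has_dim\<close>, which asks for unique coordinates, generation and independence
  are separate conditions here.\<close>

definition quot_basis :: "'b set => 'b set => nat => (nat => 'b) => bool"
 where "quot_basis Z B d b \<longleftrightarrow> (\<forall>j<d. b j \<in> Z) &
  (\<forall>z\<in>Z. \<exists>c. z - (\<Sum>j<d. c j *s b j) \<in> B) &
  (\<forall>c. (\<Sum>j<d. c j *s b j) \<in> B --> (\<forall>j<d. c j = 0))"

text \<open>A basis of \<open>B\<close> is extended to one of \<open>Z\<close>; the added vectors
  represent a basis of the quotient.\<close>

lemma quot_basis_exists:
 assumes B: "subspace B" "B <= Z" and Z: "subspace Z" "Z <= span F" "finite F"
 shows "\<exists>b d. quot_basis Z B d b"
proof -
 obtain S where S: "S <= B" "independent S" "B <= span S"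
  using maximal_independent_subset .
 obtain T where T: "S <= T" "T <= Z" "independent T" "Z <= span T"
  using maximal_independent_subset_extend[of S Z] S B(2) by blast
 have "finite T"
  using independent_span_bound[OF Z(3) T(3)] T(2) Z(2) by blast
 define d where "d = card (T - S)"
 obtain b where b: "bij_betw b {..<d} (T - S)"
  using ex_bij_betw_nat_finite[of "T - S"] \<open>finite T\<close> by (auto simp: d_def atLeast0LessThan)
 have spanS: "span S = B"
  using S B(1) by (simp add: span_minimal subset_antisym)
 have reindex: "(\<Sum>j<d. c j *s b j) = (\<Sum>t\<in>T - S. c (inv_into {..<d} b t) *s t)" for c
 proof -
  have "(\<Sum>j<d. c j *s b j) = (\<Sum>j<d. (%t. c (inv_into {..<d} b t) *s t) (b j))"
   using b by (intro sum.cong refl) (simp add: bij_betw_def)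
  also have "... = (\<Sum>t\<in>T - S. c (inv_into {..<d} b t) *s t)"
   by (rule sum.reindex_bij_betw[OF b])
  finally show ?thesis .
 qed
 have "quot_basis Z B d b"
  unfolding quot_basis_def
 proof (intro conjI allI impI ballI)
  fix j assume "j < d"
  then show "b j \<in> Z" using b T(2) by (auto simp: bij_betw_def)
 next
  fix z assume "z \<in> Z"
  then obtain u where u: "z = (\<Sum>t\<in>T. u t *s t)"
   using T(4) span_finite[OF \<open>finite T\<close>] by blast
  have "(\<Sum>j<d. u (b j) *s b j) = (\<Sum>t\<in>T - S. u t *s t)"
   by (rule sum.reindex_bij_betw[OF b])
  then have "z - (\<Sum>j<d. u (b j) *s b j) = (\<Sum>t\<in>S. u t *s t)"
   using T(1) \<open>finite T\<close> by (simp add: u sum_diff)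
  moreover have "(\<Sum>t\<in>S. u t *s t) \<in> B"
   using S(1) B(1) by (intro subspace_sum subspace_scale) auto
  ultimately show "\<exists>c. z - (\<Sum>j<d. c j *s b j) \<in> B"
   by (intro exI[of _ "%j. u (b j)"]) simp
 next
  fix c j assume c: "(\<Sum>j<d. c j *s b j) \<in> B" and j: "j < d"
  define u where "u t = c (inv_into {..<d} b t)" for t
  have fS: "finite S" using T(1) \<open>finite T\<close> finite_subset by blast
  obtain v where v: "(\<Sum>t\<in>T - S. u t *s t) = (\<Sum>t\<in>S. v t *s t)"
   using c span_finite[OF fS] unfolding spanS reindex u_def by blast
  \<comment> \<open>Collects the two expressions of the same vector into one linear relation on the
    basis \<open>T\<close>.\<close>
  define w where "w t = (if t \<in> S then - v t else u t)" for t
  have "(\<Sum>t\<in>T. w t *s t) = (\<Sum>t\<in>T - S. w t *s t) + (\<Sum>t\<in>S. w t *s t)"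
   using T(1) \<open>finite T\<close> by (simp add: sum.subset_diff)
  also have "... = (\<Sum>t\<in>T - S. u t *s t) - (\<Sum>t\<in>S. v t *s t)"
   by (simp add: w_def sum_negf)
  finally have "(\<Sum>t\<in>T. w t *s t) = 0" using v by simp
  then have "w (b j) = 0"
   using T(3) \<open>finite T\<close> b j independentD[of T T w "b j"] by (auto simp: bij_betw_def)
  moreover have "b j \<notin> S" using b j by (auto simp: bij_betw_def)
  ultimately show "c j = 0" using b j by (simp add: w_def u_def bij_betw_def)
 qed
 then show ?thesis by blast
qed

text \<open>A basis of \<open>B\<close> together with the vectors \<open>b j\<close> is a basis of
  \<open>Z\<close>. In particular \<open>d\<close> is determined by the two subspaces.\<close>

lemma quot_basis_dim:
 assumes B: "subspace B" "B <= Z" and Z: "subspace Z" "Z <= span F" "finite F"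
  and b: "quot_basis Z B d b"
 shows "dim Z = dim B + d"
proof -
 obtain S where S: "S <= B" "independent S" "B <= span S" "card S = dim B"
  using basis_exists .
 have spanS: "span S = B"
  using S B(1) by (simp add: span_minimal subset_antisym)
 have fS: "finite S"
  using independent_span_bound[OF Z(3) S(2)] S(1) B(2) Z(2) by blast
 have b1: "!!j. j < d ==> b j \<in> Z" and b2: "!!z. z \<in> Z ==> \<exists>c. z - (\<Sum>j<d. c j *s b j) \<in> B"
  and b3: "!!c j. (\<Sum>j<d. c j *s b j) \<in> B ==> j < d ==> c j = 0"
  using b by (auto simp: quot_basis_def)
 have inj: "inj_on b {..<d}"
 proof (rule inj_onI, rule ccontr)
  fix i j assume ij: "i \<in> {..<d}" "j \<in> {..<d}" "b i = b j" "i ~= j"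
  let ?c = "%k. if k = i then 1 :: 'a else if k = j then - 1 else 0"
  have "(\<Sum>k<d. ?c k *s b k) = (\<Sum>k\<in>{i, j}. ?c k *s b k)"
   using ij by (intro sum.mono_neutral_right) auto
  also have "... = 0" using ij by simp
  finally have "?c i = 0" using b3[of ?c i] B(1) ij by (simp add: subspace_0)
  then show False by simp
 qed
 have notin: "b j \<notin> S" if "j < d" for j
 proof
  assume "b j \<in> S"
  let ?c = "%k. if k = j then 1 :: 'a else 0"
  have "(\<Sum>k<d. ?c k *s b k) = b j"
   using that by (simp add: if_distrib[of "%x. x *s _"] sum.delta cong: if_cong)
  then have "?c j = 0" using b3[of ?c j] \<open>b j \<in> S\<close> S(1) that by auto
  then show False by simp
 qed
 let ?T = "S \<union> b ` {..<d}"
 have fT: "finite ?T" using fS by simp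
 have sumT: "(\<Sum>t\<in>?T. w t *s t) = (\<Sum>t\<in>S. w t *s t) + (\<Sum>j<d. w (b j) *s b j)" for w
  using fS notin inj by (subst sum.union_disjoint) (auto simp: sum.reindex)
 have ind: "independent ?T"
 proof (rule independent_if_scalars_zero[OF fT])
  fix w x assume w: "(\<Sum>t\<in>?T. w t *s t) = 0" and x: "x \<in> ?T"
  have "(\<Sum>j<d. w (b j) *s b j) = - (\<Sum>t\<in>S. w t *s t)"
   using w unfolding sumT by (simp add: eq_neg_iff_add_eq_0 add.commute)
  also have "... \<in> B" using S(1) B(1) by (intro subspace_neg subspace_sum subspace_scale) auto
  finally have *: "(\<Sum>j<d. w (b j) *s b j) \<in> B" .
  have wb: "w (b j) = 0" if "j < d" for j using b3[OF * that] .
  then have "(\<Sum>t\<in>S. w t *s t) = 0" using w unfolding sumT by simp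
  then show "w x = 0" using x wb independentD[OF S(2) fS order_refl] by auto
 qed
 have spn: "Z <= span ?T"
 proof
  fix z assume "z \<in> Z"
  then obtain c where c: "z - (\<Sum>j<d. c j *s b j) \<in> B" using b2 by blast
  have "(\<Sum>j<d. c j *s b j) \<in> span ?T"
   by (intro span_sum span_scale span_base) auto
  moreover have "z - (\<Sum>j<d. c j *s b j) \<in> span ?T"
   using c spanS span_mono[of S ?T] by blast
  ultimately show "z \<in> span ?T" using span_add by fastforce
 qed
 have "?T <= Z" using S(1) B(2) b1 by auto
 then have "dim Z = card ?T"
  using basis_card_eq_dim spn ind by simp
 also have "... = card S + d"
  using fS notin inj by (subst card_Un_disjoint) (auto simp: card_image)
 finally show ?thesis using S(4) by simp
qed

text \<open>A basis of \<open>Z\<close> modulo the kernel is mapped to a basis of the image, so both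
  differences of dimensions are the same number.\<close>

lemma rank_nullity_subspace:
 assumes Z: "subspace Z" "Z <= span F" "finite F"
  and f: "!!x y. f (x + y) = f x + f y" "!!c x. f (c *s x) = c *s f x"
 shows "dim Z = dim {z \<in> Z. f z = 0} + dim (f ` Z)"
proof -
 have f0: "f 0 = 0" using f(2)[of 0 0] by simp
 have fneg: "f (- x) = - f x" for x using f(2)[of "- 1" x] by simp
 have fdiff: "f (x - y) = f x - f y" for x y using f(1)[of x "- y"] fneg by simp
 have fsum: "f (\<Sum>j<d. c j *s b j) = (\<Sum>j<d. c j *s f (b j))" for d c and b :: "nat => 'b"
  by (induction d) (simp_all add: f f0)
 let ?K = "{z \<in> Z. f z = 0}"
 have K: "subspace ?K"
  using Z(1) by (auto simp: subspace_def f f0)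
 obtain b d where b: "quot_basis Z ?K d b"
  using quot_basis_exists[OF K _ Z] by blast
 have im: "quot_basis (f ` Z) {0} d (%j. f (b j))"
  unfolding quot_basis_def
 proof (intro conjI allI impI ballI)
  fix y assume "y \<in> f ` Z"
  then obtain z where z: "z \<in> Z" "y = f z" by blast
  then obtain c where "z - (\<Sum>j<d. c j *s b j) \<in> ?K" using b by (auto simp: quot_basis_def)
  then show "\<exists>c. y - (\<Sum>j<d. c j *s f (b j)) \<in> {0}"
   by (intro exI[of _ c]) (simp add: fdiff fsum z)
 next
  fix c j assume c: "(\<Sum>j<d. c j *s f (b j)) \<in> {0}" "j < d"
  have "(\<Sum>j<d. c j *s b j) \<in> Z"
   using b Z(1) by (intro subspace_sum subspace_scale) (auto simp: quot_basis_def)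
  then have "(\<Sum>j<d. c j *s b j) \<in> ?K" using c(1) by (simp add: fsum)
  then show "c j = 0" using b c(2) by (auto simp: quot_basis_def)
 qed (use b in \<open>auto simp: quot_basis_def\<close>)
 have fZ: "subspace (f ` Z)"
  using Z(1) unfolding subspace_def
  by (auto simp flip: f intro!: imageI) (metis f0 imageI)
 have "f ` span F <= span (f ` F)"
 proof
  fix y assume "y \<in> f ` span F"
  then obtain x where x: "x \<in> span F" "y = f x" by blast
  from x(1) have "f x \<in> span (f ` F)"
  proof (induction rule: span_induct_alt)
   case base show ?case by (simp add: f0 span_zero)
  next
   case (step c x y)
   then show ?case by (simp add: f span_add span_scale span_base)
  qed
  then show "y \<in> span (f ` F)" using x(2) by simp
 qed
 then have sub: "f ` Z <= span (f ` F)" using Z(2) by blast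
 have "dim {0} = 0"
  using dim_span_eq_card_independent[OF independent_empty] by simp
 then have "dim (f ` Z) = d"
  using quot_basis_dim[OF subspace_single_0 _ fZ sub _ im] Z(3) subspace_0[OF fZ] by simp
 then show ?thesis using quot_basis_dim[OF K _ Z b] by simp
qed

text \<open>By rank and nullity each step adds the dimension of the image under \<open>f n\<close>,
  which is the same for both filtrations. In the application the steps are bounds on the weight and
  \<open>f n\<close> takes the top part.\<close>

lemma dim_eq_filtration:
 fixes V V' :: "nat => 'b set"
 assumes V: "!!n. subspace (V n)" "!!n. V n <= span F"
  and V': "!!n. subspace (V' n)" "!!n. V' n <= span F"
  and F: "finite F" and 0: "V 0 = V' 0"
  and f: "!!n x y. f n (x + y) = f n x + f n y" "!!n c x. f n (c *s x) = c *s f n x"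
  and ker: "!!n. {z \<in> V (Suc n). f n z = 0} = V n" "!!n. {z \<in> V' (Suc n). f n z = 0} = V' n"
  and im: "!!n. f n ` V (Suc n) = f n ` V' (Suc n)"
 shows "dim (V n) = dim (V' n)"
proof (induction n)
 case 0
 show ?case by (simp add: \<open>V 0 = V' 0\<close>)
next
 case (Suc n)
 then show ?case
  using rank_nullity_subspace[OF V F, of "f n" "Suc n"] rank_nullity_subspace[OF V' F, of "f n" "Suc n"] f ker im
  by simp
qed

end

subsection \<open>Initial forms and squarefree monomial ideals\<close>

lemma weight_initial_form_part:
 "weight_initial_form w f = part (%m. mon_weight w m = weight_degree w f) f"
proof -
 have "weight_initial_form w f = (\<Sum>m\<in>keys f.
   if mon_weight w m = weight_degree w f then single m (lookup f m) else 0)"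
  unfolding weight_initial_form_def by (simp add: sum.inter_filter)
 also have "... = part (%m. mon_weight w m = weight_degree w f)
   (\<Sum>m\<in>keys f. single m (lookup f m))"
  by (simp add: part_sum part_single)
 finally show ?thesis by (simp add: sum_singles)
qed

lemma weight_degree_eqI:
 assumes "m \<in> keys f" "mon_weight w m = d"
  and "!!m. m \<in> keys f ==> mon_weight w m \<le> d"
 shows "weight_degree w f = d"
 unfolding weight_degree_def using assms by (intro Max_eqI) auto

lemma mon_weight_le_weight_degree:
 "m \<in> keys f ==> mon_weight w m \<le> weight_degree w f"
 by (simp add: weight_degree_def)

text \<open>If \<open>d\<close> is attained, the part is the initial form; if \<open>d\<close> is
  only an upper bound, it is 0. Allowing both spares a computation of the weight degree wherever
  terms may cancel.\<close>

lemma top_part_in_initial_ideal: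
 assumes "f \<in> I" "!!m. m \<in> keys f ==> mon_weight w m \<le> d"
 shows "part (%m. mon_weight w m = d) f \<in> weight_initial_ideal w I"
proof (cases "\<exists>m\<in>keys f. mon_weight w m = d")
 case True
 then have "weight_degree w f = d" using assms(2) weight_degree_eqI by metis
 then have "part (%m. mon_weight w m = d) f = weight_initial_form w f"
  by (simp add: weight_initial_form_part)
 then show ?thesis
  using assms(1) by (simp add: weight_initial_ideal_def ideal.span_base)
next
 case False
 then have "part (%m. mon_weight w m = d) f = 0" by (intro part_eq_0) blast
 then show ?thesis by (simp add: weight_initial_ideal_def ideal.span_zero)
qed

text \<open>The polynomials whose weight components are all top parts of elements of
  \<open>I\<close> form an ideal that contains every initial form. So a weight-homogeneous element
  of the initial ideal is the top part of a single element of \<open>I\<close>, not just a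
  combination of initial forms.\<close>

lemma initial_ideal_lift:
 fixes I :: "('n::finite, 'k::field) mpol set"
 assumes I: "homogeneous_ideal I" and f: "f \<in> weight_initial_ideal w I"
  and d: "!!m. m \<in> keys f ==> mon_weight w m = d" and e: "homogeneous e f"
 shows "\<exists>g\<in>I. homogeneous e g & (\<forall>m\<in>keys g. mon_weight w m \<le> d) &
  part (%m. mon_weight w m = d) g = f"
proof -
 note id = homogeneous_ideal_is_ideal[OF I]
 \<comment> \<open>Fixing the bound \<open>d\<close>, instead of the actual weight degree, makes
   this set closed under addition even if top parts cancel.\<close>
 define L where "L d = {part (%m. mon_weight w m = d) g | g. g \<in> I &
  (\<forall>m\<in>keys g. mon_weight w m \<le> d)}" for d
 define V where "V = {f. \<forall>d. part (%m. mon_weight w m = d) f \<in> L d}"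
 have L0: "0 \<in> L d" for d
  unfolding L_def using ideal.subspace_0[OF id] by (auto intro!: exI[of _ 0])
 have Ladd: "f + g \<in> L d" if fg: "f \<in> L d" "g \<in> L d" for f g d
 proof -
  obtain f' g' where *: "f = part (%m. mon_weight w m = d) f'" "g = part (%m. mon_weight w m = d) g'"
   "f' \<in> I" "g' \<in> I" "\<forall>m\<in>keys f'. mon_weight w m \<le> d" "\<forall>m\<in>keys g'. mon_weight w m \<le> d"
   using fg by (auto simp: L_def)
  then have "f + g = part (%m. mon_weight w m = d) (f' + g')" "f' + g' \<in> I"
   "\<forall>m\<in>keys (f' + g'). mon_weight w m \<le> d"
   using keys_add[of f' g'] by (auto simp: part_add ideal.subspace_add[OF id])
  then show ?thesis unfolding L_def by blast
 qed
 have Lsingle: "single m c * f \<in> L (mon_weight w m + d)" if "f \<in> L d" for f m c d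
 proof -
  obtain g where g: "f = part (%m. mon_weight w m = d) g" "g \<in> I"
   "\<forall>m\<in>keys g. mon_weight w m \<le> d"
   using \<open>f \<in> L d\<close> by (auto simp: L_def)
  have "single m c * f = part (%k. mon_weight w k = mon_weight w m + d) (single m c * g)"
   by (simp add: part_single_mult g(1) mon_weight_add)
  moreover have "single m c * g \<in> I" using ideal.subspace_scale[OF id g(2)] .
  moreover have "mon_weight w k \<le> mon_weight w m + d" if "k \<in> keys (single m c * g)" for k
  proof -
   obtain p q where "k = p + q" "p \<in> keys (single m c)" "q \<in> keys g"
    using keys_mult[of "single m c" g] \<open>k \<in> _\<close> by blast
   then show ?thesis using g(3) by (auto simp: mon_weight_add split: if_splits)
  qed
  ultimately show ?thesis unfolding L_def by blast
 qed
 have "is_ideal V"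
 proof (rule monomial_module_is_ideal)
  fix m c and f :: "('n, 'k) mpol" assume f: "f \<in> V"
  show "single m c * f \<in> V"
   unfolding V_def
  proof (intro CollectI allI)
   fix d
   show "part (%k. mon_weight w k = d) (single m c * f) \<in> L d"
   proof (cases "mon_weight w m \<le> d")
    case True
    then have "(%k. mon_weight w (m + k) = d) = (%k. mon_weight w k = d - mon_weight w m)"
     by (auto simp: mon_weight_add)
    then show ?thesis
     using Lsingle[of "part (%k. mon_weight w k = d - mon_weight w m) f" "d - mon_weight w m" m c] f True
     by (simp add: part_single_mult V_def)
   next
    case False
    then have "part (%k. mon_weight w (m + k) = d) f = 0"
     by (intro part_eq_0) (simp add: mon_weight_add)
    then show ?thesis by (simp add: part_single_mult L0)
   qed
  qed
 qed (auto simp: V_def L0 part_add Ladd)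
 moreover have "weight_initial_form w g \<in> V" if "g \<in> I" for g
  unfolding V_def
 proof (intro CollectI allI)
  fix d
  show "part (%m. mon_weight w m = d) (weight_initial_form w g) \<in> L d"
  proof (cases "d = weight_degree w g")
   case True
   then have "part (%m. mon_weight w m = d) (weight_initial_form w g) = part (%m. mon_weight w m = d) g"
    by (simp add: weight_initial_form_part part_part)
   then show ?thesis
    using that True mon_weight_le_weight_degree by (auto simp: L_def)
  next
   case False
   then have "part (%m. mon_weight w m = d) (weight_initial_form w g) = 0"
    by (intro part_eq_0) (simp add: weight_initial_form_part keys_part)
   then show ?thesis by (simp add: L0)
  qed
 qed
 ultimately have "weight_initial_ideal w I <= V"
  unfolding weight_initial_ideal_def by (intro ideal.span_minimal) auto
 then have "part (%m. mon_weight w m = d) f \<in> L d" using f by (auto simp: V_def)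
 moreover have "part (%m. mon_weight w m = d) f = f" using d by (intro part_eq_self)
 ultimately obtain g where g: "f = part (%m. mon_weight w m = d) g" "g \<in> I"
   "\<forall>m\<in>keys g. mon_weight w m \<le> d"
  by (auto simp: L_def)
 \<comment> \<open>Taking components of the standard degree commutes with taking parts of a given
   weight, so the lift can be made homogeneous.\<close>
 have "part (%m. mon_weight w m = d) (hcomp e g) = hcomp e f"
  by (simp add: g(1) hcomp_def part_part conj_commute)
 then have "part (%m. mon_weight w m = d) (hcomp e g) = f"
  using e by (simp add: homog_iff_hcomp)
 then show ?thesis
  using homogeneous_ideal_hcomp[OF I g(2), of e] g(3)
  by (intro bexI[of _ "hcomp e g"]) (auto simp: hcomp_def keys_part homogeneous_def)
qed

text \<open>A square-free monomial divides another monomial as soon as its support is contained in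
  the support of the other. Hence membership is decided term by term, and by supports only.\<close>

lemma squarefree_monomial_ideal_mem_iff:
 fixes J :: "('n::finite, 'k::field) mpol set"
 assumes "squarefree_monomial_ideal J"
 shows "f \<in> J \<longleftrightarrow> (\<forall>m\<in>keys f. single m 1 \<in> J)"
  and "single m 1 \<in> J ==> keys m <= keys m' ==> single m' 1 \<in> J"
  and "is_ideal J"
proof -
 obtain M where M: "\<forall>m\<in>M. \<forall>i. lookup m i \<le> 1"
  and J: "J = ideal_gen ((%m. single m 1) ` M)"
  using assms unfolding squarefree_monomial_ideal_def by blast
 show id: "is_ideal J" unfolding J by (rule ideal.subspace_span)
 define V where "V = {f :: ('n, 'k) mpol. \<forall>m\<in>keys f. \<exists>u\<in>M. keys u <= keys m}"
 have keys_plus: "keys (a + b) = keys a \<union> keys b" for a b :: "'n mon"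
  by (auto simp: in_keys_iff lookup_add)
 have "is_ideal V"
 proof (rule monomial_module_is_ideal)
  fix f g assume "f \<in> V" "g \<in> V"
  then show "f + g \<in> V" using keys_add[of f g] unfolding V_def by blast
 next
  fix m c f assume f: "f \<in> V"
  show "single m c * f \<in> V"
   unfolding V_def
  proof (intro CollectI ballI)
   fix k assume "k \<in> keys (single m c * f)"
   then obtain p q where pq: "k = p + q" "q \<in> keys f"
    using keys_mult[of "single m c" f] by blast
   then obtain u where "u \<in> M" "keys u <= keys q"
    using f unfolding V_def by blast
   then show "\<exists>u\<in>M. keys u <= keys k"
    using pq keys_plus by blast
  qed
 qed (simp add: V_def)
 then have JV: "J <= V"
  unfolding J by (intro ideal.span_minimal) (auto simp: V_def)
 have mem: "single m 1 \<in> J" if "u \<in> M" "keys u <= keys m" for u m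
 proof -
  have "m = (m - u) + u"
  proof (rule poly_mapping_eqI)
   fix i
   have "lookup u i \<le> lookup m i"
    using M that by (metis One_nat_def Suc_leI in_keys_iff le_trans not_gr_zero subsetD zero_le)
   then show "lookup m i = lookup ((m - u) + u) i"
    by (simp add: lookup_add lookup_minus)
  qed
  then have "single m (1::'k) = single (m - u) 1 * single u 1"
   by (simp add: mult_single)
  then show ?thesis
   unfolding J using that by (simp add: ideal.span_scale ideal.span_base)
 qed
 have iff: "single m 1 \<in> J \<longleftrightarrow> (\<exists>u\<in>M. keys u <= keys m)" for m
  using JV mem by (auto simp: V_def)
 show "single m 1 \<in> J ==> keys m <= keys m' ==> single m' 1 \<in> J"
  unfolding iff by blast
 show "f \<in> J \<longleftrightarrow> (\<forall>m\<in>keys f. single m 1 \<in> J)"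
 proof
  assume "f \<in> J"
  then show "\<forall>m\<in>keys f. single m 1 \<in> J"
   using JV unfolding iff V_def by blast
 next
  assume *: "\<forall>m\<in>keys f. single m 1 \<in> J"
  have "(\<Sum>m\<in>keys f. const_pol (lookup f m) * single m 1) \<in> J"
   by (intro ideal.subspace_sum ideal.subspace_scale id) (use * in blast)
  then show "f \<in> J" by (simp add: mult_single sum_singles)
 qed
qed

section \<open>Homogeneous cochains, their weights and their values in an ideal\<close>

lemma sum_count_list: "(\<Sum>j\<in>UNIV. count_list xs j) = length xs" for xs :: "'n::finite list"
proof (induction xs)
 case (Cons i xs)
 have "(\<Sum>j\<in>UNIV. count_list (i # xs) j) = (\<Sum>j\<in>UNIV. count_list xs j + (if j = i then 1 else 0))"
  by (intro sum.cong) auto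
 then show ?case using Cons by (simp add: sum.distrib)
qed simp

definition wsum :: "('n::finite => nat) => ('n => int) => int"
 where "wsum w a = (\<Sum>j\<in>UNIV. int (w j) * a j)"

definition wlist :: "('n::finite => nat) => 'n list => nat"
 where "wlist w xs = mon_weight w (mcount xs)"

lemma wsum_mdeg: "wsum w (mdeg N xs m) = int (mon_weight w m) - int N * int (wlist w xs)"
 by (simp add: wsum_def mdeg_def mon_weight_def wlist_def mcount_def sum_distrib_left
   sum_subtractf algebra_simps)

lemma mon_degree_mcount: "mon_degree (mcount xs) = length xs"
 by (simp add: mon_weight_def mcount_def sum_count_list)

lemma sum_mdeg: "(\<Sum>j\<in>UNIV. mdeg N xs m j) = int (mon_degree m) - int N * int (length xs)"
 using wsum_mdeg[of "%_. 1" N xs m] mon_degree_mcount[of xs] by (simp add: wsum_def wlist_def)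

text \<open>Fractions of degree \<open>nu\<close> on lists of length \<open>p\<close>, that is, Cech
  degree p - 1; \<open>p = 0\<close> is the augmentation. Values at lists of any other length are
  set to 0, which makes the space finite-dimensional.\<close>

definition kC :: "int => nat => nat => ('n::finite list => ('n, 'k::field) mpol) set"
 where "kC nu N p = {c. \<forall>xs. if length xs = p then homogeneous (nu + int (N * p)) (c xs) else c xs = 0}"

definition valued :: "('n, 'k::field) mpol set => ('n list => ('n, 'k) mpol) set"
 where "valued I = {c. \<forall>xs. c xs \<in> I}"

lemma kC_iff:
 "c \<in> kC nu N p \<longleftrightarrow> cin N (%a. sum a UNIV = nu) c & (\<forall>xs. length xs ~= p --> c xs = 0)"
proof -
 have "(\<forall>xs. if length xs = p then homogeneous (nu + int (N * p)) (c xs) else c xs = 0) \<longleftrightarrow>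
  (\<forall>xs. \<forall>m\<in>keys (c xs). sum (mdeg N xs m) UNIV = nu) & (\<forall>xs. length xs ~= p --> c xs = 0)"
  unfolding sum_mdeg homogeneous_def by (auto simp: algebra_simps; force)
 then show ?thesis unfolding kC_def cin_keys by simp
qed

lemma kC_zero [simp]: "0 \<in> kC nu N p"
 by (simp add: kC_def)

lemma kC_add: "c \<in> kC nu N p ==> c' \<in> kC nu N p ==> c + c' \<in> kC nu N p"
 by (simp add: kC_iff cin_add)

lemma kC_diff: "c \<in> kC nu N p ==> c' \<in> kC nu N p ==> c - c' \<in> kC nu N p"
 by (simp add: kC_iff cin_diff)

lemma kC_cpart: "c \<in> kC nu N p ==> cpart N Q c \<in> kC nu N p"
 by (simp add: kC_iff cin_cpart) (simp add: cpart_def)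

lemma kdiff_length:
 assumes "!!ys. length ys ~= p ==> c ys = 0" "length xs ~= Suc p"
 shows "kdiff N c xs = 0"
 by (rule kdiff_eq_0) (use assms in auto)

lemma kC_kdiff: "c \<in> kC nu N p ==> kdiff N c \<in> kC nu N (Suc p)"
 using kdiff_length[of p c] by (auto simp: kC_iff cin_kdiff)

lemma kC_hmt:
 assumes "c \<in> kC nu N (Suc p)"
 shows "hmt N c \<in> kC nu N p"
proof -
 have "hmt N c xs = 0" if "length xs ~= p" for xs
 proof (rule poly_mapping_eqI)
  fix m
  have "c (j # xs) = 0" for j using assms that by (simp add: kC_iff)
  then show "lookup (hmt N c xs) m = lookup 0 m"
   by (simp add: lookup_hmt cf_def Let_def)
 qed
 then show ?thesis using assms by (simp add: kC_iff cin_hmt)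
qed

lemma kC_tr: "c \<in> kC nu N p ==> tr c \<in> kC nu (Suc N) p"
 by (simp add: kC_iff cin_tr) (simp add: tr_def)

lemma valued_diff: "is_ideal I ==> c \<in> valued I ==> c' \<in> valued I ==> c - c' \<in> valued I"
 by (simp add: valued_def ideal.subspace_diff)

lemma valued_add: "is_ideal I ==> c \<in> valued I ==> c' \<in> valued I ==> c + c' \<in> valued I"
 by (simp add: valued_def ideal.subspace_add)

lemma valued_zero: "is_ideal I ==> 0 \<in> valued I"
 by (simp add: valued_def ideal.subspace_0)

lemma valued_kdiff: "is_ideal I ==> c \<in> valued I ==> kdiff N c \<in> valued I"
 by (simp add: valued_def kdiff_in)

lemma valued_tr: "is_ideal I ==> c \<in> valued I ==> tr c \<in> valued I"
 by (simp add: valued_def tr_def ideal.subspace_scale)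

definition nonpos :: "('n => int) => bool"
 where "nonpos a \<longleftrightarrow> (\<forall>j. a j \<le> 0)"

lemma nonpos_ge:
 fixes a :: "'n::finite => int"
 assumes "nonpos a" "sum a UNIV = nu"
 shows "a j \<ge> - \<bar>nu\<bar>"
proof -
 have "sum a UNIV \<le> sum a {j}"
  using assms(1) by (subst sum.remove[of UNIV j]) (auto simp: nonpos_def intro: sum_nonpos)
 then show ?thesis using assms(2) by simp
qed

lemma wsum_nonpos_le: "nonpos a ==> wsum w a \<le> 0"
 unfolding wsum_def nonpos_def by (intro sum_nonpos) (simp add: mult_nonneg_nonpos)

text \<open>All entries are at least -|nu|. So the nonpositive multidegrees of sum \<open>nu\<close>
  have weights between this bound and 0, and the bound is the threshold in
  \<open>low_levels_exact\<close>.\<close>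

lemma wsum_nonpos_ge:
 fixes a :: "'n::finite => int"
 assumes "nonpos a" "sum a UNIV = nu"
 shows "wsum w a \<ge> - int (sum w UNIV) * \<bar>nu\<bar>"
proof -
 have "wsum w a \<ge> (\<Sum>j\<in>UNIV. int (w j) * - \<bar>nu\<bar>)"
  unfolding wsum_def by (intro sum_mono mult_left_mono nonpos_ge assms) simp
 then show ?thesis by (simp add: sum_distrib_right sum_negf)
qed

text \<open>
 Cochains of multidegree \<open>a \<le> 0\<close> do not see the exponent \<open>N\<close> of the denominators once
 \<open>N\<close> exceeds \<open>\<bar>nu\<bar>\<close>, since the entries of \<open>a\<close> add up to \<open>nu\<close>.
\<close>

lemma untr:
 assumes "u \<in> kC nu (Suc N) p" "cin (Suc N) nonpos u" "int N \<ge> \<bar>nu\<bar>"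
 obtains v where "v \<in> kC nu N p" "tr v = u"
proof
 define v where "v xs = Abs_poly_mapping (%m. lookup (u xs) (m + mcount xs))" for xs
 have lookup_v: "lookup (v xs) m = lookup (u xs) (m + mcount xs)" for xs m
 proof -
  have "{m. lookup (u xs) (m + mcount xs) ~= 0} = (%m. m + mcount xs) -` keys (u xs)"
   by (auto simp: in_keys_iff)
  moreover have "finite ((%m. m + mcount xs) -` keys (u xs))"
   by (intro finite_vimageI) (auto intro: injI)
  ultimately show ?thesis by (simp add: v_def)
 qed
 have cfv: "cf N a v xs = cf (Suc N) a u xs" for a xs
 proof (cases "integral_at N a xs")
  case True
  have "amon (Suc N) a xs = amon N a xs + mcount xs"
  proof (rule poly_mapping_eqI)
   fix i
   have "a i + int N * int (count_list xs i) \<ge> 0" using True by (simp add: integral_at_def)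
   then show "lookup (amon (Suc N) a xs) i = lookup (amon N a xs + mcount xs) i"
    unfolding amon_def lookup_mon shift_Suc lookup_add mcount_def by auto
  qed
  moreover have "integral_at (Suc N) a xs"
   using True unfolding integral_at_def shift_Suc by (smt (verit) of_nat_0_le_iff)
  ultimately show ?thesis using True by (simp add: cf_def lookup_v)
 next
  case False
  have "cf (Suc N) a u xs = 0"
  proof (rule ccontr)
   assume "cf (Suc N) a u xs ~= 0"
   then have a: "nonpos a" "sum a UNIV = nu" "integral_at (Suc N) a xs"
    using assms(1,2) by (auto simp: kC_iff cin_def cf_def split: if_splits)
   \<comment> \<open>Where \<open>j\<close> is not an entry of \<open>xs\<close>, both exponents
     impose the same condition; where it is one, \<open>N\<close> alone outweighs the entry, which
     is at least -|nu|.\<close>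
   have "a j + int N * int (count_list xs j) \<ge> 0" for j
   proof (cases "count_list xs j = 0")
    case True
    then show ?thesis using a(3) by (auto simp: integral_at_def dest: spec[of _ j])
   next
    case False
    then have "int N * 1 \<le> int N * int (count_list xs j)"
     by (intro mult_left_mono) auto
    then show ?thesis using nonpos_ge[OF a(1,2), of j] assms(3) by linarith
   qed
   then show False using False by (simp add: integral_at_def)
  qed
  then show ?thesis using False by (simp add: cf_def)
 qed
 show eq: "tr v = u"
  by (rule cf_eqI[of "Suc N"]) (simp add: cf_tr cfv)
 have "v xs = 0" if "length xs ~= p" for xs
  using assms(1) that by (intro poly_mapping_eqI) (simp add: lookup_v kC_iff)
 then show "v \<in> kC nu N p"
  using assms(1) eq cin_tr[of N _ v] by (auto simp: kC_iff)
qed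

text \<open>Isolates the factor \<open>xl xs ^ n\<close> that \<open>lower_cochain\<close> replaces
  by a form of smaller weight.\<close>

lemma untr_power:
 assumes "u \<in> kC nu (N + n) p" "cin (N + n) nonpos u" "int N \<ge> \<bar>nu\<bar>"
 obtains v where "v \<in> kC nu N p" "u = (%xs. xl xs ^ n * v xs)"
 using assms
proof (induction n arbitrary: u thesis)
 case 0
 then show ?case by simp
next
 case (Suc n)
 obtain v where v: "v \<in> kC nu (N + n) p" "tr v = u"
  using untr[of u nu "N + n" p] Suc.prems by auto
 then have "cin (N + n) nonpos v" using Suc.prems(3) cin_tr[of "N + n" nonpos v] by simp
 then obtain v' where "v' \<in> kC nu N p" "v = (%xs. xl xs ^ n * v' xs)"
  using Suc.IH v(1) Suc.prems(4) by blast
 moreover from this(2) have "u = (%xs. xl xs ^ Suc n * v' xs)"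
  unfolding v(2)[symmetric] tr_def by (auto simp: mult.assoc)
 ultimately show ?case using Suc.prems(1) by blast
qed

section \<open>Lifting from the initial ideal by descent on the weight\<close>

locale squarefree_degeneration =
 fixes I J :: "('n::finite, 'k::field) mpol set" and w :: "'n => nat" and nu :: int
 assumes I: "homogeneous_ideal I"
  and in_I: "weight_initial_ideal w I = J"
  and J: "squarefree_monomial_ideal J"
begin

lemma ideal_I: "is_ideal I"
 using I by (rule homogeneous_ideal_is_ideal)

lemma ideal_J: "is_ideal J"
 using J by (rule squarefree_monomial_ideal_mem_iff)

abbreviation "K \<equiv> kC nu"
abbreviation "lev N d \<equiv> cin N (%a. wsum w a \<le> d)"
abbreviation "pure N d \<equiv> cin N (%a. wsum w a = d)"
abbreviation "topc N d \<equiv> cpart N (%a. wsum w a = d)"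

lemma lev_drop: "lev N d c ==> topc N d c = 0 ==> lev N (d - 1) c"
 unfolding cin_def
proof (intro allI impI)
 fix a xs assume *: "\<forall>a xs. cf N a c xs ~= 0 --> wsum w a \<le> d" "topc N d c = 0" "cf N a c xs ~= 0"
 then have "cf N a (topc N d c) xs = 0" by simp
 then have "wsum w a ~= d" using *(3) by (auto simp: cf_cpart)
 then show "wsum w a \<le> d - 1" using * by force
qed

lemma pure_lev: "pure N d c ==> d \<le> e ==> lev N e c"
 by (erule cin_mono) auto

lemma lev_mono: "lev N d c ==> d \<le> e ==> lev N e c"
 by (erule cin_mono) auto

lemma top_lev_less: "lev N e c ==> e < d ==> topc N d c = 0"
 by (rule cf_eqI[of N]) (auto simp: cin_def cf_cpart)

text \<open>Numerators have a fixed degree, which bounds their weight from above, and the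
  denominators bound the weight of a fraction from below. So for given \<open>N\<close> and
  \<open>p\<close> every descent on the weight starts somewhere and ends at 0.\<close>

lemma lev_bounds:
 assumes "c \<in> K N p"
 shows "lev N (int (sum w UNIV) * \<bar>nu + int (N * p)\<bar>) c"
  and "lev N (- int (N * p * sum w UNIV) - 1) c ==> c = 0"
proof -
 have wle: "mon_weight w m \<le> sum w UNIV * mon_degree m" for m
 proof -
  have "mon_weight w m \<le> (\<Sum>i\<in>UNIV. sum w UNIV * lookup m i)"
   unfolding mon_weight_def by (intro sum_mono mult_right_mono member_le_sum) auto
  then show ?thesis by (simp add: mon_weight_def sum_distrib_left)
 qed
 show "lev N (int (sum w UNIV) * \<bar>nu + int (N * p)\<bar>) c"
  unfolding cin_keys
 proof (intro allI ballI)
  fix xs m assume m: "m \<in> keys (c xs)"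
  then have "length xs = p" using assms by (auto simp: kC_def split: if_splits)
  then have "int (mon_degree m) = nu + int (N * p)"
   using assms m unfolding kC_def homogeneous_def by (auto split: if_splits dest: spec[of _ xs])
  then have "int (mon_weight w m) \<le> int (sum w UNIV) * \<bar>nu + int (N * p)\<bar>"
   using wle[of m] by (metis abs_of_nat of_nat_le_iff of_nat_mult)
  then show "wsum w (mdeg N xs m) \<le> int (sum w UNIV) * \<bar>nu + int (N * p)\<bar>"
   unfolding wsum_mdeg by (smt (verit) of_nat_0_le_iff mult_nonneg_nonneg)
 qed
 show "c = 0" if lev: "lev N (- int (N * p * sum w UNIV) - 1) c"
 proof
  fix xs show "c xs = 0 xs"
  proof (rule poly_mapping_eqI, rule ccontr)
   fix m assume m: "lookup (c xs) m ~= lookup (0 xs) m"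
   then have "c xs ~= 0" by auto
   then have "length xs = p" using assms by (auto simp: kC_def split: if_splits)
   have "wlist w xs \<le> sum w UNIV * p"
    using wle[of "mcount xs"] mon_degree_mcount[of xs] \<open>length xs = p\<close> by (simp add: wlist_def)
   then have "int N * int (wlist w xs) \<le> int (N * p * sum w UNIV)"
    by (simp flip: of_nat_mult add: mult.assoc mult.commute[of p])
   moreover have "wsum w (mdeg N xs m) \<le> - int (N * p * sum w UNIV) - 1"
    using lev m unfolding cin_keys by (simp add: in_keys_iff)
   ultimately show False unfolding wsum_mdeg by linarith
  qed
 qed
qed

lemma valued_J_iff:
 "c \<in> valued J \<longleftrightarrow> (\<forall>a xs. cf N a c xs ~= 0 --> single (amon N a xs) 1 \<in> J)"
proof
 assume "c \<in> valued J"
 then show "\<forall>a xs. cf N a c xs ~= 0 --> single (amon N a xs) 1 \<in> J"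
  using squarefree_monomial_ideal_mem_iff(1)[OF J] unfolding valued_def cf_def
  by (metis (mono_tags, lifting) in_keys_iff mem_Collect_eq)
next
 assume *: "\<forall>a xs. cf N a c xs ~= 0 --> single (amon N a xs) 1 \<in> J"
 have "c xs \<in> J" for xs
  unfolding squarefree_monomial_ideal_mem_iff(1)[OF J, of "c xs"]
  using * by (metis amon_mdeg cf_mdeg in_keys_iff)
 then show "c \<in> valued J" by (simp add: valued_def)
qed

lemma valued_J_cpart: "c \<in> valued J ==> cpart N Q c \<in> valued J"
 unfolding valued_J_iff[of _ N] by (simp add: cf_cpart)

lemma keys_amon: "keys (amon N a xs) = {j. a j + int N * int (count_list xs j) > 0}"
 by (auto simp: in_keys_iff amon_def)

lemma J_support: "single m 1 \<in> J ==> keys m <= keys m' ==>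
  single m' 1 \<in> J"
 using squarefree_monomial_ideal_mem_iff(2)[OF J] .

lemma top_valued_J:
 assumes "c \<in> valued I" "lev N d c"
 shows "topc N d c \<in> valued J"
 unfolding valued_def
proof (intro CollectI allI)
 fix xs
 \<comment> \<open>The weight of the numerator of a fraction of weight \<open>d\<close>. It may be
   negative, and then no monomial has it.\<close>
 let ?e = "d + int N * int (wlist w xs)"
 have le: "int (mon_weight w m) \<le> ?e" if "m \<in> keys (c xs)" for m
  using assms(2) that unfolding cin_keys wsum_mdeg by force
 have "topc N d c xs = part (%m. int (mon_weight w m) = ?e) (c xs)"
  unfolding cpart_def wsum_mdeg by (intro part_cong) auto
 also have "... \<in> J"
 proof (cases "?e \<ge> 0")
  case True
  then have "part (%m. int (mon_weight w m) = ?e) (c xs) = part (%m. mon_weight w m = nat ?e) (c xs)"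
   by (intro part_cong) auto
  also have "... \<in> weight_initial_ideal w I"
   using assms(1) le by (intro top_part_in_initial_ideal) (force simp: valued_def)+
  finally show ?thesis by (simp add: in_I)
 next
  case False
  then have "part (%m. int (mon_weight w m) = ?e) (c xs) = 0" by (intro part_eq_0) linarith
  then show ?thesis by (simp add: ideal.subspace_0[OF ideal_J])
 qed
 finally show "topc N d c xs \<in> J" .
qed

text \<open>Each value is lifted separately by \<open>initial_ideal_lift\<close>. As the lift has
  values in \<open>I\<close>, subtracting it removes a J-valued top part without any change modulo
  \<open>I\<close>.\<close>

lemma lift_J:
 assumes "c \<in> valued J" "c \<in> K N p" "pure N d c"
 obtains c' where "c' \<in> valued I" "c' \<in> K N p" "lev N d c'" "topc N d c' = c"
proof -
 have "\<exists>g\<in>I. (if length xs = p then homogeneous (nu + int (N * p)) g else g = 0) &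
   (\<forall>m\<in>keys g. wsum w (mdeg N xs m) \<le> d) &
   part (%m. wsum w (mdeg N xs m) = d) g = c xs" for xs
 proof (cases "length xs = p & c xs ~= 0")
  case False
  then have "c xs = 0" using assms(2) by (auto simp: kC_def split: if_splits)
  then show ?thesis
   by (intro bexI[of _ 0]) (auto simp: ideal.subspace_0[OF ideal_I])
 next
  case True
  let ?e = "d + int N * int (wlist w xs)"
  have eq: "int (mon_weight w m) = ?e" if "m \<in> keys (c xs)" for m
   using assms(3) that unfolding cin_keys wsum_mdeg by force
  obtain m where "m \<in> keys (c xs)"
   using True by (metis all_not_in_conv in_keys_iff lookup_zero poly_mapping_eqI)
  then have "?e \<ge> 0" using eq[of m] by linarith
  have "c xs \<in> weight_initial_ideal w I" using assms(1) by (simp add: in_I valued_def)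
  moreover have "mon_weight w m = nat ?e" if "m \<in> keys (c xs)" for m
   using eq[OF that] by linarith
  moreover have "homogeneous (nu + int (N * p)) (c xs)"
   using assms(2) True unfolding kC_def by (auto split: if_splits dest: spec[of _ xs])
  ultimately obtain g where g: "g \<in> I" "homogeneous (nu + int (N * p)) g"
   "\<forall>m\<in>keys g. mon_weight w m \<le> nat ?e" "part (%m. mon_weight w m = nat ?e) g = c xs"
   using initial_ideal_lift[OF I] by blast
  have "(%m. wsum w (mdeg N xs m) = d) = (%m. mon_weight w m = nat ?e)"
   unfolding wsum_mdeg using \<open>?e \<ge> 0\<close> by (intro ext) linarith
  then show ?thesis
   using g True \<open>?e \<ge> 0\<close> by (intro bexI[of _ g]) (auto simp: wsum_mdeg)
 qed
 then obtain c' where c': "!!xs. c' xs \<in> I"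
   "!!xs. if length xs = p then homogeneous (nu + int (N * p)) (c' xs) else c' xs = 0"
   "!!xs m. m\<in>keys (c' xs) ==> wsum w (mdeg N xs m) \<le> d"
   "!!xs. part (%m. wsum w (mdeg N xs m) = d) (c' xs) = c xs"
  by metis
 show thesis
 proof
  show "c' \<in> valued I" using c'(1) by (simp add: valued_def)
  show "c' \<in> K N p" unfolding kC_def using c'(2) by blast
  show "lev N d c'" unfolding cin_keys using c'(3) by blast
  show "topc N d c' = c" using c'(4) by (intro ext) (simp add: cpart_def)
 qed
qed

text \<open>
 Modulo \<open>J\<close>, the Koszul complex is contractible in the multidegrees with a positive entry, because
 membership of a monomial in \<open>J\<close> only depends on its support.
\<close>

lemma contract_mod_J:
 assumes "kdiff N c \<in> valued J"
 shows "c - kdiff N (hmt N c) - cpart N nonpos c \<in> valued J"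
 unfolding valued_J_iff[of _ N]
proof (intro allI impI)
 fix a xs assume nz: "cf N a (c - kdiff N (hmt N c) - cpart N nonpos c) xs ~= 0"
 have eq: "cf N a (c - kdiff N (hmt N c) - cpart N nonpos c) xs =
   cf N a (c - kdiff N (hmt N c)) xs - (if nonpos a then cf N a c xs else 0)"
  by (simp add: cf_diff[of N a "c - kdiff N (hmt N c)"] cf_cpart)
 show "single (amon N a xs) 1 \<in> J"
 proof (cases "\<exists>j. a j > 0")
  case False
  then have "nonpos a" by (auto simp: nonpos_def not_less)
  then show ?thesis using nz False unfolding eq hmt_homotopy by simp
 next
  case True
  define j where "j = (SOME j. a j > 0)"
  have j: "a j > 0" unfolding j_def using True by (rule someI_ex)
  have "\<not> nonpos a" using j by (auto simp: nonpos_def not_le)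
  then have "cf N a (kdiff N c) (j # xs) ~= 0"
   using nz True unfolding eq hmt_homotopy j_def by simp
  then have "single (amon N a (j # xs)) 1 \<in> J"
   using assms unfolding valued_J_iff[of _ N] by blast
  \<comment> \<open>Since \<open>a j\<close> is positive, the variable j already divides the
    numerator at \<open>xs\<close>; a further factor in the denominator does not enlarge the
    support.\<close>
  moreover have "keys (amon N a (j # xs)) <= keys (amon N a xs)"
  proof -
   have "a j + int N * int (count_list xs j) > 0" using j by (smt (verit) of_nat_0_le_iff mult_nonneg_nonneg)
   then show ?thesis unfolding keys_amon shift_Cons by auto
  qed
  ultimately show ?thesis by (rule J_support)
 qed
qed

text \<open>This is the form in which the contraction is used. A coboundary lifts as it stands and a
  J-valued cochain lifts by \<open>lift_J\<close>, so the only problem in the descents is the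
  summand \<open>n\<close> in nonpositive multidegrees. All summands keep the weight
  \<open>d\<close>.\<close>

lemma contract_mod_J_parts:
 assumes "c \<in> K N (Suc p)" "kdiff N c \<in> valued J" "pure N d c"
 obtains e n j where "c = kdiff N e + n + j" "e \<in> K N p" "n \<in> K N (Suc p)" "j \<in> K N (Suc p)"
  "pure N d e" "pure N d n" "pure N d j" "cin N nonpos n" "j \<in> valued J" "kdiff N n \<in> valued J"
proof
 let ?e = "hmt N c" and ?n = "cpart N nonpos c"
 let ?j = "c - kdiff N ?e - ?n"
 show "c = kdiff N ?e + ?n + ?j" by simp
 show e: "?e \<in> K N p" using assms(1) by (rule kC_hmt)
 show n: "?n \<in> K N (Suc p)" using assms(1) by (rule kC_cpart)
 show "?j \<in> K N (Suc p)" by (intro kC_diff assms(1) n kC_kdiff e)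
 show "pure N d ?e" by (rule cin_hmt) (rule assms)
 show "pure N d ?n" by (rule cin_cpart) (rule assms)
 show "pure N d ?j" by (intro cin_diff assms cin_kdiff cin_hmt cin_cpart)
 show "cin N nonpos ?n" by (rule cin_cpart_self)
 show "?j \<in> valued J" by (rule contract_mod_J) (rule assms)
 show "kdiff N ?n \<in> valued J"
  unfolding kdiff_cpart by (rule valued_J_cpart) (rule assms)
qed

text \<open>In these weights there is no nonpositive multidegree, so the top part is a coboundary up
  to a J-valued cochain, and subtracting lifts of both lowers the weight. The induction counts the
  weights that remain above the lower bound of \<open>lev_bounds\<close>. The bound on
  \<open>e\<close> matters: the correction must not disturb higher weights.\<close>

lemma low_levels_exact:
 assumes "y \<in> K N (Suc p)" "kdiff N y \<in> valued I" "lev N d y" "d < - int (sum w UNIV) * \<bar>nu\<bar>"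
 shows "\<exists>e\<in>K N p. lev N d e & y - kdiff N e \<in> valued I"
 using assms
proof (induction "nat (d + int (N * Suc p * sum w UNIV) + 1)" arbitrary: y d)
 case 0
 then have "d \<le> - int (N * Suc p * sum w UNIV) - 1" by linarith
 then have "y = 0" by (rule lev_bounds(2)[OF 0(2) lev_mono[OF 0(4)]])
 then have "y - kdiff N 0 = 0" by (simp only: kdiff_zero diff_self)
 moreover have "lev N d (0 :: 'n list => ('n, 'k) mpol)" by (rule cin_zero)
 ultimately show ?case
  using valued_zero[OF ideal_I] kC_zero by metis
next
 case (Suc k)
 let ?t = "topc N d y"
 have t: "?t \<in> K N (Suc p)" "pure N d ?t" using Suc.prems(1) by (simp_all add: kC_cpart cin_cpart_self)
 have "kdiff N ?t \<in> valued J"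
  unfolding kdiff_cpart using Suc.prems(2,3) by (intro top_valued_J cin_kdiff)
 then obtain e n j where enj: "?t = kdiff N e + n + j" "e \<in> K N p" "n \<in> K N (Suc p)" "j \<in> K N (Suc p)"
  "pure N d e" "pure N d n" "pure N d j" "cin N nonpos n" "j \<in> valued J"
  using contract_mod_J_parts[OF t(1) _ t(2)] by metis
 have "n = 0"
 proof (rule cf_eqI[of N], rule ccontr)
  fix a xs assume "cf N a n xs ~= cf N a 0 xs"
  then have "nonpos a" "sum a UNIV = nu" "wsum w a = d"
   using enj(3,6,8) by (auto simp: cin_def kC_iff)
  then show False using wsum_nonpos_ge[of a nu w] Suc.prems(4) by linarith
 qed
 obtain j' where j': "j' \<in> valued I" "j' \<in> K N (Suc p)" "lev N d j'" "topc N d j' = j"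
  using lift_J[OF enj(9,4,7)] .
 let ?y = "y - kdiff N e - j'"
 have y: "?y \<in> K N (Suc p)"
  by (intro kC_diff kC_kdiff Suc.prems enj j')
 have ky: "kdiff N ?y \<in> valued I"
  using Suc.prems(2) j'(1) ideal_I
  by (simp add: kdiff_diff kdiff_kdiff valued_diff valued_kdiff)
 have ly: "lev N (d - 1) ?y"
 proof (rule lev_drop)
  show "lev N d ?y"
   by (intro cin_diff cin_kdiff Suc.prems j' pure_lev[OF enj(5)] order_refl)
  show "topc N d ?y = 0"
   using enj(1) \<open>n = 0\<close> by (simp add: cpart_diff j'(4) cpart_eq_self[OF cin_kdiff[OF enj(5)]])
 qed
 have "\<exists>e'\<in>K N p. lev N (d - 1) e' & ?y - kdiff N e' \<in> valued I"
  using Suc.hyps(2) Suc.prems(4) by (intro Suc.hyps(1)[OF _ y ky ly]) linarith+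
 then obtain e' where e': "e' \<in> K N p" "lev N (d - 1) e'" "?y - kdiff N e' \<in> valued I" by blast
 show ?case
 proof (intro bexI conjI)
  show "e + e' \<in> K N p" by (intro kC_add enj e')
  show "lev N d (e + e')"
   by (intro cin_add pure_lev[OF enj(5)] lev_mono[OF e'(2)]) auto
  have "y - kdiff N (e + e') = (?y - kdiff N e') + j'" by (simp add: kdiff_add)
  then show "y - kdiff N (e + e') \<in> valued I"
   using e'(3) j'(1) by (simp only: valued_add[OF ideal_I])
 qed
qed

end

context squarefree_degeneration
begin

text \<open>The first summand keeps the exponent that \<open>untr_power\<close> cannot remove. The
  remaining part M of \<open>N\<close> exceeds the length \<open>sum w UNIV * nat |nu|\<close> of
  the interval of weights of nonpositive multidegrees. Only \<open>w\<close> and \<open>nu\<close>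
  enter.\<close>

definition large :: "nat => bool"
 where "large N \<longleftrightarrow> N \<ge> nat \<bar>nu\<bar> + sum w UNIV * nat \<bar>nu\<bar> + 1"

lemma large_Suc: "large N ==> large (Suc N)"
 by (simp add: large_def)

lemma large_abs: "large N ==> int N > \<bar>nu\<bar>"
proof -
 assume "large N"
 then have "N \<ge> nat \<bar>nu\<bar> + 1" by (simp add: large_def)
 then show ?thesis by linarith
qed

lemma power_diff_in_I:
 assumes "x - g \<in> I"
 shows "x ^ M - g ^ M \<in> I"
proof (induction M)
 case (Suc M)
 have "x ^ Suc M - g ^ Suc M = x * (x ^ M - g ^ M) + g ^ M * (x - g)"
  by (simp add: algebra_simps)
 then show ?case
  using Suc assms by (simp only: ideal.subspace_add[OF ideal_I] ideal.subspace_scale[OF ideal_I])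
qed (simp add: ideal.subspace_0[OF ideal_I])

lemma keys_power_weight:
 fixes g :: "('n, 'k) mpol"
 assumes "!!m. m \<in> keys g ==> mon_weight w m \<le> b"
 shows "m \<in> keys (g ^ M) ==> mon_weight w m \<le> M * b"
proof (induction M arbitrary: m)
 case (Suc M)
 then obtain p q where "m = p + q" "p \<in> keys g" "q \<in> keys (g ^ M)"
  using keys_mult[of g "g ^ M"] by auto
 then show ?case using Suc.IH[of q] assms[of p] by (simp add: mon_weight_add)
qed (simp split: if_splits)

text \<open>
 A monomial \<open>xl ys \<in> J\<close> is congruent modulo \<open>I\<close> to a form of smaller weight, so its \<open>M\<close>-th power is
 congruent to a form whose weight is smaller by at least \<open>M\<close>.
\<close>

lemma lower_monomial:
 assumes "xl ys \<in> J"
 obtains g where "xl ys - g \<in> I" "homogeneous (int (length ys)) g" "wlist w ys > 0"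
  "!!m. m \<in> keys g ==> mon_weight w m \<le> wlist w ys - 1"
  | "xl ys \<in> I"
proof -
 have "xl ys \<in> weight_initial_ideal w I" using assms by (simp add: in_I)
 moreover have "mon_weight w m = wlist w ys" if "m \<in> keys (xl ys :: ('n, 'k) mpol)" for m
  using that by (auto simp: xl_def wlist_def split: if_splits)
 moreover have h: "homogeneous (int (length ys)) (xl ys :: ('n, 'k) mpol)"
  unfolding xl_def by (rule homog_single) (simp only: mon_degree_mcount)
 ultimately obtain G where G: "G \<in> I" "homogeneous (int (length ys)) G"
  "\<forall>m\<in>keys G. mon_weight w m \<le> wlist w ys"
  "part (%m. mon_weight w m = wlist w ys) G = xl ys"
  using initial_ideal_lift[OF I] by blast
 have *: "mon_weight w m < wlist w ys" if m: "m \<in> keys (xl ys - G)" for m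
 proof (rule ccontr)
  assume ge: "\<not> mon_weight w m < wlist w ys"
  have "xl ys - G = - part (%m. mon_weight w m ~= wlist w ys) G"
   using part_split[of G "%m. mon_weight w m = wlist w ys"] G(4) by (simp add: algebra_simps)
  then have "m \<in> keys G" "mon_weight w m ~= wlist w ys"
   using m by (auto simp: in_keys_iff lookup_part split: if_splits)
  then show False using G(3) ge by force
 qed
 \<comment> \<open>If the form \<open>xl ys - G\<close> is 0, \<open>wlist w ys\<close> may be 0 as
   well, and \<open>wlist w ys - 1\<close> would not be a smaller weight; so this case is an
   alternative of its own.\<close>
 show thesis
 proof (cases "xl ys - G = 0")
  case True
  then show ?thesis using that(2) G(1) by simp
 next
  case False
  then obtain m where "m \<in> keys (xl ys - G)"
   by (metis all_not_in_conv in_keys_iff lookup_zero poly_mapping_eqI)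
  show ?thesis
  proof (rule that(1)[of "xl ys - G"])
   show "xl ys - (xl ys - G) \<in> I" using G(1) by simp
   show "homogeneous (int (length ys)) (xl ys - G)" using h G(2) by (rule homog_diff)
   show "0 < wlist w ys" using *[OF \<open>m \<in> _\<close>] by simp
   show "mon_weight w m \<le> wlist w ys - 1" if "m \<in> keys (xl ys - G)" for m
    using *[OF that] by simp
  qed
 qed
qed

text \<open>Wherever \<open>u\<close> is nonzero its value is \<open>xl ys ^ M\<close> times a
  polynomial, with \<open>xl ys\<close> in \<open>J\<close>. Replacing \<open>xl ys\<close> by the
  form of \<open>lower_monomial\<close> changes the value by an element of \<open>I\<close> and
  gains at least 1 in weight for each of the M factors.\<close>

lemma lower_cochain:
 assumes u: "u \<in> K N p" "u \<in> valued J" "cin N nonpos u" "lev N d u"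
  and N: "N = nat \<bar>nu\<bar> + M"
 obtains y where "y \<in> K N p" "y - u \<in> valued I" "lev N (d - int M) y"
proof -
 obtain v where v: "v \<in> K (nat \<bar>nu\<bar>) p" "u = (%xs. xl xs ^ M * v xs)"
  using untr_power[of u nu "nat \<bar>nu\<bar>" M p] u N by auto
 \<comment> \<open>In a nonpositive multidegree the numerator involves only variables of the
   denominator, and membership in \<open>J\<close> passes to every monomial of larger
   support.\<close>
 have supp: "xl ys \<in> J" if nz: "u ys ~= 0" for ys
 proof -
  obtain m where m: "m \<in> keys (u ys)"
   using nz by (metis all_not_in_conv in_keys_iff lookup_zero poly_mapping_eqI)
  then have "nonpos (mdeg N ys m)" using u(3) by (auto simp: cin_keys)
  then have "keys m <= keys (mcount ys)"
  proof (intro subsetI)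
   fix j assume "j \<in> keys m" "nonpos (mdeg N ys m)"
   then have "int (lookup m j) > 0" "int (lookup m j) \<le> int N * int (count_list ys j)"
    by (auto simp: in_keys_iff nonpos_def mdeg_def)
   then have "count_list ys j ~= 0" by (metis mult_zero_right not_le of_nat_0)
   then show "j \<in> keys (mcount ys)" by (simp add: in_keys_iff mcount_def)
  qed
  moreover have "single m 1 \<in> J"
   using u(2) m squarefree_monomial_ideal_mem_iff(1)[OF J, of "u ys"] by (auto simp: valued_def)
  ultimately show ?thesis unfolding xl_def by (metis J_support)
 qed
 have "\<exists>h. h - u ys \<in> I & (if length ys = p then homogeneous (nu + int (N * p)) h else h = 0) &
   (\<forall>m\<in>keys h. wsum w (mdeg N ys m) \<le> d - int M)" for ys
 proof (cases "u ys = 0")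
  case True
  then show ?thesis using ideal.subspace_0[OF ideal_I] by (intro exI[of _ 0]) auto
 next
  case False
  then have len: "length ys = p" using u(1) by (auto simp: kC_iff)
  have "xl ys \<in> J" using supp False by blast
  then show ?thesis
  proof (cases rule: lower_monomial)
   case 2
   show ?thesis
   proof (cases "M = 0")
    case True
    have "homogeneous (nu + int (N * p)) (u ys)"
     using u(1) len unfolding kC_def by (auto split: if_splits dest: spec[of _ ys])
    then show ?thesis
     using True u(4) len ideal.subspace_0[OF ideal_I] by (intro exI[of _ "u ys"]) (auto simp: cin_keys)
   next
    case False
    then have "xl ys ^ M * v ys = (xl ys ^ (M - 1) * v ys) * xl ys"
     by (cases M) (auto simp: mult_ac)
    then have "u ys \<in> I" unfolding v(2) using 2 by (simp only: ideal.subspace_scale[OF ideal_I])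
    then show ?thesis using ideal.subspace_neg[OF ideal_I] by (intro exI[of _ 0]) auto
   qed
  next
   case (1 g)
   let ?h = "g ^ M * v ys"
   have "?h - u ys = - (v ys * (xl ys ^ M - g ^ M))"
    by (simp only: v(2) right_diff_distrib minus_diff_eq mult.commute)
   then have "?h - u ys \<in> I"
    using power_diff_in_I[OF 1(1)]
    by (simp only: ideal.subspace_neg[OF ideal_I] ideal.subspace_scale[OF ideal_I])
   moreover have "homogeneous (nu + int (N * p)) ?h"
   proof -
    have "homogeneous (nu + int (nat \<bar>nu\<bar> * p)) (v ys)"
     using v(1) len unfolding kC_def by (auto split: if_splits dest: spec[of _ ys])
    then have "homogeneous (int (length ys) * int M + (nu + int (nat \<bar>nu\<bar> * p))) ?h"
     by (intro homog_mult homog_power 1(2))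
    then show ?thesis unfolding len N by (simp add: algebra_simps)
   qed
   moreover have "wsum w (mdeg N ys m) \<le> d - int M" if m: "m \<in> keys ?h" for m
   proof -
    obtain a b where ab: "m = a + b" "a \<in> keys (g ^ M)" "b \<in> keys (v ys)"
     using keys_mult[of "g ^ M" "v ys"] m by auto
    have "mon_weight w a \<le> M * (wlist w ys - 1)"
     using keys_power_weight[OF 1(4) ab(2)] by blast
    then have "int (mon_weight w a) \<le> int M * (int (wlist w ys) - 1)"
     using 1(3) of_nat_le_iff[of "mon_weight w a" "M * (wlist w ys - 1)", where 'a = int]
     by (simp add: of_nat_diff)
    \<comment> \<open>The factor \<open>xl ys ^ M\<close> offsets the change of denominators: the
      multidegree of \<open>b\<close> over the exponent |nu| also occurs in \<open>u\<close> over
      \<open>N\<close>, where the weight is known to be at most \<open>d\<close>.\<close>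
    moreover have "wsum w (mdeg (nat \<bar>nu\<bar>) ys b) \<le> d"
    proof -
     have "u ys = single (mon (%j. M * count_list ys j)) 1 * v ys"
     proof -
      have "xl ys ^ M = (single (mon (%j. M * count_list ys j)) 1 :: ('n, 'k) mpol)"
      proof (induction M)
       case 0
       have "mon (%j. 0) = (0 :: 'n mon)" by (rule poly_mapping_eqI) simp
       then show ?case by simp
      next
       case (Suc M)
       have "mon (%j. Suc M * count_list ys j) = mcount ys + mon (%j. M * count_list ys j)"
        by (rule poly_mapping_eqI) (simp add: lookup_add mcount_def)
       then show ?case using Suc by (simp add: xl_def mult_single)
      qed
      then show ?thesis by (simp add: v(2))
     qed
     then have "lookup (u ys) (mon (%j. M * count_list ys j) + b) = lookup (v ys) b"
      by (simp add: lookup_single_mult)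
     then have "mon (%j. M * count_list ys j) + b \<in> keys (u ys)"
      using ab(3) by (simp add: in_keys_iff)
     moreover have "mdeg N ys (mon (%j. M * count_list ys j) + b) = mdeg (nat \<bar>nu\<bar>) ys b"
      by (rule ext) (simp add: mdeg_def lookup_add N algebra_simps)
     ultimately show ?thesis using u(4) unfolding cin_keys by metis
    qed
    ultimately show ?thesis
     unfolding wsum_mdeg ab(1) mon_weight_add N by (simp add: algebra_simps)
   qed
   ultimately show ?thesis using len by (intro exI[of _ ?h]) auto
  qed
 qed
 then obtain y where y: "!!ys. y ys - u ys \<in> I"
   "!!ys. if length ys = p then homogeneous (nu + int (N * p)) (y ys) else y ys = 0"
   "!!ys m. m\<in>keys (y ys) ==> wsum w (mdeg N ys m) \<le> d - int M"
  by metis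
 show thesis
 proof
  show "y \<in> K N p" unfolding kC_def using y(2) by blast
  show "y - u \<in> valued I" using y(1) by (simp add: valued_def fun_diff_def)
  show "lev N (d - int M) y" unfolding cin_keys using y(3) by blast
 qed
qed

text \<open>Let \<open>n\<close> be the summand in nonpositive multidegrees; if it is nonzero, then
  d \<le> 0. Its differential has values in \<open>J\<close> and is congruent modulo
  \<open>I\<close> to some \<open>y\<close> of weight at most d - M, hence below the weights of
  nonpositive multidegrees. There \<open>y\<close> is a cocycle modulo \<open>I\<close> and
  therefore the differential of some \<open>e'\<close> of the same low weight. So
  \<open>n - e'\<close> is a cocycle modulo \<open>I\<close> with top part \<open>n\<close>.\<close>

lemma lift_cocycle:
 assumes N: "large N" and c: "c \<in> K N (Suc p)" "kdiff N c \<in> valued J" "pure N d c"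
 obtains c' where "c' \<in> K N (Suc p)" "kdiff N c' \<in> valued I" "lev N d c'" "topc N d c' = c"
proof -
 define M where "M = N - nat \<bar>nu\<bar>"
 have M: "N = nat \<bar>nu\<bar> + M" "M \<ge> 1" "int M > int (sum w UNIV) * \<bar>nu\<bar>"
 proof -
  have "M \<ge> sum w UNIV * nat \<bar>nu\<bar> + 1" using N by (simp add: large_def M_def)
  then have "int M \<ge> int (sum w UNIV * nat \<bar>nu\<bar> + 1)" by (simp only: of_nat_le_iff)
  then show "int M > int (sum w UNIV) * \<bar>nu\<bar>" by simp
 qed (use N in \<open>auto simp: large_def M_def\<close>)
 obtain e n j where enj: "c = kdiff N e + n + j" "e \<in> K N p" "n \<in> K N (Suc p)" "j \<in> K N (Suc p)"
  "pure N d e" "pure N d n" "pure N d j" "cin N nonpos n" "j \<in> valued J" "kdiff N n \<in> valued J"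
  using contract_mod_J_parts[OF c] by metis
 obtain j' where j': "j' \<in> valued I" "j' \<in> K N (Suc p)" "lev N d j'" "topc N d j' = j"
  using lift_J[OF enj(9,4,7)] .
 have "\<exists>n'\<in>K N (Suc p). kdiff N n' \<in> valued I & lev N d n' & topc N d n' = n"
 proof (cases "n = 0")
  case True
  then show ?thesis
   by (intro bexI[of _ 0] conjI) (simp_all add: cpart_def fun_eq_iff valued_zero[OF ideal_I])
 next
  case False
  then obtain a xs where "cf N a n xs ~= 0" by (metis cf_eqI cf_zero zero_fun_apply)
  then have "d \<le> 0" using enj(6,8) wsum_nonpos_le[of a w] by (auto simp: cin_def)
  have u: "kdiff N n \<in> K N (Suc (Suc p))" "lev N d (kdiff N n)" "cin N nonpos (kdiff N n)"
   by (auto intro: kC_kdiff enj cin_kdiff pure_lev[OF enj(6)])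
  obtain y where y: "y \<in> K N (Suc (Suc p))" "y - kdiff N n \<in> valued I" "lev N (d - int M) y"
   using lower_cochain[OF u(1) enj(10) u(3,2) M(1)] .
  have "kdiff N y = kdiff N (y - kdiff N n)" by (simp add: kdiff_diff kdiff_kdiff)
  then have "kdiff N y \<in> valued I" using valued_kdiff[OF ideal_I y(2)] by simp
  moreover have "d - int M < - int (sum w UNIV) * \<bar>nu\<bar>" using \<open>d \<le> 0\<close> M(3) by linarith
  ultimately obtain e' where e': "e' \<in> K N (Suc p)" "lev N (d - int M) e'" "y - kdiff N e' \<in> valued I"
   using low_levels_exact[OF y(1) _ y(3)] by blast
  show ?thesis
  proof (intro bexI[of _ "n - e'"] conjI)
   show "n - e' \<in> K N (Suc p)" by (intro kC_diff enj e')
   have "kdiff N (n - e') = (y - kdiff N e') - (y - kdiff N n)" by (simp add: kdiff_diff)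
   then show "kdiff N (n - e') \<in> valued I"
    using valued_diff[OF ideal_I e'(3) y(2)] by simp
   show "lev N d (n - e')"
    by (intro cin_diff pure_lev[OF enj(6)] lev_mono[OF e'(2)]) auto
   have "topc N d e' = 0" using M(2) by (intro top_lev_less[OF e'(2)]) linarith
   then show "topc N d (n - e') = n"
    using cpart_eq_self[OF enj(6)] by (simp add: cpart_diff)
  qed
 qed
 then obtain n' where n': "n' \<in> K N (Suc p)" "kdiff N n' \<in> valued I" "lev N d n'" "topc N d n' = n"
  by blast
 show thesis
 proof
  show "kdiff N e + n' + j' \<in> K N (Suc p)" by (intro kC_add kC_kdiff enj n' j')
  show "kdiff N (kdiff N e + n' + j') \<in> valued I"
   using n'(2) valued_kdiff[OF ideal_I j'(1)] ideal_I by (simp add: kdiff_add kdiff_kdiff valued_add)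
  show "lev N d (kdiff N e + n' + j')"
   by (intro cin_add n' j' cin_kdiff pure_lev[OF enj(5)] order_refl)
  show "topc N d (kdiff N e + n' + j') = c"
   using enj(1) by (simp add: cpart_add n'(4) j'(4) cpart_eq_self[OF cin_kdiff[OF enj(5)]])
 qed
qed

end

context squarefree_degeneration
begin

text \<open>The differential modulo \<open>I\<close> is strict for the weight filtration. If the
  weight of \<open>e\<close> exceeds that of \<open>y\<close>, the top part of \<open>e\<close> is a
  cocycle modulo \<open>J\<close>; it is the top part of a cocycle modulo \<open>I\<close>, and
  subtracting that one lowers the weight of \<open>e\<close>.\<close>

lemma strict_level:
 assumes N: "large N" and y: "y \<in> K N (Suc (Suc p))" "lev N d y" and e: "e \<in> K N (Suc p)"
  and ye: "y - kdiff N e \<in> valued I"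
 shows "\<exists>e'\<in>K N (Suc p). lev N d e' & y - kdiff N e' \<in> valued I"
proof -
 have "\<exists>e'\<in>K N (Suc p). lev N d e' & y - kdiff N e' \<in> valued I"
  if "lev N b e" "e \<in> K N (Suc p)" "y - kdiff N e \<in> valued I" for b e
  using that
 proof (induction "nat (b - d)" arbitrary: b e)
  case 0
  then show ?case using lev_mono[of N b e d] by auto
 next
  case (Suc k)
  have lev: "lev N b (y - kdiff N e)"
   using Suc.hyps(2) by (intro cin_diff cin_kdiff lev_mono[OF y(2)] Suc.prems) linarith
  have "topc N b (y - kdiff N e) = - topc N b (kdiff N e)"
   using top_lev_less[OF y(2), of b] Suc.hyps(2) by (simp add: cpart_diff)
  then have "- topc N b (kdiff N e) \<in> valued J"
   using top_valued_J[OF Suc.prems(3) lev] by simp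
  then have "kdiff N (topc N b e) \<in> valued J"
   unfolding kdiff_cpart using valued_diff[OF ideal_J valued_zero[OF ideal_J]] by fastforce
  then obtain c where c: "c \<in> K N (Suc p)" "kdiff N c \<in> valued I" "lev N b c" "topc N b c = topc N b e"
   using lift_cocycle[OF N kC_cpart[OF Suc.prems(2)] _ cin_cpart_self] by blast
  have "lev N (b - 1) (e - c)"
   by (rule lev_drop) (simp_all add: cin_diff Suc.prems c cpart_diff)
  moreover have "e - c \<in> K N (Suc p)" by (intro kC_diff Suc.prems c)
  moreover have eq: "y - kdiff N (e - c) = (y - kdiff N e) + kdiff N c" by (simp add: kdiff_diff)
  have "y - kdiff N (e - c) \<in> valued I"
   unfolding eq by (rule valued_add[OF ideal_I Suc.prems(3) c(2)])
  ultimately show ?case using Suc.hyps by (intro Suc.hyps(1)[of "b - 1"]) linarith+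
 qed
 then show ?thesis using lev_bounds(1)[OF e] e ye by blast
qed

text \<open>The strict bound on \<open>N\<close> keeps the entries of the numerator positive at all
  variables of the denominator. So its support, and with it membership in \<open>J\<close>, is the
  same for both exponents.\<close>

lemma J_raise:
 assumes "int N > \<bar>nu\<bar>" "nonpos a" "sum a UNIV = nu"
  and "single (amon (Suc N) a xs) 1 \<in> J"
 shows "single (amon N a xs) 1 \<in> J"
proof (rule J_support[OF assms(4)])
 show "keys (amon (Suc N) a xs) <= keys (amon N a xs)"
  unfolding keys_amon
 proof (intro Collect_mono impI)
  fix j assume j: "a j + int (Suc N) * int (count_list xs j) > 0"
  have "a j \<le> 0" using assms(2) by (simp add: nonpos_def)
  then have "count_list xs j ~= 0" using j by (intro notI) simp
  then have "int N * 1 \<le> int N * int (count_list xs j)" by (intro mult_left_mono) auto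
  then show "a j + int N * int (count_list xs j) > 0"
   using nonpos_ge[OF assms(2,3), of j] assms(1) by linarith
 qed
qed

lemma tr_valued_J_iff:
 assumes "int N > \<bar>nu\<bar>" "c \<in> K N p" "cin N nonpos c"
 shows "tr c \<in> valued J ==> c \<in> valued J"
 using J_raise[OF assms(1)] assms(2,3)
 unfolding valued_J_iff[of "tr c" "Suc N"] valued_J_iff[of c N] cf_tr cin_def kC_iff by blast

text \<open>Raising the exponent is onto on cohomology. The top part of \<open>z\<close> is a
  coboundary, a J-valued cochain and a nonpositive part; the last comes from the exponent
  \<open>N\<close> by \<open>untr\<close>, is a cocycle modulo \<open>J\<close> there as well, and
  lifts by \<open>lift_cocycle\<close>. Subtracting the three lifts lowers the weight.\<close>

theorem cocycles_raise:
 assumes N: "large N" and z: "z \<in> K (Suc N) (Suc p)" "kdiff (Suc N) z \<in> valued I"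
 shows "\<exists>z0\<in>K N (Suc p). kdiff N z0 \<in> valued I &
  (\<exists>e\<in>K (Suc N) p. z - tr z0 - kdiff (Suc N) e \<in> valued I)"
proof -
 have "\<exists>z0\<in>K N (Suc p). kdiff N z0 \<in> valued I &
  (\<exists>e\<in>K (Suc N) p. z - tr z0 - kdiff (Suc N) e \<in> valued I)"
  if "lev (Suc N) d z" "z \<in> K (Suc N) (Suc p)" "kdiff (Suc N) z \<in> valued I" for d z
  using that
 proof (induction "nat (d + int (Suc N * Suc p * sum w UNIV) + 1)" arbitrary: d z)
  case 0
  then have "d \<le> - int (Suc N * Suc p * sum w UNIV) - 1" by linarith
  then have "z = 0" by (rule lev_bounds(2)[OF 0(3) lev_mono[OF 0(2)]])
  have "tr 0 = (0 :: 'n list => ('n, 'k) mpol)" using tr_diff[of 0 0] by (simp only: diff_self)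
  then have "z - tr 0 - kdiff (Suc N) 0 \<in> valued I"
   unfolding \<open>z = 0\<close> kdiff_zero diff_self by (simp only: diff_self valued_zero[OF ideal_I])
  moreover have "kdiff N 0 \<in> valued I" unfolding kdiff_zero by (rule valued_zero[OF ideal_I])
  ultimately show ?case using kC_zero by blast
 next
  case (Suc k)
  let ?t = "topc (Suc N) d z"
  have "kdiff (Suc N) ?t \<in> valued J"
   unfolding kdiff_cpart using Suc.prems by (intro top_valued_J cin_kdiff)
  then obtain e n j where enj: "?t = kdiff (Suc N) e + n + j" "e \<in> K (Suc N) p" "n \<in> K (Suc N) (Suc p)"
   "j \<in> K (Suc N) (Suc p)" "pure (Suc N) d e" "pure (Suc N) d n" "pure (Suc N) d j" "cin (Suc N) nonpos n"
   "j \<in> valued J" "kdiff (Suc N) n \<in> valued J"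
   using contract_mod_J_parts[OF kC_cpart[OF Suc.prems(2)] _ cin_cpart_self] by metis
  obtain j' where j': "j' \<in> valued I" "j' \<in> K (Suc N) (Suc p)" "lev (Suc N) d j'" "topc (Suc N) d j' = j"
   using lift_J[OF enj(9,4,7)] .
  obtain v where v: "v \<in> K N (Suc p)" "tr v = n"
   using untr[OF enj(3,8)] large_abs[OF N] by auto
  have vp: "cin N nonpos v" "pure N d v"
   using enj(8,6) unfolding v(2)[symmetric] cin_tr .
  have "tr (kdiff N v) \<in> valued J" using enj(10) unfolding v(2)[symmetric] kdiff_tr .
  then have "kdiff N v \<in> valued J"
   using tr_valued_J_iff[OF large_abs[OF N] kC_kdiff[OF v(1)] cin_kdiff[OF vp(1)]] by blast
  then obtain v' where v': "v' \<in> K N (Suc p)" "kdiff N v' \<in> valued I" "lev N d v'" "topc N d v' = v"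
   using lift_cocycle[OF N v(1) _ vp(2)] by blast
  let ?z = "z - kdiff (Suc N) e - tr v' - j'"
  have 1: "?z \<in> K (Suc N) (Suc p)"
   by (intro kC_diff kC_kdiff kC_tr Suc.prems enj v' j')
  have 2: "kdiff (Suc N) ?z \<in> valued I"
   unfolding kdiff_diff kdiff_kdiff kdiff_tr
   by (intro valued_diff[OF ideal_I] Suc.prems valued_zero[OF ideal_I] valued_tr[OF ideal_I]
     v' valued_kdiff[OF ideal_I] j')
  have 3: "lev (Suc N) (d - 1) ?z"
  proof (rule lev_drop)
   show "lev (Suc N) d ?z"
    by (intro cin_diff cin_kdiff Suc.prems j' pure_lev[OF enj(5)] order_refl)
     (simp only: cin_tr v'(3))
   show "topc (Suc N) d ?z = 0"
    using enj(1) by (simp add: cpart_diff j'(4) cpart_eq_self[OF cin_kdiff[OF enj(5)]] cpart_tr v'(4) v(2))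
  qed
  have k: "k = nat (d - 1 + int (Suc N * Suc p * sum w UNIV) + 1)" using Suc.hyps(2) by linarith
  obtain z0 e' where ze: "z0 \<in> K N (Suc p)" "kdiff N z0 \<in> valued I" "e' \<in> K (Suc N) p"
   "?z - tr z0 - kdiff (Suc N) e' \<in> valued I"
   using Suc.hyps(1)[OF k 3 1 2] by blast
  show ?case
  proof (rule bexI[of _ "z0 + v'"], rule conjI)
   have eq: "z - tr (z0 + v') - kdiff (Suc N) (e + e') = (?z - tr z0 - kdiff (Suc N) e') + j'"
    by (simp add: tr_add kdiff_add)
   have "z - tr (z0 + v') - kdiff (Suc N) (e + e') \<in> valued I"
    unfolding eq using ze(4) j'(1) by (rule valued_add[OF ideal_I])
   then show "\<exists>e\<in>K (Suc N) p. z - tr (z0 + v') - kdiff (Suc N) e \<in> valued I"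
    using kC_add[OF enj(2) ze(3)] by blast
   show "kdiff N (z0 + v') \<in> valued I"
    unfolding kdiff_add by (rule valued_add[OF ideal_I ze(2) v'(2)])
   show "z0 + v' \<in> K N (Suc p)" by (rule kC_add[OF ze(1) v'(1)])
  qed
 qed
 then show ?thesis using lev_bounds(1)[OF z(1)] z by blast
qed

text \<open>Raising the exponent is injective on cohomology. By \<open>strict_level\<close> the
  bounding cochain has no larger weight than \<open>y\<close>, so top parts can be compared modulo
  \<open>J\<close>. In nonpositive multidegrees this relation descends to the exponent
  \<open>N\<close> by \<open>untr\<close>.\<close>

theorem coboundaries_raise:
 assumes N: "large N" and y: "y \<in> K N (Suc (Suc p))" "kdiff N y \<in> valued I"
  and e: "e \<in> K (Suc N) (Suc p)" "tr y - kdiff (Suc N) e \<in> valued I"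
 shows "\<exists>e'\<in>K N (Suc p). y - kdiff N e' \<in> valued I"
proof -
 have "\<exists>e'\<in>K N (Suc p). y - kdiff N e' \<in> valued I"
  if "lev N d y" "y \<in> K N (Suc (Suc p))" "kdiff N y \<in> valued I"
   "e \<in> K (Suc N) (Suc p)" "tr y - kdiff (Suc N) e \<in> valued I" for d y e
  using that
 proof (induction "nat (d + int (N * Suc (Suc p) * sum w UNIV) + 1)" arbitrary: d y e)
  case 0
  then have "d \<le> - int (N * Suc (Suc p) * sum w UNIV) - 1" by linarith
  then have "y = 0" by (rule lev_bounds(2)[OF 0(3) lev_mono[OF 0(2)]])
  then have "y - kdiff N 0 \<in> valued I"
   by (simp only: kdiff_zero diff_self valued_zero[OF ideal_I])
  then show ?case using kC_zero by blast
 next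
  case (Suc k)
  obtain f where f: "f \<in> K (Suc N) (Suc p)" "lev (Suc N) d f" "tr y - kdiff (Suc N) f \<in> valued I"
   using strict_level[OF large_Suc[OF N] kC_tr[OF Suc.prems(2)] _ Suc.prems(4,5), of d]
    Suc.prems(1) unfolding cin_tr by blast
  let ?t = "topc N d y"
  have "kdiff N ?t \<in> valued J"
   unfolding kdiff_cpart using Suc.prems by (intro top_valued_J cin_kdiff)
  then obtain h n j where hnj: "?t = kdiff N h + n + j" "h \<in> K N (Suc p)" "n \<in> K N (Suc (Suc p))"
   "j \<in> K N (Suc (Suc p))" "pure N d h" "pure N d n" "pure N d j" "cin N nonpos n" "j \<in> valued J"
   using contract_mod_J_parts[OF kC_cpart[OF Suc.prems(2)] _ cin_cpart_self] by metis
  have lev: "lev (Suc N) d (tr y - kdiff (Suc N) f)"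
   by (intro cin_diff cin_kdiff f) (simp only: cin_tr Suc.prems)
  have "tr ?t - kdiff (Suc N) (topc (Suc N) d f) \<in> valued J"
   using top_valued_J[OF f(3) lev] by (simp add: cpart_diff cpart_tr kdiff_cpart)
  then have "tr ?t - kdiff (Suc N) (topc (Suc N) d f) - tr j \<in> valued J"
   by (rule valued_diff[OF ideal_J _ valued_tr[OF ideal_J hnj(9)]])
  moreover define g where "g = topc (Suc N) d f - tr h"
  moreover have "tr ?t - kdiff (Suc N) (topc (Suc N) d f) - tr j = tr n - kdiff (Suc N) g"
   by (simp add: g_def hnj(1) tr_add kdiff_diff kdiff_tr)
  ultimately have *: "tr n - kdiff (Suc N) g \<in> valued J" by simp
  have g: "g \<in> K (Suc N) (Suc p)" "pure (Suc N) d g"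
   unfolding g_def by (intro kC_diff kC_cpart kC_tr f hnj cin_diff cin_cpart_self; simp only: cin_tr hnj)+
  obtain v where v: "v \<in> K N (Suc p)" "tr v = cpart (Suc N) nonpos g"
   using untr[OF kC_cpart[OF g(1)] cin_cpart_self] large_abs[OF N] by auto
  have vp: "cin N nonpos v" "pure N d v"
   using cin_cpart_self[of "Suc N" nonpos g] cin_cpart[OF g(2), of nonpos]
   unfolding v(2)[symmetric] cin_tr .
  have "cpart (Suc N) nonpos (tr n - kdiff (Suc N) g) = tr (n - kdiff N v)"
   unfolding cpart_diff tr_diff kdiff_cpart[symmetric] v(2)[symmetric] kdiff_tr
   by (simp add: cpart_tr cpart_eq_self[OF hnj(8)])
  then have "tr (n - kdiff N v) \<in> valued J" using valued_J_cpart[OF *] by metis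
  moreover have nv: "n - kdiff N v \<in> K N (Suc (Suc p))" "cin N nonpos (n - kdiff N v)"
   by (intro kC_diff kC_kdiff hnj v cin_diff cin_kdiff vp)+
  ultimately have "n - kdiff N v \<in> valued J"
   using tr_valued_J_iff[OF large_abs[OF N]] by blast
  \<comment> \<open>So the top part of \<open>y\<close> is the differential of \<open>h + v\<close>
    up to a J-valued cochain, and the latter lifts as a whole.\<close>
  then have "n - kdiff N v + j \<in> valued J" using hnj(9) by (rule valued_add[OF ideal_J])
  moreover have "n - kdiff N v + j \<in> K N (Suc (Suc p))" "pure N d (n - kdiff N v + j)"
   by (intro kC_add nv hnj cin_add cin_diff cin_kdiff vp)+
  ultimately obtain j' where j': "j' \<in> valued I" "j' \<in> K N (Suc (Suc p))" "lev N d j'"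
   "topc N d j' = n - kdiff N v + j"
   using lift_J by metis
  define b where "b = h + v"
  have b: "b \<in> K N (Suc p)" "pure N d b" unfolding b_def by (intro kC_add cin_add hnj v vp)+
  let ?y = "y - kdiff N b - j'"
  have 1: "?y \<in> K N (Suc (Suc p))" by (intro kC_diff kC_kdiff Suc.prems b j')
  have 2: "kdiff N ?y \<in> valued I"
   unfolding kdiff_diff kdiff_kdiff
   by (intro valued_diff[OF ideal_I] Suc.prems valued_zero[OF ideal_I] valued_kdiff[OF ideal_I] j')
  have 3: "lev N (d - 1) ?y"
  proof (rule lev_drop)
   show "lev N d ?y"
    by (intro cin_diff cin_kdiff Suc.prems j' pure_lev[OF b(2)] order_refl)
   show "topc N d ?y = 0"
    using hnj(1) by (simp add: cpart_diff j'(4) cpart_eq_self[OF cin_kdiff[OF b(2)]])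
     (simp add: b_def kdiff_add)
  qed
  have 4: "e - tr b \<in> K (Suc N) (Suc p)" by (intro kC_diff kC_tr Suc.prems b)
  have "tr ?y - kdiff (Suc N) (e - tr b) = (tr y - kdiff (Suc N) e) - tr j'"
   by (simp add: tr_diff kdiff_diff kdiff_tr)
  then have 5: "tr ?y - kdiff (Suc N) (e - tr b) \<in> valued I"
   using valued_diff[OF ideal_I Suc.prems(5) valued_tr[OF ideal_I j'(1)]] by simp
  have k: "k = nat (d - 1 + int (N * Suc (Suc p) * sum w UNIV) + 1)" using Suc.hyps(2) by linarith
  obtain e' where e': "e' \<in> K N (Suc p)" "?y - kdiff N e' \<in> valued I"
   using Suc.hyps(1)[OF k 3 1 2 4 5] by blast
  have "y - kdiff N (b + e') = (?y - kdiff N e') + j'" by (simp add: kdiff_add)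
  then have "y - kdiff N (b + e') \<in> valued I"
   using e'(2) j'(1) by (simp only: valued_add[OF ideal_I])
  then show ?case using kC_add[OF b(1) e'(1)] by blast
 qed
 then show ?thesis using lev_bounds(1)[OF y(1)] y e by blast
qed

text \<open>In the lowest degree there is no coboundary to correct with, so injectivity means that
  multiplication by \<open>xl\<close> reflects membership in \<open>I\<close>. The cocycle condition
  enters where the numerator at \<open>[j]\<close> is not divisible by the variable j.\<close>

theorem tr_valued_I:
 assumes N: "large N" and y: "y \<in> K N (Suc 0)" "kdiff N y \<in> valued I" "tr y \<in> valued I"
 shows "y \<in> valued I"
proof -
 have "y \<in> valued I"
  if "lev N d y" "y \<in> K N (Suc 0)" "kdiff N y \<in> valued I" "tr y \<in> valued I" for d y
  using that
 proof (induction "nat (d + int (N * Suc 0 * sum w UNIV) + 1)" arbitrary: d y)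
  case 0
  then have "d \<le> - int (N * Suc 0 * sum w UNIV) - 1" by linarith
  then have "y = 0" by (rule lev_bounds(2)[OF 0(3) lev_mono[OF 0(2)]])
  then show ?case by (simp only: valued_zero[OF ideal_I])
 next
  case (Suc k)
  let ?t = "topc N d y"
  have kt: "kdiff N ?t \<in> valued J"
   unfolding kdiff_cpart using Suc.prems by (intro top_valued_J cin_kdiff)
  have "lev (Suc N) d (tr y)" using Suc.prems(1) by (simp only: cin_tr)
  then have tt: "tr ?t \<in> valued J"
   unfolding cpart_tr[symmetric] by (rule top_valued_J[OF Suc.prems(4)])
  have t: "?t \<in> K N (Suc 0)" by (rule kC_cpart[OF Suc.prems(2)])
  have "?t \<in> valued J"
   unfolding valued_J_iff[of _ N]
  proof (intro allI impI)
   fix a xs assume nz: "cf N a ?t xs ~= 0"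
   then have "length xs = Suc 0" and a: "sum a UNIV = nu" "integral_at N a xs"
    using t by (auto simp: kC_iff cin_def cf_def split: if_splits)
   then obtain j where xs: "xs = [j]" by (auto simp: length_Suc_conv)
   have raised: "single (amon (Suc N) a xs) 1 \<in> J"
    using tt nz unfolding valued_J_iff[of "tr ?t" "Suc N"] cf_tr by blast
   show "single (amon N a xs) 1 \<in> J"
   proof (cases "a j + int N > 0")
    case True
    then show ?thesis
     by (intro J_support[OF raised]) (auto simp: keys_amon xs)
   next
    case False
    then have aj: "a j = - int N" using a(2) by (auto simp: integral_at_def xs dest: spec[of _ j])
    \<comment> \<open>Nonpositive entries would be at least -|nu|, which is greater than
      \<open>- int N\<close>.\<close>
    have "\<exists>i. a i > 0"
    proof (rule ccontr)
     assume "\<not> ?thesis"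
     then have "nonpos a" by (auto simp: nonpos_def not_less)
     then show False using nonpos_ge[OF _ a(1), of j] aj large_abs[OF N] by linarith
    qed
    then obtain i where i: "a i > 0" by blast
    then have "i ~= j" using aj by auto
    have "N > 0" using large_abs[OF N] by linarith
    \<comment> \<open>The face \<open>[i]\<close> has no fraction of this multidegree, so the
      differential at \<open>[i, j]\<close> consists of the coefficient at \<open>[j]\<close>
      alone.\<close>
    then have "\<not> integral_at N a [i]"
     using aj \<open>i ~= j\<close> by (auto simp: integral_at_def not_le intro!: exI[of _ j])
    then have "cf N a (kdiff N ?t) [i, j] = cf N a ?t xs"
     by (simp add: cf_kdiff xs cf_def[of N a _ "[i]"])
    then have "single (amon N a [i, j]) 1 \<in> J"
     using kt nz unfolding valued_J_iff[of _ N] by metis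
    then show ?thesis
    proof (rule J_support)
     show "keys (amon N a [i, j]) <= keys (amon N a xs)"
      using i \<open>i ~= j\<close> by (auto simp: keys_amon xs)
    qed
   qed
  qed
  then obtain j' where j': "j' \<in> valued I" "j' \<in> K N (Suc 0)" "lev N d j'" "topc N d j' = ?t"
   using lift_J[OF _ t cin_cpart_self] by blast
  let ?y = "y - j'"
  have 1: "?y \<in> K N (Suc 0)" by (intro kC_diff Suc.prems j')
  have 2: "kdiff N ?y \<in> valued I"
   unfolding kdiff_diff
   by (intro valued_diff[OF ideal_I] Suc.prems valued_kdiff[OF ideal_I] j')
  have 3: "tr ?y \<in> valued I"
   unfolding tr_diff
   by (intro valued_diff[OF ideal_I] Suc.prems valued_tr[OF ideal_I] j')
  have 4: "lev N (d - 1) ?y"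
   by (rule lev_drop) (simp_all add: cin_diff Suc.prems j' cpart_diff)
  have "k = nat (d - 1 + int (N * Suc 0 * sum w UNIV) + 1)" using Suc.hyps(2) by linarith
  then have "?y \<in> valued I"
   using Suc.hyps(1)[OF _ 4 1 2 3] by blast
  moreover have "y = ?y + j'" by simp
  ultimately show ?case using valued_add[OF ideal_I _ j'(1)] by metis
 qed
 then show ?thesis using lev_bounds(1)[OF y(1)] y by blast
qed

end

section \<open>Equality of dimensions for \<open>S/I\<close> and \<open>S/J\<close>\<close>

abbreviation cscale :: "'k => ('n list => ('n, 'k::field) mpol) => 'n list => ('n, 'k) mpol"
 where "cscale a c \<equiv> (%xs. const_pol a * c xs)"

interpretation cochain: vector_space_quotient "cscale :: 'k => ('n list => ('n, 'k::field) mpol) => _"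
proof
 fix a b :: 'k and x y :: "'n list => ('n, 'k) mpol"
 show "cscale a (x + y) = cscale a x + cscale a y" by (rule ext) (simp add: distrib_left)
 show "cscale (a + b) x = cscale a x + cscale b x" by (rule ext) (simp add: single_add distrib_right)
 show "cscale a (cscale b x) = cscale (a * b) x"
  by (rule ext) (simp only: const_pol_simps(2) mult.assoc)
 show "cscale 1 x = x" by simp
qed

lemma cf_cscale: "cf N a (cscale c x) xs = c * cf N a x xs"
 by (simp add: cf_def)

lemma cpart_cscale: "cpart N Q (cscale c x) = cscale c (cpart N Q x)"
 by (rule cf_eqI[of N]) (simp add: cf_cpart cf_cscale)

lemma cin_cscale: "cin N Q x ==> cin N Q (cscale c x)"
 by (simp add: cin_def cf_cscale)

lemma kC_cscale: "x \<in> kC nu N p ==> cscale c x \<in> kC nu N p"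
 by (simp add: kC_iff cin_cscale)

lemma valued_cscale: "is_ideal I ==> x \<in> valued I ==> cscale c x \<in> valued I"
 by (simp add: valued_def ideal.subspace_scale)

lemma kdiff_cscale: "kdiff N (cscale c x) = cscale c (kdiff N x)"
 by (rule ext) (rule kdiff_mult)

lemma finite_monomials_of_degree: "finite {m :: 'n::finite mon. mon_degree m = d}"
proof (rule finite_subset)
 show "{m :: 'n mon. mon_degree m = d} <= mon ` (UNIV \<rightarrow>\<^sub>E {..d})"
 proof
  fix m :: "'n mon" assume "m \<in> {m. mon_degree m = d}"
  then have "(\<Sum>i\<in>UNIV. lookup m i) = d" by (simp add: mon_weight_def)
  then have "lookup m i \<le> d" for i
   using member_le_sum[of i UNIV "lookup m"] by simp
  then have "lookup m \<in> UNIV \<rightarrow>\<^sub>E {..d}" by auto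
  then show "m \<in> mon ` (UNIV \<rightarrow>\<^sub>E {..d})" by (metis imageI mon_lookup)
 qed
qed (auto intro!: finite_imageI finite_PiE)

lemma sum_fun_apply: "(\<Sum>i\<in>A. f i) x = (\<Sum>i\<in>A. f i x)" for f :: "'i => 'a => 'b::comm_monoid_add"
 by (induction A rule: infinite_finite_induct) auto

lemma kC_finite_span:
 obtains F where "finite F" "kC nu N p <= cochain.span (F :: ('n::finite list => ('n, 'k::field) mpol) set)"
proof
 define L where "L = {xs :: 'n list. length xs = p}"
 \<comment> \<open>For a negative degree \<open>nat\<close> yields the monomials of degree 0; the
   cochains are then 0 and lie in the span all the same.\<close>
 define M where "M = {m :: 'n mon. mon_degree m = nat (nu + int (N * p))}"
 define b :: "'n list \<times> 'n mon => 'n list => ('n, 'k) mpol" where "b = (%(s, m) xs. if xs = s then single m 1 else (0 :: ('n, 'k) mpol))"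
 have fin: "finite L" "finite M"
  using finite_lists_length_eq[of "UNIV :: 'n set" p] finite_monomials_of_degree
  by (auto simp: L_def M_def)
 show "finite (b ` (L \<times> M))" using fin by simp
 show "kC nu N p <= cochain.span (b ` (L \<times> M))"
 proof
  fix c :: "'n list => ('n, 'k) mpol" assume c: "c \<in> kC nu N p"
  have "c = (\<Sum>s\<in>L. \<Sum>m\<in>M. cscale (lookup (c s) m) (b (s, m)))"
  proof (rule ext)
   fix xs
   have "(\<Sum>s\<in>L. \<Sum>m\<in>M. cscale (lookup (c s) m) (b (s, m))) xs =
     (\<Sum>s\<in>L. if s = xs then (\<Sum>m\<in>M. single m (lookup (c xs) m)) else 0)"
    unfolding sum_fun_apply by (intro sum.cong refl) (auto simp: b_def mult_single)
   also have "... = c xs"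
   proof (cases "length xs = p")
    case True
    then have "homogeneous (nu + int (N * p)) (c xs)"
     using c unfolding kC_def by (auto split: if_splits dest: spec[of _ xs])
    then have "keys (c xs) <= M" by (force simp: homogeneous_def M_def)
    then have "(\<Sum>m\<in>M. single m (lookup (c xs) m)) =
      (\<Sum>m\<in>keys (c xs). single m (lookup (c xs) m))"
     using fin by (intro sum.mono_neutral_right) (auto simp: in_keys_iff)
    then show ?thesis using True fin by (simp add: sum_singles L_def)
   next
    case False
    then show ?thesis using c fin by (simp add: kC_iff L_def)
   qed
   finally show "c xs = (\<Sum>s\<in>L. \<Sum>m\<in>M. cscale (lookup (c s) m) (b (s, m))) xs" ..
  qed
  also have "... \<in> cochain.span (b ` (L \<times> M))"
   by (intro cochain.span_sum cochain.span_scale cochain.span_base) auto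
  finally show "c \<in> cochain.span (b ` (L \<times> M))" .
 qed
qed

definition kZ :: "('n::finite, 'k::field) mpol set => int => nat => nat => ('n list => ('n, 'k) mpol) set"
 where "kZ I nu N i = {c \<in> kC nu N (Suc i). kdiff N c \<in> valued I}"

text \<open>Like \<open>kZ\<close>, it contains all cochains with values in \<open>I\<close>, so the
  quotient of the two is the cohomology of the complex for \<open>S/I\<close> in Cech degree
  \<open>i\<close>. For \<open>i = 0\<close> the values at the empty list do not count as giving
  coboundaries, in accordance with the unaugmented complex.\<close>

definition kB :: "('n::finite, 'k::field) mpol set => int => nat => nat => ('n list => ('n, 'k) mpol) set"
 where "kB I nu N i = {c \<in> kC nu N (Suc i).
  if i = 0 then c \<in> valued I else \<exists>e\<in>kC nu N i. c - kdiff N e \<in> valued I}"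

lemma subspace_kZ: "is_ideal I ==> cochain.subspace (kZ I nu N i)"
 by (rule cochain.subspaceI)
   (auto simp: kZ_def kdiff_add valued_add valued_zero kC_add kC_cscale
    kdiff_cscale valued_cscale)

lemma subspace_kB:
 fixes I :: "('n::finite, 'k::field) mpol set"
 assumes I: "is_ideal I" shows "cochain.subspace (kB I nu N i)"
proof (rule cochain.subspaceI)
 have "(0 :: 'n list => ('n, 'k) mpol) - kdiff N 0 = 0" by (simp only: kdiff_zero diff_self)
 then show "0 \<in> kB I nu N i"
  using valued_zero[OF I] kC_zero unfolding kB_def by (smt (verit) mem_Collect_eq)
next
 fix x y assume x: "x \<in> kB I nu N i" and y: "y \<in> kB I nu N i"
 show "x + y \<in> kB I nu N i"
 proof (cases "i = 0")
  case True
  then show ?thesis using x y by (auto simp: kB_def kC_add valued_add[OF I])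
 next
  case False
  then obtain e f where ef: "e \<in> kC nu N i" "f \<in> kC nu N i"
   "x - kdiff N e \<in> valued I" "y - kdiff N f \<in> valued I"
   using x y by (auto simp: kB_def)
  have "x + y - kdiff N (e + f) = (x - kdiff N e) + (y - kdiff N f)" by (simp add: kdiff_add)
  then have "x + y - kdiff N (e + f) \<in> valued I" using ef valued_add[OF I] by metis
  then show ?thesis using False x y kC_add[OF ef(1,2)]
   by (auto simp: kB_def kC_add)
 qed
next
 fix c x assume x: "x \<in> kB I nu N i"
 show "cscale c x \<in> kB I nu N i"
 proof (cases "i = 0")
  case True
  then show ?thesis using x by (auto simp: kB_def kC_cscale valued_cscale[OF I])
 next
  case False
  then obtain e where e: "e \<in> kC nu N i" "x - kdiff N e \<in> valued I"
   using x by (auto simp: kB_def)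
  have "cscale c x - kdiff N (cscale c e) = cscale c (x - kdiff N e)"
   unfolding kdiff_cscale by (rule ext) (simp add: right_diff_distrib)
  then have "cscale c x - kdiff N (cscale c e) \<in> valued I" using e valued_cscale[OF I] by metis
  then show ?thesis using False x kC_cscale[OF e(1)]
   by (auto simp: kB_def kC_cscale)
 qed
qed

lemma kB_subset: "is_ideal I ==> kB I nu N i <= kZ I nu N i"
proof
 fix c assume I: "is_ideal I" and c: "c \<in> kB I nu N i"
 show "c \<in> kZ I nu N i"
 proof (cases "i = 0")
  case True
  then show ?thesis using c by (auto simp: kB_def kZ_def valued_kdiff[OF I])
 next
  case False
  then obtain e where e: "c - kdiff N e \<in> valued I" using c by (auto simp: kB_def)
  have "kdiff N c = kdiff N (c - kdiff N e)" by (simp add: kdiff_diff kdiff_kdiff)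
  then have "kdiff N c \<in> valued I" using valued_kdiff[OF I e] by metis
  then show ?thesis using c by (simp add: kB_def kZ_def)
 qed
qed

context squarefree_degeneration
begin

text \<open>The weight filtrations of both spaces have the same graded pieces, begin with 0 and
  exhaust the spaces after finitely many steps.\<close>

lemma dim_eq_top_parts:
 fixes X Y :: "('n list => ('n, 'k) mpol) set"
 assumes X: "cochain.subspace X" "X <= K N p" and Y: "cochain.subspace Y" "Y <= K N p"
  and XY: "!!d. topc N d ` {c \<in> X. lev N d c} = topc N d ` {c \<in> Y. lev N d c}"
 shows "cochain.dim X = cochain.dim Y"
proof -
 obtain F where F: "finite F" "K N p <= cochain.span (F :: ('n list => ('n, 'k) mpol) set)"
  using kC_finite_span .
 \<comment> \<open>The level at which \<open>lev_bounds\<close> forces a cochain to be 0.\<close>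
 define l where "l = - int (N * p * sum w UNIV) - 1"
 define V :: "('n list => ('n, 'k) mpol) set => nat => _" where "V X n = {c \<in> X. lev N (l + int n) c}" for X n
 have V: "cochain.subspace (V X n)" if "cochain.subspace X" for X :: "('n list => ('n, 'k) mpol) set" and n
  using that unfolding V_def cochain.subspace_def by (auto simp: cin_add cin_cscale)
 have V0: "V X 0 = {0}" if "cochain.subspace X" "X <= K N p" for X :: "('n list => ('n, 'k) mpol) set"
  using that lev_bounds(2)[of _ N p] cochain.subspace_0[OF that(1)] unfolding V_def l_def by auto
 have ker: "{z \<in> V X (Suc n). topc N (l + int (Suc n)) z = 0} = V X n" for X :: "('n list => ('n, 'k) mpol) set" and n
  unfolding V_def using lev_drop[of N "l + int (Suc n)"]
  by (auto intro: lev_mono top_lev_less)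
 have Fsp: "V X n <= cochain.span F" "V Y n <= cochain.span F" for n
  using X(2) Y(2) F(2) by (auto simp: V_def)
 have eq: "cochain.dim (V X n) = cochain.dim (V Y n)" for n
 proof (rule cochain.dim_eq_filtration[where F = F and f = "%n. topc N (l + int (Suc n))"])
  show "V X 0 = V Y 0" by (simp only: V0[OF X] V0[OF Y])
  show "topc N (l + int (Suc n)) ` V X (Suc n) = topc N (l + int (Suc n)) ` V Y (Suc n)" for n
   unfolding V_def by (rule XY)
 qed (rule V X Y Fsp F ker cpart_add cpart_cscale)+
 define b where "b = int (sum w UNIV) * \<bar>nu + int (N * p)\<bar>"
 have "V X (nat (b - l)) = X" if "X <= K N p" for X :: "('n list => ('n, 'k) mpol) set"
 proof -
  have "lev N (l + int (nat (b - l))) c" if "c \<in> X" for c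
  proof (rule lev_mono)
   show "lev N b c" unfolding b_def using that \<open>X <= K N p\<close> by (intro lev_bounds(1)) blast
   show "b \<le> l + int (nat (b - l))" by linarith
  qed
  then show ?thesis by (auto simp: V_def)
 qed
 then show ?thesis using eq X(2) Y(2) by metis
qed

text \<open>Top parts of cocycles modulo \<open>I\<close> are cocycles modulo \<open>J\<close>, and
  \<open>lift_cocycle\<close> shows that all of them arise. The inclusion that fails for a general
  degeneration is the second one.\<close>

lemma dim_kZ:
 assumes N: "large N"
 shows "cochain.dim (kZ I nu N i) = cochain.dim (kZ J nu N i)"
proof (rule dim_eq_top_parts[OF subspace_kZ[OF ideal_I] _ subspace_kZ[OF ideal_J]])
 fix d
 show "topc N d ` {c \<in> kZ I nu N i. lev N d c} = topc N d ` {c \<in> kZ J nu N i. lev N d c}"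
 proof (intro equalityI image_subsetI)
  fix c assume "c \<in> {c \<in> kZ I nu N i. lev N d c}"
  then have c: "c \<in> K N (Suc i)" "kdiff N c \<in> valued I" "lev N d c" by (auto simp: kZ_def)
  let ?t = "topc N d c"
  have "kdiff N ?t \<in> valued J"
   unfolding kdiff_cpart using c by (intro top_valued_J cin_kdiff)
  then have "?t \<in> kZ J nu N i" using kC_cpart[OF c(1)] by (simp add: kZ_def)
  moreover have "lev N d ?t" by (rule cin_cpart[OF c(3)])
  moreover have "topc N d ?t = ?t" by (rule cpart_eq_self[OF cin_cpart_self])
  ultimately show "?t \<in> topc N d ` {c \<in> kZ J nu N i. lev N d c}" by (intro image_eqI[of _ _ ?t]) auto
 next
  fix c assume "c \<in> {c \<in> kZ J nu N i. lev N d c}"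
  then have c: "c \<in> K N (Suc i)" "kdiff N c \<in> valued J" by (auto simp: kZ_def)
  have "kdiff N (topc N d c) \<in> valued J"
   unfolding kdiff_cpart by (rule valued_J_cpart[OF c(2)])
  then obtain c' where "c' \<in> K N (Suc i)" "kdiff N c' \<in> valued I" "lev N d c'" "topc N d c' = topc N d c"
   using lift_cocycle[OF N kC_cpart[OF c(1)] _ cin_cpart_self] by blast
  then show "topc N d c \<in> topc N d ` {c \<in> kZ I nu N i. lev N d c}"
   by (intro image_eqI[of _ _ c']) (auto simp: kZ_def)
 qed
qed (auto simp: kZ_def)

text \<open>Here lifting is easy by \<open>lift_J\<close>. The other inclusion rests on
  \<open>strict_level\<close>: otherwise the top part of a coboundary might come from cancellation
  in a bounding cochain of larger weight.\<close>

lemma dim_kB: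
 assumes N: "large N"
 shows "cochain.dim (kB I nu N i) = cochain.dim (kB J nu N i)"
proof (rule dim_eq_top_parts[OF subspace_kB[OF ideal_I] _ subspace_kB[OF ideal_J]])
 fix d
 show "topc N d ` {c \<in> kB I nu N i. lev N d c} = topc N d ` {c \<in> kB J nu N i. lev N d c}"
 proof (intro equalityI image_subsetI)
  fix c assume "c \<in> {c \<in> kB I nu N i. lev N d c}"
  then have c: "c \<in> kB I nu N i" "c \<in> K N (Suc i)" "lev N d c" by (auto simp: kB_def)
  let ?t = "topc N d c"
  have "?t \<in> kB J nu N i"
  proof (cases i)
   case 0
   then show ?thesis
    using c top_valued_J[of c N d] kC_cpart[OF c(2)] by (simp add: kB_def)
  next
   case (Suc p)
   obtain e where e: "e \<in> K N (Suc p)" "lev N d e" "c - kdiff N e \<in> valued I"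
    using strict_level[OF N _ c(3), of p] c(1,2) Suc by (auto simp: kB_def)
   have "topc N d (c - kdiff N e) \<in> valued J"
    by (intro top_valued_J e cin_diff c cin_kdiff)
   then have "?t - kdiff N (topc N d e) \<in> valued J" by (simp add: cpart_diff kdiff_cpart)
   then show ?thesis
    using Suc kC_cpart[OF c(2)] kC_cpart[OF e(1)] by (auto simp: kB_def)
  qed
  moreover have "lev N d ?t" by (rule cin_cpart[OF c(3)])
  moreover have "topc N d ?t = ?t" by (rule cpart_eq_self[OF cin_cpart_self])
  ultimately show "?t \<in> topc N d ` {c \<in> kB J nu N i. lev N d c}" by (intro image_eqI[of _ _ ?t]) auto
 next
  fix c assume "c \<in> {c \<in> kB J nu N i. lev N d c}"
  then have c: "c \<in> kB J nu N i" "c \<in> K N (Suc i)" by (auto simp: kB_def)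
  let ?t = "topc N d c"
  have t: "?t \<in> K N (Suc i)" by (rule kC_cpart[OF c(2)])
  show "?t \<in> topc N d ` {c \<in> kB I nu N i. lev N d c}"
  proof (cases i)
   case 0
   have "?t \<in> valued J" using c(1) 0 by (auto simp: kB_def intro: valued_J_cpart)
   then obtain c' where "c' \<in> valued I" "c' \<in> K N (Suc i)" "lev N d c'" "topc N d c' = ?t"
    using lift_J[OF _ t cin_cpart_self] by blast
   then show ?thesis using 0 by (intro image_eqI[of _ _ c']) (auto simp: kB_def)
  next
   case (Suc p)
   obtain e where e: "e \<in> K N i" "c - kdiff N e \<in> valued J"
    using c(1) Suc by (auto simp: kB_def)
   let ?e = "topc N d e"
   have e': "?e \<in> K N i" by (rule kC_cpart[OF e(1)])
   have "?t - kdiff N ?e \<in> valued J"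
    using valued_J_cpart[OF e(2)] unfolding cpart_diff kdiff_cpart .
   moreover have "?t - kdiff N ?e \<in> K N (Suc i)" by (intro kC_diff t kC_kdiff e')
   moreover have "pure N d (?t - kdiff N ?e)" by (intro cin_diff cin_kdiff cin_cpart_self)
   ultimately obtain j where j: "j \<in> valued I" "j \<in> K N (Suc i)" "lev N d j" "topc N d j = ?t - kdiff N ?e"
    by (rule lift_J)
   let ?c = "kdiff N ?e + j"
   have "topc N d ?c = ?t"
    by (simp add: cpart_add j(4) cpart_eq_self[OF cin_kdiff[OF cin_cpart_self]])
   moreover have "lev N d ?c"
    by (intro cin_add j cin_kdiff pure_lev[OF cin_cpart_self] order_refl)
   moreover have "?c \<in> kB I nu N i"
    using Suc e' j kC_add[OF kC_kdiff[OF e'] j(2)]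
    by (auto simp: kB_def intro!: bexI[of _ ?e])
   ultimately show ?thesis by (intro image_eqI[of _ _ ?c]) auto
  qed
 qed
qed (auto simp: kB_def)

theorem kcohomology_dim:
 assumes N: "large N"
 shows "(\<exists>b. cochain.quot_basis (kZ I nu N i) (kB I nu N i) d b) \<longleftrightarrow>
  d = cochain.dim (kZ J nu N i) - cochain.dim (kB J nu N i)"
proof -
 obtain F where F: "finite F" "K N (Suc i) <= cochain.span (F :: ('n list => ('n, 'k) mpol) set)"
  using kC_finite_span .
 have Z: "kZ I nu N i <= cochain.span F" using F(2) by (auto simp: kZ_def)
 note facts = subspace_kB[OF ideal_I] kB_subset[OF ideal_I] subspace_kZ[OF ideal_I] Z F(1)
 show ?thesis
  using cochain.quot_basis_exists[OF facts] cochain.quot_basis_dim[OF facts]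
   dim_kZ[OF N, of i] dim_kB[OF N, of i] by (metis add_diff_cancel_left')
qed

end

subsection \<open>The initial ideals of the fibers\<close>

text \<open>With \<open>D\<close> the weight degree of \<open>g\<close> this is the homogenization
  of \<open>g\<close> at t = \<alpha>. \<open>D\<close> is left free because components and sums may
  have smaller weight degree; a larger \<open>D\<close> contributes a power of \<alpha>.\<close>

definition hz :: "('n::finite => nat) => 'k => nat => ('n, 'k::field) mpol => ('n, 'k) mpol"
 where "hz w \<alpha> D g = (\<Sum>m\<in>keys g.
  single m (lookup g m * \<alpha> ^ (D - mon_weight w m)))"

lemma lookup_hz:
 "lookup (hz w \<alpha> D g) m = lookup g m * \<alpha> ^ (D - mon_weight w m)"
proof -
 have "lookup (hz w \<alpha> D g) m =
   (\<Sum>k\<in>keys g. if k = m then lookup g m * \<alpha> ^ (D - mon_weight w m) else 0)"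
  unfolding hz_def lookup_sum by (intro sum.cong refl) (simp add: lookup_single when_def)
 then show ?thesis by (simp add: in_keys_iff)
qed

lemma poly_weight_homogenization:
 "Polynomial.poly (weight_homogenization w g) (const_pol \<alpha>) = hz w \<alpha> (weight_degree w g) g"
proof -
 have "const_pol \<alpha> ^ n = (const_pol (\<alpha> ^ n) :: ('a, 'b) mpol)" for n
  by (induction n) (simp_all add: mult_single)
 then show ?thesis
  unfolding weight_homogenization_def hz_def poly_sum poly_monom by (simp add: mult_single)
qed

lemma keys_hz_subset: "keys (hz w \<alpha> D g) <= keys g"
 by (auto simp: in_keys_iff lookup_hz)

text \<open>The terms of top weight are multiplied by \<open>\<alpha> ^ 0\<close>, which is 1 even
  for \<alpha> = 0.\<close>

lemma weight_initial_form_hz: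
 "weight_initial_form w (hz w \<alpha> (weight_degree w g) g) = weight_initial_form w g"
proof (cases "g = 0")
 case True
 then show ?thesis by (simp add: hz_def)
next
 case False
 then have "keys g ~= {}"
  by (metis all_not_in_conv in_keys_iff lookup_zero poly_mapping_eqI)
 then have "weight_degree w g \<in> mon_weight w ` keys g"
  unfolding weight_degree_def by (intro Max_in) auto
 then obtain m where m: "m \<in> keys g" "mon_weight w m = weight_degree w g" by auto
 have "weight_degree w (hz w \<alpha> (weight_degree w g) g) = weight_degree w g"
 proof (rule weight_degree_eqI)
  show "m \<in> keys (hz w \<alpha> (weight_degree w g) g)"
   using m by (simp add: in_keys_iff lookup_hz)
 qed (use m mon_weight_le_weight_degree keys_hz_subset in blast)+
 then show ?thesis
  unfolding weight_initial_form_part by (intro poly_mapping_eqI) (simp add: lookup_part lookup_hz)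
qed

lemma hz_raise: "(!!m. m \<in> keys g ==> mon_weight w m \<le> D) ==>
  hz w \<alpha> (D + n) g = const_pol (\<alpha> ^ n) * hz w \<alpha> D g"
proof (rule poly_mapping_eqI)
 fix m assume *: "!!m. m \<in> keys g ==> mon_weight w m \<le> D"
 show "lookup (hz w \<alpha> (D + n) g) m = lookup (const_pol (\<alpha> ^ n) * hz w \<alpha> D g) m"
 proof (cases "m \<in> keys g")
  case True
  then have "D + n - mon_weight w m = n + (D - mon_weight w m)" using * by force
  then show ?thesis by (simp add: lookup_hz power_add)
 qed (simp add: lookup_hz in_keys_iff)
qed

text \<open>Evaluation at t = \<alpha> kills \<open>[:- const_pol \<alpha>, 1:]\<close>, and each
  homogenization differs from its value by a multiple of this polynomial.\<close>

lemma fiber_ideal_eq: "fiber_ideal w I \<alpha> = ideal_gen ((%g. hz w \<alpha> (weight_degree w g) g) ` I)"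
 (is "_ = ideal_gen (?ev ` I)")
proof
 let ?G = "hom_ideal w I \<union> {[:- const_pol \<alpha>, 1:]}"
 show "fiber_ideal w I \<alpha> <= ideal_gen (?ev ` I)"
 proof
  fix f assume "f \<in> fiber_ideal w I \<alpha>"
  then have f: "[:f:] \<in> ideal_gen ?G" by (simp add: fiber_ideal_def)
  let ?V = "{p. Polynomial.poly p (const_pol \<alpha>) \<in> ideal_gen (?ev ` I)}"
  have V: "is_ideal ?V"
   by (rule ideal.subspaceI) (auto simp: ideal.span_zero ideal.span_add ideal.span_scale)
  have "hom_ideal w I <= ?V"
   unfolding hom_ideal_def
   by (rule ideal.span_minimal[OF _ V]) (auto simp: poly_weight_homogenization ideal.span_base)
  then have "ideal_gen ?G <= ?V"
   by (intro ideal.span_minimal V) (auto simp: ideal.span_zero)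
  then show "f \<in> ideal_gen (?ev ` I)" using f by auto
 qed
 show "ideal_gen (?ev ` I) <= fiber_ideal w I \<alpha>"
 proof (rule ideal.span_minimal)
  show "is_ideal (fiber_ideal w I \<alpha>)"
  proof (rule ideal.subspaceI)
   fix c f assume "f \<in> fiber_ideal w I \<alpha>"
   then have "[:c:] * [:f:] \<in> ideal_gen ?G" unfolding fiber_ideal_def by (intro ideal.span_scale) simp
   then show "c * f \<in> fiber_ideal w I \<alpha>" by (simp add: fiber_ideal_def mult.commute)
  next
   fix f g assume "f \<in> fiber_ideal w I \<alpha>" "g \<in> fiber_ideal w I \<alpha>"
   then have "[:f:] + [:g:] \<in> ideal_gen ?G" unfolding fiber_ideal_def by (intro ideal.span_add) simp_all
   then show "f + g \<in> fiber_ideal w I \<alpha>" by (simp add: fiber_ideal_def)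
  qed (simp add: fiber_ideal_def ideal.span_zero)
  show "?ev ` I <= fiber_ideal w I \<alpha>"
  proof (rule image_subsetI)
   fix g assume "g \<in> I"
   let ?p = "weight_homogenization w g"
   have "Polynomial.poly (?p - [:?ev g:]) (const_pol \<alpha>) = 0"
    by (simp add: poly_weight_homogenization)
   then obtain q where q: "?p - [:?ev g:] = [:- const_pol \<alpha>, 1:] * q"
    using poly_eq_0_iff_dvd by (metis dvd_def)
   have "q * [:- const_pol \<alpha>, 1:] \<in> ideal_gen ?G"
    by (intro ideal.span_scale ideal.span_base) simp
   moreover have "?p \<in> hom_ideal w I"
    using \<open>g \<in> I\<close> unfolding hom_ideal_def by (intro ideal.span_base) simp
   then have "?p \<in> ideal_gen ?G" by (intro ideal.span_base) simp
   moreover have "[:?ev g:] = ?p - q * [:- const_pol \<alpha>, 1:]"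
    unfolding mult.commute[of q] q[symmetric] by simp
   ultimately have "[:?ev g:] \<in> ideal_gen ?G" by (metis ideal.span_diff)
   then show "?ev g \<in> fiber_ideal w I \<alpha>" by (simp add: fiber_ideal_def)
  qed
 qed
qed

text \<open>A component of a generator is the generator of the corresponding component of
  \<open>g\<close>, times the power of \<alpha> that accounts for the drop of the weight
  degree.\<close>

lemma homog_fiber_ideal:
 assumes I: "homogeneous_ideal I"
 shows "homogeneous_ideal (fiber_ideal w I \<alpha>)"
 unfolding fiber_ideal_eq
proof (rule homogeneous_idealI)
 let ?G = "(%g. hz w \<alpha> (weight_degree w g) g) ` I"
 have "hcomp e h \<in> ideal_gen ?G" if h: "h \<in> ?G" for h e
 proof -
  obtain g where g: "g \<in> I" "h = hz w \<alpha> (weight_degree w g) g" using h by blast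
  let ?c = "hcomp e g"
  have eq: "hcomp e h = hz w \<alpha> (weight_degree w g) ?c"
   unfolding g(2) hcomp_def by (rule poly_mapping_eqI) (simp add: lookup_part lookup_hz)
  show ?thesis
  proof (cases "?c = 0")
   case True
   then show ?thesis by (simp add: eq hz_def ideal.span_zero)
  next
   case False
   have "keys ?c ~= {}"
    using False by (metis all_not_in_conv in_keys_iff lookup_zero poly_mapping_eqI)
   then have "weight_degree w ?c \<le> weight_degree w g"
    unfolding weight_degree_def by (intro Max_mono) (auto simp: hcomp_def keys_part)
   then obtain n where n: "weight_degree w g = weight_degree w ?c + n" using le_Suc_ex by blast
   have "hcomp e h = const_pol (\<alpha> ^ n) * hz w \<alpha> (weight_degree w ?c) ?c"
    unfolding eq n by (rule hz_raise) (rule mon_weight_le_weight_degree)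
   moreover have "?c \<in> I" by (rule homogeneous_ideal_hcomp[OF I g(1)])
   ultimately show ?thesis by (simp add: ideal.span_scale ideal.span_base)
  qed
 qed
 then show "hcomp e f \<in> ideal_gen ?G" if "f \<in> ideal_gen ?G" for f e
  using hcomp_closed_generated[of ?G f e] that by blast
qed (rule ideal.subspace_span)

lemma squarefree_monomial_ideal_part:
 "squarefree_monomial_ideal J ==> f \<in> J ==> part P f \<in> J"
 for J :: "('n::finite, 'k::field) mpol set"
 using squarefree_monomial_ideal_mem_iff(1)[of J f] squarefree_monomial_ideal_mem_iff(1)[of J "part P f"]
 by (simp add: keys_part)

text \<open>For \<alpha> = 0 the generators are the initial forms, so the fiber ideal lies in
  \<open>J\<close>, which contains the parts of its elements. For \<alpha> \<noteq> 0 every element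
  of the fiber ideal is a rescaled element of \<open>I\<close>, and rescaling changes initial forms
  only by a unit.\<close>

lemma weight_initial_ideal_fiber_ideal:
 assumes I: "homogeneous_ideal I" and J: "squarefree_monomial_ideal J" "weight_initial_ideal w I = J"
 shows "weight_initial_ideal w (fiber_ideal w I \<alpha>) = J"
proof
 let ?ev = "%g. hz w \<alpha> (weight_degree w g) g"
 note idI = homogeneous_ideal_is_ideal[OF I]
 note idJ = squarefree_monomial_ideal_mem_iff(3)[OF J(1)]
 have "weight_initial_form w ` I <= weight_initial_form w ` fiber_ideal w I \<alpha>"
 proof (rule image_subsetI)
  fix g assume "g \<in> I"
  then have "?ev g \<in> fiber_ideal w I \<alpha>" unfolding fiber_ideal_eq by (intro ideal.span_base) simp
  then show "weight_initial_form w g \<in> weight_initial_form w ` fiber_ideal w I \<alpha>"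
   using weight_initial_form_hz[of w \<alpha> g] by (metis imageI)
 qed
 then show "J <= weight_initial_ideal w (fiber_ideal w I \<alpha>)"
  unfolding J(2)[symmetric] weight_initial_ideal_def by (rule ideal.span_mono)
 have "weight_initial_form w f \<in> J" if f: "f \<in> fiber_ideal w I \<alpha>" for f
 proof (cases "\<alpha> = 0")
  case True
  have "?ev g \<in> J" if "g \<in> I" for g
  proof -
   have "?ev g = weight_initial_form w g"
    unfolding weight_initial_form_part True
   proof (rule poly_mapping_eqI)
    fix m
    show "lookup (hz w 0 (weight_degree w g) g) m =
      lookup (part (%m. mon_weight w m = weight_degree w g) g) m"
    proof (cases "m \<in> keys g")
     case True
     then have "mon_weight w m \<le> weight_degree w g" by (rule mon_weight_le_weight_degree)
     then show ?thesis by (auto simp: lookup_hz lookup_part power_0_left)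
    qed (simp add: lookup_hz lookup_part in_keys_iff)
   qed
   then show ?thesis
    using that unfolding J(2)[symmetric] weight_initial_ideal_def by (simp add: ideal.span_base)
  qed
  then have "fiber_ideal w I \<alpha> <= J"
   unfolding fiber_ideal_eq by (intro ideal.span_minimal idJ) auto
  then show ?thesis
   using f unfolding weight_initial_form_part by (intro squarefree_monomial_ideal_part J) auto
 next
  case False
  \<comment> \<open>The bound \<open>D\<close> makes this set an ideal; the generators alone, with
    \<open>D\<close> the weight degree, are not closed under addition.\<close>
  define V where "V = {hz w \<alpha> D g | D g. g \<in> I & (\<forall>m\<in>keys g. mon_weight w m \<le> D)}"
  have idV: "is_ideal V"
  proof (rule monomial_module_is_ideal)
   show "0 \<in> V"
    unfolding V_def using ideal.subspace_0[OF idI] by (auto simp: hz_def intro!: exI[of _ 0])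
  next
   fix f g assume f: "f \<in> V" and g: "g \<in> V"
   obtain D a where a: "f = hz w \<alpha> D a" "a \<in> I" "\<forall>m\<in>keys a. mon_weight w m \<le> D"
    using f by (auto simp: V_def)
   obtain E b where b: "g = hz w \<alpha> E b" "b \<in> I" "\<forall>m\<in>keys b. mon_weight w m \<le> E"
    using g by (auto simp: V_def)
   \<comment> \<open>The inverse powers compensate for raising \<open>D\<close> and \<open>E\<close>
     to the common bound \<open>D + E\<close>.\<close>
   define c where "c = const_pol (inverse (\<alpha> ^ E)) * a + const_pol (inverse (\<alpha> ^ D)) * b"
   have "f + g = hz w \<alpha> (D + E) c"
   proof (rule poly_mapping_eqI)
    fix m
    have 1: "lookup a m * \<alpha> ^ (D + E - mon_weight w m) =
      lookup a m * (\<alpha> ^ (D - mon_weight w m) * \<alpha> ^ E)"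
     using a(3) by (cases "m \<in> keys a") (auto simp: in_keys_iff simp flip: power_add)
    have 2: "lookup b m * \<alpha> ^ (D + E - mon_weight w m) =
      lookup b m * (\<alpha> ^ (E - mon_weight w m) * \<alpha> ^ D)"
     using b(3) by (cases "m \<in> keys b") (auto simp: in_keys_iff add.commute simp flip: power_add)
    have "lookup (hz w \<alpha> (D + E) c) m =
      inverse (\<alpha> ^ E) * (lookup a m * \<alpha> ^ (D + E - mon_weight w m)) +
      inverse (\<alpha> ^ D) * (lookup b m * \<alpha> ^ (D + E - mon_weight w m))"
     by (simp add: lookup_hz c_def lookup_add distrib_right mult.assoc)
    also have "... = lookup (f + g) m"
     unfolding 1 2 using False by (simp add: lookup_hz a(1) b(1) lookup_add field_simps)
    finally show "lookup (f + g) m = lookup (hz w \<alpha> (D + E) c) m" ..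
   qed
   moreover have "c \<in> I"
    unfolding c_def by (intro ideal.subspace_add ideal.subspace_scale idI a b)
   moreover have "mon_weight w m \<le> D + E" if "m \<in> keys c" for m
   proof -
    have "m \<in> keys a \<or> m \<in> keys b"
     using that by (auto simp: c_def in_keys_iff lookup_add)
    then show ?thesis using a(3) b(3) by force
   qed
   ultimately show "f + g \<in> V" unfolding V_def by blast
  next
   fix m c f assume f: "f \<in> V"
   obtain D a where a: "f = hz w \<alpha> D a" "a \<in> I" "\<forall>m\<in>keys a. mon_weight w m \<le> D"
    using f by (auto simp: V_def)
   have "single m c * f = hz w \<alpha> (mon_weight w m + D) (single m c * a)"
   proof (rule poly_mapping_eqI)
    fix n
    show "lookup (single m c * f) n =
      lookup (hz w \<alpha> (mon_weight w m + D) (single m c * a)) n"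
    proof (cases "\<exists>k. n = m + k")
     case True
     then show ?thesis by (auto simp: lookup_hz a(1) lookup_single_mult mon_weight_add)
    next
     case False
     then have "!!k. n ~= m + k" by blast
     then show ?thesis by (simp add: lookup_hz lookup_single_mult_eq_0)
    qed
   qed
   moreover have "single m c * a \<in> I" by (rule ideal.subspace_scale[OF idI a(2)])
   moreover have "mon_weight w n \<le> mon_weight w m + D"
    if n: "n \<in> keys (single m c * a)" for n
   proof -
    obtain p q where "n = p + q" "p \<in> keys (single m c)" "q \<in> keys a"
     using n keys_mult[of "single m c" a] by blast
    then show ?thesis using a(3) by (auto simp: mon_weight_add split: if_splits)
   qed
   ultimately show "single m c * f \<in> V"
    unfolding V_def by (intro CollectI exI conjI ballI) auto
  qed
  have evV: "?ev ` I <= V"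
  proof (rule image_subsetI)
   fix g assume "g \<in> I"
   then show "?ev g \<in> V"
    unfolding V_def
    by (intro CollectI exI[of _ "weight_degree w g"] exI[of _ g]) (simp add: mon_weight_le_weight_degree)
  qed
  have "fiber_ideal w I \<alpha> <= V" unfolding fiber_ideal_eq by (rule ideal.span_minimal[OF evV idV])
  then have "f \<in> V" using f by (rule subsetD)
  then obtain D g where g: "f = hz w \<alpha> D g" "g \<in> I" "\<forall>m\<in>keys g. mon_weight w m \<le> D"
   by (auto simp: V_def)
  have "keys f = keys g" using False by (simp add: g(1) set_eq_iff in_keys_iff lookup_hz)
  then have deg: "weight_degree w f = weight_degree w g" by (simp add: weight_degree_def)
  have "weight_initial_form w f = const_pol (\<alpha> ^ (D - weight_degree w g)) * weight_initial_form w g"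
   unfolding weight_initial_form_part deg by (rule poly_mapping_eqI) (simp add: g(1) lookup_part lookup_hz)
  moreover have "weight_initial_form w g \<in> J"
   using g(2) unfolding J(2)[symmetric] weight_initial_ideal_def by (simp add: ideal.span_base)
  ultimately show ?thesis by (simp add: ideal.subspace_scale[OF idJ])
 qed
 then show "weight_initial_ideal w (fiber_ideal w I \<alpha>) <= J"
  unfolding weight_initial_ideal_def by (intro ideal.span_minimal idJ) auto
qed

subsection \<open>Modules over the field of scalars\<close>

lemma cring_scalar_ring: "cring (scalar_ring :: 'k::field ring)"
proof (rule cringI)
 show "abelian_group (scalar_ring :: 'k ring)"
 proof (rule abelian_groupI)
  fix x :: 'k
  show "\<exists>y\<in>carrier scalar_ring. y +[scalar_ring] x = 0[scalar_ring]"
   by (rule bexI[of _ "- x"]) (simp_all add: scalar_ring_def)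
 qed (simp_all add: scalar_ring_def add.assoc add.commute)
 show "comm_monoid (scalar_ring :: 'k ring)"
  by (rule comm_monoidI) (simp_all add: scalar_ring_def mult.assoc mult.commute)
qed (simp add: scalar_ring_def distrib_right)

lemma scalar_ring_simps [simp]:
 "carrier scalar_ring = UNIV" "x +[scalar_ring] y = x + y" "x \<otimes>\<^bsub>scalar_ring\<^esub> y = x * y"
 "\<one>\<^bsub>scalar_ring\<^esub> = 1" "0[scalar_ring] = 0"
 by (simp_all add: scalar_ring_def)

abbreviation is_module :: "('k::field, 'v) module => bool"
 where "is_module M \<equiv> Module.module scalar_ring M"

lemma scalar_moduleI:
 fixes M :: "('k::field, 'v) module"
 assumes "!!x y. x \<in> carrier M ==> y \<in> carrier M ==> x +[M] y \<in> carrier M"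
  and "0[M] \<in> carrier M"
  and "!!c x. x \<in> carrier M ==> c *[M] x \<in> carrier M"
  and "!!x y z. x \<in> carrier M ==> y \<in> carrier M ==> z \<in> carrier M ==>
   (x +[M] y) +[M] z = x +[M] (y +[M] z)"
  and "!!x y. x \<in> carrier M ==> y \<in> carrier M ==> x +[M] y = y +[M] x"
  and "!!x. x \<in> carrier M ==> 0[M] +[M] x = x"
  and "!!x. x \<in> carrier M ==> 0 *[M] x = 0[M]"
  and "!!a b x. x \<in> carrier M ==> (a + b) *[M] x = a *[M] x +[M] b *[M] x"
  and "!!a x y. x \<in> carrier M ==> y \<in> carrier M ==>
   a *[M] (x +[M] y) = a *[M] x +[M] a *[M] y"
  and "!!a b x. x \<in> carrier M ==> (a * b) *[M] x = a *[M] (b *[M] x)"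
  and "!!x. x \<in> carrier M ==> 1 *[M] x = x"
 shows "is_module M"
proof (rule moduleI)
 show "abelian_group M"
 proof (rule abelian_groupI)
  fix x assume x: "x \<in> carrier M"
  have "(- 1) *[M] x +[M] 1 *[M] x = (- 1 + 1) *[M] x" using assms(8) x by metis
  also have "... = 0[M]" using assms(7) x by simp
  finally show "\<exists>y\<in>carrier M. y +[M] x = 0[M]"
   using assms(3,11) x by metis
 qed (use assms in auto)
qed (use assms cring_scalar_ring in auto)

lemma module_facts:
 assumes "is_module M"
 shows "!!x y. x \<in> carrier M ==> y \<in> carrier M ==> x +[M] y \<in> carrier M"
  and "0[M] \<in> carrier M"
  and "!!c x. x \<in> carrier M ==> c *[M] x \<in> carrier M"
  and "!!x y z. x \<in> carrier M ==> y \<in> carrier M ==> z \<in> carrier M ==>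
   (x +[M] y) +[M] z = x +[M] (y +[M] z)"
  and "!!x y. x \<in> carrier M ==> y \<in> carrier M ==> x +[M] y = y +[M] x"
  and "!!x. x \<in> carrier M ==> 0[M] +[M] x = x"
  and "!!x. x \<in> carrier M ==> 0 *[M] x = 0[M]"
  and "!!a b x. x \<in> carrier M ==> (a + b) *[M] x = a *[M] x +[M] b *[M] x"
  and "!!a x y. x \<in> carrier M ==> y \<in> carrier M ==>
   a *[M] (x +[M] y) = a *[M] x +[M] a *[M] y"
  and "!!a b x. x \<in> carrier M ==> (a * b) *[M] x = a *[M] (b *[M] x)"
  and "!!x. x \<in> carrier M ==> 1 *[M] x = x"
  and "!!a. a *[M] 0[M] = 0[M]"
proof -
 interpret M: Module.module scalar_ring M by (rule assms)
 show "x +[M] y \<in> carrier M" if "x \<in> carrier M" "y \<in> carrier M" for x y using that by simp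
 show "0[M] \<in> carrier M" by simp
 show "c *[M] x \<in> carrier M" if "x \<in> carrier M" for c x
  using M.smult_closed[OF _ that] by simp
 show "(x +[M] y) +[M] z = x +[M] (y +[M] z)"
  if "x \<in> carrier M" "y \<in> carrier M" "z \<in> carrier M" for x y z using M.M.a_assoc[OF that] .
 show "x +[M] y = y +[M] x" if "x \<in> carrier M" "y \<in> carrier M" for x y
  using M.M.a_comm[OF that] .
 show "0[M] +[M] x = x" if "x \<in> carrier M" for x using that by simp
 show "0 *[M] x = 0[M]" if "x \<in> carrier M" for x using M.smult_l_null[OF that] by simp
 show "(a + b) *[M] x = a *[M] x +[M] b *[M] x" if "x \<in> carrier M" for a b x
  using M.smult_l_distr[OF _ _ that, of a b] by simp
 show "a *[M] (x +[M] y) = a *[M] x +[M] a *[M] y"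
  if "x \<in> carrier M" "y \<in> carrier M" for a x y
  using M.smult_r_distr[OF _ that, of a] by simp
 show "(a * b) *[M] x = a *[M] (b *[M] x)" if "x \<in> carrier M" for a b x
  using M.smult_assoc1[OF _ _ that, of a b] by simp
 show "1 *[M] x = x" if "x \<in> carrier M" for x using M.smult_one[OF that] by simp
 show "a *[M] 0[M] = 0[M]" for a using M.smult_r_null[of a] by simp
qed

lemma submoduleI:
 fixes M M' :: "('k::field, 'v) module"
 assumes "is_module M" and "carrier M' <= carrier M"
  and "!!x y. x \<in> carrier M' ==> y \<in> carrier M' ==> x +[M'] y = x +[M] y & x +[M] y \<in> carrier M'"
  and "!!c x. x \<in> carrier M' ==> c *[M'] x = c *[M] x & c *[M] x \<in> carrier M'"
  and "0[M'] = 0[M]" "0[M] \<in> carrier M'"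
 shows "is_module M'"
proof -
 note f = module_facts[OF assms(1)]
 have c: "x \<in> carrier M" if "x \<in> carrier M'" for x using assms(2) that by blast
 note add = assms(3)[THEN conjunct1] assms(3)[THEN conjunct2]
 note smult = assms(4)[THEN conjunct1] assms(4)[THEN conjunct2]
 show ?thesis
 proof (rule scalar_moduleI)
  fix x y z a b
  show "0[M'] \<in> carrier M'" by (simp add: assms)
  assume x: "x \<in> carrier M'"
  show "a *[M'] x \<in> carrier M'" by (simp add: smult x)
  show "0[M'] +[M'] x = x" by (simp add: add x assms(5,6) f(6) c)
  show "0 *[M'] x = 0[M']" by (simp add: smult x assms(5) f(7) c)
  show "(a + b) *[M'] x = a *[M'] x +[M'] b *[M'] x"
   by (simp add: smult add x f(8) c)
  show "(a * b) *[M'] x = a *[M'] (b *[M'] x)" by (simp add: smult x f(10) c)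
  show "1 *[M'] x = x" by (simp add: smult x f(11) c)
  assume y: "y \<in> carrier M'"
  show "x +[M'] y \<in> carrier M'" by (simp add: add x y)
  show "x +[M'] y = y +[M'] x" using f(5)[of x y] by (simp add: add x y c)
  show "a *[M'] (x +[M'] y) = a *[M'] x +[M'] a *[M'] y"
   by (simp add: smult add x y f(9) c)
  assume z: "z \<in> carrier M'"
  show "x +[M'] y +[M'] z = x +[M'] (y +[M'] z)"
   by (simp add: add x y z f(4) c)
 qed
qed

definition prod_module :: "'i set => ('i => ('k::field, 'v) module) => ('k, 'i => 'v) module"
 where "prod_module A M =
  \<lparr>carrier = (\<Pi>\<^sub>E i\<in>A. carrier (M i)), mult = undefined, one = undefined,
   zero = (\<lambda>i\<in>A. 0[M i]),
   add = (%x y. \<lambda>i\<in>A. x i +[M i] y i),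
   smult = (%c x. \<lambda>i\<in>A. c *[M i] x i)\<rparr>"

lemma prod_module_simps:
 "carrier (prod_module A M) = (\<Pi>\<^sub>E i\<in>A. carrier (M i))"
 "0[prod_module A M] = (\<lambda>i\<in>A. 0[M i])"
 "x +[prod_module A M] y = (\<lambda>i\<in>A. x i +[M i] y i)"
 "c *[prod_module A M] x = (\<lambda>i\<in>A. c *[M i] x i)"
 by (simp_all add: prod_module_def)

lemma is_module_prod:
 assumes "!!i. i \<in> A ==> is_module (M i)"
 shows "is_module (prod_module A M)"
proof (rule scalar_moduleI, unfold prod_module_simps)
 note f = module_facts[OF assms]
 fix x y z :: "'a => 'c" and a b :: 'b
 show "(\<lambda>i\<in>A. 0[M i]) \<in> (\<Pi>\<^sub>E i\<in>A. carrier (M i))" by (simp add: f(2))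
 assume x: "x \<in> (\<Pi>\<^sub>E i\<in>A. carrier (M i))"
 then have x': "x i \<in> carrier (M i)" if "i \<in> A" for i using that by auto
 have eqI: "(\<lambda>i\<in>A. u i) = x" if "!!i. i \<in> A ==> u i = x i" for u
  using that x by (intro ext) (auto simp: restrict_def PiE_def extensional_def)
 show "(\<lambda>i\<in>A. a *[M i] x i) \<in> (\<Pi>\<^sub>E i\<in>A. carrier (M i))" by (auto simp: f(3) x')
 show "(\<lambda>i\<in>A. (\<lambda>i\<in>A. 0[M i]) i +[M i] x i) = x" by (rule eqI) (simp add: f(6) x')
 show "(\<lambda>i\<in>A. 0 *[M i] x i) = (\<lambda>i\<in>A. 0[M i])" by (rule restrict_ext) (simp add: f(7) x')
 show "(\<lambda>i\<in>A. (a + b) *[M i] x i) =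
   (\<lambda>i\<in>A. (\<lambda>i\<in>A. a *[M i] x i) i +[M i] (\<lambda>i\<in>A. b *[M i] x i) i)"
  by (rule restrict_ext) (simp add: f(8) x')
 show "(\<lambda>i\<in>A. (a * b) *[M i] x i) = (\<lambda>i\<in>A. a *[M i] (\<lambda>i\<in>A. b *[M i] x i) i)"
  by (rule restrict_ext) (simp add: f(10) x')
 show "(\<lambda>i\<in>A. 1 *[M i] x i) = x" by (rule eqI) (simp add: f(11) x')
 assume y: "y \<in> (\<Pi>\<^sub>E i\<in>A. carrier (M i))"
 then have y': "y i \<in> carrier (M i)" if "i \<in> A" for i using that by auto
 show "(\<lambda>i\<in>A. x i +[M i] y i) \<in> (\<Pi>\<^sub>E i\<in>A. carrier (M i))" by (auto simp: f(1) x' y')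
 show "(\<lambda>i\<in>A. x i +[M i] y i) = (\<lambda>i\<in>A. y i +[M i] x i)"
  by (rule restrict_ext) (rule f(5)[OF _ x' y'])
 show "(\<lambda>i\<in>A. a *[M i] (\<lambda>i\<in>A. x i +[M i] y i) i) =
   (\<lambda>i\<in>A. (\<lambda>i\<in>A. a *[M i] x i) i +[M i] (\<lambda>i\<in>A. a *[M i] y i) i)"
  by (rule restrict_ext) (simp add: f(9) x' y')
 assume z: "z \<in> (\<Pi>\<^sub>E i\<in>A. carrier (M i))"
 then have z': "z i \<in> carrier (M i)" if "i \<in> A" for i using that by auto
 show "(\<lambda>i\<in>A. (\<lambda>i\<in>A. x i +[M i] y i) i +[M i] z i) =
   (\<lambda>i\<in>A. x i +[M i] (\<lambda>i\<in>A. y i +[M i] z i) i)"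
  by (rule restrict_ext) (simp add: f(4) x' y' z')
qed

lemma module_minus_eq:
 assumes "is_module M" "x \<in> carrier M" "y \<in> carrier M"
 shows "x -[M] y = x +[M] (- 1) *[M] y"
proof -
 interpret M: Module.module scalar_ring M by (rule assms)
 have "\<ominus>\<^bsub>scalar_ring\<^esub> (1::'a) = - 1"
  by (rule M.R.minus_equality) auto
 then have "(- 1) *[M] y = \<ominus>\<^bsub>M\<^esub> y"
  using M.smult_l_minus[of 1 y] assms M.smult_one[of y] by simp
 then show ?thesis by (simp add: a_minus_def)
qed

subsection \<open>Transfer of quotient dimensions along linear correspondences\<close>

text \<open>A relation is used because connecting homomorphisms and choices of numerators become
  maps only on the quotients. Partners of the vectors \<open>b j\<close> are chosen arbitrarily;
  linearity relates all combinations, and the hypothesis on \<open>B\<close> decides about them on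
  both sides at once.\<close>

lemma quotient_has_dim_transfer:
 fixes M :: "('k::field, 'v) module" and M' :: "('k, 'w) module"
 assumes M: "is_module M" and M': "is_module M'"
  and Z: "Z <= carrier M" and Z': "Z' <= carrier M'"
  and R: "!!z z'. R z z' ==> z \<in> Z & z' \<in> Z'"
  and R0: "R 0[M] 0[M']"
  and Radd: "!!x x' y y'. R x x' ==> R y y' ==> R (x +[M] y) (x' +[M'] y')"
  and Rsmult: "!!c x x'. R x x' ==> R (c *[M] x) (c *[M'] x')"
  and left: "!!z. z \<in> Z ==> \<exists>z'. R z z'" and right: "!!z'. z' \<in> Z' ==> \<exists>z. R z z'"
  and B: "!!z z'. R z z' ==> z \<in> B \<longleftrightarrow> z' \<in> B'"
  and dim: "quotient_has_dim M Z B d"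
 shows "quotient_has_dim M' Z' B' d"
proof -
 interpret M: Module.module scalar_ring M by (rule M)
 interpret M': Module.module scalar_ring M' by (rule M')
 obtain b where b0: "\<forall>j<d. b j \<in> Z" and uniq0: "\<forall>z\<in>Z. \<exists>!c. c \<in> {..<d} \<rightarrow>\<^sub>E UNIV &
   z -[M] (\<Oplus>\<^bsub>M\<^esub>j\<in>{..<d}. c j *[M] b j) \<in> B"
  using dim unfolding quotient_has_dim_def by (elim exE conjE)
 note b = b0[rule_format] and uniq = bspec[OF uniq0]
 have "\<exists>b'. \<forall>j<d. R (b j) (b' j)" using left[OF b] by metis
 then obtain b' where b': "!!j. j < d ==> R (b j) (b' j)" by blast
 have Rsum: "R (\<Oplus>\<^bsub>M\<^esub>j\<in>{..<n}. c j *[M] b j) (\<Oplus>\<^bsub>M'\<^esub>j\<in>{..<n}. c j *[M'] b' j)"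
  if "n \<le> d" for n and c :: "nat => 'k"
  using that
 proof (induction n)
  case 0
  show ?case using R0 by simp
 next
  case (Suc n)
  have bc: "c j *[M] b j \<in> carrier M" "c j *[M'] b' j \<in> carrier M'" if "j < Suc n" for j
   using that Suc.prems R[OF b'[of j]] Z Z' M.smult_closed M'.smult_closed by auto
  have "(\<Oplus>\<^bsub>M\<^esub>j\<in>{..<Suc n}. c j *[M] b j) =
    c n *[M] b n +[M] (\<Oplus>\<^bsub>M\<^esub>j\<in>{..<n}. c j *[M] b j)"
   unfolding lessThan_Suc using bc by (intro M.finsum_insert) auto
  moreover have "(\<Oplus>\<^bsub>M'\<^esub>j\<in>{..<Suc n}. c j *[M'] b' j) =
    c n *[M'] b' n +[M'] (\<Oplus>\<^bsub>M'\<^esub>j\<in>{..<n}. c j *[M'] b' j)"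
   unfolding lessThan_Suc using bc by (intro M'.finsum_insert) auto
  ultimately show ?case
   using Suc by (auto intro!: Radd Rsmult b')
 qed
 have key: "z -[M] (\<Oplus>\<^bsub>M\<^esub>j\<in>{..<d}. c j *[M] b j) \<in> B \<longleftrightarrow>
   z' -[M'] (\<Oplus>\<^bsub>M'\<^esub>j\<in>{..<d}. c j *[M'] b' j) \<in> B'" if "R z z'" for z z' c
 proof -
  let ?s = "\<Oplus>\<^bsub>M\<^esub>j\<in>{..<d}. c j *[M] b j" and ?s' = "\<Oplus>\<^bsub>M'\<^esub>j\<in>{..<d}. c j *[M'] b' j"
  have s: "R ?s ?s'" by (rule Rsum) simp
  have c: "z \<in> carrier M" "?s \<in> carrier M" "z' \<in> carrier M'" "?s' \<in> carrier M'"
   using R[OF that] R[OF s] Z Z' by blast+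
  have "R (z -[M] ?s) (z' -[M'] ?s')"
   unfolding module_minus_eq[OF M c(1,2)] module_minus_eq[OF M' c(3,4)]
   by (rule Radd[OF that Rsmult[OF s]])
  then show ?thesis by (rule B)
 qed
 show ?thesis
  unfolding quotient_has_dim_def
 proof (intro exI conjI allI impI ballI)
  show "b' j \<in> Z'" if "j < d" for j using R b' that by blast
  fix z' assume "z' \<in> Z'"
  then obtain z where "R z z'" using right by blast
  then show "\<exists>!c. c \<in> {..<d} \<rightarrow>\<^sub>E UNIV & z' -[M'] (\<Oplus>\<^bsub>M'\<^esub>j\<in>{..<d}. c j *[M'] b' j) \<in> B'"
   using uniq[of z] key[of z z'] R by auto
 qed
qed

lemma module_diff:
 fixes M :: "('k::field, 'v) module"
 assumes M: "is_module M"
 shows module_diff_closed: "!!x y. x \<in> carrier M ==> y \<in> carrier M ==> x -[M] y \<in> carrier M"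
  and module_diff_self: "!!x. x \<in> carrier M ==> x -[M] x = 0[M]"
  and module_diff_zero: "!!x. x \<in> carrier M ==> x -[M] 0[M] = x"
  and module_diff_eq_0: "!!x y. x \<in> carrier M ==> y \<in> carrier M ==> x -[M] y = 0[M] \<longleftrightarrow> x = y"
  and module_diff_add_cancel: "!!x y. x \<in> carrier M ==> y \<in> carrier M ==> (x -[M] y) +[M] y = x"
  and module_add_diff: "!!a b c d. a \<in> carrier M ==> b \<in> carrier M ==> c \<in> carrier M ==> d \<in> carrier M ==>
   (a +[M] b) -[M] (c +[M] d) = (a -[M] c) +[M] (b -[M] d)"
  and module_diff_diff: "!!a b c d. a \<in> carrier M ==> b \<in> carrier M ==> c \<in> carrier M ==> d \<in> carrier M ==>
   (a -[M] b) -[M] (c -[M] d) = (a -[M] c) -[M] (b -[M] d)"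
  and module_smult_diff: "!!c x y. x \<in> carrier M ==> y \<in> carrier M ==>
   c *[M] (x -[M] y) = c *[M] x -[M] c *[M] y"
proof -
 interpret M: Module.module scalar_ring M by (rule M)
 show closed: "x -[M] y \<in> carrier M" if "x \<in> carrier M" "y \<in> carrier M" for x y
  using that by simp
 show "x -[M] x = 0[M]" if "x \<in> carrier M" for x
  using that by (simp add: a_minus_def M.M.r_neg)
 show "x -[M] 0[M] = x" if "x \<in> carrier M" for x
  using that by (simp add: a_minus_def)
 show cancel: "(x -[M] y) +[M] y = x" if "x \<in> carrier M" "y \<in> carrier M" for x y
  using that by (simp add: a_minus_def M.M.a_assoc M.M.l_neg)
 show "x -[M] y = 0[M] \<longleftrightarrow> x = y" if "x \<in> carrier M" "y \<in> carrier M" for x y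
  using cancel[OF that] that by (auto simp: a_minus_def M.M.r_neg)
 show "(a +[M] b) -[M] (c +[M] d) = (a -[M] c) +[M] (b -[M] d)"
  if "a \<in> carrier M" "b \<in> carrier M" "c \<in> carrier M" "d \<in> carrier M" for a b c d
  using that by (simp add: a_minus_def M.M.minus_add M.M.a_ac)
 show "(a -[M] b) -[M] (c -[M] d) = (a -[M] c) -[M] (b -[M] d)"
  if "a \<in> carrier M" "b \<in> carrier M" "c \<in> carrier M" "d \<in> carrier M" for a b c d
  using that by (simp add: a_minus_def M.M.minus_add M.M.a_ac)
 show "c *[M] (x -[M] y) = c *[M] x -[M] c *[M] y"
  if "x \<in> carrier M" "y \<in> carrier M" for c x y
  using that M.smult_r_distr[of c x "\<ominus>\<^bsub>M\<^esub> y"] M.smult_r_minus[of c y] by (simp add: a_minus_def)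
qed

lemma linear_homD:
 assumes "linear_hom M N phi"
 shows "x \<in> carrier M ==> phi x \<in> carrier N"
  and "x \<in> carrier M ==> y \<in> carrier M ==> phi (x +[M] y) = phi x +[N] phi y"
  and "x \<in> carrier M ==> phi (c *[M] x) = c *[N] phi x"
 using assms by (auto simp: linear_hom_def)

lemma linear_hom_diff:
 assumes "linear_hom M N phi" "is_module M" "is_module N"
 shows linear_hom_zero: "phi 0[M] = 0[N]"
  and "x \<in> carrier M ==> y \<in> carrier M ==> phi (x -[M] y) = phi x -[N] phi y"
proof -
 note h = linear_homD[OF assms(1)] and M = module_facts[OF assms(2)] and N = module_facts[OF assms(3)]
 show "phi 0[M] = 0[N]" using h(3)[of "0[M]" 0] M(7)[of "0[M]"] N(7)[of "phi 0[M]"] M(2) h(1) by metis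
 assume "x \<in> carrier M" "y \<in> carrier M"
 then show "phi (x -[M] y) = phi x -[N] phi y"
  using module_minus_eq[OF assms(2), of x y] module_minus_eq[OF assms(3), of "phi x" "phi y"] h M(3) by simp
qed

subsection \<open>Alternating sums over deletions\<close>

fun altsum :: "('k::field, 'v) module => ('j list => 'v) => 'j list => 'v"
 where
  "altsum M c [] = 0[M]"
 | "altsum M c (j # xs) = c xs -[M] altsum M (%ys. c (j # ys)) xs"

definition faces_in :: "'j list => ('j list => 'v) => 'v set => bool"
 where "faces_in xs c S \<longleftrightarrow> (\<forall>ys. Suc (length ys) = length xs & set ys <= set xs --> c ys \<in> S)"

lemma faces_in_Cons: "faces_in (j # xs) c S ==> c xs \<in> S & faces_in xs (%ys. c (j # ys)) S"
 unfolding faces_in_def by (intro conjI allI impI; elim allE[of _ xs] allE[of _ "j # _"]; force)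

lemma altsum_closed:
 assumes "is_module M" shows "faces_in xs c (carrier M) ==> altsum M c xs \<in> carrier M"
proof (induction xs arbitrary: c)
 case (Cons j xs)
 then show ?case using faces_in_Cons[OF Cons.prems] by (simp add: module_diff_closed[OF assms])
qed (simp add: module_facts[OF assms])

lemma altsum_cong:
 assumes "!!ys. Suc (length ys) = length xs ==> set ys <= set xs ==> c ys = c' ys"
 shows "altsum M c xs = altsum M c' xs"
 using assms
proof (induction xs arbitrary: c c')
 case (Cons j xs)
 have "altsum M (%ys. c (j # ys)) xs = altsum M (%ys. c' (j # ys)) xs"
  by (rule Cons.IH) (rule Cons.prems; auto)
 moreover have "c xs = c' xs" by (rule Cons.prems) auto
 ultimately show ?case by simp
qed simp

lemma altsum_hom:
 assumes "linear_hom M N phi" "is_module M" "is_module N"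
 shows "faces_in xs c (carrier M) ==> phi (altsum M c xs) = altsum N (%ys. phi (c ys)) xs"
proof (induction xs arbitrary: c)
 case (Cons j xs)
 then show ?case
  using faces_in_Cons[OF Cons.prems] by (simp add: linear_hom_diff[OF assms] altsum_closed[OF assms(2)])
qed (simp add: linear_hom_diff[OF assms])

lemma altsum_diff:
 assumes "is_module M"
 shows "faces_in xs c (carrier M) ==> faces_in xs c' (carrier M) ==>
  altsum M (%ys. c ys -[M] c' ys) xs = altsum M c xs -[M] altsum M c' xs"
proof (induction xs arbitrary: c c')
 case (Cons j xs)
 note f = faces_in_Cons[OF Cons.prems(1)] faces_in_Cons[OF Cons.prems(2)]
 show ?case
  using f Cons.IH[of "%ys. c (j # ys)" "%ys. c' (j # ys)"]
  by (simp add: module_diff_diff[OF assms] altsum_closed[OF assms])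
qed (simp add: module_diff_self[OF assms] module_facts(2)[OF assms])

lemma altsum_add:
 assumes "is_module M"
 shows "faces_in xs c (carrier M) ==> faces_in xs c' (carrier M) ==>
  altsum M (%ys. c ys +[M] c' ys) xs = altsum M c xs +[M] altsum M c' xs"
proof (induction xs arbitrary: c c')
 case (Cons j xs)
 note f = faces_in_Cons[OF Cons.prems(1)] faces_in_Cons[OF Cons.prems(2)]
 show ?case
  using f Cons.IH[of "%ys. c (j # ys)" "%ys. c' (j # ys)"]
  by (simp add: module_add_diff[OF assms] altsum_closed[OF assms])
qed (simp add: module_facts[OF assms])

lemma altsum_smult:
 assumes "is_module M"
 shows "faces_in xs c (carrier M) ==> altsum M (%ys. a *[M] c ys) xs = a *[M] altsum M c xs"
proof (induction xs arbitrary: c)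
 case (Cons j xs)
 note f = faces_in_Cons[OF Cons.prems(1)]
 show ?case
  using f Cons.IH[of "%ys. c (j # ys)"]
  by (simp add: module_smult_diff[OF assms] altsum_closed[OF assms])
qed (simp add: module_facts[OF assms])

lemma altsum_altsum:
 assumes "is_module M"
  and "!!zs. Suc (Suc (length zs)) = length xs ==> set zs <= set xs ==> c zs \<in> carrier M"
 shows "altsum M (altsum M c) xs = 0[M]"
 using assms(2)
proof (induction xs arbitrary: c)
 case (Cons j xs)
 let ?c = "%zs. c (j # zs)"
 have f1: "faces_in xs c (carrier M)"
  unfolding faces_in_def by (intro allI impI Cons.prems) auto
 have f2: "faces_in xs (altsum M ?c) (carrier M)"
  unfolding faces_in_def
 proof (intro allI impI altsum_closed[OF assms(1)])
  fix ys assume "Suc (length ys) = length xs & set ys <= set xs"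
  then show "faces_in ys ?c (carrier M)"
   unfolding faces_in_def by (intro allI impI Cons.prems) auto
 qed
 have "altsum M (altsum M c) (j # xs) = altsum M c xs -[M] (altsum M c xs -[M] altsum M (altsum M ?c) xs)"
  by (simp add: altsum_diff[OF assms(1) f1 f2])
 also have "altsum M (altsum M ?c) xs = 0[M]"
  by (rule Cons.IH) (rule Cons.prems; auto)
 finally show ?case
  using altsum_closed[OF assms(1) f1]
  by (simp add: module_diff_zero[OF assms(1)] module_diff_self[OF assms(1)])
qed simp

section \<open>Gluing and locality for sheaves\<close>

abbreviation Sec :: "('p, 'k, 'v) sheaf_data => 'p set => 'v set"
 where "Sec F U \<equiv> carrier (sections F U)"

lemma presheafD:
 assumes "presheaf X F"
 shows psh_mod: "openin X U ==> is_module (sections F U)"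
  and psh_restr_hom: "openin X U ==> openin X V ==> V <= U ==>
   linear_hom (sections F U) (sections F V) (restr F U V)"
  and psh_restr_self: "openin X U ==> s \<in> Sec F U ==> restr F U U s = s"
  and psh_restr_restr: "openin X U ==> openin X V ==> openin X V' ==> V' <= V ==> V <= U ==>
   s \<in> Sec F U ==> restr F V V' (restr F U V s) = restr F U V' s"
 using assms unfolding presheaf_def by simp_all

lemma psh_restr_closed:
 "presheaf X F ==> openin X U ==> openin X V ==> V <= U ==> s \<in> Sec F U ==> restr F U V s \<in> Sec F V"
 using linear_homD(1)[OF psh_restr_hom] .

lemma sheaf_presheaf: "sheaf X F ==> presheaf X F"
 by (simp add: sheaf_def)

lemma flasque_sheaf: "flasque X F ==> sheaf X F"
 by (simp add: flasque_def)

lemma flasque_extend: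
 assumes "flasque X F" "openin X U" "openin X V" "V <= U" "s \<in> Sec F V"
 obtains t where "t \<in> Sec F U" "restr F U V t = s"
proof -
 have "restr F U V ` Sec F U = Sec F V" using assms by (simp add: flasque_def)
 then show ?thesis using assms(5) that by (metis imageE)
qed

lemma sheaf_ex1:
 assumes "sheaf X F" and "\<forall>V\<in>\<U>. openin X V & s V \<in> Sec F V"
  and "\<forall>V\<in>\<U>. \<forall>W\<in>\<U>. restr F V (V \<inter> W) (s V) = restr F W (V \<inter> W) (s W)"
 shows "\<exists>!a. a \<in> Sec F (\<Union>\<U>) & (\<forall>V\<in>\<U>. restr F (\<Union>\<U>) V a = s V)"
 by (rule assms(1)[unfolded sheaf_def, THEN conjunct2, THEN spec, THEN spec, THEN mp, OF conjI[OF assms(2,3)]])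

text \<open>The sheaf axiom indexes sections by the open sets themselves. In a family two indices
  may share an open set; agreement on the intersection then forces equal sections, so the choice
  made by \<open>idx\<close> is harmless.\<close>

lemma sheaf_glue:
 assumes F: "sheaf X F" and open_V: "!!i. i \<in> A ==> openin X (V i)"
  and s: "!!i. i \<in> A ==> s i \<in> Sec F (V i)"
  and agree: "!!i j. i \<in> A ==> j \<in> A ==> restr F (V i) (V i \<inter> V j) (s i) = restr F (V j) (V i \<inter> V j) (s j)"
  and W: "W = (\<Union>i\<in>A. V i)"
 obtains a where "a \<in> Sec F W" "!!i. i \<in> A ==> restr F W (V i) a = s i"
proof -
 define idx where "idx D = (SOME i. i \<in> A & V i = D)" for D
 have idx: "idx D \<in> A" "V (idx D) = D" if "D \<in> V ` A" for D
 proof -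
  have "\<exists>i. i \<in> A & V i = D" using that by blast
  then show "idx D \<in> A" "V (idx D) = D" unfolding idx_def by (metis (mono_tags, lifting) someI_ex)+
 qed
 define t where "t D = s (idx D)" for D
 have pre: "presheaf X F" using F by (rule sheaf_presheaf)
 have si: "s i = s j" if "i \<in> A" "j \<in> A" "V i = V j" for i j
  using agree[OF that(1,2)] s[OF that(1)] s[OF that(2)] open_V[OF that(1)] that(3)
   psh_restr_self[OF pre] by (metis inf.idem)
 have "\<exists>!a. a \<in> Sec F (\<Union>(V ` A)) & (\<forall>D\<in>V ` A. restr F (\<Union>(V ` A)) D a = t D)"
 proof -
  have 1: "\<forall>D\<in>V ` A. openin X D & t D \<in> Sec F D"
   using idx open_V s unfolding t_def by metis
  have 2: "\<forall>D\<in>V ` A. \<forall>E\<in>V ` A. restr F D (D \<inter> E) (t D) = restr F E (D \<inter> E) (t E)"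
   using agree idx unfolding t_def by metis
  show ?thesis using sheaf_ex1[OF F 1 2] .
 qed
 then obtain a where a: "a \<in> Sec F (\<Union>(V ` A))" "\<forall>D\<in>V ` A. restr F (\<Union>(V ` A)) D a = t D" by blast
 show thesis
 proof (rule that)
  show "a \<in> Sec F W" using a(1) by (simp add: W)
  show "restr F W (V i) a = s i" if "i \<in> A" for i
   using a(2) that si[OF idx(1) that] idx(2) unfolding W t_def by (metis imageI)
 qed
qed

lemma sheaf_locality:
 assumes F: "sheaf X F" and open_V: "!!i. i \<in> A ==> openin X (V i)" and W: "W = (\<Union>i\<in>A. V i)"
  and a: "a \<in> Sec F W" and b: "b \<in> Sec F W"
  and eq: "!!i. i \<in> A ==> restr F W (V i) a = restr F W (V i) b"
 shows "a = b"
proof -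
 have pre: "presheaf X F" using F by (rule sheaf_presheaf)
 have oW: "openin X W" unfolding W using open_V by (intro openin_Union) auto
 have sub: "V i <= W" if "i \<in> A" for i using that W by blast
 define t where "t D = restr F W D a" for D
 have 1: "\<forall>D\<in>V ` A. openin X D & t D \<in> Sec F D"
  using open_V sub psh_restr_closed[OF pre oW _ _ a] by (auto simp: t_def)
 have 2: "\<forall>D\<in>V ` A. \<forall>E\<in>V ` A. restr F D (D \<inter> E) (t D) = restr F E (D \<inter> E) (t E)"
 proof (intro ballI)
  fix D E assume "D \<in> V ` A" "E \<in> V ` A"
  then have "openin X D" "openin X E" "D <= W" "E <= W" using open_V sub by auto
  then show "restr F D (D \<inter> E) (t D) = restr F E (D \<inter> E) (t E)"
   unfolding t_def by (simp add: psh_restr_restr[OF pre oW _ _ _ _ a] openin_Int)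
 qed
 have ex1: "\<exists>!a. a \<in> Sec F (\<Union>(V ` A)) & (\<forall>D\<in>V ` A. restr F (\<Union>(V ` A)) D a = t D)"
  using sheaf_ex1[OF F 1 2] .
 show ?thesis
  by (rule ex1E[OF ex1]) (metis (no_types, lifting) W a b eq imageE t_def)
qed

subsection \<open>Cech cochains\<close>

text \<open>Intersecting with \<open>W\<close> gives the empty list a meaning: there the complex is
  augmented by the sections over \<open>W\<close>. It also allows restriction to a smaller
  \<open>W\<close> with the cover unchanged.\<close>

definition cop :: "'p set => ('j => 'p set) => 'j list => 'p set"
 where "cop W U xs = W \<inter> (\<Inter>j\<in>set xs. U j)"

lemma cop_Nil [simp]: "cop W U [] = W"
 by (simp add: cop_def)

lemma cop_Cons: "cop W U (j # xs) = U j \<inter> cop W U xs"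
 by (auto simp: cop_def)

lemma cop_mono: "set ys <= set xs ==> cop W U xs <= cop W U ys"
 by (auto simp: cop_def)

lemma cop_mono2: "W' <= W ==> cop W' U xs <= cop W U xs"
 by (auto simp: cop_def)

text \<open>\<open>p\<close> counts indices, so the Cech degree is p - 1. Values at other lists are
  arbitrary; they are normalized only in \<open>cmod\<close>, where equality of cochains
  matters.\<close>

definition chain :: "('p, 'k, 'v) sheaf_data => 'p set => ('j => 'p set) => 'j set => nat => ('j list => 'v) => bool"
 where "chain F W U J p c \<longleftrightarrow> (\<forall>xs. length xs = p & set xs <= J --> c xs \<in> Sec F (cop W U xs))"

definition cdiff :: "('p, 'k::field, 'v) sheaf_data => 'p set => ('j => 'p set) => ('j list => 'v) => 'j list => 'v"
 where "cdiff F W U c xs =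
  altsum (sections F (cop W U xs)) (%ys. restr F (cop W U ys) (cop W U xs) (c ys)) xs"

definition cocycle :: "('p, 'k::field, 'v) sheaf_data => 'p set => ('j => 'p set) => 'j set => nat => ('j list => 'v) => bool"
 where "cocycle F W U J p c \<longleftrightarrow> chain F W U J p c &
  (\<forall>xs. length xs = Suc p & set xs <= J --> cdiff F W U c xs = 0[sections F (cop W U xs)])"

definition is_cdiff :: "('p, 'k::field, 'v) sheaf_data => 'p set => ('j => 'p set) => 'j set => nat =>
  ('j list => 'v) => ('j list => 'v) => bool"
 where "is_cdiff F W U J p e c \<longleftrightarrow> chain F W U J p e &
  (\<forall>xs. length xs = Suc p & set xs <= J --> cdiff F W U e xs = c xs)"

locale cech =
 fixes X :: "'p topology" and W :: "'p set" and U :: "'j => 'p set" and J :: "'j set"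
 assumes open_W: "openin X W" and open_U: "!!j. j \<in> J ==> openin X (U j)"
begin

lemma open_cop: "set xs <= J ==> openin X (cop W U xs)"
 by (induction xs) (auto simp: cop_Cons open_W open_U intro: openin_Int)

lemma chainD: "chain F W U J p c ==> length xs = p ==> set xs <= J ==> c xs \<in> Sec F (cop W U xs)"
 by (simp add: chain_def)

lemma chain_restr:
 assumes F: "presheaf X F" and c: "chain F W U J p c" and ys: "length ys = p" "set ys <= set xs" and xs: "set xs <= J"
 shows "restr F (cop W U ys) (cop W U xs) (c ys) \<in> Sec F (cop W U xs)"
proof -
 have "set ys <= J" using ys xs by blast
 then show ?thesis
  by (intro psh_restr_closed[OF F] open_cop xs cop_mono ys chainD[OF c])
qed

lemma chain_faces:
 assumes F: "presheaf X F" and c: "chain F W U J p c" and xs: "length xs = Suc p" "set xs <= J"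
 shows "faces_in xs (%ys. restr F (cop W U ys) (cop W U xs) (c ys)) (Sec F (cop W U xs))"
 unfolding faces_in_def using chain_restr[OF F c _ _ xs(2)] xs(1) by auto

lemma chain_cdiff:
 assumes F: "presheaf X F" and c: "chain F W U J p c"
 shows "chain F W U J (Suc p) (cdiff F W U c)"
 unfolding chain_def cdiff_def
 using altsum_closed[OF psh_mod[OF F open_cop] chain_faces[OF F c]] by blast

lemma restr_cdiff:
 assumes F: "presheaf X F" and c: "chain F W U J p c" and ys: "length ys = Suc p" "set ys <= set xs" and xs: "set xs <= J"
 shows "restr F (cop W U ys) (cop W U xs) (cdiff F W U c ys) =
  altsum (sections F (cop W U xs)) (%zs. restr F (cop W U zs) (cop W U xs) (c zs)) ys"
proof -
 have ysJ: "set ys <= J" using ys xs by blast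
 note o = open_cop[OF ysJ] open_cop[OF xs]
 have "restr F (cop W U ys) (cop W U xs) (cdiff F W U c ys) =
  altsum (sections F (cop W U xs)) (%zs. restr F (cop W U ys) (cop W U xs) (restr F (cop W U zs) (cop W U ys) (c zs))) ys"
  unfolding cdiff_def
  by (intro altsum_hom[OF psh_restr_hom[OF F o cop_mono[OF ys(2)]] psh_mod[OF F o(1)]
     psh_mod[OF F o(2)]] chain_faces[OF F c ys(1) ysJ])
 also have "... = altsum (sections F (cop W U xs)) (%zs. restr F (cop W U zs) (cop W U xs) (c zs)) ys"
 proof (rule altsum_cong)
  fix zs assume "Suc (length zs) = length ys" "set zs <= set ys"
  then have "length zs = p" "set zs <= J" "cop W U ys <= cop W U zs" and zs: "set zs <= set ys" using ys ysJ cop_mono[of zs ys W U] by auto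
  then show "restr F (cop W U ys) (cop W U xs) (restr F (cop W U zs) (cop W U ys) (c zs)) =
    restr F (cop W U zs) (cop W U xs) (c zs)"
   by (intro psh_restr_restr[OF F open_cop o] cop_mono ys zs chainD[OF c])
 qed
 finally show ?thesis .
qed

lemma cdiff_cdiff:
 assumes F: "presheaf X F" and c: "chain F W U J p c" and xs: "length xs = Suc (Suc p)" "set xs <= J"
 shows "cdiff F W U (cdiff F W U c) xs = 0[sections F (cop W U xs)]"
proof -
 have "cdiff F W U (cdiff F W U c) xs = altsum (sections F (cop W U xs))
   (%ys. restr F (cop W U ys) (cop W U xs) (cdiff F W U c ys)) xs"
  by (simp add: cdiff_def[of F W U "cdiff F W U c"])
 also have "... = altsum (sections F (cop W U xs))
   (altsum (sections F (cop W U xs)) (%zs. restr F (cop W U zs) (cop W U xs) (c zs))) xs"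
  by (rule altsum_cong) (rule restr_cdiff[OF F c _ _ xs(2)], use xs(1) in auto)
 also have "... = 0[sections F (cop W U xs)]"
  by (rule altsum_altsum[OF psh_mod[OF F open_cop[OF xs(2)]]])
    (rule chain_restr[OF F c _ _ xs(2)], use xs(1) in auto)
 finally show ?thesis .
qed

lemma cocycle_cdiff: "presheaf X F ==> chain F W U J p c ==> cocycle F W U J (Suc p) (cdiff F W U c)"
 by (simp add: cocycle_def chain_cdiff cdiff_cdiff)

lemma cdiff_hom:
 assumes F: "presheaf X F" and G: "presheaf X G" and phi: "sheaf_hom X F G phi" and c: "chain F W U J p c"
  and xs: "length xs = Suc p" "set xs <= J"
 shows "phi (cop W U xs) (cdiff F W U c xs) = cdiff G W U (%ys. phi (cop W U ys) (c ys)) xs"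
proof -
 note o = open_cop[OF xs(2)]
 have "phi (cop W U xs) (cdiff F W U c xs) =
  altsum (sections G (cop W U xs)) (%ys. phi (cop W U xs) (restr F (cop W U ys) (cop W U xs) (c ys))) xs"
  unfolding cdiff_def using phi o
  by (intro altsum_hom[OF _ psh_mod[OF F o] psh_mod[OF G o]] chain_faces[OF F c xs])
    (simp add: sheaf_hom_def)
 also have "... = cdiff G W U (%ys. phi (cop W U ys) (c ys)) xs"
  unfolding cdiff_def
 proof (rule altsum_cong)
  fix ys assume "Suc (length ys) = length xs" "set ys <= set xs"
  then have "length ys = p" "set ys <= J" "cop W U xs <= cop W U ys" using xs cop_mono[of ys xs W U] by auto
  then show "phi (cop W U xs) (restr F (cop W U ys) (cop W U xs) (c ys)) =
   restr G (cop W U ys) (cop W U xs) (phi (cop W U ys) (c ys))"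
   using phi o open_cop[of ys] chainD[OF c] unfolding sheaf_hom_def by blast
 qed
 finally show ?thesis .
qed

lemma chain_hom:
 "sheaf_hom X F G phi ==> chain F W U J p c ==> chain G W U J p (%ys. phi (cop W U ys) (c ys))"
 unfolding chain_def
proof (intro allI impI)
 fix xs assume phi: "sheaf_hom X F G phi" and c: "\<forall>xs. length xs = p & set xs <= J --> c xs \<in> Sec F (cop W U xs)"
  and xs: "length xs = p & set xs <= J"
 have "linear_hom (sections F (cop W U xs)) (sections G (cop W U xs)) (phi (cop W U xs))"
  using phi open_cop[of xs] xs by (simp add: sheaf_hom_def)
 then show "phi (cop W U xs) (c xs) \<in> Sec G (cop W U xs)"
  by (rule linear_homD(1)) (use c xs in simp)
qed

lemma chain_diff:
 assumes F: "presheaf X F" and c: "chain F W U J p c" "chain F W U J p c'"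
 shows "chain F W U J p (%ys. c ys -[sections F (cop W U ys)] c' ys)"
 using c module_diff_closed[OF psh_mod[OF F open_cop]] unfolding chain_def by blast

lemma chain_add:
 assumes F: "presheaf X F" and c: "chain F W U J p c" "chain F W U J p c'"
 shows "chain F W U J p (%ys. c ys +[sections F (cop W U ys)] c' ys)"
 using c module_facts(1)[OF psh_mod[OF F open_cop]] unfolding chain_def by blast

lemma cdiff_op:
 assumes F: "presheaf X F" and c: "chain F W U J p c" "chain F W U J p c'" and xs: "length xs = Suc p" "set xs <= J"
  and hom: "!!M N phi x y. linear_hom M N phi ==> is_module M ==> is_module N ==> x \<in> carrier M ==> y \<in> carrier M ==>
   phi (op M x y) = op N (phi x) (phi y)"
  and sum: "!!M (f :: 'j list => 'v) g. is_module M ==> faces_in xs f (carrier M) ==> faces_in xs g (carrier M) ==>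
   altsum M (%ys. op M (f ys) (g ys)) xs = op M (altsum M f xs) (altsum M g xs)"
 shows "cdiff F W U (%ys. op (sections F (cop W U ys)) (c ys) (c' ys)) xs =
  op (sections F (cop W U xs)) (cdiff F W U c xs) (cdiff F W U c' xs)"
 unfolding cdiff_def sum[OF psh_mod[OF F open_cop[OF xs(2)]] chain_faces[OF F c(1) xs] chain_faces[OF F c(2) xs], symmetric]
proof (rule altsum_cong)
 fix ys assume "Suc (length ys) = length xs" "set ys <= set xs"
 then have ys: "length ys = p" "set ys <= J" "cop W U xs <= cop W U ys" using xs cop_mono[of ys xs W U] by auto
 show "restr F (cop W U ys) (cop W U xs) (op (sections F (cop W U ys)) (c ys) (c' ys)) =
   op (sections F (cop W U xs)) (restr F (cop W U ys) (cop W U xs) (c ys)) (restr F (cop W U ys) (cop W U xs) (c' ys))"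
  by (intro hom psh_restr_hom[OF F] psh_mod[OF F] open_cop xs(2) ys chainD[OF c(1)] chainD[OF c(2)])
qed

context
 fixes F p c c' and xs :: "'j list"
 assumes c: "presheaf X F" "chain F W U J p c" "chain F W U J p c'" "length xs = Suc p" "set xs <= J"
begin

lemma cdiff_diff: "cdiff F W U (%ys. c ys -[sections F (cop W U ys)] c' ys) xs =
  cdiff F W U c xs -[sections F (cop W U xs)] cdiff F W U c' xs"
 by (rule cdiff_op[OF c, where op = a_minus]) (rule linear_hom_diff altsum_diff; assumption)+

lemma cdiff_add: "cdiff F W U (%ys. c ys +[sections F (cop W U ys)] c' ys) xs =
  cdiff F W U c xs +[sections F (cop W U xs)] cdiff F W U c' xs"
 by (rule cdiff_op[OF c, where op = "%M x y. x +[M] y"]) (rule linear_homD altsum_add; assumption)+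

end

lemma cdiff_smult:
 assumes "presheaf X F" "chain F W U J p c" "length xs = Suc p" "set xs <= J"
 shows "cdiff F W U (%ys. a *[sections F (cop W U ys)] c ys) xs = a *[sections F (cop W U xs)] cdiff F W U c xs"
 by (rule cdiff_op[OF assms(1,2,2-), where op = "%M x y. a *[M] x"]) (rule linear_homD altsum_smult; assumption)+

lemma cdiff_cong:
 assumes "!!ys. Suc (length ys) = length xs ==> set ys <= set xs ==> c ys = c' ys"
 shows "cdiff F W U c xs = cdiff F W U c' xs"
 unfolding cdiff_def by (rule altsum_cong) (simp add: assms)

lemma cdiff_hom_eq:
 assumes "presheaf X F" "presheaf X G" "sheaf_hom X F G phi" "chain F W U J p c" and xs: "length xs = Suc p" "set xs <= J"
  and eq: "!!ys. length ys = p ==> set ys <= J ==> phi (cop W U ys) (c ys) = c' ys"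
 shows "phi (cop W U xs) (cdiff F W U c xs) = cdiff G W U c' xs"
 unfolding cdiff_hom[OF assms(1-6)] by (rule cdiff_cong) (use xs eq in auto)

lemma cdiff_singleton:
 assumes F: "presheaf X F" and s: "s \<in> Sec F W" and xs: "length xs = Suc 0" "set xs <= J"
 shows "cdiff F W U (%_. s) xs = restr F W (cop W U xs) s"
proof -
 obtain j where j: "xs = [j]" using xs(1) by (auto simp: length_Suc_conv)
 have o: "openin X (cop W U [j])" using open_cop[OF xs(2)] j by simp
 show ?thesis
  using module_diff_zero[OF psh_mod[OF F o] psh_restr_closed[OF F open_W o _ s]]
  by (simp add: cdiff_def j) (simp add: cop_def)
qed

text \<open>If \<open>W\<close> lies in \<open>U j\<close>, putting \<open>j\<close> in front of a
  list does not change the intersection. The cocycle condition at \<open>j # xs\<close> then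
  expresses \<open>c xs\<close> by the values at lists that start with \<open>j\<close>.\<close>

lemma contraction:
 assumes F: "presheaf X F" and c: "cocycle F W U J p c" and j: "j \<in> J" "W <= U j"
  and xs: "length xs = p" "set xs <= J"
 shows "c xs = cdiff F W U (%ys. c (j # ys)) xs"
proof -
 have cop: "cop W U (j # ys) = cop W U ys" for ys using j(2) by (auto simp: cop_def)
 let ?M = "sections F (cop W U xs)"
 have ch: "chain F W U J p c" using c by (simp add: cocycle_def)
 have M: "is_module ?M" by (rule psh_mod[OF F open_cop[OF xs(2)]])
 have js: "length (j # xs) = Suc p" "set (j # xs) <= J" using xs j by auto
 have "cdiff F W U c (j # xs) = restr F (cop W U xs) (cop W U xs) (c xs) -[?M]
   altsum ?M (%ys. restr F (cop W U (j # ys)) (cop W U xs) (c (j # ys))) xs"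
  by (simp add: cdiff_def cop)
 also have "... = c xs -[?M] cdiff F W U (%ys. c (j # ys)) xs"
  by (simp add: cdiff_def cop psh_restr_self[OF F open_cop[OF xs(2)] chainD[OF ch xs]])
 finally have "c xs -[?M] cdiff F W U (%ys. c (j # ys)) xs = 0[?M]"
  using c js cop[of xs] unfolding cocycle_def by metis
 moreover have "cdiff F W U (%ys. c (j # ys)) xs \<in> carrier ?M"
 proof (cases p)
  case 0
  then show ?thesis using xs module_facts(2)[OF M] by (simp add: cdiff_def)
 next
  case (Suc q)
  have "chain F W U J q (%ys. c (j # ys))"
   unfolding chain_def
  proof (intro allI impI)
   fix ys assume "length ys = q & set ys <= J"
   then have "c (j # ys) \<in> Sec F (cop W U (j # ys))"
    using j Suc by (intro chainD[OF ch]) auto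
   then show "c (j # ys) \<in> Sec F (cop W U ys)" by (simp only: cop)
  qed
  then have "chain F W U J (Suc q) (cdiff F W U (%ys. c (j # ys)))" by (rule chain_cdiff[OF F])
  then show ?thesis using xs Suc by (simp add: chainD)
 qed
 ultimately show ?thesis using module_diff_eq_0[OF M chainD[OF ch xs]] by blast
qed

end

lemma sheaf_empty: "sheaf X F ==> a \<in> Sec F {} ==> b \<in> Sec F {} ==> a = b"
 using sheaf_locality[of X F "{}" "%_. {}" "{}" a b] by simp

definition rchain :: "('p, 'k::field, 'v) sheaf_data => 'p set => 'p set => ('j => 'p set) => ('j list => 'v) => 'j list => 'v"
 where "rchain F W W' U c xs = restr F (cop W U xs) (cop W' U xs) (c xs)"

context cech
begin

lemma chain_rchain:
 assumes F: "presheaf X F" and c: "chain F W U J p c" and W': "openin X W'" "W' <= W"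
 shows "chain F W' U J p (rchain F W W' U c)"
proof -
 interpret W': cech X W' U J by unfold_locales (use W' open_U in auto)
 show ?thesis
  unfolding chain_def rchain_def
  by (intro allI impI psh_restr_closed[OF F] open_cop W'.open_cop cop_mono2 W'(2) chainD[OF c]) auto
qed

lemma cdiff_rchain:
 assumes F: "presheaf X F" and c: "chain F W U J p c" and W': "openin X W'" "W' <= W"
  and xs: "length xs = Suc p" "set xs <= J"
 shows "cdiff F W' U (rchain F W W' U c) xs = rchain F W W' U (cdiff F W U c) xs"
proof -
 interpret W': cech X W' U J by unfold_locales (use W' open_U in auto)
 note o = open_cop[OF xs(2)] and o' = W'.open_cop[OF xs(2)] and sub = cop_mono2[OF W'(2), of U xs]
 have "rchain F W W' U (cdiff F W U c) xs = altsum (sections F (cop W' U xs))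
   (%ys. restr F (cop W U xs) (cop W' U xs) (restr F (cop W U ys) (cop W U xs) (c ys))) xs"
  unfolding rchain_def cdiff_def
  by (intro altsum_hom[OF psh_restr_hom[OF F o o' sub] psh_mod[OF F o] psh_mod[OF F o']]
    chain_faces[OF F c xs])
 also have "... = cdiff F W' U (rchain F W W' U c) xs"
  unfolding cdiff_def rchain_def
 proof (rule altsum_cong)
  fix ys assume ys: "Suc (length ys) = length xs" "set ys <= set xs"
  have ysJ: "set ys <= J" and len: "length ys = p" using ys xs by auto
  note oo = open_cop[OF ysJ] W'.open_cop[OF ysJ]
  note ss = cop_mono[OF ys(2), of W U] cop_mono[OF ys(2), of W' U] cop_mono2[OF W'(2), of U ys]
  show "restr F (cop W U xs) (cop W' U xs) (restr F (cop W U ys) (cop W U xs) (c ys)) =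
    restr F (cop W' U ys) (cop W' U xs) (restr F (cop W U ys) (cop W' U ys) (c ys))"
   using psh_restr_restr[OF F oo(1) o o' sub ss(1) chainD[OF c len ysJ]]
    psh_restr_restr[OF F oo(1) oo(2) o' ss(2) ss(3) chainD[OF c len ysJ]] by simp
 qed
 finally show ?thesis ..
qed

lemma cocycle_rchain:
 assumes F: "presheaf X F" and c: "cocycle F W U J p c" and W': "openin X W'" "W' <= W"
 shows "cocycle F W' U J p (rchain F W W' U c)"
proof -
 interpret W': cech X W' U J by unfold_locales (use W' open_U in auto)
 have ch: "chain F W U J p c" using c by (simp add: cocycle_def)
 show ?thesis
  unfolding cocycle_def
 proof (intro conjI allI impI chain_rchain[OF F ch W'])
  fix xs assume xs: "length xs = Suc p & set xs <= J"
  have s: "length xs = Suc p" "set xs <= J" using xs by auto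
  have "cdiff F W U c xs = 0[sections F (cop W U xs)]" using c xs by (simp add: cocycle_def)
  then show "cdiff F W' U (rchain F W W' U c) xs = 0[sections F (cop W' U xs)]"
   unfolding cdiff_rchain[OF F ch W' s] rchain_def
   using linear_hom_zero[OF psh_restr_hom[OF F open_cop[OF s(2)] W'.open_cop[OF s(2)] cop_mono2[OF W'(2)]]]
    psh_mod[OF F open_cop[OF s(2)]] psh_mod[OF F W'.open_cop[OF s(2)]] by simp
 qed
qed

lemma rchain_rchain:
 assumes F: "presheaf X F" and c: "chain F W U J p c" and W': "openin X W'" "W' <= W" "openin X W''" "W'' <= W'"
  and xs: "length xs = p" "set xs <= J"
 shows "rchain F W' W'' U (rchain F W W' U c) xs = rchain F W W'' U c xs"
proof -
 interpret W': cech X W' U J by unfold_locales (use W' open_U in auto)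
 interpret W'': cech X W'' U J by unfold_locales (use W' open_U in auto)
 show ?thesis
  unfolding rchain_def
  by (intro psh_restr_restr[OF F] open_cop W'.open_cop W''.open_cop xs cop_mono2 W' chainD[OF c])
qed

text \<open>Inside one member of the cover the cocycle \<open>u\<close> is the differential of the
  cochain with values \<open>u (k # ys)\<close>. These sections extend because the sheaf is flasque,
  and the differential of the extension is the required cocycle.\<close>

lemma extend_cocycle:
 assumes F: "flasque X F" and W': "openin X W'" "W' <= W" and u: "cocycle F W' U J p u"
  and k: "k \<in> J" "W <= U k"
 obtains v where "cocycle F W U J p v" "!!xs. length xs = p ==> set xs <= J ==> rchain F W W' U v xs = u xs"
proof -
 interpret W': cech X W' U J by unfold_locales (use W' open_U in auto)
 have S: "sheaf X F" using F by (rule flasque_sheaf)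
 then have P: "presheaf X F" by (rule sheaf_presheaf)
 have uch: "chain F W' U J p u" using u by (simp add: cocycle_def)
 have kW': "W' <= U k" using k W' by blast
 have con: "u xs = cdiff F W' U (%ys. u (k # ys)) xs" if "length xs = p" "set xs <= J" for xs
  using W'.contraction[OF P u k(1) kW' that] .
 have cop: "cop W' U (k # ys) = cop W' U ys" for ys using kW' by (auto simp: cop_def)
 have ex: "\<exists>t. t \<in> Sec F (cop W U ys) & (Suc (length ys) = p --> restr F (cop W U ys) (cop W' U ys) t = u (k # ys))"
  if "set ys <= J" for ys
 proof (cases "Suc (length ys) = p")
  case True
  have "u (k # ys) \<in> Sec F (cop W' U (k # ys))"
   by (rule W'.chainD[OF uch]) (use True that k in auto)
  then have "u (k # ys) \<in> Sec F (cop W' U ys)" by (simp only: cop)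
  then show ?thesis
   using flasque_extend[OF F open_cop[OF that] W'.open_cop[OF that] cop_mono2[OF W'(2)]] by metis
 next
  case False
  then show ?thesis using module_facts(2)[OF psh_mod[OF P open_cop[OF that]]] by blast
 qed
 define f where "f ys = (SOME t. t \<in> Sec F (cop W U ys) &
  (Suc (length ys) = p --> restr F (cop W U ys) (cop W' U ys) t = u (k # ys)))" for ys
 have f: "f ys \<in> Sec F (cop W U ys)" "Suc (length ys) = p ==> restr F (cop W U ys) (cop W' U ys) (f ys) = u (k # ys)"
  if "set ys <= J" for ys
  using someI_ex[OF ex[OF that]] unfolding f_def by auto
 have fch: "chain F W U J q f" for q unfolding chain_def using f(1) by blast
 let ?v = "cdiff F W U f"
 have r: "rchain F W W' U ?v xs = u xs" if xs: "length xs = p" "set xs <= J" for xs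
 proof (cases p)
  case 0
  have "restr F W W' 0[sections F W] = 0[sections F W']"
   by (rule linear_hom_zero[OF psh_restr_hom[OF P open_W W'] psh_mod[OF P open_W] psh_mod[OF P W'(1)]])
  then show ?thesis using con[OF xs] xs 0 by (simp add: cdiff_def rchain_def)
 next
  case (Suc q)
  have "rchain F W W' U ?v xs = cdiff F W' U (rchain F W W' U f) xs"
   using cdiff_rchain[OF P fch W', of xs q] xs Suc by simp
  also have "... = cdiff F W' U (%ys. u (k # ys)) xs"
   by (rule W'.cdiff_cong) (use xs f(2) in \<open>auto simp: rchain_def\<close>)
  also have "... = u xs" using con[OF xs] ..
  finally show ?thesis .
 qed
 have "cocycle F W U J p ?v"
 proof (cases p)
  case 0
  have z: "?v [] = 0[sections F W]" by (simp add: cdiff_def)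
  have "cdiff F W U ?v [j] = 0[sections F (cop W U [j])]" if "j \<in> J" for j
  proof -
   have o: "openin X (cop W U [j])" using that by (intro open_cop) auto
   note M = psh_mod[OF P o]
   have "restr F W (cop W U [j]) 0[sections F W] = 0[sections F (cop W U [j])]"
    by (rule linear_hom_zero[OF psh_restr_hom[OF P open_W o] psh_mod[OF P open_W] M])
      (auto simp: cop_def)
   then show ?thesis using module_diff_self[OF M module_facts(2)[OF M]] z by (simp add: cdiff_def[of F W U ?v])
  qed
  then show ?thesis
   unfolding cocycle_def chain_def 0 using z module_facts(2)[OF psh_mod[OF P open_W]]
   by (auto simp: length_Suc_conv)
 qed (simp only: cocycle_cdiff[OF P fch])
 then show thesis using r by (rule that)
qed

text \<open>The base set grows by one member of the cover at a time while the cover itself is kept.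
  On the new piece the cocycle bounds by \<open>contraction\<close>; the two bounding cochains
  differ on the overlap by a cocycle, which extends by \<open>extend_cocycle\<close>, and after this
  correction they glue.\<close>

theorem flasque_acyclic:
 assumes F: "flasque X F" and fin: "finite J" and cover: "W <= (\<Union>j\<in>J. U j)"
  and c: "cocycle F W U J (Suc p) c"
 shows "\<exists>g. is_cdiff F W U J p g c"
proof -
 have S: "sheaf X F" using F by (rule flasque_sheaf)
 then have P: "presheaf X F" by (rule sheaf_presheaf)
 have cch: "chain F W U J (Suc p) c" using c by (simp add: cocycle_def)
 have "\<exists>g. is_cdiff F (W \<inter> (\<Union>j\<in>K. U j)) U J p g (rchain F W (W \<inter> (\<Union>j\<in>K. U j)) U c)" if "K <= J" for K
  using finite_subset[OF that fin] that
 proof (induction K rule: finite_induct)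
  \<comment> \<open>Over the empty set any two sections are equal, so every cochain bounds.\<close>
  case empty
  interpret V: cech X "{}" U J by unfold_locales (use open_U in auto)
  let ?g = "%xs::'j list. 0[sections F {}]"
  have cop: "cop {} U xs = {}" for xs :: "'j list" by (simp add: cop_def)
  have g: "chain F {} U J p ?g"
   unfolding chain_def cop using module_facts(2)[OF psh_mod[OF P openin_empty]] by blast
  have "cdiff F {} U ?g xs = rchain F W {} U c xs" if s: "length xs = Suc p" "set xs <= J" for xs
  proof (rule sheaf_empty[OF S])
   show "cdiff F {} U ?g xs \<in> Sec F {}"
    using V.chainD[OF V.chain_cdiff[OF P g] s] by (simp only: cop)
   show "rchain F W {} U c xs \<in> Sec F {}"
    using V.chainD[OF chain_rchain[OF P cch openin_empty empty_subsetI] s] by (simp only: cop)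
  qed
  then have "is_cdiff F {} U J p ?g (rchain F W {} U c)" using g unfolding is_cdiff_def by blast
  then show ?case by auto
 next
  case (insert k K)
  define V1 where "V1 = W \<inter> (\<Union>j\<in>K. U j)"
  define V2 where "V2 = W \<inter> U k"
  define V12 where "V12 = V1 \<inter> V2"
  define V where "V = W \<inter> (\<Union>j\<in>insert k K. U j)"
  have kJ: "k \<in> J" "K <= J" using insert.prems by auto
  have o: "openin X V1" "openin X V2" "openin X V12" "openin X V"
   unfolding V1_def V2_def V12_def V_def using open_W open_U kJ by (auto intro!: openin_Int openin_Union)
  have sub: "V1 <= W" "V2 <= W" "V12 <= V1" "V12 <= V2" "V12 <= W" "V1 <= V" "V2 <= V" "V <= W"
   unfolding V1_def V2_def V12_def V_def by auto
  interpret V1: cech X V1 U J by unfold_locales (use o open_U in auto)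
  interpret V2: cech X V2 U J by unfold_locales (use o open_U in auto)
  interpret V12: cech X V12 U J by unfold_locales (use o open_U in auto)
  interpret V: cech X V U J by unfold_locales (use o open_U in auto)
  obtain g1 where g1: "chain F V1 U J p g1"
   "!!xs. length xs = Suc p ==> set xs <= J ==> cdiff F V1 U g1 xs = rchain F W V1 U c xs"
   using insert.IH[OF kJ(2)] unfolding is_cdiff_def V1_def by metis
  have c2: "cocycle F V2 U J (Suc p) (rchain F W V2 U c)" by (rule cocycle_rchain[OF P c o(2) sub(2)])
  then have c2ch: "chain F V2 U J (Suc p) (rchain F W V2 U c)" by (simp add: cocycle_def)
  have kV2: "V2 <= U k" by (auto simp: V2_def)
  define g2 where "g2 = (%ys. rchain F W V2 U c (k # ys))"
  have cop2: "cop V2 U (k # ys) = cop V2 U ys" for ys using kV2 by (auto simp: cop_def)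
  have g2: "chain F V2 U J p g2"
   unfolding chain_def g2_def
  proof (intro allI impI)
   fix ys assume "length ys = p & set ys <= J"
   then have "rchain F W V2 U c (k # ys) \<in> Sec F (cop V2 U (k # ys))"
    using kJ by (intro V2.chainD[OF c2ch]) auto
   then show "rchain F W V2 U c (k # ys) \<in> Sec F (cop V2 U ys)" by (simp only: cop2)
  qed
  have dg2: "cdiff F V2 U g2 xs = rchain F W V2 U c xs" if "length xs = Suc p" "set xs <= J" for xs
   using V2.contraction[OF P c2 kJ(1) kV2 that] by (simp add: g2_def)
  let ?r1 = "rchain F V1 V12 U g1" and ?r2 = "rchain F V2 V12 U g2"
  have r: "chain F V12 U J p ?r1" "chain F V12 U J p ?r2"
   by (rule V1.chain_rchain[OF P g1(1) o(3) sub(3)] V2.chain_rchain[OF P g2 o(3) sub(4)])+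
  define u where "u = (%ys. ?r1 ys -[sections F (cop V12 U ys)] ?r2 ys)"
  have uch: "chain F V12 U J p u" unfolding u_def by (rule V12.chain_diff[OF P r])
  have u: "cocycle F V12 U J p u"
   unfolding cocycle_def
  proof (intro conjI allI impI uch)
   fix xs assume "length xs = Suc p & set xs <= J"
   then have s: "length xs = Suc p" "set xs <= J" by auto
   have cong: "rchain F A B U x xs = rchain F A B U y xs" if "x xs = y xs" for A B x y
    using that by (simp add: rchain_def)
   have "cdiff F V12 U ?r1 xs = rchain F V1 V12 U (rchain F W V1 U c) xs"
    unfolding V1.cdiff_rchain[OF P g1(1) o(3) sub(3) s] by (rule cong) (rule g1(2)[OF s])
   also have "... = rchain F V2 V12 U (rchain F W V2 U c) xs"
    unfolding rchain_rchain[OF P cch o(1) sub(1) o(3) sub(3) s] rchain_rchain[OF P cch o(2) sub(2) o(3) sub(4) s] ..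
   also have "... = cdiff F V12 U ?r2 xs"
    unfolding V2.cdiff_rchain[OF P g2 o(3) sub(4) s] by (rule cong) (rule dg2[OF s, symmetric])
   finally have "cdiff F V12 U ?r1 xs = cdiff F V12 U ?r2 xs" .
   then show "cdiff F V12 U u xs = 0[sections F (cop V12 U xs)]"
    unfolding u_def V12.cdiff_diff[OF P r s]
    using module_diff_self[OF psh_mod[OF P V12.open_cop[OF s(2)]] V12.chainD[OF V12.chain_cdiff[OF P r(2)] s]]
    by simp
  qed
  obtain v where v: "cocycle F V2 U J p v"
   "!!xs. length xs = p ==> set xs <= J ==> rchain F V2 V12 U v xs = u xs"
   using V2.extend_cocycle[OF F o(3) sub(4) u kJ(1) kV2] by blast
  have vch: "chain F V2 U J p v" using v(1) by (simp add: cocycle_def)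
  \<comment> \<open>Adding the extended cocycle makes the cochain agree with \<open>g1\<close> on
    the overlap and leaves its differential unchanged.\<close>
  define g3 where "g3 = (%ys. g2 ys +[sections F (cop V2 U ys)] v ys)"
  have g3: "chain F V2 U J p g3" unfolding g3_def by (rule V2.chain_add[OF P g2 vch])
  have dg3: "cdiff F V2 U g3 xs = rchain F W V2 U c xs" if s: "length xs = Suc p" "set xs <= J" for xs
  proof -
   have M: "is_module (sections F (cop V2 U xs))" by (rule psh_mod[OF P V2.open_cop[OF s(2)]])
   have "cdiff F V2 U v xs = 0[sections F (cop V2 U xs)]" using v(1) s by (simp add: cocycle_def)
   then show ?thesis
    unfolding g3_def V2.cdiff_add[OF P g2 vch s] dg2[OF s]
    using module_facts(5,6)[OF M] module_facts(2)[OF M] V2.chainD[OF c2ch s] by metis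
  qed
  have agree: "rchain F V2 V12 U g3 xs = rchain F V1 V12 U g1 xs" if s: "length xs = p" "set xs <= J" for xs
  proof -
   let ?M = "sections F (cop V12 U xs)"
   have M: "is_module ?M" by (rule psh_mod[OF P V12.open_cop[OF s(2)]])
   have "rchain F V2 V12 U g3 xs = ?r2 xs +[?M] rchain F V2 V12 U v xs"
    unfolding rchain_def g3_def
    by (intro linear_homD(2)[OF psh_restr_hom[OF P]] V2.open_cop V12.open_cop s cop_mono2 sub
      V2.chainD[OF g2] V2.chainD[OF vch])
   also have "... = ?r2 xs +[?M] (?r1 xs -[?M] ?r2 xs)"
    using v(2)[OF s] by (simp add: u_def)
   also have "... = ?r1 xs"
    using module_diff_add_cancel[OF M V12.chainD[OF r(1) s] V12.chainD[OF r(2) s]]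
     module_facts(5)[OF M V12.chainD[OF r(2) s] module_diff_closed[OF M V12.chainD[OF r(1) s] V12.chainD[OF r(2) s]]]
    by simp
   finally show ?thesis .
  qed
  have "\<exists>a. a \<in> Sec F (cop V U xs) & restr F (cop V U xs) (cop V1 U xs) a = g1 xs &
   restr F (cop V U xs) (cop V2 U xs) a = g3 xs" if s: "length xs = p" "set xs <= J" for xs
  proof -
   let ?D = "%b. if b then cop V1 U xs else cop V2 U xs" and ?s = "%b. if b then g1 xs else g3 xs"
   have int: "cop V1 U xs \<inter> cop V2 U xs = cop V12 U xs" "cop V2 U xs \<inter> cop V1 U xs = cop V12 U xs"
    by (auto simp: cop_def V12_def)
   have un: "cop V U xs = (\<Union>b\<in>(UNIV :: bool set). ?D b)"
    by (auto simp: cop_def V_def V1_def V2_def UNIV_bool)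
   obtain a where a: "a \<in> Sec F (cop V U xs)"
     "!!b. b \<in> UNIV ==> restr F (cop V U xs) (?D b) a = ?s b"
   proof (rule sheaf_glue[OF S _ _ _ un, of ?s])
    show "openin X (?D b)" for b using V1.open_cop[OF s(2)] V2.open_cop[OF s(2)] by simp
    show "?s b \<in> Sec F (?D b)" for b using V1.chainD[OF g1(1) s] V2.chainD[OF g3 s] by simp
    show "restr F (?D b) (?D b \<inter> ?D b') (?s b) = restr F (?D b') (?D b \<inter> ?D b') (?s b')" for b b'
     using agree[OF s] by (cases b; cases b') (simp_all add: int rchain_def)
   qed (rule that)
   then show ?thesis using a(2)[of True] a(2)[of False] by auto
  qed
  then obtain g where g: "!!xs. length xs = p ==> set xs <= J ==> g xs \<in> Sec F (cop V U xs) &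
   restr F (cop V U xs) (cop V1 U xs) (g xs) = g1 xs & restr F (cop V U xs) (cop V2 U xs) (g xs) = g3 xs"
   by metis
  have gch: "chain F V U J p g" unfolding chain_def using g by blast
  have "cdiff F V U g xs = rchain F W V U c xs" if s: "length xs = Suc p" "set xs <= J" for xs
  proof -
   let ?D = "%b. if b then cop V1 U xs else cop V2 U xs"
   have un: "cop V U xs = (\<Union>b\<in>(UNIV :: bool set). ?D b)"
    by (auto simp: cop_def V_def V1_def V2_def UNIV_bool)
   have r: "restr F (cop V U xs) (cop A U xs) (cdiff F V U g xs) = restr F (cop V U xs) (cop A U xs) (rchain F W V U c xs)"
    if A: "openin X A" "A <= V" and h: "!!ys. length ys = p ==> set ys <= J ==> restr F (cop V U ys) (cop A U ys) (g ys) = h ys"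
     "cdiff F A U h xs = rchain F W A U c xs" for A h
   proof -
    interpret A: cech X A U J by unfold_locales (use A open_U in auto)
    have "restr F (cop V U xs) (cop A U xs) (cdiff F V U g xs) = cdiff F A U (rchain F V A U g) xs"
     using V.cdiff_rchain[OF P gch A s] by (simp add: rchain_def)
    also have "... = cdiff F A U h xs"
     by (rule A.cdiff_cong) (use h s in \<open>auto simp: rchain_def\<close>)
    also have "... = rchain F V A U (rchain F W V U c) xs"
     unfolding h(2) rchain_rchain[OF P cch o(4) sub(8) A s] ..
    finally show ?thesis by (simp add: rchain_def)
   qed
   show ?thesis
   proof (rule sheaf_locality[OF S _ un])
    show "openin X (?D b)" for b using V1.open_cop[OF s(2)] V2.open_cop[OF s(2)] by simp
    show "cdiff F V U g xs \<in> Sec F (cop V U xs)" by (rule V.chainD[OF V.chain_cdiff[OF P gch] s])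
    show "rchain F W V U c xs \<in> Sec F (cop V U xs)"
     by (rule V.chainD[OF chain_rchain[OF P cch o(4) sub(8)] s])
    show "restr F (cop V U xs) (?D b) (cdiff F V U g xs) = restr F (cop V U xs) (?D b) (rchain F W V U c xs)" for b
     using r[OF o(1) sub(6) _ g1(2)[OF s]] r[OF o(2) sub(7) _ dg3[OF s]] g by simp
   qed
  qed
  then show ?case using gch unfolding is_cdiff_def V_def by blast
 qed
 from this[of J] obtain g where g: "is_cdiff F W U J p g (rchain F W W U c)"
  using cover by (auto simp: inf_absorb1)
 have "rchain F W W U c xs = c xs" if "length xs = Suc p" "set xs <= J" for xs
  unfolding rchain_def by (rule psh_restr_self[OF P open_cop[OF that(2)] chainD[OF cch that]])
 then show ?thesis using g unfolding is_cdiff_def by auto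
qed

lemma glue_cocycle:
 assumes S: "sheaf X F" and cover: "W <= (\<Union>j\<in>J. U j)" and c: "cocycle F W U J (Suc 0) c"
 obtains a where "a \<in> Sec F W" "!!j. j \<in> J ==> restr F W (cop W U [j]) a = c [j]"
proof -
 have P: "presheaf X F" using S by (rule sheaf_presheaf)
 have cch: "chain F W U J (Suc 0) c" using c by (simp add: cocycle_def)
 have cj: "c [j] \<in> Sec F (cop W U [j])" "openin X (cop W U [j])" if "j \<in> J" for j
  using chainD[OF cch, of "[j]"] open_cop[of "[j]"] that by auto
 have un: "W = (\<Union>j\<in>J. cop W U [j])" using cover by (auto simp: cop_def)
 have agree: "restr F (cop W U [i]) (cop W U [i] \<inter> cop W U [j]) (c [i]) =
   restr F (cop W U [j]) (cop W U [i] \<inter> cop W U [j]) (c [j])" if ij: "i \<in> J" "j \<in> J" for i j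
 proof -
  have int: "cop W U [i] \<inter> cop W U [j] = cop W U [i, j]" by (auto simp: cop_def)
  let ?M = "sections F (cop W U [i, j])"
  have o: "openin X (cop W U [i, j])" using ij by (intro open_cop) auto
  have M: "is_module ?M" by (rule psh_mod[OF P o])
  have mem: "restr F (cop W U [i]) (cop W U [i, j]) (c [i]) \<in> carrier ?M"
    "restr F (cop W U [j]) (cop W U [i, j]) (c [j]) \<in> carrier ?M"
   using ij by (auto intro!: psh_restr_closed[OF P] cj o) (auto simp: cop_def)
  have "cdiff F W U c [i, j] = 0[?M]" using c ij by (simp add: cocycle_def)
  then have "restr F (cop W U [j]) (cop W U [i, j]) (c [j]) -[?M]
    (restr F (cop W U [i]) (cop W U [i, j]) (c [i]) -[?M] 0[?M]) = 0[?M]"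
   by (simp add: cdiff_def)
  then show ?thesis
   unfolding int module_diff_zero[OF M mem(1)] module_diff_eq_0[OF M mem(2,1)] by simp
 qed
 show thesis
 proof (rule sheaf_glue[OF S cj(2) cj(1) agree un])
 qed (use that in auto)
qed

end

section \<open>Short exact sequences with flasque middle term and the connecting relation\<close>

locale sheaf_ses =
 fixes X :: "'p topology" and A :: "('p, 'k::field, 'u) sheaf_data" and phi :: "'p set => 'u => 'v"
  and B :: "('p, 'k, 'v) sheaf_data" and psi :: "'p set => 'v => 'w" and C :: "('p, 'k, 'w) sheaf_data"
 assumes A: "sheaf X A" and B: "flasque X B" and C: "sheaf X C"
  and phi: "sheaf_hom X A B phi" and psi: "sheaf_hom X B C psi"
  and inj: "!!V. openin X V ==> inj_on (phi V) (Sec A V)"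
  and exact: "!!V s. openin X V ==> s \<in> Sec B V ==> psi V s = 0[sections C V] \<longleftrightarrow> s \<in> phi V ` Sec A V"
  and locally_onto: "!!V s x. openin X V ==> s \<in> Sec C V ==> x \<in> V ==>
   \<exists>V'. openin X V' & x \<in> V' & V' <= V & (\<exists>t\<in>Sec B V'. psi V' t = restr C V V' s)"
begin

lemma PA: "presheaf X A" using A by (rule sheaf_presheaf)
lemma SB: "sheaf X B" using B by (rule flasque_sheaf)
lemma PB: "presheaf X B" using SB by (rule sheaf_presheaf)
lemma PC: "presheaf X C" using C by (rule sheaf_presheaf)

lemma homphi: "openin X V ==> linear_hom (sections A V) (sections B V) (phi V)"
 using phi by (simp add: sheaf_hom_def)

lemma hompsi: "openin X V ==> linear_hom (sections B V) (sections C V) (psi V)"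
 using psi by (simp add: sheaf_hom_def)

lemma psiphi: "openin X V ==> a \<in> Sec A V ==> psi V (phi V a) = 0[sections C V]"
 using exact[of V "phi V a"] linear_homD(1)[OF homphi] by blast

lemma phi_eq: "openin X V ==> a \<in> Sec A V ==> a' \<in> Sec A V ==> phi V a = phi V a' ==> a = a'"
 using inj by (meson inj_onD)

end

locale ses_cech = sheaf_ses X A phi B psi C + cech X W U J
 for X :: "'p topology" and A :: "('p, 'k::field, 'u) sheaf_data" and phi :: "'p set => 'u => 'v"
  and B :: "('p, 'k, 'v) sheaf_data" and psi :: "'p set => 'v => 'w" and C :: "('p, 'k, 'w) sheaf_data"
  and W :: "'p set" and U :: "'j => 'p set" and J :: "'j set" +
 assumes finite_J: "finite J" and cover: "W <= (\<Union>j\<in>J. U j)"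
begin

text \<open>The connecting homomorphism of the snake lemma as a relation: \<open>b\<close> lifts
  \<open>c\<close>, and \<open>a\<close> is the preimage of the differential of \<open>b\<close>.
  Different choices of \<open>b\<close> change \<open>a\<close> by a coboundary.\<close>

definition connects :: "nat => ('j list => 'w) => ('j list => 'u) => bool"
 where "connects p c a \<longleftrightarrow> (\<exists>b. chain B W U J (Suc p) b &
  (\<forall>xs. length xs = Suc p & set xs <= J --> psi (cop W U xs) (b xs) = c xs) &
  (\<forall>xs. length xs = Suc (Suc p) & set xs <= J --> phi (cop W U xs) (a xs) = cdiff B W U b xs))"

text \<open>Coboundaries of those cochains that lift to \<open>B\<close>. They are compared with all
  coboundaries only in \<open>coboundary_lift_iff\<close>, because for \<open>p = 0\<close> the
  cochain is a section over \<open>W\<close>, where \<open>psi\<close> may fail to be onto.\<close>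

abbreviation lifts :: "nat => ('j list => 'w) => bool"
 where "lifts p c \<equiv> \<exists>g. chain B W U J p g &
  (\<forall>xs. length xs = Suc p & set xs <= J --> psi (cop W U xs) (cdiff B W U g xs) = c xs)"

lemma chain_lift:
 assumes "!!xs. length xs = p ==> set xs <= J ==> c xs \<in> psi (cop W U xs) ` Sec B (cop W U xs)"
 obtains b where "chain B W U J p b" "!!xs. length xs = p ==> set xs <= J ==> psi (cop W U xs) (b xs) = c xs"
proof -
 have "\<exists>t. t \<in> Sec B (cop W U xs) & psi (cop W U xs) t = c xs" if "length xs = p" "set xs <= J" for xs
  using assms[OF that] by auto
 then obtain b where "!!xs. length xs = p ==> set xs <= J ==> b xs \<in> Sec B (cop W U xs) & psi (cop W U xs) (b xs) = c xs"
  by metis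
 then show thesis using that[of b] by (auto simp: chain_def)
qed

lemma chain_kernel:
 assumes b: "chain B W U J p b" and 0: "!!xs. length xs = p ==> set xs <= J ==> psi (cop W U xs) (b xs) = 0[sections C (cop W U xs)]"
 obtains a where "chain A W U J p a" "!!xs. length xs = p ==> set xs <= J ==> phi (cop W U xs) (a xs) = b xs"
proof -
 have "\<exists>a. a \<in> Sec A (cop W U xs) & phi (cop W U xs) a = b xs" if "length xs = p" "set xs <= J" for xs
  using exact[OF open_cop[OF that(2)] chainD[OF b that]] 0[OF that] by auto
 then obtain a where "!!xs. length xs = p ==> set xs <= J ==> a xs \<in> Sec A (cop W U xs) & phi (cop W U xs) (a xs) = b xs"
  by metis
 then show thesis using that[of a] by (auto simp: chain_def)
qed

lemma cocycle_of_image: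
 assumes a: "chain A W U J p a" and b: "cocycle B W U J p b"
  and ab: "!!xs. length xs = p ==> set xs <= J ==> phi (cop W U xs) (a xs) = b xs"
 shows "cocycle A W U J p a"
 unfolding cocycle_def
proof (intro conjI allI impI a)
 fix xs assume "length xs = Suc p & set xs <= J"
 then have s: "length xs = Suc p" "set xs <= J" by auto
 note o = open_cop[OF s(2)]
 have "phi (cop W U xs) (cdiff A W U a xs) = cdiff B W U b xs" by (rule cdiff_hom_eq[OF PA PB phi a s ab])
 also have "... = 0[sections B (cop W U xs)]" using b s by (simp add: cocycle_def)
 also have "... = phi (cop W U xs) 0[sections A (cop W U xs)]"
  using linear_hom_zero[OF homphi[OF o] psh_mod[OF PA o] psh_mod[OF PB o]] ..
 finally show "cdiff A W U a xs = 0[sections A (cop W U xs)]"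
  by (rule phi_eq[OF o chainD[OF chain_cdiff[OF PA a] s] module_facts(2)[OF psh_mod[OF PA o]]])
qed

lemma connects_right:
 assumes onto: "!!xs. length xs = Suc p ==> set xs <= J ==> c xs \<in> psi (cop W U xs) ` Sec B (cop W U xs)"
  and c: "cocycle C W U J (Suc p) c"
 obtains a where "connects p c a" "cocycle A W U J (Suc (Suc p)) a"
proof -
 obtain b where b: "chain B W U J (Suc p) b"
  and b0: "!!xs. length xs = Suc p ==> set xs <= J ==> psi (cop W U xs) (b xs) = c xs"
  using chain_lift[OF onto] by blast
 have "psi (cop W U xs) (cdiff B W U b xs) = 0[sections C (cop W U xs)]"
  if "length xs = Suc (Suc p)" "set xs <= J" for xs
  using c that cdiff_hom_eq[OF PB PC psi b that b0] by (simp add: cocycle_def)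
 then obtain a where a: "chain A W U J (Suc (Suc p)) a"
   "!!xs. length xs = Suc (Suc p) ==> set xs <= J ==> phi (cop W U xs) (a xs) = cdiff B W U b xs"
  using chain_kernel[OF chain_cdiff[OF PB b]] by metis
 have "cocycle A W U J (Suc (Suc p)) a"
  by (rule cocycle_of_image[OF a(1) cocycle_cdiff[OF PB b] a(2)])
 moreover have "connects p c a" unfolding connects_def using a(2) b b0 by blast
 ultimately show thesis using that by blast
qed

text \<open>The image of \<open>a\<close> in the flasque sheaf \<open>B\<close> bounds some
  \<open>b\<close>, and \<open>psi\<close> turns \<open>b\<close> into a cocycle of
  \<open>C\<close>.\<close>

lemma connects_left:
 assumes a: "cocycle A W U J (Suc (Suc p)) a"
 obtains c where "connects p c a" "cocycle C W U J (Suc p) c"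
proof -
 have ach: "chain A W U J (Suc (Suc p)) a" using a by (simp add: cocycle_def)
 let ?a = "%ys. phi (cop W U ys) (a ys)"
 have "cocycle B W U J (Suc (Suc p)) ?a"
  unfolding cocycle_def
 proof (intro conjI allI impI chain_hom[OF phi ach])
  fix xs assume "length xs = Suc (Suc (Suc p)) & set xs <= J"
  then have s: "length xs = Suc (Suc (Suc p))" "set xs <= J" by auto
  note o = open_cop[OF s(2)]
  have "cdiff A W U a xs = 0[sections A (cop W U xs)]" using a s by (simp add: cocycle_def)
  then show "cdiff B W U ?a xs = 0[sections B (cop W U xs)]"
   using cdiff_hom[OF PA PB phi ach s]
    linear_hom_zero[OF homphi[OF o] psh_mod[OF PA o] psh_mod[OF PB o]] by simp
 qed
 then have "\<exists>b. is_cdiff B W U J (Suc p) b ?a" by (rule flasque_acyclic[OF B finite_J cover])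
 then obtain b where b: "chain B W U J (Suc p) b"
   "!!xs. length xs = Suc (Suc p) ==> set xs <= J ==> cdiff B W U b xs = ?a xs"
  unfolding is_cdiff_def by auto
 let ?c = "%ys. psi (cop W U ys) (b ys)"
 have "cocycle C W U J (Suc p) ?c"
  unfolding cocycle_def
 proof (intro conjI allI impI chain_hom[OF psi b(1)])
  fix xs assume "length xs = Suc (Suc p) & set xs <= J"
  then have s: "length xs = Suc (Suc p)" "set xs <= J" by auto
  show "cdiff C W U ?c xs = 0[sections C (cop W U xs)]"
   using cdiff_hom[OF PB PC psi b(1) s] b(2)[OF s] psiphi[OF open_cop[OF s(2)] chainD[OF ach s]] by simp
 qed
 moreover have "connects p ?c a" unfolding connects_def using b by (intro exI[of _ b]) auto
 ultimately show thesis using that by blast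
qed

text \<open>If \<open>a\<close> bounds \<open>e\<close>, then \<open>b\<close> minus the image of
  \<open>e\<close> is a cocycle of the flasque sheaf \<open>B\<close> and bounds some
  \<open>g\<close>. Conversely, \<open>b\<close> minus the differential of \<open>g\<close> is
  killed by \<open>psi\<close> and comes from some \<open>e\<close>.\<close>

lemma connects_coboundary:
 assumes ca: "connects p c a" and a: "cocycle A W U J (Suc (Suc p)) a" and cch: "chain C W U J (Suc p) c"
 shows "(\<exists>e. is_cdiff A W U J (Suc p) e a) \<longleftrightarrow>
  lifts p c"
  (is "?L \<longleftrightarrow> ?R")
proof
 obtain b where b: "chain B W U J (Suc p) b"
  "!!xs. length xs = Suc p ==> set xs <= J ==> psi (cop W U xs) (b xs) = c xs"
  "!!xs. length xs = Suc (Suc p) ==> set xs <= J ==> phi (cop W U xs) (a xs) = cdiff B W U b xs"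
  using ca unfolding connects_def by auto
 have ach: "chain A W U J (Suc (Suc p)) a" using a by (simp add: cocycle_def)
 {
  assume ?L
  then obtain e where e: "chain A W U J (Suc p) e"
    "!!xs. length xs = Suc (Suc p) ==> set xs <= J ==> cdiff A W U e xs = a xs"
   unfolding is_cdiff_def by auto
  let ?e = "%ys. phi (cop W U ys) (e ys)"
  have ech: "chain B W U J (Suc p) ?e" by (rule chain_hom[OF phi e(1)])
  define u where "u = (%ys. b ys -[sections B (cop W U ys)] ?e ys)"
  have "cocycle B W U J (Suc p) u"
   unfolding cocycle_def
  proof (intro conjI allI impI)
   show "chain B W U J (Suc p) u" unfolding u_def by (rule chain_diff[OF PB b(1) ech])
   fix xs assume "length xs = Suc (Suc p) & set xs <= J"
   then have s: "length xs = Suc (Suc p)" "set xs <= J" by auto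
   have "cdiff B W U ?e xs = cdiff B W U b xs"
    using cdiff_hom[OF PA PB phi e(1) s] e(2)[OF s] b(3)[OF s] by simp
   then show "cdiff B W U u xs = 0[sections B (cop W U xs)]"
    unfolding u_def cdiff_diff[OF PB b(1) ech s]
    using module_diff_self[OF psh_mod[OF PB open_cop[OF s(2)]] chainD[OF chain_cdiff[OF PB b(1)] s]] by simp
  qed
  then obtain g where g: "chain B W U J p g"
    "!!xs. length xs = Suc p ==> set xs <= J ==> cdiff B W U g xs = u xs"
   using flasque_acyclic[OF B finite_J cover] unfolding is_cdiff_def by metis
  have "psi (cop W U xs) (cdiff B W U g xs) = c xs" if s: "length xs = Suc p" "set xs <= J" for xs
  proof -
   note o = open_cop[OF s(2)]
   have "psi (cop W U xs) (u xs) = c xs -[sections C (cop W U xs)] 0[sections C (cop W U xs)]"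
    unfolding u_def
    using linear_hom_diff(2)[OF hompsi[OF o] psh_mod[OF PB o] psh_mod[OF PC o] chainD[OF b(1) s] chainD[OF ech s]]
     psiphi[OF o chainD[OF e(1) s]] b(2)[OF s] by simp
   then show ?thesis
    unfolding g(2)[OF s] module_diff_zero[OF psh_mod[OF PC o] chainD[OF cch s]] .
  qed
  then show ?R
   using g(1) by blast
 next
  assume ?R
  then obtain g where g: "chain B W U J p g"
    "!!xs. length xs = Suc p ==> set xs <= J ==> psi (cop W U xs) (cdiff B W U g xs) = c xs"
   by auto
  have gd: "chain B W U J (Suc p) (cdiff B W U g)" by (rule chain_cdiff[OF PB g(1)])
  define u where "u = (%ys. b ys -[sections B (cop W U ys)] cdiff B W U g ys)"
  have u: "chain B W U J (Suc p) u" unfolding u_def by (rule chain_diff[OF PB b(1) gd])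
  have "psi (cop W U xs) (u xs) = 0[sections C (cop W U xs)]" if s: "length xs = Suc p" "set xs <= J" for xs
  proof -
   note o = open_cop[OF s(2)]
   show ?thesis
    unfolding u_def
    using linear_hom_diff(2)[OF hompsi[OF o] psh_mod[OF PB o] psh_mod[OF PC o] chainD[OF b(1) s] chainD[OF gd s]]
     b(2)[OF s] g(2)[OF s] module_diff_self[OF psh_mod[OF PC o] chainD[OF cch s]] by simp
  qed
  then obtain e where e: "chain A W U J (Suc p) e"
   "!!xs. length xs = Suc p ==> set xs <= J ==> phi (cop W U xs) (e xs) = u xs"
   using chain_kernel[OF u] by metis
  have "cdiff A W U e xs = a xs" if s: "length xs = Suc (Suc p)" "set xs <= J" for xs
  proof -
   note o = open_cop[OF s(2)]
   have "phi (cop W U xs) (cdiff A W U e xs) = cdiff B W U u xs" by (rule cdiff_hom_eq[OF PA PB phi e(1) s e(2)])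
   also have "... = cdiff B W U b xs"
    unfolding u_def cdiff_diff[OF PB b(1) gd s] cdiff_cdiff[OF PB g(1) s]
    by (rule module_diff_zero[OF psh_mod[OF PB o] chainD[OF chain_cdiff[OF PB b(1)] s]])
   also have "... = phi (cop W U xs) (a xs)" using b(3)[OF s] ..
   finally show ?thesis
    by (rule phi_eq[OF o chainD[OF chain_cdiff[OF PA e(1)] s] chainD[OF ach s]])
  qed
  then show ?L using e(1) unfolding is_cdiff_def by blast
 }
qed

lemma coboundary_lift_iff:
 assumes onto: "!!xs. length xs = p ==> set xs <= J ==> Sec C (cop W U xs) <= psi (cop W U xs) ` Sec B (cop W U xs)"
 shows "lifts p c
  \<longleftrightarrow> (\<exists>f. is_cdiff C W U J p f c)" (is "?L \<longleftrightarrow> _")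
proof
 assume ?L
 then obtain g where g: "chain B W U J p g"
   "!!xs. length xs = Suc p ==> set xs <= J ==> psi (cop W U xs) (cdiff B W U g xs) = c xs"
  by auto
 have "is_cdiff C W U J p (%ys. psi (cop W U ys) (g ys)) c"
  unfolding is_cdiff_def using chain_hom[OF psi g(1)] cdiff_hom[OF PB PC psi g(1)] g(2) by auto
 then show "\<exists>f. is_cdiff C W U J p f c" by blast
next
 assume "\<exists>f. is_cdiff C W U J p f c"
 then obtain f where f: "chain C W U J p f" "!!xs. length xs = Suc p ==> set xs <= J ==> cdiff C W U f xs = c xs"
  unfolding is_cdiff_def by auto
 have "f xs \<in> psi (cop W U xs) ` Sec B (cop W U xs)" if "length xs = p" "set xs <= J" for xs
  by (rule subsetD[OF onto[OF that] chainD[OF f(1) that]])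
 then obtain g where g: "chain B W U J p g" "!!xs. length xs = p ==> set xs <= J ==> psi (cop W U xs) (g xs) = f xs"
  using chain_lift[of p f] by metis
 then show ?L using g(1) f(2) cdiff_hom_eq[OF PB PC psi g(1) _ _ g(2)] by auto
qed

end

subsection \<open>Cartan's criterion\<close>

text \<open>Modelled on principal open sets: a base of the topology that is closed under
  intersection and consists of quasi-compact sets.\<close>

locale open_basis =
 fixes X :: "'p topology" and \<B> :: "'p set set"
 assumes basis_open: "D \<in> \<B> ==> openin X D"
  and basis_Int: "D \<in> \<B> ==> E \<in> \<B> ==> D \<inter> E \<in> \<B>"
  and basis_refine: "openin X V ==> x \<in> V ==> \<exists>D\<in>\<B>. x \<in> D & D <= V"
  and basis_compact: "D \<in> \<B> ==> \<A> <= \<B> ==> \<Union>\<A> = D ==> \<exists>\<U>\<subseteq>\<A>. finite \<U> & \<Union>\<U> = D"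
begin

text \<open>\<open>Suc (Suc p)\<close> indices mean Cech degree at least 1. A cover is a finite set
  of basis members indexed by itself, hence the identity as indexing function.\<close>

definition cech_acyclic :: "('p, 'k::field, 'v) sheaf_data => bool"
 where "cech_acyclic F \<longleftrightarrow> (\<forall>D\<in>\<B>. \<forall>\<U>\<subseteq>\<B>. finite \<U> & \<Union>\<U> = D -->
  (\<forall>p c. cocycle F D (%V. V) \<U> (Suc (Suc p)) c --> (\<exists>e. is_cdiff F D (%V. V) \<U> (Suc p) e c)))"

lemma cech_acyclicD:
 assumes "cech_acyclic F" "D \<in> \<B>" "\<U> <= \<B>" "finite \<U>" "\<Union>\<U> = D"
  and "cocycle F D (%V. V) \<U> (Suc (Suc p)) c"
 shows "\<exists>e. is_cdiff F D (%V. V) \<U> (Suc p) e c"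
 by (rule assms(1)[unfolded cech_acyclic_def, THEN bspec[OF _ assms(2)], THEN spec, THEN mp[OF _ assms(3)],
    THEN mp[OF _ conjI[OF assms(4,5)]], THEN spec, THEN spec, THEN mp[OF _ assms(6)]])

lemma cop_basis:
 assumes "D \<in> \<B>" "\<U> <= \<B>" shows "set xs <= \<U> ==> cop D (%V. V) xs \<in> \<B>"
proof (induction xs)
 case (Cons j xs)
 then have "j \<in> \<B>" "cop D (%V. V) xs \<in> \<B>" using assms(2) by auto
 then show ?case unfolding cop_Cons by (rule basis_Int)
qed (simp add: assms)

text \<open>The obstruction to lifting a section over \<open>D\<close> is a cocycle of
  \<open>A\<close> in Cech degree 1. Compactness provides a finite cover by basis sets with local
  lifts, acyclicity of \<open>A\<close> makes the obstruction bound, and the corrected lift is the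
  value \<open>g []\<close>.\<close>

lemma ses_sections_onto:
 assumes ses: "sheaf_ses X A phi B psi C" and acA: "cech_acyclic A" and D: "D \<in> \<B>"
 shows "Sec C D <= psi D ` Sec B D"
proof
 interpret sheaf_ses X A phi B psi C by (rule ses)
 fix s assume s: "s \<in> Sec C D"
 have oD: "openin X D" by (rule basis_open[OF D])
 define \<A> where "\<A> = {V \<in> \<B>. V <= D & (\<exists>t\<in>Sec B V. psi V t = restr C D V s)}"
 have "\<Union>\<A> = D"
 proof
  show "\<Union>\<A> <= D" by (auto simp: \<A>_def)
  show "D <= \<Union>\<A>"
  proof
   fix x assume "x \<in> D"
   then obtain V t where V: "openin X V" "x \<in> V" "V <= D" "t \<in> Sec B V" "psi V t = restr C D V s"
    using locally_onto[OF oD s] by blast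
   obtain E where E: "E \<in> \<B>" "x \<in> E" "E <= V" using basis_refine[OF V(1,2)] by blast
   note oE = basis_open[OF E(1)]
   have "psi E (restr B V E t) = restr C V E (psi V t)"
    using psi V(1,4) oE E(3) unfolding sheaf_hom_def by auto
   also have "... = restr C D E s"
    unfolding V(5) by (rule psh_restr_restr[OF PC oD V(1) oE E(3) V(3) s])
   finally have "E \<in> \<A>"
    using psh_restr_closed[OF PB V(1) oE E(3) V(4)] E V(3) unfolding \<A>_def by blast
   then show "x \<in> \<Union>\<A>" using E(2) by blast
  qed
 qed
 then obtain \<U> where \<U>: "\<U> <= \<A>" "finite \<U>" "\<Union>\<U> = D"
  using basis_compact[OF D, of \<A>] by (auto simp: \<A>_def)
 have \<U>B: "\<U> <= \<B>" using \<U>(1) by (auto simp: \<A>_def)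
 interpret ses_cech X A phi B psi C D "%V. V" \<U>
  by unfold_locales (use oD \<U>B \<U> basis_open in auto)
 define c where "c = (%xs. restr C D (cop D (%V. V) xs) s)"
 have c: "cocycle C D (%V. V) \<U> (Suc 0) c"
 proof -
  have e: "chain C D (%V. V) \<U> 0 (%_. s)" using s by (simp add: chain_def)
  have eq: "cdiff C D (%V. V) (%_. s) xs = c xs" if "length xs = Suc 0" "set xs <= \<U>" for xs
   using cdiff_singleton[OF PC s that] by (simp add: c_def)
  show ?thesis
   unfolding cocycle_def
  proof (intro conjI allI impI)
   show "chain C D (%V. V) \<U> (Suc 0) c"
    using chain_cdiff[OF PC e] eq unfolding chain_def by auto
   fix xs assume "length xs = Suc (Suc 0) & set xs <= \<U>"
   then have xs: "length xs = Suc (Suc 0)" "set xs <= \<U>" by auto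
   have "cdiff C D (%V. V) c xs = cdiff C D (%V. V) (cdiff C D (%V. V) (%_. s)) xs"
    by (rule cdiff_cong) (use eq xs in auto)
   then show "cdiff C D (%V. V) c xs = 0[sections C (cop D (%V. V) xs)]"
    using cdiff_cdiff[OF PC e xs] by simp
  qed
 qed
 have onto: "c xs \<in> psi (cop D (%V. V) xs) ` Sec B (cop D (%V. V) xs)"
  if xs: "length xs = Suc 0" "set xs <= \<U>" for xs
 proof -
  obtain V where V: "xs = [V]" using xs(1) by (auto simp: length_Suc_conv)
  have "V \<in> \<A>" using V xs(2) \<U>(1) by auto
  then have "cop D (%V. V) xs = V" by (auto simp: V cop_def \<A>_def)
  then show ?thesis using \<open>V \<in> \<A>\<close> by (force simp: \<A>_def c_def image_iff)
 qed
 obtain a where a: "connects 0 c a" "cocycle A D (%V. V) \<U> (Suc (Suc 0)) a"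
  by (rule connects_right[OF onto c])
 moreover have "\<exists>e. is_cdiff A D (%V. V) \<U> (Suc 0) e a"
  by (rule cech_acyclicD[OF acA D \<U>B \<U>(2,3) a(2)])
 ultimately obtain g where g: "chain B D (%V. V) \<U> 0 g"
   "!!xs. length xs = Suc 0 ==> set xs <= \<U> ==> psi (cop D (%V. V) xs) (cdiff B D (%V. V) g xs) = c xs"
  using connects_coboundary[of 0 c a] c unfolding cocycle_def by auto
 define t where "t = g []"
 have t: "t \<in> Sec B D" using chainD[OF g(1), of "[]"] by (simp add: t_def)
 have "psi D t = s"
 proof (rule sheaf_locality[OF C])
  show "D = (\<Union>V\<in>\<U>. V)" using \<U>(3) by simp
  show "psi D t \<in> Sec C D" by (rule linear_homD(1)[OF hompsi[OF oD] t])
  fix V assume V: "V \<in> \<U>"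
  then show oV: "openin X V" using \<U>B basis_open by auto
  have VD: "V <= D" using V \<U>(3) by auto
  have cop: "cop D (%V. V) [V] = V" using VD by (auto simp: cop_def)
  have rt: "restr B D V t \<in> Sec B V" by (rule psh_restr_closed[OF PB oD oV VD t])
  have "cdiff B D (%V. V) g [V] = restr B D V t"
   using module_diff_zero[OF psh_mod[OF PB oV] rt] by (simp add: cdiff_def cop t_def)
  then have "psi V (restr B D V t) = restr C D V s"
   using g(2)[of "[V]"] V by (simp add: cop c_def)
  moreover have "psi V (restr B D V t) = restr C D V (psi D t)"
   using psi t oD oV VD unfolding sheaf_hom_def by auto
  ultimately show "restr C D V (psi D t) = restr C D V s" by simp
 qed (rule s)
 then show "s \<in> psi D ` Sec B D" using t by blast
qed

text \<open>By \<open>ses_sections_onto\<close>, cochains of \<open>C\<close> on basis sets lift to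
  \<open>B\<close>, so acyclicity of \<open>A\<close> one degree higher gives that of
  \<open>C\<close>.\<close>

lemma ses_cech_acyclic:
 assumes ses: "sheaf_ses X A phi B psi C" and acA: "cech_acyclic A"
 shows "cech_acyclic C"
 unfolding cech_acyclic_def
proof (intro ballI allI impI)
 fix D \<U> p c assume D: "D \<in> \<B>" and \<U>: "\<U> <= \<B>" "finite \<U> & \<Union>\<U> = D"
  and c: "cocycle C D (%V. V) \<U> (Suc (Suc p)) c"
 interpret sheaf_ses X A phi B psi C by (rule ses)
 interpret ses_cech X A phi B psi C D "%V. V" \<U>
  by unfold_locales (use D \<U> basis_open in auto)
 have onto: "Sec C (cop D (%V. V) xs) <= psi (cop D (%V. V) xs) ` Sec B (cop D (%V. V) xs)" if "set xs <= \<U>" for xs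
  by (rule ses_sections_onto[OF ses acA cop_basis[OF D \<U>(1) that]])
 have cch: "chain C D (%V. V) \<U> (Suc (Suc p)) c" using c by (simp add: cocycle_def)
 obtain a where a: "connects (Suc p) c a" "cocycle A D (%V. V) \<U> (Suc (Suc (Suc p))) a"
  using connects_right[OF _ c] subsetD[OF onto chainD[OF cch]] by blast
 have "\<exists>e. is_cdiff A D (%V. V) \<U> (Suc (Suc p)) e a"
  by (rule cech_acyclicD[OF acA D \<U>(1) conjunct1[OF \<U>(2)] conjunct2[OF \<U>(2)] a(2)])
 then show "\<exists>e. is_cdiff C D (%V. V) \<U> (Suc p) e c"
  unfolding connects_coboundary[OF a cch] using coboundary_lift_iff[of "Suc p" c] onto by simp
qed

end

section \<open>Dimensions of Cech cohomology and their shift along short exact sequences\<close>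

lemma quotient_has_dim_iff:
 fixes M :: "('k::field, 'v) module" and M' :: "('k, 'w) module"
 assumes M: "is_module M" and M': "is_module M'"
  and Z: "Z <= carrier M" and Z': "Z' <= carrier M'"
  and R: "!!z z'. R z z' ==> z \<in> Z & z' \<in> Z'"
  and R0: "R 0[M] 0[M']"
  and Radd: "!!x x' y y'. R x x' ==> R y y' ==> R (x +[M] y) (x' +[M'] y')"
  and Rsmult: "!!c x x'. R x x' ==> R (c *[M] x) (c *[M'] x')"
  and left: "!!z. z \<in> Z ==> \<exists>z'. R z z'" and right: "!!z'. z' \<in> Z' ==> \<exists>z. R z z'"
  and B: "!!z z'. R z z' ==> z \<in> B \<longleftrightarrow> z' \<in> B'"
 shows "quotient_has_dim M Z B d \<longleftrightarrow> quotient_has_dim M' Z' B' d"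
proof
 assume d: "quotient_has_dim M Z B d"
 show "quotient_has_dim M' Z' B' d"
 proof (rule quotient_has_dim_transfer[OF M M' Z Z', where R = R and B = B])
  show "z \<in> B \<longleftrightarrow> z' \<in> B'" if "R z z'" for z z' using that by (rule B)
 qed (fact R R0 Radd Rsmult left right d)+
next
 assume d: "quotient_has_dim M' Z' B' d"
 show "quotient_has_dim M Z B d"
 proof (rule quotient_has_dim_transfer[OF M' M Z' Z, where R = "%x y. R y x" and B = B'])
  show "z \<in> Z' & z' \<in> Z" if "R z' z" for z z' using R[OF that] by simp
  show "z \<in> B' \<longleftrightarrow> z' \<in> B" if "R z' z" for z z' using B[OF that] by simp
 qed (fact R0 Radd Rsmult left right d)+
qed

lemma quotient_has_dim_hom:
 assumes M: "is_module M" and M': "is_module M'" and phi: "linear_hom M M' phi"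
  and B: "!!x. x \<in> carrier M ==> x \<in> B \<longleftrightarrow> phi x \<in> B'"
 shows "quotient_has_dim M (carrier M) B d \<longleftrightarrow> quotient_has_dim M' (phi ` carrier M) B' d"
 by (rule quotient_has_dim_iff[OF M M', where R = "%x y. x \<in> carrier M & y = phi x"])
   (use module_facts(1-3)[OF M] linear_homD[OF phi] linear_hom_zero[OF phi M M'] B in auto)

context cech
begin

definition idx :: "nat => 'j list set"
 where "idx p = {xs. length xs = p & set xs <= J}"

definition cmod :: "('p, 'k::field, 'v) sheaf_data => nat => ('k, 'j list => 'v) module"
 where "cmod F p = prod_module (idx p) (%xs. sections F (cop W U xs))"

definition cech_cocycles :: "('p, 'k::field, 'v) sheaf_data => nat => ('j list => 'v) set"
 where "cech_cocycles F p = {c \<in> carrier (cmod F p). cocycle F W U J p c}"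

definition cech_coboundaries :: "('p, 'k::field, 'v) sheaf_data => nat => ('j list => 'v) set"
 where "cech_coboundaries F p = {c \<in> carrier (cmod F (Suc p)).
  if p = 0 then c = 0[cmod F (Suc p)] else \<exists>e. is_cdiff F W U J p e c}"

definition cech_dim :: "('p, 'k::field, 'v) sheaf_data => nat => nat => bool"
 where "cech_dim F p d \<longleftrightarrow> quotient_has_dim (cmod F (Suc p)) (cech_cocycles F (Suc p)) (cech_coboundaries F p) d"

lemma module_cmod: "presheaf X F ==> is_module (cmod F p)"
 unfolding cmod_def by (rule is_module_prod) (simp add: idx_def psh_mod open_cop)

lemma idxD: "xs \<in> idx p ==> length xs = p" "xs \<in> idx p ==> set xs <= J"
 by (auto simp: idx_def)

lemma chain_cong: "(!!xs. xs \<in> idx p ==> c xs = c' xs) ==> chain F W U J p c \<longleftrightarrow> chain F W U J p c'"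
 by (simp add: chain_def idx_def)

lemma cdiff_cong_idx:
 assumes "!!xs. xs \<in> idx p ==> c xs = c' xs" "length xs = Suc p" "set xs <= J"
 shows "cdiff F W U c xs = cdiff F W U c' xs"
 by (rule cdiff_cong) (rule assms(1), use assms(2,3) in \<open>auto simp: idx_def\<close>)

lemma cocycle_cong:
 assumes "!!xs. xs \<in> idx p ==> c xs = c' xs"
 shows "cocycle F W U J p c \<longleftrightarrow> cocycle F W U J p c'"
proof -
 have "cdiff F W U c xs = cdiff F W U c' xs" if "length xs = Suc p" "set xs <= J" for xs
  by (rule cdiff_cong_idx[of p]) (use assms that in auto)
 then show ?thesis unfolding cocycle_def using chain_cong[of p c c' F, OF assms] by auto
qed

lemma chain_carrier: "c \<in> carrier (cmod F p) ==> chain F W U J p c"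
 by (auto simp: cmod_def prod_module_simps chain_def idx_def PiE_mem)

lemma restrict_carrier: "chain F W U J p c ==> restrict c (idx p) \<in> carrier (cmod F p)"
 by (auto simp: cmod_def prod_module_simps chain_def idx_def)

lemma cmod_simps:
 "xs \<in> idx p ==> (x +[cmod F p] y) xs = x xs +[sections F (cop W U xs)] y xs"
 "xs \<in> idx p ==> (a *[cmod F p] x) xs = a *[sections F (cop W U xs)] x xs"
 "xs \<in> idx p ==> 0[cmod F p] xs = 0[sections F (cop W U xs)]"
 by (simp_all add: cmod_def prod_module_simps)

lemma cmod_eqI: "x \<in> carrier (cmod F p) ==> y \<in> carrier (cmod F p) ==> (!!xs. xs \<in> idx p ==> x xs = y xs) ==> x = y"
 unfolding cmod_def prod_module_simps by (rule PiE_ext)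

definition cd :: "('p, 'k::field, 'v) sheaf_data => nat => ('j list => 'v) => 'j list => 'v"
 where "cd F p c = (\<lambda>xs\<in>idx (Suc p). cdiff F W U c xs)"

definition cmap :: "('p set => 'v => 'w) => nat => ('j list => 'v) => 'j list => 'w"
 where "cmap phi p c = (\<lambda>xs\<in>idx p. phi (cop W U xs) (c xs))"

definition glob :: "('p, 'k::field, 'v) sheaf_data => 'v => 'j list => 'v"
 where "glob F s = (\<lambda>xs\<in>idx (Suc 0). restr F W (cop W U xs) s)"

lemma linear_hom_cmodI:
 assumes "!!x. x \<in> carrier M ==> f x \<in> carrier (cmod F p)"
  and "!!x y xs. x \<in> carrier M ==> y \<in> carrier M ==> xs \<in> idx p ==>
   f (x +[M] y) xs = f x xs +[sections F (cop W U xs)] f y xs"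
  and "!!a x xs. x \<in> carrier M ==> xs \<in> idx p ==> f (a *[M] x) xs = a *[sections F (cop W U xs)] f x xs"
  and F: "presheaf X F" and M: "is_module M"
 shows "linear_hom M (cmod F p) f"
 unfolding linear_hom_def
 using assms(1-3) module_facts(1,3)[OF M] module_facts(1,3)[OF module_cmod[OF F]]
 by (intro conjI ballI allI funcsetI cmod_eqI[of _ F p]) (simp_all add: cmod_simps)

lemma linear_cd:
 assumes F: "presheaf X F" shows "linear_hom (cmod F p) (cmod F (Suc p)) (cd F p)"
proof (rule linear_hom_cmodI[OF _ _ _ F module_cmod[OF F]])
 fix x y xs a assume x: "x \<in> carrier (cmod F p)"
 note cx = chain_carrier[OF x]
 show "cd F p x \<in> carrier (cmod F (Suc p))"
  unfolding cd_def by (rule restrict_carrier[OF chain_cdiff[OF F cx]])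
 assume xs: "xs \<in> idx (Suc p)"
 have "cdiff F W U (a *[cmod F p] x) xs = cdiff F W U (%ys. a *[sections F (cop W U ys)] x ys) xs"
  by (rule cdiff_cong_idx[OF _ idxD[OF xs]]) (simp add: cmod_simps)
 then show "cd F p (a *[cmod F p] x) xs = a *[sections F (cop W U xs)] cd F p x xs"
  using xs by (simp add: cd_def cdiff_smult[OF F cx idxD[OF xs]])
 assume y: "y \<in> carrier (cmod F p)"
 have "cdiff F W U (x +[cmod F p] y) xs = cdiff F W U (%ys. x ys +[sections F (cop W U ys)] y ys) xs"
  by (rule cdiff_cong_idx[OF _ idxD[OF xs]]) (simp add: cmod_simps)
 then show "cd F p (x +[cmod F p] y) xs = cd F p x xs +[sections F (cop W U xs)] cd F p y xs"
  using xs by (simp add: cd_def cdiff_add[OF F cx chain_carrier[OF y] idxD[OF xs]])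
qed

lemma linear_cmap:
 assumes F: "presheaf X F" and G: "presheaf X G" and phi: "sheaf_hom X F G phi"
 shows "linear_hom (cmod F p) (cmod G p) (cmap phi p)"
proof (rule linear_hom_cmodI[OF _ _ _ G module_cmod[OF F]])
 have h: "linear_hom (sections F (cop W U xs)) (sections G (cop W U xs)) (phi (cop W U xs))" if "xs \<in> idx p" for xs
  using phi open_cop[OF idxD(2)[OF that]] unfolding sheaf_hom_def by blast
 have c: "x xs \<in> Sec F (cop W U xs)" if "x \<in> carrier (cmod F p)" "xs \<in> idx p" for x xs
  by (rule chainD[OF chain_carrier[OF that(1)] idxD[OF that(2)]])
 fix x y xs a assume x: "x \<in> carrier (cmod F p)"
 show "cmap phi p x \<in> carrier (cmod G p)"
  unfolding cmap_def by (rule restrict_carrier[OF chain_hom[OF phi chain_carrier[OF x]]])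
 assume xs: "xs \<in> idx p"
 show "cmap phi p (a *[cmod F p] x) xs = a *[sections G (cop W U xs)] cmap phi p x xs"
  using xs c[OF x xs] linear_homD(3)[OF h[OF xs]] by (simp add: cmap_def cmod_simps)
 assume "y \<in> carrier (cmod F p)"
 then show "cmap phi p (x +[cmod F p] y) xs = cmap phi p x xs +[sections G (cop W U xs)] cmap phi p y xs"
  using xs c[OF x xs] c[of y xs] linear_homD(2)[OF h[OF xs]] by (simp add: cmap_def cmod_simps)
qed

lemma cech_cocycles_iff:
 assumes F: "presheaf X F"
 shows "c \<in> cech_cocycles F p \<longleftrightarrow> c \<in> carrier (cmod F p) & cd F p c = 0[cmod F (Suc p)]"
proof -
 have "cd F p c = 0[cmod F (Suc p)] \<longleftrightarrow> (\<forall>xs\<in>idx (Suc p). cdiff F W U c xs = 0[sections F (cop W U xs)])"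
  unfolding cd_def cmod_def prod_module_simps by (auto simp: fun_eq_iff restrict_def)
 then show ?thesis using chain_carrier[of c F p] by (auto simp: cech_cocycles_def cocycle_def idx_def)
qed

lemma cech_cocycles_module:
 assumes F: "presheaf X F"
 shows "0[cmod F p] \<in> cech_cocycles F p"
  and "x \<in> cech_cocycles F p ==> y \<in> cech_cocycles F p ==> x +[cmod F p] y \<in> cech_cocycles F p"
  and "x \<in> cech_cocycles F p ==> a *[cmod F p] x \<in> cech_cocycles F p"
 using linear_hom_zero[OF linear_cd[OF F] module_cmod[OF F] module_cmod[OF F]] linear_homD(2,3)[OF linear_cd[OF F]]
  module_facts(1-3)[OF module_cmod[OF F]] module_facts(2,6,12)[OF module_cmod[OF F]]
 by (simp_all add: cech_cocycles_iff[OF F])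

lemma restrict_cocycle: "cocycle F W U J p c ==> restrict c (idx p) \<in> cech_cocycles F p"
 using restrict_carrier[of F p c] cocycle_cong[of p "restrict c (idx p)" c F]
 by (simp add: cech_cocycles_def) (simp add: cocycle_def)

lemma linear_glob:
 assumes F: "presheaf X F" shows "linear_hom (sections F W) (cmod F (Suc 0)) (glob F)"
proof (rule linear_hom_cmodI[OF _ _ _ F psh_mod[OF F open_W]])
 have h: "linear_hom (sections F W) (sections F (cop W U xs)) (restr F W (cop W U xs))" if "xs \<in> idx p" for xs p
  using psh_restr_hom[OF F open_W open_cop[OF idxD(2)[OF that]]] by (simp add: cop_def)
 fix x y xs a assume x: "x \<in> Sec F W"
 show "glob F x \<in> carrier (cmod F (Suc 0))"
  unfolding glob_def using linear_homD(1)[OF h x] by (intro restrict_carrier) (auto simp: chain_def idx_def)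
 assume xs: "xs \<in> idx (Suc 0)"
 show "glob F (a *[sections F W] x) xs = a *[sections F (cop W U xs)] glob F x xs"
  using linear_homD(3)[OF h[OF xs] x] xs by (simp add: glob_def)
 assume y: "y \<in> Sec F W"
 show "glob F (x +[sections F W] y) xs = glob F x xs +[sections F (cop W U xs)] glob F y xs"
  using linear_homD(2)[OF h[OF xs] x y] xs by (simp add: glob_def)
qed

lemma glob_image:
 assumes F: "sheaf X F" and cover: "W <= (\<Union>j\<in>J. U j)"
 shows "glob F ` Sec F W = cech_cocycles F (Suc 0)"
proof (intro equalityI subsetI)
 have P: "presheaf X F" using F by (rule sheaf_presheaf)
 fix c assume "c \<in> glob F ` Sec F W"
 then obtain s where s: "s \<in> Sec F W" "c = glob F s" by blast
 have "glob F s = restrict (cdiff F W U (%_. s)) (idx (Suc 0))"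
  unfolding glob_def by (rule restrict_ext) (simp add: cdiff_singleton[OF P s(1) idxD])
 moreover have "chain F W U J 0 (%_. s)" using s by (simp add: chain_def)
 ultimately show "c \<in> cech_cocycles F (Suc 0)" using restrict_cocycle[OF cocycle_cdiff[OF P]] s(2) by simp
next
 fix c assume c: "c \<in> cech_cocycles F (Suc 0)"
 then have "cocycle F W U J (Suc 0) c" by (simp add: cech_cocycles_def)
 then obtain s where s: "s \<in> Sec F W" "!!j. j \<in> J ==> restr F W (cop W U [j]) s = c [j]"
  using glue_cocycle[OF F cover] by blast
 have "c = glob F s"
 proof (rule cmod_eqI)
  show "c \<in> carrier (cmod F (Suc 0))" using c by (simp add: cech_cocycles_def)
  show "glob F s \<in> carrier (cmod F (Suc 0))" by (rule linear_homD(1)[OF linear_glob[OF sheaf_presheaf[OF F]] s(1)])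
  fix xs assume xs: "xs \<in> idx (Suc 0)"
  obtain j where "xs = [j]" using idxD(1)[OF xs] by (auto simp: length_Suc_conv)
  then show "c xs = glob F s xs" using s(2)[of j] xs idxD(2)[OF xs] by (simp add: glob_def)
 qed
 then show "c \<in> glob F ` Sec F W" using s(1) by blast
qed

text \<open>Restriction to the cover identifies global sections with cocycles in Cech degree 0. This
  brings quotients of global sections into the form to which the connecting relation
  applies.\<close>

lemma quotient_has_dim_glob:
 assumes F: "sheaf X F" and cover: "W <= (\<Union>j\<in>J. U j)" and S: "S <= Sec F W"
 shows "quotient_has_dim (sections F W) (Sec F W) S d \<longleftrightarrow>
  quotient_has_dim (cmod F (Suc 0)) (cech_cocycles F (Suc 0)) (glob F ` S) d"
proof -
 have P: "presheaf X F" using F by (rule sheaf_presheaf)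
 have inj: "s = t" if st: "s \<in> Sec F W" "t \<in> Sec F W" "glob F s = glob F t" for s t
 proof (rule sheaf_locality[OF F])
  show "W = (\<Union>j\<in>J. cop W U [j])" using cover by (auto simp: cop_def)
  fix j assume "j \<in> J"
  then have i: "[j] \<in> idx (Suc 0)" by (simp add: idx_def)
  show "openin X (cop W U [j])" by (rule open_cop[OF idxD(2)[OF i]])
  show "restr F W (cop W U [j]) s = restr F W (cop W U [j]) t" using fun_cong[OF st(3), of "[j]"] i by (simp add: glob_def)
 qed (use st in auto)
 have B: "s \<in> S \<longleftrightarrow> glob F s \<in> glob F ` S" if "s \<in> Sec F W" for s using inj[OF that] S by blast
 show ?thesis
  using quotient_has_dim_hom[OF psh_mod[OF P open_W] module_cmod[OF P] linear_glob[OF P] B]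
  unfolding glob_image[OF F cover] .
qed

lemma cech_dim_0:
 assumes F: "sheaf X F" and cover: "W <= (\<Union>j\<in>J. U j)"
 shows "quotient_has_dim (sections F W) (Sec F W) {0[sections F W]} d \<longleftrightarrow> cech_dim F 0 d"
proof -
 note P = sheaf_presheaf[OF F]
 note M = psh_mod[OF P open_W] and M' = module_cmod[OF P, of "Suc 0"]
 have "glob F ` {0[sections F W]} = cech_coboundaries F 0"
  using linear_hom_zero[OF linear_glob[OF P] M M'] module_facts(2)[OF M'] by (auto simp: cech_coboundaries_def)
 then show ?thesis
  using quotient_has_dim_glob[OF F cover, of "{0[sections F W]}"] module_facts(2)[OF M] by (simp add: cech_dim_def)
qed

end

context ses_cech
begin

lemma connects_cong:
 assumes "!!xs. xs \<in> idx (Suc p) ==> c xs = c' xs" "!!xs. xs \<in> idx (Suc (Suc p)) ==> a xs = a' xs"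
 shows "connects p c a \<longleftrightarrow> connects p c' a'"
 unfolding connects_def using assms unfolding idx_def by simp

lemma connects_iff:
 assumes c: "c \<in> carrier (cmod C (Suc p))"
 shows "connects p c a \<longleftrightarrow>
  (\<exists>b\<in>carrier (cmod B (Suc p)). cmap psi (Suc p) b = c & cmap phi (Suc (Suc p)) a = cd B (Suc p) b)"
proof
 assume "connects p c a"
 then obtain b where b: "chain B W U J (Suc p) b" "!!xs. xs \<in> idx (Suc p) ==> psi (cop W U xs) (b xs) = c xs"
  "!!xs. xs \<in> idx (Suc (Suc p)) ==> phi (cop W U xs) (a xs) = cdiff B W U b xs"
  unfolding connects_def idx_def by auto
 let ?b = "restrict b (idx (Suc p))"
 have bc: "?b \<in> carrier (cmod B (Suc p))" by (rule restrict_carrier[OF b(1)])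
 have "cmap psi (Suc p) ?b = c"
  using b(2) by (intro cmod_eqI[OF linear_homD(1)[OF linear_cmap[OF PB PC psi] bc] c]) (simp add: cmap_def)
 moreover have "cmap phi (Suc (Suc p)) a = cd B (Suc p) ?b"
  unfolding cmap_def cd_def
  by (rule restrict_ext) (use b(3) cdiff_cong_idx[of "Suc p" ?b b _ B] in \<open>simp add: idx_def\<close>)
 ultimately show "\<exists>b\<in>carrier (cmod B (Suc p)). cmap psi (Suc p) b = c & cmap phi (Suc (Suc p)) a = cd B (Suc p) b"
  using bc by blast
next
 assume "\<exists>b\<in>carrier (cmod B (Suc p)). cmap psi (Suc p) b = c & cmap phi (Suc (Suc p)) a = cd B (Suc p) b"
 then obtain b where b: "b \<in> carrier (cmod B (Suc p))" "cmap psi (Suc p) b = c" "cmap phi (Suc (Suc p)) a = cd B (Suc p) b" by blast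
 show "connects p c a"
  unfolding connects_def b(2)[symmetric]
 proof (intro exI[of _ b] conjI allI impI chain_carrier[OF b(1)])
  show "phi (cop W U xs) (a xs) = cdiff B W U b xs" if "length xs = Suc (Suc p) & set xs <= J" for xs
   using fun_cong[OF b(3), of xs] that by (simp add: cmap_def cd_def idx_def)
 qed (simp add: cmap_def idx_def)
qed

lemma connects_linear:
 assumes "c \<in> carrier (cmod C (Suc p))" "c' \<in> carrier (cmod C (Suc p))"
  and "a \<in> carrier (cmod A (Suc (Suc p)))" "a' \<in> carrier (cmod A (Suc (Suc p)))"
  and "connects p c a" "connects p c' a'"
 shows "connects p (c +[cmod C (Suc p)] c') (a +[cmod A (Suc (Suc p))] a')"
  and "connects p (k *[cmod C (Suc p)] c) (k *[cmod A (Suc (Suc p))] a)"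
  and "connects p 0[cmod C (Suc p)] 0[cmod A (Suc (Suc p))]"
proof -
 note m = module_cmod[OF PA] module_cmod[OF PB] module_cmod[OF PC]
 note l = linear_cmap[OF PB PC psi] linear_cmap[OF PA PB phi] linear_cd[OF PB]
 note f = module_facts(1)[OF m(3)] module_facts(2)[OF m(3)] module_facts(3)[OF m(3)] 
 obtain b b' where b: "b \<in> carrier (cmod B (Suc p))" "cmap psi (Suc p) b = c" "cmap phi (Suc (Suc p)) a = cd B (Suc p) b"
  and b': "b' \<in> carrier (cmod B (Suc p))" "cmap psi (Suc p) b' = c'" "cmap phi (Suc (Suc p)) a' = cd B (Suc p) b'"
  using assms connects_iff by metis
 show "connects p (c +[cmod C (Suc p)] c') (a +[cmod A (Suc (Suc p))] a')"
  unfolding connects_iff[OF f(1)[OF assms(1,2)]]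
  using b b' assms linear_homD(2)[OF l(1)] linear_homD(2)[OF l(2)] linear_homD(2)[OF l(3)] module_facts(1)[OF m(2)]
  by (intro bexI[of _ "b +[cmod B (Suc p)] b'"]) simp_all
 show "connects p (k *[cmod C (Suc p)] c) (k *[cmod A (Suc (Suc p))] a)"
  unfolding connects_iff[OF f(3)[OF assms(1)]]
  using b assms linear_homD(3)[OF l(1)] linear_homD(3)[OF l(2)] linear_homD(3)[OF l(3)] module_facts(3)[OF m(2)]
  by (intro bexI[of _ "k *[cmod B (Suc p)] b"]) simp_all
 show "connects p 0[cmod C (Suc p)] 0[cmod A (Suc (Suc p))]"
  unfolding connects_iff[OF f(2)]
  using linear_hom_zero[OF l(1) m(2,3)] linear_hom_zero[OF l(2) m(1,2)] linear_hom_zero[OF l(3) m(2,2)] module_facts(2)[OF m(2)]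
  by (intro bexI[of _ "0[cmod B (Suc p)]"]) simp_all
qed

text \<open>\<open>connects\<close> is linear, total on cocycles from both sides, and matches
  \<open>S\<close> with the coboundaries of \<open>A\<close>. \<open>S\<close> is kept abstract for
  its two uses: the coboundaries of \<open>C\<close>, and in Cech degree 0 the global sections that
  lift to \<open>B\<close>.\<close>

lemma cech_dim_connects:
 assumes onto: "!!xs. set xs <= J ==> xs ~= [] ==> Sec C (cop W U xs) <= psi (cop W U xs) ` Sec B (cop W U xs)"
  and S: "!!c. c \<in> cech_cocycles C (Suc p) ==> c \<in> S \<longleftrightarrow> lifts p c"
 shows "quotient_has_dim (cmod C (Suc p)) (cech_cocycles C (Suc p)) S d \<longleftrightarrow> cech_dim A (Suc p) d"
 unfolding cech_dim_def
proof (rule quotient_has_dim_iff[OF module_cmod[OF PC] module_cmod[OF PA], where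
  R = "%c a. c \<in> cech_cocycles C (Suc p) & a \<in> cech_cocycles A (Suc (Suc p)) & connects p c a"])
 let ?R = "%c a. c \<in> cech_cocycles C (Suc p) & a \<in> cech_cocycles A (Suc (Suc p)) & connects p c a"
 note zC = cech_cocycles_module[OF PC, where p = "Suc p"] and zA = cech_cocycles_module[OF PA, where p = "Suc (Suc p)"]
 have cl: "c \<in> carrier (cmod C (Suc p))" "a \<in> carrier (cmod A (Suc (Suc p)))" if "?R c a" for c a
  using that by (simp_all add: cech_cocycles_def)
 show "\<exists>a. ?R c a" if c: "c \<in> cech_cocycles C (Suc p)" for c
 proof -
  have cc: "cocycle C W U J (Suc p) c" using c by (simp add: cech_cocycles_def)
  have "c xs \<in> psi (cop W U xs) ` Sec B (cop W U xs)" if "length xs = Suc p" "set xs <= J" for xs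
   by (rule subsetD[OF onto[OF that(2)] chainD[OF conjunct1[OF cc[unfolded cocycle_def]] that]]) (use that(1) in auto)
  then obtain a where a: "connects p c a" "cocycle A W U J (Suc (Suc p)) a" using connects_right[OF _ cc] by metis
  have "connects p c (restrict a (idx (Suc (Suc p))))"
   using a(1) by (subst connects_cong[of _ _ c _ a]) simp_all
  then show ?thesis using c restrict_cocycle[OF a(2)] by blast
 qed
 show left: "\<exists>c. ?R c a" if a: "a \<in> cech_cocycles A (Suc (Suc p))" for a
 proof -
  have "cocycle A W U J (Suc (Suc p)) a" using a by (simp add: cech_cocycles_def)
  then obtain c where c: "connects p c a" "cocycle C W U J (Suc p) c" using connects_left by metis
  have "connects p (restrict c (idx (Suc p))) a"
   using c(1) by (subst connects_cong[of _ _ c _ a]) simp_all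
  then show ?thesis using a restrict_cocycle[OF c(2)] by blast
 qed
 show "?R 0[cmod C (Suc p)] 0[cmod A (Suc (Suc p))]"
  using left[OF zA(1)] connects_linear(3)[OF cl(1) cl(1) cl(2) cl(2)] zC(1) zA(1) by blast
 show "?R (x +[cmod C (Suc p)] y) (x' +[cmod A (Suc (Suc p))] y')" if "?R x x'" "?R y y'" for x x' y y'
  using that connects_linear(1)[OF cl(1)[OF that(1)] cl(1)[OF that(2)] cl(2)[OF that(1)] cl(2)[OF that(2)]] zC(2) zA(2) by simp
 show "?R (k *[cmod C (Suc p)] x) (k *[cmod A (Suc (Suc p))] x')" if "?R x x'" for k x x'
  using that connects_linear(2)[OF cl(1)[OF that] cl(1)[OF that] cl(2)[OF that] cl(2)[OF that]] zC(3) zA(3) by simp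
 show "c \<in> S \<longleftrightarrow> a \<in> cech_coboundaries A (Suc p)" if R: "?R c a" for c a
  using connects_coboundary[of p c a] S[of c] R by (simp add: cech_coboundaries_def cech_cocycles_def cocycle_def)
qed (auto simp: cech_cocycles_def)

theorem cech_dim_shift:
 assumes onto: "!!xs. set xs <= J ==> xs ~= [] ==> Sec C (cop W U xs) <= psi (cop W U xs) ` Sec B (cop W U xs)"
 shows "cech_dim C (Suc p) d \<longleftrightarrow> cech_dim A (Suc (Suc p)) d"
proof -
 have "Sec C (cop W U xs) <= psi (cop W U xs) ` Sec B (cop W U xs)" if "length xs = Suc p" "set xs <= J" for xs
  by (rule onto[OF that(2)]) (use that(1) in auto)
 then show ?thesis
  unfolding cech_dim_def[of C]
  by (intro cech_dim_connects[OF onto]) (simp_all add: cech_coboundaries_def cech_cocycles_def coboundary_lift_iff)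
qed

text \<open>The hypothesis \<open>onto\<close> leaves out the empty list, that is, \<open>W\<close>
  itself: the cokernel of \<open>psi\<close> over \<open>W\<close> is what becomes the Cech
  cohomology of \<open>A\<close> in degree 1.\<close>

theorem cech_dim_1:
 assumes onto: "!!xs. set xs <= J ==> xs ~= [] ==> Sec C (cop W U xs) <= psi (cop W U xs) ` Sec B (cop W U xs)"
 shows "quotient_has_dim (sections C W) (Sec C W) (psi W ` Sec B W) d \<longleftrightarrow> cech_dim A (Suc 0) d"
proof -
 have psiW: "psi W ` Sec B W <= Sec C W" using linear_homD(1)[OF hompsi[OF open_W]] by blast
 have ev: "psi (cop W U xs) (cdiff B W U g xs) = glob C (psi W (g [])) xs"
  if g: "chain B W U J 0 g" and xs: "xs \<in> idx (Suc 0)" for g xs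
 proof -
  have t: "g [] \<in> Sec B W" using chainD[OF g, of "[]"] by simp
  have "cdiff B W U g xs = cdiff B W U (%_. g []) xs"
   by (rule cdiff_cong) (use idxD(1)[OF xs] in auto)
  then show ?thesis
   using psi open_W open_cop[OF idxD(2)[OF xs]] t xs unfolding cdiff_singleton[OF PB t idxD[OF xs]] sheaf_hom_def
   by (simp add: glob_def cop_def)
 qed
 have S: "c \<in> glob C ` psi W ` Sec B W \<longleftrightarrow> lifts 0 c"
  if c: "c \<in> cech_cocycles C (Suc 0)" for c
 proof
  assume "c \<in> glob C ` psi W ` Sec B W"
  then obtain t where t: "t \<in> Sec B W" "c = glob C (psi W t)" by blast
  have "chain B W U J 0 (%_. t)" using t by (simp add: chain_def)
  then show "lifts 0 c"
   using ev[of "%_. t"] t(2) by (intro exI[of _ "%_. t"]) (simp add: idx_def)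
 next
  assume "lifts 0 c"
  then obtain g where g: "chain B W U J 0 g" "!!xs. xs \<in> idx (Suc 0) ==> psi (cop W U xs) (cdiff B W U g xs) = c xs"
   by (auto simp: idx_def)
  have t: "g [] \<in> Sec B W" using chainD[OF g(1), of "[]"] by simp
  have "c = glob C (psi W (g []))"
   using c linear_homD(1)[OF linear_glob[OF PC]] psiW t ev[OF g(1)] g(2)
   by (intro cmod_eqI[of _ C "Suc 0"]) (auto simp: cech_cocycles_def)
  then show "c \<in> glob C ` psi W ` Sec B W" using t by blast
 qed
 show ?thesis
  unfolding quotient_has_dim_glob[OF C cover psiW] by (rule cech_dim_connects[OF onto S])
qed

end

section \<open>Kernel sheaves and the cohomology of a flasque resolution\<close>

definition ker_sheaf :: "('p, 'k::field, 'v) sheaf_data => ('p, 'k, 'w) sheaf_data => ('p set => 'v => 'w) =>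
  ('p, 'k, 'v) sheaf_data"
 where "ker_sheaf F G phi = \<lparr>sections = (%U. (sections F U)\<lparr>carrier := {s \<in> Sec F U. phi U s = 0[sections G U]}\<rparr>),
  restr = restr F\<rparr>"

lemma ker_sheaf_simps [simp]:
 "Sec (ker_sheaf F G phi) U = {s \<in> Sec F U. phi U s = 0[sections G U]}"
 "0[sections (ker_sheaf F G phi) U] = 0[sections F U]"
 "x +[sections (ker_sheaf F G phi) U] y = x +[sections F U] y"
 "a *[sections (ker_sheaf F G phi) U] x = a *[sections F U] x"
 "restr (ker_sheaf F G phi) = restr F"
 by (simp_all add: ker_sheaf_def)

lemma sheaf_homD:
 assumes "sheaf_hom X F G phi"
 shows "openin X U ==> linear_hom (sections F U) (sections G U) (phi U)"
  and "openin X U ==> openin X V ==> V <= U ==> s \<in> Sec F U ==> phi V (restr F U V s) = restr G U V (phi U s)"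
 using assms by (simp_all add: sheaf_hom_def)

lemma sheaf_ker:
 assumes F: "sheaf X F" and G: "sheaf X G" and phi: "sheaf_hom X F G phi"
 shows "sheaf X (ker_sheaf F G phi)"
proof -
 have PF: "presheaf X F" and PG: "presheaf X G" using F G by (auto intro: sheaf_presheaf)
 let ?K = "ker_sheaf F G phi"
 have h: "linear_hom (sections F U) (sections G U) (phi U)" if "openin X U" for U
  using sheaf_homD(1)[OF phi that] .
 have res: "restr F U V s \<in> Sec ?K V" if o: "openin X U" "openin X V" "V <= U" and s: "s \<in> Sec ?K U" for U V s
 proof -
  have "phi V (restr F U V s) = restr G U V 0[sections G U]"
   using sheaf_homD(2)[OF phi o] s by simp
  then show ?thesis
   using psh_restr_closed[OF PF o] s
    linear_hom_zero[OF psh_restr_hom[OF PG o] psh_mod[OF PG o(1)] psh_mod[OF PG o(2)]] by simp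
 qed
 have mod: "is_module (sections ?K U)" if o: "openin X U" for U
 proof (rule submoduleI[OF psh_mod[OF PF o]])
  note MF = module_facts[OF psh_mod[OF PF o]] and MG = module_facts[OF psh_mod[OF PG o]]
  show "x +[sections ?K U] y = x +[sections F U] y & x +[sections F U] y \<in> Sec ?K U"
   if "x \<in> Sec ?K U" "y \<in> Sec ?K U" for x y
   using that MF(1) MG(2) MG(6) linear_homD(2)[OF h[OF o]] by simp
  show "a *[sections ?K U] x = a *[sections F U] x & a *[sections F U] x \<in> Sec ?K U"
   if "x \<in> Sec ?K U" for a x
   using that MF(3) MG(12) linear_homD(3)[OF h[OF o]] by simp
  show "0[sections F U] \<in> Sec ?K U"
   using MF(2) linear_hom_zero[OF h[OF o] psh_mod[OF PF o] psh_mod[OF PG o]] by simp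
 qed auto
 have pre: "presheaf X ?K"
  unfolding presheaf_def
 proof (intro conjI allI impI)
  fix U V assume o: "openin X U & openin X V & V <= U"
  show "linear_hom (sections ?K U) (sections ?K V) (restr ?K U V)"
   unfolding linear_hom_def
   using res[of U V] o psh_restr_hom[OF PF, of U V] by (auto simp: linear_hom_def)
 next
  fix U V W assume o: "openin X U & openin X V & openin X W & W <= V & V <= U"
  show "\<forall>s\<in>Sec ?K U. restr ?K V W (restr ?K U V s) = restr ?K U W s"
   using psh_restr_restr[OF PF, of U V W] o by simp
 qed (use mod psh_restr_self[OF PF] in auto)
 show ?thesis
  unfolding sheaf_def
 proof (intro conjI pre allI impI)
  fix \<U> s assume H: "(\<forall>V\<in>\<U>. openin X V & s V \<in> Sec ?K V) &
    (\<forall>V\<in>\<U>. \<forall>W\<in>\<U>. restr ?K V (V \<inter> W) (s V) = restr ?K W (V \<inter> W) (s W))"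
  have 1: "\<forall>V\<in>\<U>. openin X V & s V \<in> Sec F V" using H by simp
  have 2: "\<forall>V\<in>\<U>. \<forall>W\<in>\<U>. restr F V (V \<inter> W) (s V) = restr F W (V \<inter> W) (s W)"
   by (rule conjunct2[OF H, unfolded ker_sheaf_simps])
  have oU: "openin X (\<Union>\<U>)" using 1 by (intro openin_Union) auto
  note ex1 = sheaf_ex1[OF F 1 2]
  then obtain a where a: "a \<in> Sec F (\<Union>\<U>)" "\<forall>V\<in>\<U>. restr F (\<Union>\<U>) V a = s V" by auto
  have "phi (\<Union>\<U>) a = 0[sections G (\<Union>\<U>)]"
  proof (rule sheaf_locality[OF G])
   show "\<Union>\<U> = (\<Union>V\<in>\<U>. V)" by simp
   show "phi (\<Union>\<U>) a \<in> Sec G (\<Union>\<U>)" by (rule linear_homD(1)[OF h[OF oU] a(1)])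
   show "0[sections G (\<Union>\<U>)] \<in> Sec G (\<Union>\<U>)" by (rule module_facts(2)[OF psh_mod[OF PG oU]])
   fix V assume V: "V \<in> \<U>"
   then show oV: "openin X V" using 1 by simp
   have sub: "V <= \<Union>\<U>" using V by blast
   have "restr G (\<Union>\<U>) V (phi (\<Union>\<U>) a) = phi V (s V)"
    using sheaf_homD(2)[OF phi oU oV sub a(1)] a(2) V by simp
   also have "... = 0[sections G V]" using H V by simp
   also have "... = restr G (\<Union>\<U>) V 0[sections G (\<Union>\<U>)]"
    using linear_hom_zero[OF psh_restr_hom[OF PG oU oV sub] psh_mod[OF PG oU] psh_mod[OF PG oV]] ..
   finally show "restr G (\<Union>\<U>) V (phi (\<Union>\<U>) a) = restr G (\<Union>\<U>) V 0[sections G (\<Union>\<U>)]" .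
  qed
  then show "\<exists>!a. a \<in> Sec ?K (\<Union>\<U>) & (\<forall>V\<in>\<U>. restr ?K (\<Union>\<U>) V a = s V)"
   using a ex1 by (intro ex1I[of _ a]) auto
 qed
qed

text \<open>Local preimages under the injective map \<open>phi\<close> are unique, hence agree on
  overlaps and glue. So exactness at \<open>B\<close> holds for sections and not just
  locally.\<close>

lemma sheaf_exact_global:
 assumes A: "sheaf X A" and B: "sheaf X B" and C: "sheaf X C" and phi: "sheaf_hom X A B phi"
  and inj: "!!V. openin X V ==> inj_on (phi V) (Sec A V)"
  and ex: "sheaf_exact X A phi B psi C" and V: "openin X V" and s: "s \<in> Sec B V"
 shows "psi V s = 0[sections C V] \<longleftrightarrow> s \<in> phi V ` Sec A V"
proof -
 have PA: "presheaf X A" and PB: "presheaf X B" using A B by (auto intro: sheaf_presheaf)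
 have local: "psi V s = 0[sections C V] \<longleftrightarrow>
    (\<forall>x\<in>V. \<exists>V'. openin X V' & x \<in> V' & V' <= V & (\<exists>a\<in>Sec A V'. phi V' a = restr B V V' s))"
  using ex V s unfolding sheaf_exact_def by simp
 show ?thesis
 proof
  assume "s \<in> phi V ` Sec A V"
  then obtain a where "a \<in> Sec A V" "phi V a = restr B V V s"
   using psh_restr_self[OF PB V s] by auto
  then show "psi V s = 0[sections C V]" unfolding local using V by blast
 next
  assume "psi V s = 0[sections C V]"
  then have "\<exists>V' a. openin X V' & x \<in> V' & V' <= V & a \<in> Sec A V' & phi V' a = restr B V V' s" if "x \<in> V" for x
   using that unfolding local by blast
  then obtain N a where N: "!!x. x \<in> V ==> openin X (N x)" "!!x. x \<in> V ==> x \<in> N x" "!!x. x \<in> V ==> N x <= V"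
   "!!x. x \<in> V ==> a x \<in> Sec A (N x)" "!!x. x \<in> V ==> phi (N x) (a x) = restr B V (N x) s"
   by metis
  have un: "V = (\<Union>x\<in>V. N x)" using N(2,3) by blast
  obtain t where t: "t \<in> Sec A V" "!!x. x \<in> V ==> restr A V (N x) t = a x"
  proof (rule sheaf_glue[OF A N(1) N(4) _ un])
   fix x y assume xy: "x \<in> V" "y \<in> V"
   have o: "openin X (N x \<inter> N y)" using N(1) xy by (intro openin_Int)
   have sub: "N x \<inter> N y <= N x" "N x \<inter> N y <= N y" by auto
   show "restr A (N x) (N x \<inter> N y) (a x) = restr A (N y) (N x \<inter> N y) (a y)"
   proof (rule inj_onD[OF inj[OF o]])
    show "phi (N x \<inter> N y) (restr A (N x) (N x \<inter> N y) (a x)) = phi (N x \<inter> N y) (restr A (N y) (N x \<inter> N y) (a y))"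
     using sheaf_homD(2)[OF phi N(1)[OF xy(1)] o sub(1) N(4)[OF xy(1)]]
      sheaf_homD(2)[OF phi N(1)[OF xy(2)] o sub(2) N(4)[OF xy(2)]] N(5) xy
      psh_restr_restr[OF PB V N(1)[OF xy(1)] o sub(1) N(3)[OF xy(1)] s]
      psh_restr_restr[OF PB V N(1)[OF xy(2)] o sub(2) N(3)[OF xy(2)] s] by simp
   qed (use psh_restr_closed[OF PA] N xy o sub in auto)
  qed (assumption | rule that)+
  have "phi V t = s"
  proof (rule sheaf_locality[OF B N(1) un])
   show "phi V t \<in> Sec B V" by (rule linear_homD(1)[OF sheaf_homD(1)[OF phi V] t(1)])
   show "restr B V (N x) (phi V t) = restr B V (N x) s" if "x \<in> V" for x
    using sheaf_homD(2)[OF phi V N(1)[OF that] N(3)[OF that] t(1)] t(2)[OF that] N(5)[OF that] by simp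
  qed (use s in auto)
  then show "s \<in> phi V ` Sec A V" using t(1) by blast
 qed
qed

text \<open>With \<open>C\<close> replaced by the kernel of \<chi>, exactness at \<open>C\<close>
  becomes local surjectivity of \<open>psi\<close>.\<close>

lemma sheaf_ses_ker:
 assumes A: "sheaf X A" and B: "flasque X B" and C: "sheaf X C" and D: "sheaf X D"
  and phi: "sheaf_hom X A B phi" and psi: "sheaf_hom X B C psi" and \<chi>: "sheaf_hom X C D \<chi>"
  and inj: "!!V. openin X V ==> inj_on (phi V) (Sec A V)"
  and exact: "!!V s. openin X V ==> s \<in> Sec B V ==> psi V s = 0[sections C V] \<longleftrightarrow> s \<in> phi V ` Sec A V"
  and ex: "sheaf_exact X B psi C \<chi> D"
 shows "sheaf_ses X A phi B psi (ker_sheaf C D \<chi>)"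
proof -
 have PB: "presheaf X B" and PC: "presheaf X C"
  using flasque_sheaf[OF B] C by (auto intro: sheaf_presheaf)
 have loc: "\<chi> V s = 0[sections D V] \<longleftrightarrow> (\<forall>x\<in>V. \<exists>V'. openin X V' & x \<in> V' & V' <= V &
      (\<exists>a\<in>Sec B V'. psi V' a = restr C V V' s))" if "openin X V" "s \<in> Sec C V" for V s
  using ex that unfolding sheaf_exact_def by simp
 have mem: "psi V t \<in> Sec (ker_sheaf C D \<chi>) V" if V: "openin X V" and t: "t \<in> Sec B V" for V t
 proof -
  have tC: "psi V t \<in> Sec C V" by (rule linear_homD(1)[OF sheaf_homD(1)[OF psi V] t])
  have "\<chi> V (psi V t) = 0[sections D V]"
   unfolding loc[OF V tC]
   by (intro ballI exI[of _ V] conjI bexI[of _ t]) (simp_all add: V t psh_restr_self[OF PC V tC])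
  then show ?thesis using tC by simp
 qed
 show ?thesis
 proof
  show "sheaf X (ker_sheaf C D \<chi>)" by (rule sheaf_ker[OF C D \<chi>])
  show "sheaf_hom X B (ker_sheaf C D \<chi>) psi"
   unfolding sheaf_hom_def
  proof (intro conjI allI impI ballI)
   fix U assume U: "openin X U"
   show "linear_hom (sections B U) (sections (ker_sheaf C D \<chi>) U) (psi U)"
    using sheaf_homD(1)[OF psi U] mem[OF U] by (auto simp: linear_hom_def)
  qed (use sheaf_homD(2)[OF psi] in simp)
  show "psi V s = 0[sections (ker_sheaf C D \<chi>) V] \<longleftrightarrow> s \<in> phi V ` Sec A V" if "openin X V" "s \<in> Sec B V" for V s
   using exact[OF that] by simp
  fix V s x assume V: "openin X V" and s: "s \<in> Sec (ker_sheaf C D \<chi>) V" and x: "x \<in> V"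
  have sC: "s \<in> Sec C V" "\<chi> V s = 0[sections D V]" using s by auto
  show "\<exists>V'. openin X V' & x \<in> V' & V' <= V & (\<exists>t\<in>Sec B V'. psi V' t = restr (ker_sheaf C D \<chi>) V V' s)"
   using bspec[OF iffD1[OF loc[OF V sC(1)] sC(2)] x] by simp
 qed (use A B phi inj in auto)
qed

text \<open>The resolution is cut into short exact sequences with the kernels \<open>Z n\<close>.
  Cartan's criterion hands acyclicity of \<open>F\<close> on to them, so Cech dimensions shift.
  Cocycles modulo coboundaries in degree n + 1 form the cokernel on global sections over
  \<open>Z (Suc n)\<close>, which is Cech cohomology of the preceding kernel, or of \<open>F\<close>
  if n = 0, in degree 1.\<close>

theorem flasque_resolution_cohomology:
 fixes X :: "'p topology" and F :: "('p, 'k::field, 'v) sheaf_data"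
  and I :: "nat => ('p, 'k, 'w) sheaf_data"
 assumes basis: "open_basis X \<B>" and res: "flasque_resolution X F \<epsilon> I \<delta>"
  and acyclic: "open_basis.cech_acyclic \<B> F"
  and fin: "finite J" and cover: "topspace X = (\<Union>j\<in>J. U j)" and U: "!!j. j \<in> J ==> U j \<in> \<B>"
 shows "quotient_has_dim (sections (I i) (topspace X)) (cocycles X I \<delta> i) (coboundaries X I \<delta> i) d \<longleftrightarrow>
  cech.cech_dim (topspace X) U J F i d"
proof -
 interpret open_basis X \<B> by (rule basis)
 let ?W = "topspace X"
 interpret cech X ?W U J
  by unfold_locales (use U basis_open in auto)
 have F: "sheaf X F" and Ifl: "!!n. flasque X (I n)" and \<epsilon>: "sheaf_hom X F (I 0) \<epsilon>"
  and \<delta>: "!!n. sheaf_hom X (I n) (I (Suc n)) (\<delta> n)"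
  and inj: "!!V. openin X V ==> inj_on (\<epsilon> V) (Sec F V)"
  and ex0: "sheaf_exact X F \<epsilon> (I 0) (\<delta> 0) (I 1)"
  and ex: "!!n. sheaf_exact X (I n) (\<delta> n) (I (Suc n)) (\<delta> (Suc n)) (I (Suc (Suc n)))"
  using res unfolding flasque_resolution_def by simp_all
 have Ish: "sheaf X (I n)" for n by (rule flasque_sheaf[OF Ifl])
 have Ipre: "presheaf X (I n)" for n by (rule sheaf_presheaf[OF Ish])
 define Z where "Z n = ker_sheaf (I n) (I (Suc n)) (\<delta> n)" for n
 have Zsh: "sheaf X (Z n)" for n unfolding Z_def by (rule sheaf_ker[OF Ish Ish \<delta>])
 have ses0: "sheaf_ses X F \<epsilon> (I 0) (\<delta> 0) (Z (Suc 0))"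
  unfolding Z_def
  by (rule sheaf_ses_ker[OF F Ifl Ish Ish \<epsilon> \<delta> \<delta> inj _ ex])
    (use sheaf_exact_global[OF F Ish Ish \<epsilon> inj ex0] in auto)
 have ses: "sheaf_ses X (Z n) (%_ s. s) (I n) (\<delta> n) (Z (Suc n))" for n
  unfolding Z_def[of "Suc n"]
 proof (rule sheaf_ses_ker[OF Zsh Ifl Ish Ish _ \<delta> \<delta> _ _ ex])
  show "sheaf_hom X (Z n) (I n) (%_ s. s)"
   by (auto simp: sheaf_hom_def linear_hom_def Z_def)
 qed (auto simp: Z_def)
 have Zac: "cech_acyclic (Z (Suc n))" for n
 proof (induction n)
  case 0
  show ?case by (rule ses_cech_acyclic[OF ses0 acyclic])
 next
  case (Suc n)
  show ?case by (rule ses_cech_acyclic[OF ses Suc])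
 qed
 \<comment> \<open>For the empty list this would be the whole space, which need not belong to the
   basis.\<close>
 have copB: "cop ?W U xs \<in> \<B>" if "set xs <= J" "xs ~= []" for xs
  using that
 proof (induction xs)
  case (Cons j xs)
  show ?case
  proof (cases "xs = []")
   case True
   have "U j <= ?W" using Cons.prems cover by auto
   then have "cop ?W U [j] = U j" by (auto simp: cop_def)
   then show ?thesis using Cons.prems U True by simp
  next
   case False
   then show ?thesis using Cons U basis_Int by (simp add: cop_Cons)
  qed
 qed simp
 have sc0: "ses_cech X F \<epsilon> (I 0) (\<delta> 0) (Z (Suc 0)) ?W U J"
  by (intro ses_cech.intro ses0 cech_axioms ses_cech_axioms.intro fin) (simp add: cover)
 have sc: "ses_cech X (Z n) (%_ s. s) (I n) (\<delta> n) (Z (Suc n)) ?W U J" for n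
  by (intro ses_cech.intro ses cech_axioms ses_cech_axioms.intro fin) (simp add: cover)
 have onto0: "Sec (Z (Suc 0)) (cop ?W U xs) <= \<delta> 0 (cop ?W U xs) ` Sec (I 0) (cop ?W U xs)"
  if "set xs <= J" "xs ~= []" for xs
  by (rule ses_sections_onto[OF ses0 acyclic copB[OF that]])
 have onto: "Sec (Z (Suc (Suc n))) (cop ?W U xs) <= \<delta> (Suc n) (cop ?W U xs) ` Sec (I (Suc n)) (cop ?W U xs)"
  if "set xs <= J" "xs ~= []" for xs n
  by (rule ses_sections_onto[OF ses Zac copB[OF that]])
 have shift: "cech_dim (Z (Suc n)) (Suc p) d \<longleftrightarrow> cech_dim F (Suc (Suc p) + n) d" for n p
 proof (induction n arbitrary: p)
  case 0
  show ?case using ses_cech.cech_dim_shift[OF sc0 onto0] by simp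
 next
  case (Suc n)
  show ?case using ses_cech.cech_dim_shift[OF sc onto] Suc[of "Suc p"] by simp
 qed
 have MI: "is_module (sections (I n) ?W)" for n by (rule psh_mod[OF Ipre]) simp
 show ?thesis
 proof (cases i)
  case 0
  have MF: "is_module (sections F ?W)" by (rule psh_mod[OF sheaf_presheaf[OF F]]) simp
  have h: "linear_hom (sections F ?W) (sections (I 0) ?W) (\<epsilon> ?W)" by (rule sheaf_homD(1)[OF \<epsilon>]) simp
  have im: "cocycles X I \<delta> 0 = \<epsilon> ?W ` Sec F ?W"
   using sheaf_exact_global[OF F Ish Ish \<epsilon> inj ex0, of ?W] linear_homD(1)[OF h]
   by (auto simp: cocycles_def)
  have "s \<in> {0[sections F ?W]} \<longleftrightarrow> \<epsilon> ?W s \<in> coboundaries X I \<delta> 0" if s: "s \<in> Sec F ?W" for s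
   using inj_onD[OF inj[of ?W] _ s, of "0[sections F ?W]"] module_facts(2)[OF MF] linear_hom_zero[OF h MF MI] by auto
  from quotient_has_dim_hom[OF MF MI h this]
  have "quotient_has_dim (sections F ?W) (Sec F ?W) {0[sections F ?W]} d \<longleftrightarrow>
    quotient_has_dim (sections (I 0) ?W) (cocycles X I \<delta> 0) (coboundaries X I \<delta> 0) d"
   unfolding im by simp
  then show ?thesis using cech_dim_0[OF F] cover 0 by simp
 next
  case (Suc n)
  have MZ: "is_module (sections (Z (Suc n)) ?W)" by (rule psh_mod[OF sheaf_presheaf[OF Zsh]]) simp
  have eq: "cocycles X I \<delta> (Suc n) = Sec (Z (Suc n)) ?W" "coboundaries X I \<delta> (Suc n) = \<delta> n ?W ` Sec (I n) ?W"
   by (auto simp: cocycles_def Z_def)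
  have 1: "quotient_has_dim (sections (I (Suc n)) ?W) (cocycles X I \<delta> (Suc n)) (coboundaries X I \<delta> (Suc n)) d \<longleftrightarrow>
   quotient_has_dim (sections (Z (Suc n)) ?W) (Sec (Z (Suc n)) ?W) (\<delta> n ?W ` Sec (I n) ?W) d"
   unfolding eq
   using quotient_has_dim_hom[OF MZ MI[of "Suc n"], where phi = "%s. s" and B = "\<delta> n ?W ` Sec (I n) ?W"
    and B' = "\<delta> n ?W ` Sec (I n) ?W"] by (simp add: linear_hom_def Z_def)
  have 2: "quotient_has_dim (sections (Z (Suc n)) ?W) (Sec (Z (Suc n)) ?W) (\<delta> n ?W ` Sec (I n) ?W) d \<longleftrightarrow>
    cech_dim F (Suc n) d"
  proof (cases n)
   case 0
   then show ?thesis using ses_cech.cech_dim_1[OF sc0 onto0] by simp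
  next
   case (Suc m)
   then show ?thesis using ses_cech.cech_dim_1[OF sc onto] shift[of m 0] by simp
  qed
  show ?thesis using 1 2 Suc by simp
 qed
qed

subsection \<open>The homogeneous Nullstellensatz\<close>

lemma prime_idealD:
 assumes "prime_ideal P"
 shows "is_ideal P" "1 \<notin> P" "a * b \<in> P \<longleftrightarrow> a \<in> P \<or> b \<in> P"
 using assms ideal.subspace_scale[of P] ideal_mult_right[of P a b]
 unfolding prime_ideal_def by auto

lemma prime_ideal_power: "prime_ideal P ==> a ^ n \<in> P \<longleftrightarrow> a \<in> P & n ~= 0"
 by (induction n) (auto simp: prime_idealD)

lemma proj_pointsD:
 assumes "P \<in> proj_points J"
 shows "homogeneous_ideal P" "prime_ideal P" "J <= P" "\<not> irrelevant_ideal <= P"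
 using assms by (simp_all add: proj_points_def)

lemma hcomp_sum: "hcomp e (\<Sum>i\<in>A. f i) = (\<Sum>i\<in>A. hcomp e (f i))"
 for f :: "'i => ('n::finite, 'k::field) mpol"
 by (simp only: hcomp_def part_sum)

text \<open>If neither factor lies in \<open>P\<close>, take in each the component of highest degree
  outside \<open>P\<close>. Their product is a component of the whole product up to elements of
  \<open>P\<close>, so it lies in \<open>P\<close>, against the homogeneous hypothesis.\<close>

lemma homog_prime_idealI:
 fixes P :: "('n::finite, 'k::field) mpol set"
 assumes P: "homogeneous_ideal P" "1 \<notin> P"
  and prime: "!!a b e e'. homogeneous e a ==> homogeneous e' b ==> a * b \<in> P ==> a \<in> P \<or> b \<in> P"
 shows "prime_ideal P"
 unfolding prime_ideal_def
proof (intro conjI allI impI)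
 show I: "is_ideal P" by (rule homogeneous_ideal_is_ideal[OF P(1)])
 show "1 \<notin> P" by (rule P(2))
 let ?E = "%f :: ('n, 'k) mpol. (%m. int (mon_degree m)) ` keys f"
 have top: "\<exists>e. hcomp e f \<notin> P & (\<forall>i>e. hcomp i f \<in> P)" if "f \<notin> P" for f
 proof -
  let ?B = "{e \<in> ?E f. hcomp e f \<notin> P}"
  have fin: "finite ?B" by simp
  have "f \<in> P" if "?B = {}"
   by (subst sum_hcomp[of f], rule ideal.subspace_sum[OF I]) (use that in auto)
  then have ne: "?B ~= {}" using \<open>f \<notin> P\<close> by blast
  have "hcomp i f \<in> P" if i: "i > Max ?B" for i
  proof (cases "i \<in> ?E f")
   case True
   show ?thesis
   proof (rule ccontr)
    assume "hcomp i f \<notin> P"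
    then have "i \<le> Max ?B" by (intro Max_ge fin CollectI conjI True)
    then show False using i by linarith
   qed
  next
   case False
   then have "hcomp i f = 0" unfolding hcomp_def by (intro part_eq_0) auto
   then show ?thesis using ideal.subspace_0[OF I] by simp
  qed
  then show ?thesis using Max_in[OF fin ne] by blast
 qed
 fix a b assume ab: "a * b \<in> P"
 show "a \<in> P \<or> b \<in> P"
 proof (rule ccontr)
  assume "\<not> (a \<in> P \<or> b \<in> P)"
  then obtain e e' where e: "hcomp e a \<notin> P" "!!i. i > e ==> hcomp i a \<in> P"
   and e': "hcomp e' b \<notin> P" "!!i. i > e' ==> hcomp i b \<in> P"
   using top by metis
  have "e' \<in> ?E b"
  proof (rule ccontr)
   assume "e' \<notin> ?E b"
   then have "hcomp e' b = 0" unfolding hcomp_def by (intro part_eq_0) auto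
   then show False using e'(1) ideal.subspace_0[OF I] by simp
  qed
  have "hcomp (e + e') (a * b) = hcomp (e + e') (\<Sum>i\<in>?E b. a * hcomp i b)"
   by (subst sum_hcomp[of b]) (simp add: sum_distrib_left)
  also have "... = (\<Sum>i\<in>?E b. hcomp (e + e' - i) a * hcomp i b)"
   by (simp only: hcomp_sum hcomp_mult_homogeneous[OF homog_hcomp])
  also have "... = hcomp e a * hcomp e' b + (\<Sum>i\<in>?E b - {e'}. hcomp (e + e' - i) a * hcomp i b)"
   using \<open>e' \<in> ?E b\<close> by (subst sum.remove[of _ e']) auto
  finally have eq: "hcomp e a * hcomp e' b =
   hcomp (e + e') (a * b) - (\<Sum>i\<in>?E b - {e'}. hcomp (e + e' - i) a * hcomp i b)" by simp
  have "hcomp e a * hcomp e' b \<in> P"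
   unfolding eq
  proof (intro ideal.subspace_diff[OF I] ideal.subspace_sum[OF I] homogeneous_ideal_hcomp[OF P(1) ab])
   fix i assume "i \<in> ?E b - {e'}"
   then consider "i > e'" | "e + e' - i > e" by fastforce
   then show "hcomp (e + e' - i) a * hcomp i b \<in> P"
    using e(2) e'(2) ideal.subspace_scale[OF I] ideal_mult_right[OF I] by cases auto
  qed
  then show False using prime[OF homog_hcomp homog_hcomp] e(1) e'(1) by blast
 qed
qed

lemma homogeneous_ideal_insert:
 fixes P :: "('n::finite, 'k::field) mpol set"
 assumes P: "homogeneous_ideal P" and a: "homogeneous d a"
 shows "homogeneous_ideal (ideal_gen (insert a P))"
proof (rule homogeneous_idealI)
 have I: "is_ideal P" by (rule homogeneous_ideal_is_ideal[OF P])
 have span: "ideal_gen P = P" using I by simp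
 fix f e assume "f \<in> ideal_gen (insert a P)"
 then obtain k where "f - k * a \<in> P" unfolding ideal.span_breakdown_eq span by blast
 then have "hcomp e (f - k * a) \<in> P" by (rule homogeneous_ideal_hcomp[OF P])
 then show "hcomp e f \<in> ideal_gen (insert a P)"
  unfolding ideal.span_breakdown_eq span by (auto simp: hcomp_diff hcomp_mult_homogeneous[OF a])
qed (rule ideal.subspace_span)

text \<open>A homogeneous ideal maximal among those that contain \<open>A\<close> and no power of
  \<open>g\<close> is prime. The positive degree of \<open>g\<close> puts \<open>g\<close> into the
  irrelevant ideal, so this prime is a point of the scheme at which \<open>g\<close> does not
  vanish.\<close>

lemma homog_nullstellensatz_ideal:
 fixes A :: "('n::finite, 'k::field) mpol set"
 assumes A: "homogeneous_ideal A" "J <= A" and g: "homogeneous e g" "e > 0"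
  and vanish: "!!P. P \<in> proj_points J ==> A <= P ==> g \<in> P"
 shows "\<exists>M. g ^ M \<in> A"
proof (rule ccontr)
 assume no: "\<nexists>M. g ^ M \<in> A"
 let ?S = "{P. homogeneous_ideal P & A <= P & (\<forall>M. g ^ M \<notin> P)}"
 have "\<exists>P\<in>?S. \<forall>Q\<in>?S. P <= Q --> Q = P"
 proof (rule subset_Zorn_nonempty)
  show "?S ~= {}" using A no by blast
  fix C assume C: "C ~= {}" "subset.chain ?S C"
  have sub: "C <= ?S" and lin: "!!P Q. P \<in> C ==> Q \<in> C ==> P <= Q \<or> Q <= P"
   using C(2) by (auto simp: subset_chain_def)
  have hI: "homogeneous_ideal P" "is_ideal P" if "P \<in> C" for P
   using sub that homogeneous_ideal_is_ideal by auto
  have "homogeneous_ideal (\<Union>C)"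
  proof (rule homogeneous_idealI)
   show "is_ideal (\<Union>C)"
   proof (rule ideal.subspaceI)
    show "0 \<in> \<Union>C" using C(1) hI ideal.subspace_0 by blast
   next
    fix x y assume "x \<in> \<Union>C" "y \<in> \<Union>C"
    then obtain P Q where "P \<in> C" "x \<in> P" "Q \<in> C" "y \<in> Q" by blast
    then have "\<exists>R\<in>C. x \<in> R & y \<in> R" using lin[of P Q] by blast
    then show "x + y \<in> \<Union>C" using hI ideal.subspace_add by blast
   next
    fix c x assume "x \<in> \<Union>C"
    then show "c * x \<in> \<Union>C" using hI ideal.subspace_scale by blast
   qed
  qed (use hI homogeneous_ideal_hcomp in blast)
  then show "\<Union>C \<in> ?S" using C(1) sub by auto
 qed
 then obtain P where P: "homogeneous_ideal P" "A <= P" "!!M. g ^ M \<notin> P"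
  and max: "!!Q. homogeneous_ideal Q ==> A <= Q ==> (!!M. g ^ M \<notin> Q) ==> P <= Q ==> Q = P"
  by auto
 have I: "is_ideal P" by (rule homogeneous_ideal_is_ideal[OF P(1)])
 have span: "ideal_gen P = P" using I by simp
 have ex: "\<exists>M k. g ^ M - k * a \<in> P" if a: "homogeneous d a" "a \<notin> P" for a d
 proof (rule ccontr)
  assume "\<nexists>M k. g ^ M - k * a \<in> P"
  then have "g ^ M \<notin> ideal_gen (insert a P)" for M
   unfolding ideal.span_breakdown_eq span by blast
  moreover have "insert a P <= ideal_gen (insert a P)" by (rule ideal.span_superset)
  ultimately have "ideal_gen (insert a P) = P"
   using max[OF homogeneous_ideal_insert[OF P(1) a(1)]] P(2) by blast
  then show False using a(2) ideal.span_base[of a "insert a P"] by simp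
 qed
 have "prime_ideal P"
 proof (rule homog_prime_idealI[OF P(1)])
  show "1 \<notin> P" using P(3)[of 0] by simp
  fix a b d d' assume ab: "homogeneous d a" "homogeneous d' b" "a * b \<in> P"
  show "a \<in> P \<or> b \<in> P"
  proof (rule ccontr)
   assume "\<not> (a \<in> P \<or> b \<in> P)"
   then obtain M k N l where kl: "g ^ M - k * a \<in> P" "g ^ N - l * b \<in> P" using ex ab by metis
   have "g ^ (M + N) = (g ^ M - k * a) * g ^ N + k * a * (g ^ N - l * b) + k * l * (a * b)"
    by (simp add: power_add algebra_simps)
   also have "... \<in> P"
    by (intro ideal.subspace_add[OF I] ideal_mult_right[OF I kl(1)] ideal.subspace_scale[OF I kl(2)]
     ideal.subspace_scale[OF I ab(3)])
   finally show False using P(3) by blast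
  qed
 qed
 moreover have "g \<notin> P" using P(3)[of 1] by simp
 moreover have "g \<in> irrelevant_ideal"
  unfolding irrelevant_ideal_def
 proof (rule CollectI, rule ccontr)
  assume "lookup g 0 ~= 0"
  then have "int (mon_degree (0 :: 'n mon)) = e"
   using g(1) unfolding homogeneous_def by (metis in_keys_iff)
  then show False using g(2) by simp
 qed
 ultimately have "P \<in> proj_points J" using P A(2) by (auto simp: proj_points_def)
 then show False using vanish[of P] P(2) \<open>g \<notin> P\<close> by blast
qed

text \<open>Applied to the ideal generated by \<open>J\<close> and the \<open>y i\<close>, written
  out with finite index sets because \<open>A\<close> may be infinite. Passing to the component in
  the degree of the power of \<open>g\<close> makes the coefficients homogeneous.\<close>

lemma homog_nullstellensatz:
 fixes y :: "'i => ('n::finite, 'k::field) mpol"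
 assumes J: "homogeneous_ideal J" and g: "homogeneous e g" "e > 0"
  and y: "!!i. i \<in> A ==> homogeneous (d i) (y i)"
  and vanish: "!!P. P \<in> proj_points J ==> (!!i. i \<in> A ==> y i \<in> P) ==> g \<in> P"
 obtains M B b where "finite B" "B <= A" "\<forall>i\<in>B. homogeneous (e * int M - d i) (b i)"
  "g ^ M - (\<Sum>i\<in>B. b i * y i) \<in> J"
proof -
 have I: "is_ideal J" by (rule homogeneous_ideal_is_ideal[OF J])
 let ?S = "{f. \<exists>B b. finite B & B <= A & f - (\<Sum>i\<in>B. b i * y i) \<in> J}"
 have "is_ideal ?S"
 proof (rule ideal.subspaceI)
  show "0 \<in> ?S" using ideal.subspace_0[OF I] by (auto intro!: exI[of _ "{}"])
 next
  fix f f' assume "f \<in> ?S" "f' \<in> ?S"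
  then obtain B b B' b' where b: "finite B" "B <= A" "f - (\<Sum>i\<in>B. b i * y i) \<in> J"
   and b': "finite B'" "B' <= A" "f' - (\<Sum>i\<in>B'. b' i * y i) \<in> J" by blast
  let ?c = "%i. (if i \<in> B then b i else 0) + (if i \<in> B' then b' i else 0)"
  have "(\<Sum>i\<in>B \<union> B'. ?c i * y i) =
   (\<Sum>i\<in>B \<union> B'. if i \<in> B then b i * y i else 0) + (\<Sum>i\<in>B \<union> B'. if i \<in> B' then b' i * y i else 0)"
   by (subst sum.distrib[symmetric]) (intro sum.cong refl, simp add: distrib_right)
  also have "... = (\<Sum>i\<in>B. b i * y i) + (\<Sum>i\<in>B'. b' i * y i)"
   using b(1) b'(1) by (simp add: sum.If_cases Int_absorb1 Int_absorb2)
  finally have "f + f' - (\<Sum>i\<in>B \<union> B'. ?c i * y i) =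
   (f - (\<Sum>i\<in>B. b i * y i)) + (f' - (\<Sum>i\<in>B'. b' i * y i))" by simp
  also have "... \<in> J" by (rule ideal.subspace_add[OF I b(3) b'(3)])
  finally show "f + f' \<in> ?S" using b(1,2) b'(1,2) by (intro CollectI exI[of _ "B \<union> B'"] exI[of _ ?c]) auto
 next
  fix c f assume "f \<in> ?S"
  then obtain B b where b: "finite B" "B <= A" "f - (\<Sum>i\<in>B. b i * y i) \<in> J" by blast
  have "c * f - (\<Sum>i\<in>B. (c * b i) * y i) = c * (f - (\<Sum>i\<in>B. b i * y i))"
   by (simp add: right_diff_distrib sum_distrib_left mult.assoc)
  then have "c * f - (\<Sum>i\<in>B. (c * b i) * y i) \<in> J" using ideal.subspace_scale[OF I b(3)] by simp
  then show "c * f \<in> ?S" using b(1,2) by (intro CollectI exI[of _ B] exI[of _ "%i. c * b i"]) auto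
 qed
 have hc: "\<exists>B b. finite B & B <= A & (\<forall>i\<in>B. homogeneous (k - d i) (b i)) & hcomp k f - (\<Sum>i\<in>B. b i * y i) \<in> J"
  if f: "f \<in> ?S" for f k
 proof -
  obtain B b where b: "finite B" "B <= A" "f - (\<Sum>i\<in>B. b i * y i) \<in> J" using f by blast
  have "hcomp k (f - (\<Sum>i\<in>B. b i * y i)) = hcomp k f - (\<Sum>i\<in>B. hcomp (k - d i) (b i) * y i)"
   unfolding hcomp_diff hcomp_sum
   by (intro arg_cong2[where f = minus] refl sum.cong hcomp_mult_homogeneous y) (use b(2) in auto)
  then have "hcomp k f - (\<Sum>i\<in>B. hcomp (k - d i) (b i) * y i) \<in> J"
   using homogeneous_ideal_hcomp[OF J b(3), of k] by simp
  then show ?thesis 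
   by (intro exI[of _ B] exI[of _ "%i. hcomp (k - d i) (b i)"] conjI ballI b(1,2) homog_hcomp)
 qed
 have S: "homogeneous_ideal ?S"
 proof (rule homogeneous_idealI[OF \<open>is_ideal ?S\<close>])
  fix f k assume "f \<in> ?S"
  from hc[OF this, of k] show "hcomp k f \<in> ?S" by (elim exE conjE) (intro CollectI exI conjI)
 qed
 have JS: "J <= ?S"
 proof
  show "f \<in> ?S" if "f \<in> J" for f using that by (intro CollectI exI[of _ "{}"]) simp
 qed
 have yS: "y i \<in> ?S" if "i \<in> A" for i
 proof (intro CollectI exI conjI)
  show "y i - (\<Sum>i\<in>{i}. 1 * y i) \<in> J" using ideal.subspace_0[OF I] by simp
 qed (use that in simp_all)
 have "\<exists>M. g ^ M \<in> ?S"
 proof (rule homog_nullstellensatz_ideal[OF S JS g])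
  fix P assume P: "P \<in> proj_points J" "?S <= P"
  show "g \<in> P" by (rule vanish[OF P(1)]) (rule subsetD[OF P(2) yS])
 qed
 then obtain M where M: "g ^ M \<in> ?S" ..
 obtain B b where B: "finite B" "B <= A" and b: "\<forall>i\<in>B. homogeneous (e * int M - d i) (b i)"
   "hcomp (e * int M) (g ^ M) - (\<Sum>i\<in>B. b i * y i) \<in> J"
  using hc[OF M, of "e * int M"] by (elim exE conjE)
 have hM: "hcomp (e * int M) (g ^ M) = g ^ M" by (subst hcomp_homogeneous[OF homog_power[OF g(1)]]) (rule if_P[OF refl])
 show thesis by (rule that[OF B b(1) b(2)[unfolded hM]])
qed

subsection \<open>The twisted sheaf\<close>

text \<open>For well-definedness of sums of fractions: both products with \<open>u\<close> and
  \<open>v\<close> as outer factors on the right lie in the ideal.\<close>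

lemma fraction_sum_identity:
 fixes a b f g a' b' f' g' u v :: "'a::comm_ring_1"
 shows "(u * v) * ((a * g + b * f) * (f' * g') - (a' * g' + b' * f') * (f * g)) =
  (v * (g * g')) * (u * (a * f' - a' * f)) + (u * (f * f')) * (v * (b * g' - b' * g))"
 by (simp add: algebra_simps)

lemma fraction_trans_identity:
 fixes a b c f g h u v :: "'a::comm_ring_1"
 shows "(u * v * g) * (a * h - c * f) = (v * h) * (u * (a * g - b * f)) + (u * f) * (v * (b * h - c * g))"
 by (simp add: algebra_simps)

text \<open>The sum of two classes of fractions is defined as a union over all representatives; it
  collapses since the class of the sum is independent of them.\<close>

lemma Union_const2:
 assumes "A ~= {}" "B ~= {}"
  and "!!a f b g. (a, f) \<in> A ==> (b, g) \<in> B ==> F a f b g = C"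
 shows "(\<Union>(a, f)\<in>A. \<Union>(b, g)\<in>B. F a f b g) = C"
proof -
 have "(\<Union>(a, f)\<in>A. \<Union>(b, g)\<in>B. F a f b g) = (\<Union>x\<in>A. \<Union>y\<in>B. C)"
  by (rule SUP_cong[OF refl], clarify, rule SUP_cong[OF refl], clarify, rule assms(3))
 then show ?thesis using assms(1,2) by simp
qed

lemma glue_functions:
 assumes ext: "!!V. V \<in> \<U> ==> s V \<in> extensional V"
  and agree: "!!V W. V \<in> \<U> ==> W \<in> \<U> ==> restrict (s V) (V \<inter> W) = restrict (s W) (V \<inter> W)"
 obtains a where "a \<in> extensional (\<Union>\<U>)" "!!V. V \<in> \<U> ==> restrict a V = s V"
  "\<forall>b. b \<in> extensional (\<Union>\<U>) & (\<forall>V\<in>\<U>. restrict b V = s V) --> b = a"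
proof -
 define N where "N p = (SOME V. V \<in> \<U> & p \<in> V)" for p
 have N: "N p \<in> \<U>" "p \<in> N p" if "p \<in> \<Union>\<U>" for p
  using someI_ex[of "%V. V \<in> \<U> & p \<in> V"] that unfolding N_def by auto
 define a where "a = (\<lambda>p\<in>\<Union>\<U>. s (N p) p)"
 have a: "a p = s V p" if V: "V \<in> \<U>" "p \<in> V" for V p
  using fun_cong[OF agree[OF N(1) V(1)], of p p] N V by (auto simp: a_def)
 show thesis
 proof (rule that[of a])
  show "restrict a V = s V" if "V \<in> \<U>" for V
   using ext[OF that] a[OF that] by (auto simp: fun_eq_iff extensional_def)
  have "b p = a p" if b: "b \<in> extensional (\<Union>\<U>)" "\<forall>V\<in>\<U>. restrict b V = s V" for b p
  proof (cases "p \<in> \<Union>\<U>")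
   case True
   then show ?thesis using bspec[OF b(2) N(1)] N(2) a[OF N(1,2)] by (metis restrict_apply')
  next
   case False
   then show ?thesis using b(1) by (simp add: a_def extensional_def)
  qed
  then show "\<forall>b. b \<in> extensional (\<Union>\<U>) & (\<forall>V\<in>\<U>. restrict b V = s V) --> b = a" by blast
 qed (simp add: a_def)
qed

text \<open>Collects the pointwise operations of \<open>twisted_sheaf\<close> into a module, so that
  the sections over an open set form a submodule of a product of stalks.\<close>

definition stalk :: "('n::finite, 'k::field) mpol set => int => ('n, 'k) proj_point =>
  ('k, (('n, 'k) mpol \<times> ('n, 'k) mpol) set) module"
 where "stalk J nu P = \<lparr>carrier = (%(a, f). frac J nu P a f) ` fraction_pairs nu P,
  mult = undefined, one = undefined, zero = frac J nu P 0 1,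
  add = (%s s'. \<Union>(a, f)\<in>s. \<Union>(b, g)\<in>s'. frac J nu P (a * g + b * f) (f * g)),
  smult = (%c s. \<Union>(a, f)\<in>s. frac J nu P (const_pol c * a) f)\<rparr>"

locale proj_scheme =
 fixes J :: "('n::finite, 'k::field) mpol set" and nu :: int
 assumes J: "homogeneous_ideal J"
begin

abbreviation "X \<equiv> proj_top J"
abbreviation "pts \<equiv> proj_points J"
abbreviation "fp \<equiv> fraction_pairs nu :: ('n, 'k) proj_point => _"
abbreviation "fr \<equiv> frac J nu"
abbreviation "st \<equiv> stalk J nu"
abbreviation "F \<equiv> twisted_sheaf J nu"

lemma ideal_J: "is_ideal J"
 by (rule homogeneous_ideal_is_ideal[OF J])

lemma fpI: "f \<notin> P ==> homogeneous e f ==> homogeneous (e + nu) a ==> (a, f) \<in> fp P"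
 by (auto simp: fraction_pairs_def)

lemma fpE:
 assumes "(a, f) \<in> fp P"
 obtains e where "f \<notin> P" "homogeneous e f" "homogeneous (e + nu) a"
 using assms by (auto simp: fraction_pairs_def)

lemma mem_fr: "(b, g) \<in> fr P a f \<longleftrightarrow> (b, g) \<in> fp P & (\<exists>u. u \<notin> P & (\<exists>e. homogeneous e u) & u * (a * g - b * f) \<in> J)"
 by (auto simp: frac_def)

lemma fr_subset:
 assumes P: "P \<in> pts" and ab: "(a, f) \<in> fp P" "(b, g) \<in> fp P"
  and u: "u \<notin> P" "homogeneous d u" "u * (a * g - b * f) \<in> J"
 shows "fr P b g <= fr P a f"
proof (rule subrelI)
 fix c h assume "(c, h) \<in> fr P b g"
 then obtain v d' where c: "(c, h) \<in> fp P" and v: "v \<notin> P" "homogeneous d' v" "v * (b * h - c * g) \<in> J"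
  by (auto simp: mem_fr)
 obtain e where g: "g \<notin> P" "homogeneous e g" using ab(2) by (rule fpE)
 have "(u * v * g) * (a * h - c * f) \<in> J"
  unfolding fraction_trans_identity[of u v g a h c f b]
  by (intro ideal.subspace_add[OF ideal_J] ideal.subspace_scale[OF ideal_J] u(3) v(3))
 moreover have "u * v * g \<notin> P" using u(1) v(1) g(1) prime_idealD(3)[OF proj_pointsD(2)[OF P]] by simp
 moreover have "homogeneous (d + d' + e) (u * v * g)"
  by (intro homog_mult u v g)
 ultimately show "(c, h) \<in> fr P a f" using c unfolding mem_fr by blast
qed

lemma fr_eqI:
 assumes P: "P \<in> pts" and ab: "(a, f) \<in> fp P" "(b, g) \<in> fp P"
  and u: "u \<notin> P" "homogeneous d u" "u * (a * g - b * f) \<in> J"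
 shows "fr P a f = fr P b g"
proof
 show "fr P b g <= fr P a f" by (rule fr_subset[OF assms])
 have "u * (b * f - a * g) = (- 1) * (u * (a * g - b * f))" by (simp add: algebra_simps)
 then have "u * (b * f - a * g) \<in> J" using ideal.subspace_scale[OF ideal_J u(3)] by metis
 then show "fr P a f <= fr P b g" by (rule fr_subset[OF P ab(2,1) u(1,2)])
qed

lemma fr_self: "P \<in> pts ==> (a, f) \<in> fp P ==> (a, f) \<in> fr P a f"
 unfolding mem_fr using prime_idealD(2)[OF proj_pointsD(2)] ideal.subspace_0[OF ideal_J]
 by (intro conjI exI[of _ 1] exI[of _ 0]) simp_all

lemma fr_eqD:
 assumes P: "P \<in> pts" and ab: "(a, f) \<in> fp P" "(b, g) \<in> fp P" and eq: "fr P a f = fr P b g"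
 obtains u d where "u \<notin> P" "homogeneous d u" "u * (a * g - b * f) \<in> J"
proof -
 have "(b, g) \<in> fr P a f" using fr_self[OF P ab(2)] eq by simp
 then show thesis using that by (auto simp: mem_fr)
qed

lemma fr_eqI1:
 assumes P: "P \<in> pts" and ab: "(a, f) \<in> fp P" "(b, g) \<in> fp P" and eq: "a * g = b * f"
 shows "fr P a f = fr P b g"
 by (rule fr_eqI[OF P ab, of 1 0])
   (use prime_idealD(2)[OF proj_pointsD(2)[OF P]] ideal.subspace_0[OF ideal_J] eq in simp_all)

lemma fp_add:
 assumes P: "P \<in> pts" and ab: "(a, f) \<in> fp P" "(b, g) \<in> fp P"
 shows "(a * g + b * f, f * g) \<in> fp P"
proof -
 obtain e where e: "f \<notin> P" "homogeneous e f" "homogeneous (e + nu) a" using ab(1) by (rule fpE)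
 obtain e' where e': "g \<notin> P" "homogeneous e' g" "homogeneous (e' + nu) b" using ab(2) by (rule fpE)
 show ?thesis
 proof (rule fpI)
  show "f * g \<notin> P" using e e' prime_idealD(3)[OF proj_pointsD(2)[OF P]] by simp
  show "homogeneous (e + e') (f * g)" by (intro homog_mult e e')
  have "homogeneous (e + nu + e') (a * g)" "homogeneous (e' + nu + e) (b * f)" by (intro homog_mult e e')+
  then show "homogeneous (e + e' + nu) (a * g + b * f)" by (intro homog_add) (simp_all add: algebra_simps)
 qed
qed

lemma fp_smult: "(a, f) \<in> fp P ==> (const_pol c * a, f) \<in> fp P"
proof (elim fpE, rule fpI)
 fix e assume "homogeneous (e + nu) a"
 then show "homogeneous (e + nu) (const_pol c * a)" using homog_mult[OF homog_const] by fastforce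
qed

lemma fp_zero: "P \<in> pts ==> (0, 1) \<in> fp P"
 by (rule fpI[of _ _ 0]) (simp_all add: prime_idealD(2)[OF proj_pointsD(2)])

lemma st_simps:
 "carrier (st P) = (%(a, f). fr P a f) ` fp P" "0[st P] = fr P 0 1"
 by (simp_all add: stalk_def)

lemma st_add:
 assumes P: "P \<in> pts" and ab: "(a, f) \<in> fp P" "(b, g) \<in> fp P"
 shows "fr P a f +[st P] fr P b g = fr P (a * g + b * f) (f * g)"
proof -
 have "(\<Union>(a, f)\<in>fr P a f. \<Union>(b, g)\<in>fr P b g. fr P (a * g + b * f) (f * g)) = fr P (a * g + b * f) (f * g)"
 proof (rule Union_const2)
  fix a' f' b' g' assume "(a', f') \<in> fr P a f" "(b', g') \<in> fr P b g"
  then obtain u v d d' where a': "(a', f') \<in> fp P" and u: "u \<notin> P" "homogeneous d u" "u * (a * f' - a' * f) \<in> J"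
   and b': "(b', g') \<in> fp P" and v: "v \<notin> P" "homogeneous d' v" "v * (b * g' - b' * g) \<in> J"
   by (auto simp: mem_fr)
  have "fr P (a * g + b * f) (f * g) = fr P (a' * g' + b' * f') (f' * g')"
  proof (rule fr_eqI[OF P fp_add[OF P ab] fp_add[OF P a' b']])
   show "u * v \<notin> P" using u(1) v(1) prime_idealD(3)[OF proj_pointsD(2)[OF P]] by simp
   show "homogeneous (d + d') (u * v)" by (intro homog_mult u v)
   show "u * v * ((a * g + b * f) * (f' * g') - (a' * g' + b' * f') * (f * g)) \<in> J"
    unfolding fraction_sum_identity
    by (intro ideal.subspace_add[OF ideal_J] ideal.subspace_scale[OF ideal_J] u(3) v(3))
  qed
  then show "fr P (a' * g' + b' * f') (f' * g') = fr P (a * g + b * f) (f * g)" ..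
 qed (use fr_self[OF P] ab in auto)
 then show ?thesis by (simp add: stalk_def)
qed

lemma st_smult:
 assumes P: "P \<in> pts" and a: "(a, f) \<in> fp P"
 shows "c *[st P] fr P a f = fr P (const_pol c * a) f"
proof -
 have "fr P (const_pol c * a') f' = fr P (const_pol c * a) f" if a': "(a', f') \<in> fr P a f" for a' f'
 proof -
  obtain u d where a': "(a', f') \<in> fp P" and u: "u \<notin> P" "homogeneous d u" "u * (a * f' - a' * f) \<in> J"
   using a' by (auto simp: mem_fr)
  have "u * (const_pol c * a * f' - const_pol c * a' * f) = const_pol c * (u * (a * f' - a' * f))"
   by (simp add: algebra_simps)
  then have "u * (const_pol c * a * f' - const_pol c * a' * f) \<in> J"
   using ideal.subspace_scale[OF ideal_J u(3)] by simp
  from fr_eqI[OF P fp_smult[OF a] fp_smult[OF a'] u(1,2) this] show ?thesis ..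
 qed
 then have "(\<Union>(a, f)\<in>fr P a f. fr P (const_pol c * a) f) = (\<Union>x\<in>fr P a f. fr P (const_pol c * a) f)"
  by (intro SUP_cong refl) auto
 also have "... = fr P (const_pol c * a) f" using fr_self[OF P a] by auto
 finally show ?thesis by (simp add: stalk_def)
qed

lemma module_st:
 assumes P: "P \<in> pts" shows "is_module (st P)"
proof (rule scalar_moduleI; unfold st_simps)
 note s = st_add[OF P] st_smult[OF P] fp_add[OF P] fp_smult fp_zero[OF P] const_pol_simps
 fix x y z and \<alpha> \<beta> :: 'k
 show "fr P 0 1 \<in> (%(a, f). fr P a f) ` fp P" using fp_zero[OF P] by auto
 assume "x \<in> (%(a, f). fr P a f) ` fp P"
 then obtain a f where a: "(a, f) \<in> fp P" and x: "x = fr P a f" by auto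
 show "\<alpha> *[st P] x \<in> (%(a, f). fr P a f) ` fp P" unfolding x using fp_smult[OF a] by (auto simp: s a)
 show "fr P 0 1 +[st P] x = x" unfolding x by (simp add: s a)
 show "0 *[st P] x = fr P 0 1"
  unfolding x using fp_smult[OF a, of 0] by (simp add: s a) (rule fr_eqI1[OF P _ fp_zero[OF P]], simp_all)
 have "fr P (const_pol (\<alpha> + \<beta>) * a) f = fr P (const_pol \<alpha> * a * f + const_pol \<beta> * a * f) (f * f)"
  by (rule fr_eqI1[OF P fp_smult[OF a] fp_add[OF P fp_smult[OF a] fp_smult[OF a]]])
    (simp add: single_add algebra_simps)
 then show "(\<alpha> + \<beta>) *[st P] x = \<alpha> *[st P] x +[st P] \<beta> *[st P] x"
  unfolding x by (simp add: s a)
 show "(\<alpha> * \<beta>) *[st P] x = \<alpha> *[st P] (\<beta> *[st P] x)" unfolding x by (simp add: s a mult.assoc)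
 show "1 *[st P] x = x" unfolding x by (simp add: s a)
 assume "y \<in> (%(a, f). fr P a f) ` fp P"
 then obtain b g where b: "(b, g) \<in> fp P" and y: "y = fr P b g" by auto
 show "x +[st P] y \<in> (%(a, f). fr P a f) ` fp P" unfolding x y using fp_add[OF P a b] by (auto simp: s a b)
 show "x +[st P] y = y +[st P] x" unfolding x y by (simp add: s a b) (simp add: mult.commute add.commute)
 show "\<alpha> *[st P] (x +[st P] y) = \<alpha> *[st P] x +[st P] \<alpha> *[st P] y"
  unfolding x y by (simp add: s a b) (simp add: algebra_simps)
 assume "z \<in> (%(a, f). fr P a f) ` fp P"
 then obtain c h where c: "(c, h) \<in> fp P" and z: "z = fr P c h" by auto
 show "x +[st P] y +[st P] z = x +[st P] (y +[st P] z)"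
  unfolding x y z by (simp add: s a b c) (simp add: algebra_simps)
qed

lemma open_pts: "openin X U ==> U <= pts"
 using openin_subset[of "X" U] by (simp add: topspace_proj_top)

lemma tw_simps:
 "Sec F U = twisted_sections J nu U" "0[sections F U] = (\<lambda>P\<in>U. fr P 0 1)"
 "x +[sections F U] y = (\<lambda>P\<in>U. x P +[st P] y P)" "c *[sections F U] x = (\<lambda>P\<in>U. c *[st P] x P)"
 "restr F U V s = restrict s V"
 by (simp_all add: twisted_sheaf_def stalk_def)

text \<open>Homogeneity of \<open>f\<close> and \<open>a\<close> does not refer to a point, so the
  degree found at \<open>P\<close> serves on the whole neighbourhood.\<close>

lemma tw_local:
 assumes "s \<in> twisted_sections J nu U" "P \<in> U"
 obtains V e f a where "openin X V" "P \<in> V" "V <= U" "homogeneous e f" "homogeneous (e + nu) a"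
  "\<forall>Q\<in>V. f \<notin> Q" "\<forall>Q\<in>V. s Q = fr Q a f"
proof -
 obtain V a f where V: "openin X V" "P \<in> V" "V <= U"
  "\<forall>Q\<in>V. (a, f) \<in> fraction_pairs nu Q & s Q = fr Q a f"
  using assms unfolding twisted_sections_def by blast
 then have "(a, f) \<in> fp P" by simp
 then obtain e where "homogeneous e f" "homogeneous (e + nu) a" by (rule fpE)
 then show thesis using that[OF V(1-3), of e f a] V(4) by (auto elim: fpE)
qed

abbreviation locfrac :: "('n, 'k) proj_point set => ('n, 'k) proj_section => ('n, 'k) proj_point => bool"
 where "locfrac U s P \<equiv> \<exists>V a f e. openin X V & P \<in> V & V <= U & homogeneous e f & homogeneous (e + nu) a &
  (\<forall>Q\<in>V. f \<notin> Q & s Q = fr Q a f)"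

lemma twI:
 assumes "s \<in> extensional U"
  and "!!P. P \<in> U ==> locfrac U s P"
 shows "s \<in> twisted_sections J nu U"
 unfolding twisted_sections_def
proof (intro CollectI conjI ballI assms(1))
 fix P assume "P \<in> U"
 from assms(2)[OF this] obtain V a f e where "openin X V" "P \<in> V" "V <= U" "homogeneous e f"
  "homogeneous (e + nu) a" "\<forall>Q\<in>V. f \<notin> Q & s Q = fr Q a f" by blast
 then have "openin X V & P \<in> V & V <= U & (\<forall>Q\<in>V. (a, f) \<in> fp Q & s Q = fr Q a f)"
  by (auto intro: fpI)
 then show "\<exists>V a f. openin X V & P \<in> V & V <= U &
   (\<forall>Q\<in>V. (a, f) \<in> fp Q & s Q = fr Q a f)" by (intro exI)
qed

lemma tw_witness:
 assumes "openin X V" "P \<in> V" "V <= U" "homogeneous e f" "homogeneous (e + nu) a"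
  and "!!Q. Q \<in> V ==> f \<notin> Q & s Q = fr Q a f"
 shows "locfrac U s P"
proof -
 have "openin X V & P \<in> V & V <= U & homogeneous e f & homogeneous (e + nu) a &
   (\<forall>Q\<in>V. f \<notin> Q & s Q = fr Q a f)" using assms by simp
 then show ?thesis by (intro exI)
qed

lemma tw_stalk:
 assumes "openin X U" "s \<in> twisted_sections J nu U"
 shows "s \<in> (\<Pi>\<^sub>E P\<in>U. carrier (st P))"
proof (rule PiE_I)
 fix P assume P: "P \<in> U"
 then obtain V a f e where "P \<in> V" "homogeneous e f" "homogeneous (e + nu) a"
  "\<forall>Q\<in>V. f \<notin> Q" "\<forall>Q\<in>V. s Q = fr Q a f" using tw_local[OF assms(2)] by metis
 then show "s P \<in> carrier (st P)" unfolding st_simps by (intro image_eqI[of _ _ "(a, f)"]) (auto intro: fpI)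
next
 show "s P = undefined" if "P \<notin> U" for P
  using assms(2) that by (simp add: twisted_sections_def extensional_def)
qed

lemma tw_restrict:
 assumes "openin X V" "V <= U" "s \<in> twisted_sections J nu U"
 shows "restrict s V \<in> twisted_sections J nu V"
proof (rule twI)
 fix P assume P: "P \<in> V"
 then have "P \<in> U" using assms(2) by blast
 obtain W a f e where W: "openin X W" "P \<in> W" "W <= U" "homogeneous e f" "homogeneous (e + nu) a"
  "\<forall>Q\<in>W. f \<notin> Q" "\<forall>Q\<in>W. s Q = fr Q a f" using tw_local[OF assms(3) \<open>P \<in> U\<close>] .
 show "locfrac V (restrict s V) P"
  by (rule tw_witness[OF openin_Int[OF W(1) assms(1)] _ _ W(4,5)]) (use W P in auto)
qed simp

lemma tw_add:
 assumes U: "openin X U" and s: "s \<in> twisted_sections J nu U" and t: "t \<in> twisted_sections J nu U"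
 shows "(\<lambda>P\<in>U. s P +[st P] t P) \<in> twisted_sections J nu U"
proof (rule twI)
 fix P assume P: "P \<in> U"
 obtain V a f e where V: "openin X V" "P \<in> V" "V <= U" "homogeneous e f" "homogeneous (e + nu) a"
  "\<forall>Q\<in>V. f \<notin> Q" "\<forall>Q\<in>V. s Q = fr Q a f" using tw_local[OF s P] .
 obtain W b g d where W: "openin X W" "P \<in> W" "W <= U" "homogeneous d g" "homogeneous (d + nu) b"
  "\<forall>Q\<in>W. g \<notin> Q" "\<forall>Q\<in>W. t Q = fr Q b g" using tw_local[OF t P] .
 have "homogeneous (e + nu + d) (a * g)" "homogeneous (d + nu + e) (b * f)" by (intro homog_mult V W)+
 then have 1: "homogeneous (e + d + nu) (a * g + b * f)" by (intro homog_add) (simp_all add: algebra_simps)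
 have "f * g \<notin> Q & (\<lambda>P\<in>U. s P +[st P] t P) Q = fr Q (a * g + b * f) (f * g)" if Q: "Q \<in> V \<inter> W" for Q
 proof -
  have Qp: "Q \<in> pts" "Q \<in> U" using Q V(3) open_pts[OF U] by auto
  have "(a, f) \<in> fp Q" "(b, g) \<in> fp Q" using Q V W by (auto intro: fpI)
  then show ?thesis
   using Q Qp V(6,7) W(6,7) st_add[OF Qp(1)] prime_idealD(3)[OF proj_pointsD(2)[OF Qp(1)]] by simp
 qed
 then show "locfrac U (\<lambda>P\<in>U. s P +[st P] t P) P"
  by (intro tw_witness[OF openin_Int[OF V(1) W(1)] _ _ homog_mult[OF V(4) W(4)] 1]) (use V(2,3) W(2,3) in auto)
qed simp

lemma tw_smult:
 assumes U: "openin X U" and s: "s \<in> twisted_sections J nu U"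
 shows "(\<lambda>P\<in>U. c *[st P] s P) \<in> twisted_sections J nu U"
proof (rule twI)
 fix P assume P: "P \<in> U"
 obtain V a f e where V: "openin X V" "P \<in> V" "V <= U" "homogeneous e f" "homogeneous (e + nu) a"
  "\<forall>Q\<in>V. f \<notin> Q" "\<forall>Q\<in>V. s Q = fr Q a f" using tw_local[OF s P] .
 have 1: "homogeneous (e + nu) (const_pol c * a)" using homog_mult[OF homog_const V(5)] by simp
 have "f \<notin> Q & (\<lambda>P\<in>U. c *[st P] s P) Q = fr Q (const_pol c * a) f" if Q: "Q \<in> V" for Q
  using Q V(3,6,7) fpI[OF bspec[OF V(6) Q] V(4,5)] open_pts[OF U] by (auto simp: st_smult)
 then show "locfrac U (\<lambda>P\<in>U. c *[st P] s P) P"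
  by (rule tw_witness[OF V(1-4) 1])
qed simp

lemma twisted_sectionI:
 assumes U: "openin X U" and "homogeneous e f" "homogeneous (e + nu) a" "!!P. P \<in> U ==> f \<notin> P"
 shows "(\<lambda>P\<in>U. fr P a f) \<in> twisted_sections J nu U"
 by (rule twI, simp) (use assms in \<open>intro tw_witness[OF U _ _ assms(2,3)], auto\<close>)

lemma one_notin: "openin X U ==> P \<in> U ==> 1 \<notin> P"
 using open_pts[of U] prime_idealD(2)[OF proj_pointsD(2)] by auto

lemma sheaf_twisted: "sheaf X F"
proof -
 have mod: "is_module (sections F U)" if U: "openin X U" for U
 proof (rule submoduleI[where M = "prod_module U st"])
  show "is_module (prod_module U st)" using open_pts[OF U] by (intro is_module_prod module_st) auto
  show "Sec F U <= carrier (prod_module U st)" using tw_stalk[OF U] by (auto simp: tw_simps prod_module_simps)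
  have "(\<lambda>P\<in>U. fr P 0 1) \<in> twisted_sections J nu U"
   by (rule twisted_sectionI[OF U, of 0]) (use one_notin[OF U] in simp_all)
  then show "0[prod_module U st] \<in> Sec F U" by (simp add: tw_simps prod_module_simps st_simps)
 qed (simp_all add: tw_simps prod_module_simps st_simps tw_add[OF U] tw_smult[OF U])
 have pre: "presheaf X F"
  unfolding presheaf_def
 proof (intro conjI allI impI ballI)
  fix U V assume UV: "openin X U & openin X V & V <= U"
  then have "V \<inter> U = V" by blast
  with UV show "linear_hom (sections F U) (sections F V) (restr F U V)"
   unfolding linear_hom_def by (auto simp: tw_simps tw_restrict) (auto simp: restrict_def fun_eq_iff)
 next
  fix U s assume "openin X U" "s \<in> Sec F U"
  then show "restr F U U s = s" by (simp add: tw_simps twisted_sections_def extensional_restrict)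
 next
  fix U V W s assume "openin X U & openin X V & openin X W & W <= V & V <= U"
  then show "restr F V W (restr F U V s) = restr F U W s" by (simp add: tw_simps Int_absorb1)
 qed (rule mod)
 show ?thesis
  unfolding sheaf_def
 proof (intro conjI pre allI impI)
  fix \<U> s assume H: "(\<forall>V\<in>\<U>. openin X V & s V \<in> Sec F V) &
   (\<forall>V\<in>\<U>. \<forall>W\<in>\<U>. restr F V (V \<inter> W) (s V) = restr F W (V \<inter> W) (s W))"
  obtain a where ea: "a \<in> extensional (\<Union>\<U>)" and aV: "!!V. V \<in> \<U> ==> restrict a V = s V"
   and unique: "\<forall>b. b \<in> extensional (\<Union>\<U>) & (\<forall>V\<in>\<U>. restrict b V = s V) --> b = a"
  proof (rule glue_functions[of \<U> s])
   show "s V \<in> extensional V" if "V \<in> \<U>" for V using H that by (auto simp: tw_simps twisted_sections_def)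
   show "restrict (s V) (V \<inter> W) = restrict (s W) (V \<inter> W)" if "V \<in> \<U>" "W \<in> \<U>" for V W
    by (rule H[THEN conjunct2, unfolded tw_simps, rule_format, OF that])
  qed (rule that)
  have a: "a \<in> twisted_sections J nu (\<Union>\<U>)"
  proof (rule twI)
   fix P assume "P \<in> \<Union>\<U>"
   then obtain V where V: "V \<in> \<U>" "P \<in> V" by blast
   have sV: "s V \<in> twisted_sections J nu V" using H V(1) by (simp add: tw_simps)
   obtain W b f e where W: "openin X W" "P \<in> W" "W <= V" "homogeneous e f" "homogeneous (e + nu) b"
    "\<forall>Q\<in>W. f \<notin> Q" "\<forall>Q\<in>W. s V Q = fr Q b f" using tw_local[OF sV V(2)] .
   have "a Q = fr Q b f" if "Q \<in> W" for Q
    using W(3,7) that fun_cong[OF aV[OF V(1)], of Q] by auto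
   then show "locfrac (\<Union>\<U>) a P"
    by (intro tw_witness[OF W(1,2) _ W(4,5)]) (use W V(1) in auto)
  qed (rule ea)
  show "\<exists>!a. a \<in> Sec F (\<Union>\<U>) & (\<forall>V\<in>\<U>. restr F (\<Union>\<U>) V a = s V)"
  proof (rule ex1I[of _ a])
   show "a \<in> Sec F (\<Union>\<U>) & (\<forall>V\<in>\<U>. restr F (\<Union>\<U>) V a = s V)" using a aV by (simp add: tw_simps)
   fix b assume b: "b \<in> Sec F (\<Union>\<U>) & (\<forall>V\<in>\<U>. restr F (\<Union>\<U>) V b = s V)"
   then show "b = a" using unique by (simp add: tw_simps twisted_sections_def)
  qed
 qed
qed

end

subsection \<open>Sections over principal open sets\<close>

text \<open>\<open>kdiff\<close> for arbitrary elements instead of the variables. Acyclicity is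
  required for covers by any principal open sets, not just for the standard cover.\<close>

fun ydiff :: "('j => 'a::comm_ring_1) => nat => ('j list => 'a) => 'j list => 'a"
 where
  "ydiff y N c [] = 0"
 | "ydiff y N c (j # xs) = y j ^ N * c xs - ydiff y N (%ys. c (j # ys)) xs"

definition yprod :: "('j => 'a::comm_ring_1) => 'j list => 'a"
 where "yprod y xs = prod_list (map y xs)"

definition ydeg :: "('j => int) => 'j list => int"
 where "ydeg d xs = sum_list (map d xs)"

lemma yprod_simps [simp]: "yprod y [] = 1" "yprod y (j # xs) = y j * yprod y xs"
 by (simp_all add: yprod_def)

lemma ydeg_simps [simp]: "ydeg d [] = 0" "ydeg d (j # xs) = d j + ydeg d xs"
 by (simp_all add: ydeg_def)

lemma ydeg_pos: "(!!j. j \<in> set xs ==> d j > 0) ==> xs ~= [] ==> ydeg d xs > 0"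
proof (induction xs)
 case (Cons j xs)
 then show ?case by (cases "xs = []") (simp_all add: add_pos_pos)
qed simp

lemma ydiff_mult: "ydiff y N (%ys. f * c ys) xs = f * ydiff y N c xs"
proof (induction xs arbitrary: c)
 case (Cons j xs)
 show ?case using Cons.IH[of "%ys. c (j # ys)"] by (simp add: right_diff_distrib mult.left_commute)
qed simp

lemma ydiff_sum: "ydiff y N (%ys. \<Sum>i\<in>B. c i ys) xs = (\<Sum>i\<in>B. ydiff y N (c i) xs)"
proof (induction xs arbitrary: c)
 case (Cons j xs)
 show ?case using Cons.IH[of "%i ys. c i (j # ys)"] by (simp add: sum_distrib_left sum_subtractf)
qed simp

lemma ydiff_raise: "ydiff y (N + M) (%ys. yprod y ys ^ M * c ys) xs = yprod y xs ^ M * ydiff y N c xs"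
proof (induction xs arbitrary: c)
 case (Cons j xs)
 have "ydiff y (N + M) (%ys. yprod y (j # ys) ^ M * c (j # ys)) xs =
   ydiff y (N + M) (%ys. y j ^ M * (yprod y ys ^ M * c (j # ys))) xs"
  by (simp add: power_mult_distrib mult.assoc)
 then show ?case using Cons.IH[of "%ys. c (j # ys)"]
  by (simp add: ydiff_mult power_mult_distrib power_add algebra_simps)
qed simp

lemma homog_yprod:
 assumes "!!j. j \<in> set xs ==> homogeneous (d j) (y j)"
 shows "homogeneous (int N * ydeg d xs) (yprod y xs ^ N :: ('n::finite, 'k::field) mpol)"
proof -
 have "homogeneous (ydeg d xs) (yprod y xs)" using assms by (induction xs) (auto intro: homog_mult)
 from homog_power[OF this, of N] show ?thesis by (simp add: mult.commute)
qed

lemma yprod_in_prime: "prime_ideal P ==> yprod y xs \<in> P \<longleftrightarrow> (\<exists>j\<in>set xs. y j \<in> P)"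
 by (induction xs) (auto simp: prime_idealD)

context proj_scheme
begin

definition D :: "('n, 'k) mpol => ('n, 'k) proj_point set"
 where "D f = {P \<in> pts. f \<notin> P}"

definition sec :: "('n, 'k) proj_point set => ('n, 'k) mpol => ('n, 'k) mpol => ('n, 'k) proj_section"
 where "sec U a f = (\<lambda>P\<in>U. fr P a f)"

lemma open_D: "homogeneous e f ==> openin X (D f)"
 unfolding openin_proj_top proj_open_def D_def by (intro exI[of _ "{f}"]) auto

lemma D_mult: "D (f * g) = D f \<inter> D g"
 by (auto simp: D_def prime_idealD(3)[OF proj_pointsD(2)])

lemma notin_power: "openin X U ==> P \<in> U ==> f \<notin> P ==> f ^ n \<notin> P"
 using prime_ideal_power[OF proj_pointsD(2)[OF subsetD[OF open_pts]]] by simp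

lemma notin_mult: "openin X U ==> P \<in> U ==> f \<notin> P ==> g \<notin> P ==> f * g \<notin> P"
 using prime_idealD(3)[OF proj_pointsD(2)[OF subsetD[OF open_pts]]] by simp

lemma notin_yprod: "openin X U ==> P \<in> U ==> (!!j. j \<in> set xs ==> y j \<notin> P) ==> yprod y xs \<notin> P"
 by (auto simp: yprod_in_prime[OF proj_pointsD(2)[OF subsetD[OF open_pts]]])

lemma sec_closed:
 "openin X U ==> homogeneous e f ==> homogeneous (e + nu) a ==> (!!P. P \<in> U ==> f \<notin> P) ==> sec U a f \<in> Sec F U"
 unfolding sec_def tw_simps by (rule twisted_sectionI)

lemma restr_sec: "V <= U ==> restr F U V (sec U a f) = sec V a f"
 by (simp add: sec_def tw_simps Int_absorb1)

lemma sec_eqI: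
 assumes U: "openin X U" and f: "homogeneous e f" "homogeneous (e + nu) a" "!!P. P \<in> U ==> f \<notin> P"
  and g: "homogeneous e' g" "homogeneous (e' + nu) b" "!!P. P \<in> U ==> g \<notin> P"
  and u: "homogeneous d u" "!!P. P \<in> U ==> u \<notin> P" "u * (a * g - b * f) \<in> J"
 shows "sec U a f = sec U b g"
 unfolding sec_def
proof (rule restrict_ext)
 fix P assume P: "P \<in> U"
 then have "P \<in> pts" using open_pts[OF U] by blast
 then show "fr P a f = fr P b g"
  by (rule fr_eqI[OF _ fpI[OF f(3)[OF P] f(1,2)] fpI[OF g(3)[OF P] g(1,2)] u(2)[OF P] u(1,3)])
qed

lemma sec_zero:
 assumes U: "openin X U" and f: "homogeneous e f" "!!P. P \<in> U ==> f \<notin> P"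
 shows "0[sections F U] = sec U 0 f"
proof -
 have "sec U 0 1 = sec U 0 f"
  by (rule sec_eqI[OF U, of 0 1 0 e f 0 0 1])
    (use f one_notin[OF U] ideal.subspace_0[OF ideal_J] in simp_all)
 then show ?thesis by (simp add: tw_simps sec_def)
qed

lemma sec_scale:
 assumes U: "openin X U" and f: "homogeneous e f" "homogeneous (e + nu) a" "!!P. P \<in> U ==> f \<notin> P"
  and h: "homogeneous d h" "!!P. P \<in> U ==> h \<notin> P"
 shows "sec U a f = sec U (h * a) (h * f)"
proof (rule sec_eqI[OF U f homog_mult[OF h(1) f(1)], of _ 0 1])
 show "homogeneous (d + e + nu) (h * a)" using homog_mult[OF h(1) f(2)] by (simp add: add.assoc)
 show "h * f \<notin> P" if "P \<in> U" for P using notin_mult[OF U that] h(2) f(3) that by blast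
 show "1 * (a * (h * f) - h * a * f) \<in> J" using ideal.subspace_0[OF ideal_J] by (simp add: algebra_simps)
qed (use one_notin[OF U] in simp_all)

lemma sec_diff:
 assumes U: "openin X U" and f: "homogeneous e f" "!!P. P \<in> U ==> f \<notin> P"
  and a: "homogeneous (e + nu) a" and b: "homogeneous (e + nu) b"
 shows "sec U a f -[sections F U] sec U b f = sec U (a - b) f"
proof -
 have m: "is_module (sections F U)" by (rule psh_mod[OF sheaf_presheaf[OF sheaf_twisted] U])
 have "fr P a f +[st P] ((- 1) *[st P] fr P b f) = fr P (a - b) f" if P: "P \<in> U" for P
 proof -
  have P': "P \<in> pts" using P open_pts[OF U] by blast
  have fp: "(a, f) \<in> fp P" "(b, f) \<in> fp P" "(a - b, f) \<in> fp P"
   using f(2)[OF P] by (auto intro!: fpI[OF _ f(1)] a b homog_diff)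
  show ?thesis
   unfolding st_smult[OF P' fp(2)] st_add[OF P' fp(1) fp_smult[OF fp(2)]]
   by (rule fr_eqI1[OF P' fp_add[OF P' fp(1) fp_smult[OF fp(2)]] fp(3)])
     (simp add: single_uminus algebra_simps)
 qed
 then have "sec U a f +[sections F U] ((- 1) *[sections F U] sec U b f) = sec U (a - b) f"
  by (simp add: tw_simps sec_def cong: restrict_cong)
 moreover have "sec U a f -[sections F U] sec U b f =
   sec U a f +[sections F U] ((- 1) *[sections F U] sec U b f)"
  by (rule module_minus_eq[OF m sec_closed[OF U f(1) a f(2)] sec_closed[OF U f(1) b f(2)]])
 ultimately show ?thesis by simp
qed

text \<open>The additional factor \<open>g\<close> of the denominator carries the induction: in the
  recursive call it absorbs \<open>y j ^ N\<close>. Later it holds the power of an element that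
  comes from a partition of unity.\<close>

lemma altsum_sec:
 assumes U: "openin X U" and y: "!!j. j \<in> set xs ==> homogeneous (d j) (y j)"
  and yU: "!!j P. j \<in> set xs ==> P \<in> U ==> y j \<notin> P"
  and g: "homogeneous e g" "!!P. P \<in> U ==> g \<notin> P"
  and a: "!!ys. Suc (length ys) = length xs ==> set ys <= set xs ==> homogeneous (e + int N * ydeg d ys + nu) (a ys)"
 shows "altsum (sections F U) (%ys. sec U (a ys) (g * yprod y ys ^ N)) xs = sec U (ydiff y N a xs) (g * yprod y xs ^ N) &
  homogeneous (e + int N * ydeg d xs + nu) (ydiff y N a xs)"
 using assms(2-)
proof (induction xs arbitrary: a g e)
 case Nil
 then show ?case using sec_zero[OF U, of e g] by simp
next
 case (Cons j xs)
 note y = Cons.prems(1) and yU = Cons.prems(2) and g = Cons.prems(3,4) and a = Cons.prems(5)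
 let ?f = "g * y j ^ N * yprod y xs ^ N" and ?e = "e + int N * ydeg d (j # xs)"
 have hj: "homogeneous (int N * d j) (y j ^ N)" using homog_power[OF y[of j], of N] by (simp add: mult.commute)
 have nj: "y j ^ N \<notin> P" if "P \<in> U" for P by (rule notin_power[OF U that yU[OF _ that]]) simp
 have hs: "homogeneous (int N * ydeg d xs) (yprod y xs ^ N)" by (rule homog_yprod) (simp add: y)
 have ns: "yprod y xs ^ N \<notin> P" if "P \<in> U" for P
  by (rule notin_power[OF U that notin_yprod[OF U that]]) (simp add: yU that)
 have "altsum (sections F U) (%ys. sec U (a (j # ys)) (g * y j ^ N * yprod y ys ^ N)) xs =
   sec U (ydiff y N (%ys. a (j # ys)) xs) (g * y j ^ N * yprod y xs ^ N) &
   homogeneous (e + int N * d j + int N * ydeg d xs + nu) (ydiff y N (%ys. a (j # ys)) xs)"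
 proof (rule Cons.IH)
  show "homogeneous (e + int N * d j) (g * y j ^ N)" by (rule homog_mult[OF g(1) hj])
  show "g * y j ^ N \<notin> P" if "P \<in> U" for P by (rule notin_mult[OF U that g(2)[OF that] nj[OF that]])
  show "homogeneous (e + int N * d j + int N * ydeg d ys + nu) (a (j # ys))"
   if "Suc (length ys) = length xs" "set ys <= set xs" for ys
   using a[of "j # ys"] that by (auto simp: algebra_simps)
 qed (simp_all add: y yU)
 moreover have "altsum (sections F U) (%ys. sec U (a (j # ys)) (g * yprod y (j # ys) ^ N)) xs =
   altsum (sections F U) (%ys. sec U (a (j # ys)) (g * y j ^ N * yprod y ys ^ N)) xs"
  by (simp add: power_mult_distrib mult.assoc)
 ultimately have IH: "altsum (sections F U) (%ys. sec U (a (j # ys)) (g * yprod y (j # ys) ^ N)) xs =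
   sec U (ydiff y N (%ys. a (j # ys)) xs) ?f"
  and h2: "homogeneous (?e + nu) (ydiff y N (%ys. a (j # ys)) xs)"
  by (simp_all add: algebra_simps)
 have as: "homogeneous (e + int N * ydeg d xs + nu) (a xs)" by (rule a) auto
 have h1: "homogeneous (?e + nu) (y j ^ N * a xs)" using homog_mult[OF hj as] by (simp add: algebra_simps)
 have "sec U (a xs) (g * yprod y xs ^ N) = sec U (y j ^ N * a xs) (y j ^ N * (g * yprod y xs ^ N))"
  by (rule sec_scale[OF U homog_mult[OF g(1) hs] as _ hj nj])
    (rule notin_mult[OF U _ g(2) ns])
 also have "y j ^ N * (g * yprod y xs ^ N) = ?f" by (simp add: ac_simps)
 finally have 1: "sec U (a xs) (g * yprod y xs ^ N) = sec U (y j ^ N * a xs) ?f" .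
 have hf: "homogeneous ?e ?f" using homog_mult[OF homog_mult[OF g(1) hj] hs] by (simp add: algebra_simps)
 have nf: "?f \<notin> P" if "P \<in> U" for P by (intro notin_mult[OF U that] g(2) nj ns that)
 have "altsum (sections F U) (%ys. sec U (a ys) (g * yprod y ys ^ N)) (j # xs) = sec U (ydiff y N a (j # xs)) ?f"
  using sec_diff[OF U hf nf h1 h2] by (simp only: altsum.simps IH 1 ydiff.simps)
 moreover have "?f = g * yprod y (j # xs) ^ N" by (simp add: power_mult_distrib mult.assoc)
 ultimately show ?case using homog_diff[OF h1 h2] by simp
qed

lemma cdiff_sec:
 assumes c: "!!ys. Suc (length ys) = length xs ==> set ys <= set xs ==>
   homogeneous (e + int N * ydeg d ys + nu) (a ys) & c ys = sec (cop W U ys) (a ys) (g * yprod y ys ^ N)"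
  and W: "openin X (cop W U xs)" and y: "!!j. j \<in> set xs ==> homogeneous (d j) (y j)"
  and yU: "!!j P. j \<in> set xs ==> P \<in> U j ==> y j \<notin> P"
  and g: "homogeneous e g" "!!P. P \<in> W ==> g \<notin> P"
 shows "cdiff F W U c xs = sec (cop W U xs) (ydiff y N a xs) (g * yprod y xs ^ N)"
  and "homogeneous (e + int N * ydeg d xs + nu) (ydiff y N a xs)"
proof -
 have *: "altsum (sections F (cop W U xs)) (%ys. sec (cop W U xs) (a ys) (g * yprod y ys ^ N)) xs =
   sec (cop W U xs) (ydiff y N a xs) (g * yprod y xs ^ N) &
   homogeneous (e + int N * ydeg d xs + nu) (ydiff y N a xs)"
  by (rule altsum_sec[OF W y _ g(1)]) (use yU g c in \<open>auto simp: cop_def\<close>)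
 have "cdiff F W U c xs = altsum (sections F (cop W U xs)) (%ys. sec (cop W U xs) (a ys) (g * yprod y ys ^ N)) xs"
  unfolding cdiff_def
 proof (rule altsum_cong)
  fix ys assume ys: "Suc (length ys) = length xs" "set ys <= set xs"
  show "restr F (cop W U ys) (cop W U xs) (c ys) = sec (cop W U xs) (a ys) (g * yprod y ys ^ N)"
   using c[OF ys] restr_sec[OF cop_mono[OF ys(2)]] by simp
 qed
 with * show "cdiff F W U c xs = sec (cop W U xs) (ydiff y N a xs) (g * yprod y xs ^ N)"
  "homogeneous (e + int N * ydeg d xs + nu) (ydiff y N a xs)" by simp_all
qed

text \<open>The homogeneous elements that multiply \<open>a\<close> into \<open>J\<close> have no
  common zero on \<open>D g\<close>, so a power of \<open>g\<close> is a combination of them modulo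
  \<open>J\<close>.\<close>

lemma sec_eq_zeroD:
 assumes g: "homogeneous e' g" "e' > 0" and f: "homogeneous e f" "homogeneous (e + nu) a" "!!P. P \<in> D g ==> f \<notin> P"
  and 0: "sec (D g) a f = 0[sections F (D g)]"
 shows "\<exists>M. g ^ M * a \<in> J"
proof -
 let ?A = "{u. (\<exists>d. homogeneous d u) & u * a \<in> J}"
 define d where "d u = (SOME d. homogeneous d u)" for u :: "('n, 'k) mpol"
 have d: "homogeneous (d u) u" if "u \<in> ?A" for u using that unfolding d_def by (auto intro: someI)
 have v: "g \<in> P" if P: "P \<in> pts" "!!u. u \<in> ?A ==> u \<in> P" for P
 proof (rule ccontr)
  assume "g \<notin> P"
  then have PD: "P \<in> D g" using P(1) by (simp add: D_def)
  have "fr P a f = fr P 0 1" using fun_cong[OF 0, of P] PD by (simp add: sec_def tw_simps)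
  then obtain u d where u: "u \<notin> P" "homogeneous d u" "u * (a * 1 - 0 * f) \<in> J"
   by (rule fr_eqD[OF P(1) fpI[OF f(3)[OF PD] f(1,2)] fp_zero[OF P(1)]])
  then have "u \<in> ?A" by auto
  then show False using P(2) u(1) by blast
 qed
 obtain M B b where B: "finite B" "B <= ?A" and "\<forall>u\<in>B. homogeneous (e' * int M - d u) (b u)"
   and b: "g ^ M - (\<Sum>u\<in>B. b u * u) \<in> J"
  using homog_nullstellensatz[OF J g d v] .
 have "g ^ M * a = (g ^ M - (\<Sum>u\<in>B. b u * u)) * a + (\<Sum>u\<in>B. b u * (u * a))"
  by (simp add: left_diff_distrib sum_distrib_right mult.assoc)
 also have "... \<in> J"
  by (intro ideal.subspace_add[OF ideal_J] ideal_mult_right[OF ideal_J b] ideal.subspace_sum[OF ideal_J],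
    rule ideal.subspace_scale[OF ideal_J]) (use B in auto)
 finally show ?thesis by blast
qed

text \<open>A homogeneous partition of unity: powers of the \<open>y i\<close> have the same zeros,
  so a power of \<open>g\<close> is a combination of them modulo \<open>J\<close>. Finitely many
  suffice, which also gives compactness.\<close>

lemma D_partition:
 fixes y :: "'i => ('n, 'k) mpol"
 assumes g: "homogeneous e g" "e > 0" and y: "!!i. i \<in> A ==> homogeneous (d i) (y i)"
  and cover: "D g <= (\<Union>i\<in>A. D (y i))"
 obtains M B b where "finite B" "B <= A" "\<forall>i\<in>B. homogeneous (e * int M - int N * d i) (b i)"
  "g ^ M - (\<Sum>i\<in>B. b i * y i ^ N) \<in> J"
proof (rule homog_nullstellensatz[OF J g, of A "%i. int N * d i" "%i. y i ^ N"])
 show "homogeneous (int N * d i) (y i ^ N)" if "i \<in> A" for i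
  using homog_power[OF y[OF that], of N] by (simp add: mult.commute)
 fix P assume P: "P \<in> pts" "!!i. i \<in> A ==> y i ^ N \<in> P"
 then have "P \<notin> (\<Union>i\<in>A. D (y i))" using prime_ideal_power[OF proj_pointsD(2)[OF P(1)]] by (auto simp: D_def)
 then show "g \<in> P" using cover P(1) by (auto simp: D_def)
qed (rule that)

lemma D_compact:
 fixes y :: "'i => ('n, 'k) mpol"
 assumes g: "homogeneous e g" "e > 0" and y: "!!i. i \<in> A ==> homogeneous (d i) (y i)"
  and cover: "D g <= (\<Union>i\<in>A. D (y i))"
 obtains B where "finite B" "B <= A" "D g <= (\<Union>i\<in>B. D (y i))"
proof -
 obtain M B b where B: "finite B" "B <= A" and "\<forall>i\<in>B. homogeneous (e * int M - int 1 * d i) (b i)"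
   and b: "g ^ M - (\<Sum>i\<in>B. b i * y i ^ 1) \<in> J"
  using D_partition[OF assms] .
 have "\<exists>i\<in>B. y i \<notin> P" if P: "P \<in> D g" for P
 proof (rule ccontr)
  assume no: "\<not> (\<exists>i\<in>B. y i \<notin> P)"
  have P': "P \<in> pts" "g \<notin> P" using P by (auto simp: D_def)
  note I = prime_idealD(1)[OF proj_pointsD(2)[OF P'(1)]]
  have "g ^ M = (g ^ M - (\<Sum>i\<in>B. b i * y i ^ 1)) + (\<Sum>i\<in>B. b i * y i)" by simp
  also have "... \<in> P"
   by (intro ideal.subspace_add[OF I] subsetD[OF proj_pointsD(3)[OF P'(1)] b] ideal.subspace_sum[OF I]
     ideal.subspace_scale[OF I]) (use no in simp)
  finally show False using P'(2) prime_ideal_power[OF proj_pointsD(2)[OF P'(1)]] by simp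
 qed
 then have "D g <= (\<Union>i\<in>B. D (y i))" by (auto simp: D_def)
 then show thesis using that B by blast
qed

lemma cop_D:
 assumes "!!j. j \<in> Idx ==> U j = D (y j)" "W = (\<Union>j\<in>Idx. U j)" "set xs <= Idx" "xs ~= []"
 shows "cop W U xs = D (yprod y xs)"
proof -
 have "cop W U xs = (\<Inter>j\<in>set xs. U j)" using assms by (cases xs) (auto simp: cop_def)
 also have "... = (\<Inter>j\<in>set xs. D (y j))" using assms(1,3) by (intro INF_cong) auto
 also have "... = D (yprod y xs)"
  using assms(4) by (cases xs) (auto simp: D_def yprod_in_prime[OF proj_pointsD(2)] simp del: yprod_simps)
 finally show ?thesis .
qed

lemma uniform_exponent:
 assumes fin: "finite S" and ex: "\<forall>xs\<in>S. \<exists>m. y xs ^ m * c xs \<in> J"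
 obtains M where "\<forall>xs\<in>S. y xs ^ M * c xs \<in> J"
proof -
 obtain m where m: "\<forall>xs\<in>S. y xs ^ m xs * c xs \<in> J" using ex unfolding bchoice_iff ..
 have "y xs ^ sum m S * c xs \<in> J" if xs: "xs \<in> S" for xs
 proof -
  have "y xs ^ sum m S * c xs = y xs ^ (sum m S - m xs) * (y xs ^ m xs * c xs)"
   using member_le_sum[OF xs _ fin, of m] by (simp flip: mult.assoc power_add)
  then show ?thesis using ideal.subspace_scale[OF ideal_J bspec[OF m xs]] by simp
 qed
 then show thesis using that by blast
qed

lemma uniform_fractions:
 assumes fin: "finite S" and y: "!!xs. xs \<in> S ==> homogeneous (ydeg d xs) (yprod y xs)"
  and open_U: "!!xs. xs \<in> S ==> openin X (U xs)" and yU: "!!xs P. xs \<in> S ==> P \<in> U xs ==> yprod y xs \<notin> P"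
  and frac: "!!xs. xs \<in> S ==> \<exists>N a. homogeneous (int N * ydeg d xs + nu) a & c xs = sec (U xs) a (yprod y xs ^ N)"
 obtains N a where "\<forall>xs\<in>S. homogeneous (int N * ydeg d xs + nu) (a xs) & c xs = sec (U xs) (a xs) (yprod y xs ^ N)"
proof -
 obtain n a where na: "\<forall>xs\<in>S. homogeneous (int (n xs) * ydeg d xs + nu) (a xs) & c xs = sec (U xs) (a xs) (yprod y xs ^ n xs)"
  using frac by metis
 define N where "N = (\<Sum>xs\<in>S. n xs)"
 have "\<forall>xs\<in>S. homogeneous (int N * ydeg d xs + nu) (yprod y xs ^ (N - n xs) * a xs) &
   c xs = sec (U xs) (yprod y xs ^ (N - n xs) * a xs) (yprod y xs ^ N)"
 proof
  fix xs assume xs: "xs \<in> S"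
  have le: "n xs \<le> N" unfolding N_def by (rule member_le_sum[OF xs _ fin]) simp
  have h: "homogeneous (int m * ydeg d xs) (yprod y xs ^ m)" for m
   using homog_power[OF y[OF xs], of m] by (simp add: mult.commute)
  have nz: "yprod y xs ^ m \<notin> P" if "P \<in> U xs" for P m by (rule notin_power[OF open_U[OF xs] that yU[OF xs that]])
  have a: "homogeneous (int (n xs) * ydeg d xs + nu) (a xs)" and c: "c xs = sec (U xs) (a xs) (yprod y xs ^ n xs)"
   using na xs by auto
  have hom: "homogeneous (int (N - n xs) * ydeg d xs + (int (n xs) * ydeg d xs + nu)) (yprod y xs ^ (N - n xs) * a xs)"
   by (rule homog_mult[OF h a])
  have eq: "int (N - n xs) * ydeg d xs + (int (n xs) * ydeg d xs + nu) = int N * ydeg d xs + nu"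
   using le by (simp add: of_nat_diff algebra_simps)
  have "c xs = sec (U xs) (yprod y xs ^ (N - n xs) * a xs) (yprod y xs ^ (N - n xs) * yprod y xs ^ n xs)"
   unfolding c by (rule sec_scale[OF open_U[OF xs] h a nz h nz])
  then show "homogeneous (int N * ydeg d xs + nu) (yprod y xs ^ (N - n xs) * a xs) &
    c xs = sec (U xs) (yprod y xs ^ (N - n xs) * a xs) (yprod y xs ^ N)"
   using le hom[unfolded eq] by (simp flip: power_add)
 qed
 then show thesis by (rule that)
qed

text \<open>With a common exponent, raised until the cocycle condition holds for numerators modulo
  \<open>J\<close>, a partition of unity contracts the complex. That the values are fractions is a
  hypothesis, since the case \<open>p = 0\<close> is what proves it for all sections in
  \<open>section_fraction\<close>; the bounding cochain is therefore given explicitly by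
  fractions.\<close>

lemma fraction_cocycle_exact:
 fixes y :: "'j => ('n, 'k) mpol"
 assumes fin: "finite Idx" and U: "!!j. j \<in> Idx ==> U j = D (y j)"
  and y: "!!j. j \<in> Idx ==> homogeneous (d j) (y j)" and d: "!!j. j \<in> Idx ==> d j > 0"
  and g: "homogeneous e g" "e > 0" and W: "W = D g" "W = (\<Union>j\<in>Idx. U j)"
  and c: "cocycle F W U Idx (Suc p) c"
  and frac: "!!xs. length xs = Suc p ==> set xs <= Idx ==>
   \<exists>N a. homogeneous (int N * ydeg d xs + nu) a & c xs = sec (cop W U xs) a (yprod y xs ^ N)"
 obtains L N b where "\<forall>ys. length ys = p & set ys <= Idx --> homogeneous (e * int L + int N * ydeg d ys + nu) (b ys)"
  and "is_cdiff F W U Idx p (%ys. sec (cop W U ys) (b ys) (g ^ L * yprod y ys ^ N)) c"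
proof -
 have oW: "openin X W" unfolding W(1) by (rule open_D[OF g(1)])
 interpret cech X W U Idx
  by unfold_locales (use oW U open_D[OF y] in auto)
 let ?S = "{xs. set xs <= Idx & length xs = Suc p}" and ?S' = "{xs. set xs <= Idx & length xs = Suc (Suc p)}"
 have yh: "homogeneous (int m * ydeg d xs) (yprod y xs ^ m)" if "set xs <= Idx" for xs m
  by (rule homog_yprod) (use y that in auto)
 have yn: "yprod y xs ^ m \<notin> P" if "set xs <= Idx" "P \<in> cop W U xs" for xs m P
  by (rule notin_power[OF open_cop[OF that(1)] that(2) notin_yprod[OF open_cop[OF that(1)] that(2)]])
    (use that U in \<open>auto simp: cop_def D_def\<close>)
 have gn: "g ^ m \<notin> P" if "set xs <= Idx" "P \<in> cop W U xs" for xs P m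
  by (rule notin_power[OF open_cop[OF that(1)] that(2)]) (use that W(1) in \<open>auto simp: cop_def D_def\<close>)
 obtain N a where Na: "\<forall>xs\<in>?S. homogeneous (int N * ydeg d xs + nu) (a xs) & c xs = sec (cop W U xs) (a xs) (yprod y xs ^ N)"
 proof (rule uniform_fractions[of ?S d y "cop W U" c])
  show "finite ?S" by (rule finite_lists_length_eq[OF fin])
  show "homogeneous (ydeg d xs) (yprod y xs)" if "xs \<in> ?S" for xs using yh[of xs 1] that by simp
  show "yprod y xs \<notin> P" if "xs \<in> ?S" "P \<in> cop W U xs" for xs P using yn[of xs P 1] that by simp
 qed (use open_cop frac in auto)
 have "\<exists>M. yprod y xs ^ M * ydiff y N a xs \<in> J" if xs: "xs \<in> ?S'" for xs
 proof -
  have s: "set xs <= Idx" "length xs = Suc (Suc p)" "xs ~= []" using xs by auto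
  have *: "homogeneous (0 + int N * ydeg d ys + nu) (a ys) & c ys = sec (cop W U ys) (a ys) (1 * yprod y ys ^ N)"
   if "Suc (length ys) = length xs" "set ys <= set xs" for ys
   using Na that s by auto
  have **: "!!j. j \<in> set xs ==> homogeneous (d j) (y j)" "!!j P. j \<in> set xs ==> P \<in> U j ==> y j \<notin> P"
   using s y U by (auto simp: D_def)
  note cd = cdiff_sec[OF * open_cop[OF s(1)] ** homog_one one_notin[OF oW]]
  have "cdiff F W U c xs = 0[sections F (cop W U xs)]" using c s by (auto simp: cocycle_def)
  then have 0: "sec (D (yprod y xs)) (ydiff y N a xs) (1 * yprod y xs ^ N) = 0[sections F (D (yprod y xs))]"
   using cd(1) cop_D[OF U W(2) s(1,3)] by simp
  show ?thesis
  proof (rule sec_eq_zeroD[OF _ _ _ _ _ 0])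
   show "homogeneous (ydeg d xs) (yprod y xs)" using yh[OF s(1), of 1] by simp
   show "ydeg d xs > 0" by (rule ydeg_pos) (use d s in auto)
   show "homogeneous (int N * ydeg d xs) (1 * yprod y xs ^ N)" using yh[OF s(1)] by simp
   show "homogeneous (int N * ydeg d xs + nu) (ydiff y N a xs)" using cd(2) by simp
   show "1 * yprod y xs ^ N \<notin> P" if "P \<in> D (yprod y xs)" for P
    using yn[OF s(1), of P N] that cop_D[OF U W(2) s(1,3)] by simp
  qed
 qed
 \<comment> \<open>Each exponent depends on the list; as the lists are finitely many, one exponent
   serves for all.\<close>
 then have "\<forall>xs\<in>?S'. \<exists>M. yprod y xs ^ M * ydiff y N a xs \<in> J" by blast
 then obtain M where M: "\<forall>xs\<in>?S'. yprod y xs ^ M * ydiff y N a xs \<in> J"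
  by (rule uniform_exponent[OF finite_lists_length_eq[OF fin]])
 define a' where "a' ys = yprod y ys ^ M * a ys" for ys
 have da': "ydiff y (N + M) a' xs \<in> J" if "xs \<in> ?S'" for xs
  unfolding a'_def ydiff_raise by (rule bspec[OF M that])
 have a'h: "homogeneous (int (N + M) * ydeg d xs + nu) (a' xs)" if "xs \<in> ?S" for xs
 proof -
  have "homogeneous (int M * ydeg d xs + (int N * ydeg d xs + nu)) (a' xs)"
   unfolding a'_def by (rule homog_mult) (use yh Na that in auto)
  then show ?thesis by (simp add: algebra_simps)
 qed
 have ca': "c xs = sec (cop W U xs) (g ^ L * a' xs) (g ^ L * yprod y xs ^ (N + M))" if xs: "xs \<in> ?S" for xs L
 proof -
  have s: "set xs <= Idx" using xs by simp
  have "c xs = sec (cop W U xs) (a xs) (yprod y xs ^ N)" using Na xs by blast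
  also have "... = sec (cop W U xs) (a' xs) (yprod y xs ^ M * yprod y xs ^ N)"
   unfolding a'_def by (rule sec_scale[OF open_cop[OF s] yh[OF s] _ yn[OF s] yh[OF s] yn[OF s]]) (use Na xs in blast)
  also have "yprod y xs ^ M * yprod y xs ^ N = yprod y xs ^ (N + M)" by (simp add: power_add mult.commute)
  also have "sec (cop W U xs) (a' xs) (yprod y xs ^ (N + M)) =
    sec (cop W U xs) (g ^ L * a' xs) (g ^ L * yprod y xs ^ (N + M))"
   by (rule sec_scale[OF open_cop[OF s] yh[OF s] a'h[OF xs] yn[OF s] homog_power[OF g(1)] gn[OF s]])
  finally show ?thesis .
 qed
 have Wcov: "D g <= (\<Union>j\<in>Idx. D (y j))" using W U by auto
 obtain L B b where B: "finite B" "B <= Idx" and bh: "\<forall>i\<in>B. homogeneous (e * int L - int (N + M) * d i) (b i)"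
   and b: "g ^ L - (\<Sum>i\<in>B. b i * y i ^ (N + M)) \<in> J"
  using D_partition[OF g y Wcov] .
 \<comment> \<open>The contraction by the partition of unity, on numerators. Its denominator
   acquires the factor \<open>g ^ L\<close>.\<close>
 define f where "f ys = (\<Sum>i\<in>B. b i * a' (i # ys))" for ys
 have gL: "homogeneous (e * int L) (g ^ L)" by (rule homog_power[OF g(1)])
 have fh: "homogeneous (e * int L + int (N + M) * ydeg d ys + nu) (f ys)" if "length ys = p" "set ys <= Idx" for ys
  unfolding f_def
 proof (rule homog_sum)
  fix i assume i: "i \<in> B"
  have "homogeneous ((e * int L - int (N + M) * d i) + (int (N + M) * ydeg d (i # ys) + nu)) (b i * a' (i # ys))"
   by (rule homog_mult[OF bspec[OF bh i] a'h]) (use that i B(2) in auto)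
  then show "homogeneous (e * int L + int (N + M) * ydeg d ys + nu) (b i * a' (i # ys))" by (simp add: algebra_simps)
 qed
 have main: "cdiff F W U (%ys. sec (cop W U ys) (f ys) (g ^ L * yprod y ys ^ (N + M))) xs = c xs"
  if xs: "length xs = Suc p" "set xs <= Idx" for xs
 proof -
  have S: "xs \<in> ?S" using xs by simp
  have *: "homogeneous (e * int L + int (N + M) * ydeg d ys + nu) (f ys) &
    sec (cop W U ys) (f ys) (g ^ L * yprod y ys ^ (N + M)) = sec (cop W U ys) (f ys) (g ^ L * yprod y ys ^ (N + M))"
   if "Suc (length ys) = length xs" "set ys <= set xs" for ys
   using fh[of ys] that xs by auto
  have **: "!!j. j \<in> set xs ==> homogeneous (d j) (y j)" "!!j P. j \<in> set xs ==> P \<in> U j ==> y j \<notin> P"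
   using xs y U by (auto simp: D_def)
  have gW: "g ^ L \<notin> P" if "P \<in> W" for P using gn[of "[]" P] that by simp
  note cd = cdiff_sec[OF * open_cop[OF xs(2)] ** gL gW]
  have hg: "homogeneous (e * int L + int (N + M) * ydeg d xs) (g ^ L * yprod y xs ^ (N + M))"
   by (rule homog_mult[OF gL yh[OF xs(2)]])
  have ng: "g ^ L * yprod y xs ^ (N + M) \<notin> P" if "P \<in> cop W U xs" for P
   by (rule notin_mult[OF open_cop[OF xs(2)] that gn[OF xs(2) that] yn[OF xs(2) that]])
  have "ydiff y (N + M) f xs = (\<Sum>i\<in>B. b i * ydiff y (N + M) (%ys. a' (i # ys)) xs)"
   unfolding f_def ydiff_sum ydiff_mult ..
  also have "... = (\<Sum>i\<in>B. b i * y i ^ (N + M)) * a' xs - (\<Sum>i\<in>B. b i * ydiff y (N + M) a' (i # xs))"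
   by (simp add: sum_distrib_right right_diff_distrib sum_subtractf mult.assoc)
  finally have eq: "ydiff y (N + M) f xs - g ^ L * a' xs =
    - ((g ^ L - (\<Sum>i\<in>B. b i * y i ^ (N + M))) * a' xs + (\<Sum>i\<in>B. b i * ydiff y (N + M) a' (i # xs)))"
   by (simp add: left_diff_distrib)
  have "(\<Sum>i\<in>B. b i * ydiff y (N + M) a' (i # xs)) \<in> J"
   by (rule ideal.subspace_sum[OF ideal_J], rule ideal.subspace_scale[OF ideal_J], rule da') (use B(2) xs in auto)
  then have inJ: "ydiff y (N + M) f xs - g ^ L * a' xs \<in> J"
   unfolding eq by (intro ideal.subspace_neg[OF ideal_J] ideal.subspace_add[OF ideal_J] ideal_mult_right[OF ideal_J b])
  have "sec (cop W U xs) (ydiff y (N + M) f xs) (g ^ L * yprod y xs ^ (N + M)) =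
    sec (cop W U xs) (g ^ L * a' xs) (g ^ L * yprod y xs ^ (N + M))"
  proof (rule sec_eqI[OF open_cop[OF xs(2)] hg cd(2) ng hg _ ng homog_one])
   show "homogeneous (e * int L + int (N + M) * ydeg d xs + nu) (g ^ L * a' xs)"
    using homog_mult[OF gL a'h[OF S]] by (simp add: add.assoc)
   show "1 \<notin> P" if "P \<in> cop W U xs" for P by (rule one_notin[OF open_cop[OF xs(2)] that])
   have "1 * (ydiff y (N + M) f xs * (g ^ L * yprod y xs ^ (N + M)) - g ^ L * a' xs * (g ^ L * yprod y xs ^ (N + M))) =
     (ydiff y (N + M) f xs - g ^ L * a' xs) * (g ^ L * yprod y xs ^ (N + M))" by (simp add: left_diff_distrib)
   then show "1 * (ydiff y (N + M) f xs * (g ^ L * yprod y xs ^ (N + M)) - g ^ L * a' xs * (g ^ L * yprod y xs ^ (N + M))) \<in> J"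
    using ideal_mult_right[OF ideal_J inJ] by simp
  qed
  then show ?thesis using cd(1) ca'[OF S] by simp
 qed
 show thesis
 proof (rule that)
  show "\<forall>ys. length ys = p & set ys <= Idx --> homogeneous (e * int L + int (N + M) * ydeg d ys + nu) (f ys)"
   using fh by blast
  show "is_cdiff F W U Idx p (%ys. sec (cop W U ys) (f ys) (g ^ L * yprod y ys ^ (N + M))) c"
   unfolding is_cdiff_def chain_def
  proof (intro conjI allI impI main)
   fix ys assume ys: "length ys = p & set ys <= Idx"
   show "sec (cop W U ys) (f ys) (g ^ L * yprod y ys ^ (N + M)) \<in> Sec F (cop W U ys)"
   proof (rule sec_closed[OF open_cop homog_mult[OF gL yh]])
    show "g ^ L * yprod y ys ^ (N + M) \<notin> P" if P: "P \<in> cop W U ys" for P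
     by (rule notin_mult[OF open_cop P gn yn]) (use ys P in auto)
   qed (use ys fh in auto)
  qed auto
 qed
qed

end

section \<open>The standard cover and the basis of principal open sets\<close>

lemma monomial_in_ideal:
 fixes P :: "('n::finite, 'k::field) mpol set"
 assumes P: "is_ideal P" "!!j. xv j \<in> P" and m: "m ~= 0"
 shows "single m c \<in> P"
proof -
 obtain j where j: "lookup m j ~= 0" using m by (metis lookup_zero poly_mapping_eqI)
 have "m = single j 1 + (m - single j 1)"
  using j by (intro poly_mapping_eqI) (auto simp: lookup_add lookup_minus lookup_single when_def)
 then have "single m c = xv j * single (m - single j 1) c"
  by (simp add: xv_def mult_single)
 then show ?thesis using ideal_mult_right[OF P(1) P(2)] by simp
qed

lemma irrelevant_idealI:
 fixes P :: "('n::finite, 'k::field) mpol set"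
 assumes P: "is_ideal P" "!!j. xv j \<in> P"
 shows "irrelevant_ideal <= P"
proof
 fix f :: "('n, 'k) mpol" assume f: "f \<in> irrelevant_ideal"
 have "(\<Sum>m\<in>keys f. single m (lookup f m)) \<in> P"
 proof (intro ideal.subspace_sum[OF P(1)] monomial_in_ideal[OF P])
  show "m ~= 0" if "m \<in> keys f" for m
   using that f by (auto simp: irrelevant_ideal_def in_keys_iff)
 qed
 then show "f \<in> P" by (simp only: sum_singles)
qed

lemma homog_xv: "homogeneous 1 (xv j :: ('n::finite, 'k::field) mpol)"
 unfolding xv_def by (rule homog_single) simp

context proj_scheme
begin

lemma xv_notin: "P \<in> pts ==> \<exists>j. xv j \<notin> P"
 using irrelevant_idealI[of P] proj_pointsD(4)[of P J] prime_idealD(1)[OF proj_pointsD(2)] by blast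

lemma pts_cover: "pts = (\<Union>j\<in>UNIV. D (xv j))"
 using xv_notin by (auto simp: D_def)

lemma homog_notin_nonneg: "P \<in> pts ==> f \<notin> P ==> homogeneous e f ==> e \<ge> 0"
 using homog_nonneg ideal.subspace_0[OF prime_idealD(1)[OF proj_pointsD(2)]] by blast

lemma D_refine:
 assumes V: "openin X V" and P: "P \<in> V"
 obtains e h where "homogeneous e h" "e > 0" "P \<in> D h" "D h <= V"
proof -
 obtain E where E: "\<forall>f\<in>E. \<exists>e. homogeneous e f" "V = {P \<in> pts. \<not> E <= P}"
  using V unfolding openin_proj_top proj_open_def by blast
 then obtain f where f: "f \<in> E" "f \<notin> P" using P by blast
 then obtain e where e: "homogeneous e f" using E(1) by blast
 have P': "P \<in> pts" using P E(2) by blast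
 \<comment> \<open>Multiplying \<open>f\<close> by a variable outside \<open>P\<close> makes its
   degree positive, as it could be 0.\<close>
 obtain j where j: "xv j \<notin> P" using xv_notin[OF P'] by blast
 have "D (f * xv j) <= V" unfolding D_mult E(2) using f(1) by (auto simp: D_def)
 moreover have "P \<in> D (f * xv j)" using f(2) j P' by (simp add: D_def prime_idealD(3)[OF proj_pointsD(2)])
 ultimately show thesis
  using that[OF homog_mult[OF e homog_xv]] homog_notin_nonneg[OF P' f(2) e] by simp
qed

text \<open>Near every point the section is a fraction whose denominator cuts out the neighbourhood.
  On a finite subcover the restrictions of \<open>s\<close> form a cocycle of fractions, and
  \<open>fraction_cocycle_exact\<close> with \<open>p = 0\<close> returns one fraction over a power
  of \<open>g\<close>.\<close>

lemma section_fraction: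
 assumes g: "homogeneous e g" "e > 0" and s: "s \<in> Sec F (D g)"
 obtains N a where "homogeneous (int N * e + nu) a" "s = sec (D g) a (g ^ N)"
proof -
 have oW: "openin X (D g)" by (rule open_D[OF g(1)])
 have pre: "presheaf X F" by (rule sheaf_presheaf[OF sheaf_twisted])
 have "\<exists>h d a. P \<in> D h & D h <= D g & homogeneous d h & d > 0 & homogeneous (d + nu) a & restr F (D g) (D h) s = sec (D h) a h"
  if P: "P \<in> D g" for P
 proof -
  have sD: "s \<in> twisted_sections J nu (D g)" using s by (simp add: tw_simps)
  obtain V e0 f a where V: "openin X V" "P \<in> V" "V <= D g" "homogeneous e0 f" "homogeneous (e0 + nu) a"
   "\<forall>Q\<in>V. f \<notin> Q" "\<forall>Q\<in>V. s Q = fr Q a f" using tw_local[OF sD P] .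
  obtain d h where h: "homogeneous d h" "d > 0" "P \<in> D h" "D h <= V" using D_refine[OF V(1,2)] .
  \<comment> \<open>Expanding by \<open>h\<close> turns the denominator into one whose principal
    open set is the neighbourhood itself.\<close>
  have Dhf: "D (h * f) = D h" using V(6) h(4) by (auto simp: D_mult) (auto simp: D_def)
  have e0: "e0 \<ge> 0" using homog_notin_nonneg[OF _ _ V(4), of P] V(6) h(3,4) by (auto simp: D_def)
  have "sec (D h) a f = sec (D h) (h * a) (h * f)"
   by (rule sec_scale[OF open_D[OF h(1)] V(4,5) _ h(1)]) (use V(6) h(4) in \<open>auto simp: D_def\<close>)
  moreover have "restr F (D g) (D h) s = sec (D h) a f"
   using V(3,7) h(4) by (auto simp: tw_simps sec_def intro!: restrict_ext)
  ultimately have "restr F (D g) (D (h * f)) s = sec (D (h * f)) (h * a) (h * f)" unfolding Dhf by simp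
  moreover have "homogeneous (d + e0 + nu) (h * a)" using homog_mult[OF h(1) V(5)] by (simp add: add.assoc)
  moreover have "P \<in> D (h * f) & D (h * f) <= D g" unfolding Dhf using h V(3) by blast
  moreover have "d + e0 > 0" using h(2) e0 by simp
  ultimately show ?thesis using homog_mult[OF h(1) V(4)] by (intro exI[of _ "h * f"] exI conjI) auto
 qed
 then have "\<forall>P\<in>D g. \<exists>h d a. P \<in> D h & D h <= D g & homogeneous d h & d > 0 & homogeneous (d + nu) a &
   restr F (D g) (D h) s = sec (D h) a h" by simp
 then obtain y d a where y: "\<forall>P\<in>D g. P \<in> D (y P) & D (y P) <= D g & homogeneous (d P) (y P) & d P > 0 &
   homogeneous (d P + nu) (a P) & restr F (D g) (D (y P)) s = sec (D (y P)) (a P) (y P)"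
  unfolding bchoice_iff by (elim exE)
 have yh: "homogeneous (d P) (y P)" if "P \<in> D g" for P using y that by simp
 have "D g <= (\<Union>P\<in>D g. D (y P))" using y by blast
 obtain B where B: "finite B" "B <= D g" "D g <= (\<Union>P\<in>B. D (y P))"
  using D_compact[OF g yh \<open>D g <= (\<Union>P\<in>D g. D (y P))\<close>] .
 have W: "D g = (\<Union>P\<in>B. D (y P))" using B y by blast
 let ?U = "%P. D (y P)" and ?W = "D g"
 interpret cech X ?W ?U B
  by unfold_locales (use oW yh B(2) in \<open>auto intro!: open_D\<close>)
 let ?c = "cdiff F ?W ?U (%_. s)"
 have ch: "chain F ?W ?U B 0 (%_. s)" using s by (simp add: chain_def)
 have cop1: "cop ?W ?U [P] = D (y P)" if "P \<in> B" for P using that W by (auto simp: cop_def)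
 have c1: "cdiff F ?W ?U (%_. t) [P] = restr F ?W (D (y P)) t" if P: "P \<in> B" and t: "t \<in> Sec F ?W" for P t
 proof -
  have o: "openin X (D (y P))" by (rule open_D[OF yh[OF subsetD[OF B(2) P]]])
  have sub: "D (y P) <= D g" using P W by blast
  show ?thesis
   using module_diff_zero[OF psh_mod[OF pre o] psh_restr_closed[OF pre oW o sub t]]
   by (simp add: cdiff_def cop1[OF P])
 qed
 obtain L N b where b: "\<forall>ys. length ys = 0 & set ys <= B --> homogeneous (e * int L + int N * ydeg d ys + nu) (b ys)"
  and cd: "is_cdiff F ?W ?U B 0 (%ys. sec (cop ?W ?U ys) (b ys) (g ^ L * yprod y ys ^ N)) ?c"
 proof (rule fraction_cocycle_exact[OF B(1) refl _ _ g refl W, where d = d and c = ?c and p = 0])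
  show "cocycle F ?W ?U B (Suc 0) ?c" by (rule cocycle_cdiff[OF pre ch])
  fix xs assume xs: "length xs = Suc 0" "set xs <= B"
  then obtain P where P: "xs = [P]" "P \<in> B" by (cases xs) auto
  have "?c xs = sec (cop ?W ?U xs) (a P) (yprod y xs ^ 1)"
   using c1[OF P(2) s] y P B(2) by (auto simp: cop1)
  moreover have "homogeneous (int 1 * ydeg d xs + nu) (a P)" using y P B(2) by auto
  ultimately show "\<exists>N a. homogeneous (int N * ydeg d xs + nu) a & ?c xs = sec (cop ?W ?U xs) a (yprod y xs ^ N)" by blast
 qed (use y B(2) in auto)
 have bh: "homogeneous (int L * e + nu) (b [])" using b by (simp add: mult.commute)
 have "s = sec ?W (b []) (g ^ L)"
 proof (rule sheaf_locality[OF sheaf_twisted _ W])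
  show "openin X (D (y P))" if "P \<in> B" for P using open_D[OF yh] that B(2) by auto
  show sW: "sec ?W (b []) (g ^ L) \<in> Sec F ?W"
  proof (rule sec_closed[OF oW homog_power[OF g(1)]])
   show "g ^ L \<notin> P" if "P \<in> D g" for P using notin_power[OF oW that] that by (simp add: D_def)
   show "homogeneous (e * int L + nu) (b [])" using bh by (simp add: mult.commute)
  qed
  fix P assume P: "P \<in> B"
  have "restr F ?W (D (y P)) s = ?c [P]" by (rule c1[OF P s, symmetric])
  also have "... = cdiff F ?W ?U (%ys. sec (cop ?W ?U ys) (b ys) (g ^ L * yprod y ys ^ N)) [P]"
   using cd P by (simp add: is_cdiff_def)
  also have "... = cdiff F ?W ?U (%_. sec ?W (b []) (g ^ L)) [P]" by (simp add: cdiff_def)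
  also have "... = restr F ?W (D (y P)) (sec ?W (b []) (g ^ L))" by (rule c1[OF P sW])
  finally show "restr F ?W (D (y P)) s = restr F ?W (D (y P)) (sec ?W (b []) (g ^ L))" .
 qed (rule s)
 then show thesis using that bh by blast
qed

text \<open>Positive degree is what the homogeneous Nullstellensatz asks for; by
  \<open>D_refine\<close> these sets still form a base.\<close>

definition \<B> :: "('n, 'k) proj_point set set"
 where "\<B> = {D f |f. \<exists>e>0. homogeneous e f}"

lemma basis_choice:
 assumes "\<U> <= \<B>"
 obtains y d where "!!V. V \<in> \<U> ==> V = D (y V)" "!!V. V \<in> \<U> ==> homogeneous (d V) (y V)" "!!V. V \<in> \<U> ==> d V > 0"
proof -
 have "\<forall>V\<in>\<U>. \<exists>f e. V = D f & homogeneous e f & e > 0"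
 proof
  fix V assume "V \<in> \<U>"
  then have "V \<in> \<B>" using assms by blast
  then show "\<exists>f e. V = D f & homogeneous e f & e > 0" by (auto simp: \<B>_def)
 qed
 then obtain y d where "\<forall>V\<in>\<U>. V = D (y V) & homogeneous (d V) (y V) & d V > 0"
  unfolding bchoice_iff by (elim exE)
 then show thesis using that[of y d] by simp
qed

lemma basis_twisted: "open_basis X \<B>"
proof
 show "openin X V" if "V \<in> \<B>" for V using that open_D by (auto simp: \<B>_def)
 show "V \<inter> W \<in> \<B>" if VW: "V \<in> \<B>" "W \<in> \<B>" for V W
 proof -
  obtain f g e e' where "V = D f" "W = D g" and h: "homogeneous e f" "homogeneous e' g" "e > 0" "e' > 0"
   using VW by (auto simp: \<B>_def)
  then have "V \<inter> W = D (f * g)" by (simp add: D_mult)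
  moreover have "\<exists>e>0. homogeneous e (f * g)" using homog_mult[OF h(1,2)] h(3,4) by (intro exI[of _ "e + e'"]) simp
  ultimately show ?thesis by (auto simp: \<B>_def)
 qed
 show "\<exists>D\<in>\<B>. x \<in> D & D <= V" if V: "openin X V" "x \<in> V" for V x
 proof -
  obtain e h where "homogeneous e h" "e > 0" "x \<in> D h" "D h <= V" using D_refine[OF V] .
  then show ?thesis by (intro bexI[of _ "D h"]) (auto simp: \<B>_def)
 qed
 fix W \<A> assume W: "W \<in> \<B>" and \<A>: "\<A> <= \<B>" "\<Union>\<A> = W"
 obtain g e where g: "W = D g" "homogeneous e g" "e > 0" using W by (auto simp: \<B>_def)
 obtain y d where y: "!!V. V \<in> \<A> ==> V = D (y V)" "!!V. V \<in> \<A> ==> homogeneous (d V) (y V)"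
  using basis_choice[OF \<A>(1)] by metis
 have "D g <= (\<Union>V\<in>\<A>. D (y V))" using \<A>(2) g(1) y(1) by auto
 obtain B where B: "finite B" "B <= \<A>" "D g <= (\<Union>V\<in>B. D (y V))"
  using D_compact[OF g(2,3) y(2) \<open>D g <= (\<Union>V\<in>\<A>. D (y V))\<close>] .
 have "(\<Union>V\<in>B. D (y V)) = (\<Union>V\<in>B. V)" by (intro SUP_cong refl y(1)[symmetric] subsetD[OF B(2)])
 then have "\<Union>B = W" using B(3) Union_mono[OF B(2)] \<A>(2) g(1) by simp
 then show "\<exists>\<U>\<subseteq>\<A>. finite \<U> & \<Union>\<U> = W" using B by blast
qed

sublocale open_basis X \<B> by (rule basis_twisted)

lemma cech_acyclic_twisted: "cech_acyclic F"
 unfolding cech_acyclic_def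
proof (intro ballI allI impI)
 fix W \<U> p c assume W: "W \<in> \<B>" and \<U>: "\<U> <= \<B>" "finite \<U> & \<Union>\<U> = W"
  and c: "cocycle F W (%V. V) \<U> (Suc (Suc p)) c"
 obtain g e where g: "W = D g" "homogeneous e g" "e > 0" using W by (auto simp: \<B>_def)
 obtain y d where y: "!!V. V \<in> \<U> ==> V = D (y V)" "!!V. V \<in> \<U> ==> homogeneous (d V) (y V)" "!!V. V \<in> \<U> ==> d V > 0"
  using basis_choice[OF \<U>(1)] by metis
 have cov: "W = (\<Union>V\<in>\<U>. V)" using \<U>(2) by simp
 show "\<exists>e. is_cdiff F W (%V. V) \<U> (Suc p) e c"
 proof (rule fraction_cocycle_exact[OF conjunct1[OF \<U>(2)] y g(2,3,1) cov c])
  fix xs assume xs: "length xs = Suc (Suc p)" "set xs <= \<U>"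
  have cop: "cop W (%V. V) xs = D (yprod y xs)" by (rule cop_D[OF y(1) cov xs(2)]) (use xs in auto)
  have s: "c xs \<in> Sec F (D (yprod y xs))" using c xs cop by (auto simp: cocycle_def chain_def)
  have h: "homogeneous (ydeg d xs) (yprod y xs)" using homog_yprod[of xs d y 1] y(2) xs(2) by auto
  have pos: "ydeg d xs > 0" by (rule ydeg_pos) (use y(3) xs in auto)
  obtain N a where "homogeneous (int N * ydeg d xs + nu) a" "c xs = sec (D (yprod y xs)) a (yprod y xs ^ N)"
   using section_fraction[OF h pos s] .
  then show "\<exists>N a. homogeneous (int N * ydeg d xs + nu) a & c xs = sec (cop W (%V. V) xs) a (yprod y xs ^ N)"
   unfolding cop by blast
 next
  fix L N b assume "is_cdiff F W (%V. V) \<U> (Suc p) (%ys. sec (cop W (%V. V) ys) (b ys) (g ^ L * yprod y ys ^ N)) c"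
  then show ?thesis by blast
 qed
qed

end

subsection \<open>Comparison with the Cech cohomology of the standard cover\<close>

lemma kdiff_eq_ydiff: "kdiff N c xs = ydiff xv N c xs"
 by (induction xs arbitrary: c) simp_all

lemma xl_eq_yprod: "xl xs = yprod xv xs"
 by (induction xs) simp_all

lemma ydeg_one: "ydeg (%_. 1) xs = int (length xs)"
 by (induction xs) simp_all

abbreviation trn :: "nat => ('n::finite list => ('n, 'k::field) mpol) => 'n list => ('n, 'k) mpol"
 where "trn m \<equiv> tr ^^ m"

lemma trn_apply: "trn m c xs = xl xs ^ m * c xs"
 by (induction m) (simp_all add: tr_def mult.assoc)

lemma trn_diff: "trn m (c - c') = trn m c - trn m c'"
 by (induction m) (simp_all only: funpow.simps id_apply comp_apply tr_diff)

lemma kdiff_trn: "kdiff (m + N) (trn m c) = trn m (kdiff N c)"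
 by (induction m) (simp_all add: kdiff_tr)

lemma kC_trn: "c \<in> kC nu N p ==> trn m c \<in> kC nu (m + N) p"
 by (induction m) (simp_all add: kC_tr)

lemma trn_trn: "trn m (trn l c) = trn (m + l) c"
 by (simp add: funpow_add)

context proj_scheme
begin

abbreviation "DX \<equiv> (%j. D (xv j))"
abbreviation "copx \<equiv> cop pts DX"

lemma DX_UNIV: "pts = (\<Union>j\<in>UNIV. DX j)"
 by (rule pts_cover)

sublocale std: cech X pts DX UNIV
proof
 show "openin X pts" using openin_topspace[of X] by (simp only: topspace_proj_top)
 show "openin X (D (xv j))" for j by (rule open_D[OF homog_xv])
qed

lemma copx_open: "openin X (copx xs)"
 by (rule std.open_cop) simp

lemma xl_notin: "P \<in> copx xs ==> xl xs ^ N \<notin> P"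
 unfolding xl_eq_yprod
 by (rule notin_power[OF copx_open _ notin_yprod[OF copx_open]]) (auto simp: cop_def D_def)

lemma xl_homogeneous: "homogeneous (int N * int (length xs)) (xl xs ^ N)"
 unfolding xl_eq_yprod ydeg_one[symmetric] by (rule homog_yprod) (rule homog_xv)

lemma copx_D: "xs ~= [] ==> copx xs = D (xl xs)"
 unfolding xl_eq_yprod by (rule cop_D[OF refl DX_UNIV]) auto

lemma kC_homogeneous: "c \<in> kC nu N p ==> length xs = p ==> homogeneous (int N * int (length xs) + nu) (c xs)"
proof -
 assume c: "c \<in> kC nu N p" and l: "length xs = p"
 from c have "homogeneous (nu + int (N * p)) (c xs)"
  unfolding kC_def mem_Collect_eq using spec[of _ xs] l by metis
 then show ?thesis using l by (simp add: add.commute)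
qed

lemma sec_add:
 assumes U: "openin X U" and f: "homogeneous e f" "!!P. P \<in> U ==> f \<notin> P"
  and a: "homogeneous (e + nu) a" and b: "homogeneous (e + nu) b"
 shows "sec U a f +[sections F U] sec U b f = sec U (a + b) f"
proof -
 have "fr P a f +[st P] fr P b f = fr P (a + b) f" if P: "P \<in> U" for P
 proof -
  have P': "P \<in> pts" using P open_pts[OF U] by blast
  have fp: "(a, f) \<in> fp P" "(b, f) \<in> fp P" "(a + b, f) \<in> fp P"
   using f(2)[OF P] by (auto intro!: fpI[OF _ f(1)] a b homog_add)
  show ?thesis
   unfolding st_add[OF P' fp(1,2)]
   by (rule fr_eqI1[OF P' fp_add[OF P' fp(1,2)] fp(3)]) (simp add: algebra_simps)
 qed
 then show ?thesis by (simp add: tw_simps sec_def cong: restrict_cong)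
qed

lemma sec_smult:
 assumes U: "openin X U" and f: "homogeneous e f" "!!P. P \<in> U ==> f \<notin> P" and a: "homogeneous (e + nu) a"
 shows "c *[sections F U] sec U a f = sec U (const_pol c * a) f"
proof -
 have "c *[st P] fr P a f = fr P (const_pol c * a) f" if P: "P \<in> U" for P
  using P open_pts[OF U] by (intro st_smult fpI[OF f(2)[OF P] f(1) a]) auto
 then show ?thesis by (simp add: tw_simps sec_def cong: restrict_cong)
qed

text \<open>For a fixed exponent this is in general neither injective modulo \<open>J\<close> nor
  onto. \<open>Phi_eq_iff\<close> and \<open>Phi_surj\<close> say that both hold after raising the
  exponent.\<close>

definition Phi :: "nat => nat => ('n list => ('n, 'k) mpol) => 'n list => ('n, 'k) proj_section"
 where "Phi N p c = (\<lambda>xs\<in>std.idx p. sec (copx xs) (c xs) (xl xs ^ N))"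

lemma Phi_apply: "length xs = p ==> Phi N p c xs = sec (copx xs) (c xs) (xl xs ^ N)"
 by (simp add: Phi_def std.idx_def)

lemma Phi_sec_closed:
 assumes "c \<in> kC nu N p" "length xs = p"
 shows "sec (copx xs) (c xs) (xl xs ^ N) \<in> Sec F (copx xs)"
 by (rule sec_closed[OF copx_open xl_homogeneous kC_homogeneous[OF assms] xl_notin])

lemma Phi_closed: "c \<in> kC nu N p ==> Phi N p c \<in> carrier (std.cmod F p)"
 unfolding std.cmod_def prod_module_simps Phi_def
 by (intro restrict_PiE_iff[THEN iffD2] ballI Phi_sec_closed) (simp_all add: std.idx_def)

lemma Phi_add: "c \<in> kC nu N p ==> c' \<in> kC nu N p ==> Phi N p (c + c') = Phi N p c +[std.cmod F p] Phi N p c'"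
 unfolding std.cmod_def prod_module_simps Phi_def
 by (rule restrict_ext)
   (simp add: std.idx_def sec_add[OF copx_open xl_homogeneous xl_notin kC_homogeneous kC_homogeneous])

lemma Phi_smult: "c \<in> kC nu N p ==> Phi N p (%xs. const_pol a * c xs) = a *[std.cmod F p] Phi N p c"
 unfolding std.cmod_def prod_module_simps Phi_def
 by (rule restrict_ext)
   (simp add: std.idx_def sec_smult[OF copx_open xl_homogeneous xl_notin kC_homogeneous])

lemma Phi_zero: "Phi N p 0 = 0[std.cmod F p]"
 unfolding std.cmod_def prod_module_simps Phi_def
 by (rule restrict_ext) (simp add: sec_zero[OF copx_open xl_homogeneous xl_notin, symmetric])

lemma Phi_tr: "c \<in> kC nu N p ==> Phi (Suc N) p (tr c) = Phi N p c"
 unfolding Phi_def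
proof (rule restrict_ext)
 fix xs :: "'n list" assume c: "c \<in> kC nu N p" and xs: "xs \<in> std.idx p"
 have "homogeneous (int (length xs)) (xl xs)" "!!P. P \<in> copx xs ==> xl xs \<notin> P"
  using xl_homogeneous[of 1 xs] xl_notin[of _ xs 1] by simp_all
 from sec_scale[OF copx_open xl_homogeneous kC_homogeneous[OF c std.idxD(1)[OF xs]] xl_notin this]
 show "sec (copx xs) (tr c xs) (xl xs ^ Suc N) = sec (copx xs) (c xs) (xl xs ^ N)"
  by (simp add: tr_def)
qed

lemma Phi_trn: "c \<in> kC nu N p ==> Phi (m + N) p (trn m c) = Phi N p c"
 by (induction m) (simp_all add: Phi_tr kC_trn)

lemma Phi_kdiff:
 assumes c: "c \<in> kC nu N p" and xs: "length xs = Suc p"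
 shows "cdiff F pts DX (Phi N p c) xs = Phi N (Suc p) (kdiff N c) xs"
proof -
 have "cdiff F pts DX (Phi N p c) xs = sec (copx xs) (ydiff xv N c xs) (1 * yprod xv xs ^ N)"
 proof (rule cdiff_sec(1)[where d = "%_. 1" and e = 0])
  show "homogeneous (0 + int N * ydeg (%_. 1) ys + nu) (c ys) &
    Phi N p c ys = sec (copx ys) (c ys) (1 * yprod xv ys ^ N)" if "Suc (length ys) = length xs" for ys
   using that xs kC_homogeneous[OF c, of ys] by (simp add: Phi_apply xl_eq_yprod ydeg_one)
  show "1 \<notin> P" if "P \<in> pts" for P using that prime_idealD(2)[OF proj_pointsD(2)] by blast
  show "xv j \<notin> P" if "P \<in> DX j" for j P using that by (simp add: D_def)
 qed (simp_all add: homog_xv copx_open)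
 then show ?thesis using xs by (simp add: Phi_apply kdiff_eq_ydiff xl_eq_yprod)
qed

lemma finite_idx: "finite {xs :: 'n list. length xs = p}"
 using finite_lists_length_eq[of "UNIV :: 'n set" p] by simp

text \<open>On each intersection, equality of the sections means that a power of
  \<open>xl xs\<close> multiplies the difference into \<open>J\<close>. There are finitely many
  lists of the given length, so one power works for all.\<close>

lemma Phi_eq_iff:
 assumes c: "c \<in> kC nu N (Suc p)" "c' \<in> kC nu N (Suc p)"
 shows "Phi N (Suc p) c = Phi N (Suc p) c' \<longleftrightarrow> (\<exists>m. trn m (c - c') \<in> valued J)"
proof
 let ?S = "{xs :: 'n list. length xs = Suc p}"
 assume eq: "Phi N (Suc p) c = Phi N (Suc p) c'"
 have "\<exists>m. xl xs ^ m * (c - c') xs \<in> J" if xs: "xs \<in> ?S" for xs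
 proof -
  have l: "length xs = Suc p" and ne: "xs ~= []" using xs by auto
  note h = kC_homogeneous[OF c(1) l] kC_homogeneous[OF c(2) l]
  have m: "is_module (sections F (copx xs))" by (rule psh_mod[OF sheaf_presheaf[OF sheaf_twisted] copx_open])
  have "sec (copx xs) (c xs) (xl xs ^ N) = sec (copx xs) (c' xs) (xl xs ^ N)"
   using fun_cong[OF eq, of xs] l by (simp add: Phi_apply)
  moreover have "sec (copx xs) (c xs) (xl xs ^ N) -[sections F (copx xs)] sec (copx xs) (c' xs) (xl xs ^ N) =
    sec (copx xs) (c xs - c' xs) (xl xs ^ N)"
   by (rule sec_diff[OF copx_open xl_homogeneous xl_notin h])
  ultimately have "sec (copx xs) (c xs - c' xs) (xl xs ^ N) = 0[sections F (copx xs)]"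
   by (simp add: module_diff_self[OF m Phi_sec_closed[OF c(2) l]])
  then have 0: "sec (D (xl xs)) (c xs - c' xs) (xl xs ^ N) = 0[sections F (D (xl xs))]"
   unfolding copx_D[OF ne] .
  show ?thesis unfolding fun_diff_def
  proof (rule sec_eq_zeroD[OF _ _ xl_homogeneous homog_diff[OF h] _ 0])
   show "homogeneous (int 1 * int (length xs)) (xl xs)" using xl_homogeneous[of 1 xs] by simp
   show "xl xs ^ N \<notin> P" if "P \<in> D (xl xs)" for P using xl_notin that copx_D[OF ne] by blast
  qed (use l in simp)
 qed
 then have "\<forall>xs\<in>?S. \<exists>m. xl xs ^ m * (c - c') xs \<in> J" by blast
 then obtain M where M: "\<forall>xs\<in>?S. xl xs ^ M * (c - c') xs \<in> J" by (rule uniform_exponent[OF finite_idx])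
 have "xl xs ^ M * (c - c') xs \<in> J" for xs
  using M c ideal.subspace_0[OF ideal_J] by (cases "xs \<in> ?S") (auto simp: kC_def)
 then show "\<exists>m. trn m (c - c') \<in> valued J" unfolding valued_def mem_Collect_eq trn_apply by blast
next
 assume "\<exists>m. trn m (c - c') \<in> valued J"
 then obtain m where m: "xl xs ^ m * (c xs - c' xs) \<in> J" for xs by (auto simp: valued_def trn_apply)
 show "Phi N (Suc p) c = Phi N (Suc p) c'"
  unfolding Phi_def
 proof (rule restrict_ext)
  fix xs assume "xs \<in> std.idx (Suc p)"
  then have l: "length xs = Suc p" by (rule std.idxD)
  show "sec (copx xs) (c xs) (xl xs ^ N) = sec (copx xs) (c' xs) (xl xs ^ N)"
  proof (rule sec_eqI[OF copx_open xl_homogeneous kC_homogeneous[OF c(1) l] xl_notin xl_homogeneous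
     kC_homogeneous[OF c(2) l] xl_notin xl_homogeneous xl_notin])
   have "xl xs ^ m * (c xs * xl xs ^ N - c' xs * xl xs ^ N) = (xl xs ^ m * (c xs - c' xs)) * xl xs ^ N"
    by (simp add: left_diff_distrib mult.assoc)
   then show "xl xs ^ m * (c xs * xl xs ^ N - c' xs * xl xs ^ N) \<in> J" using ideal_mult_right[OF ideal_J m] by simp
  qed
 qed
qed

lemma Phi_surj:
 assumes x: "x \<in> carrier (std.cmod F (Suc p))"
 obtains M c where "M \<ge> N" "c \<in> kC nu M (Suc p)" "Phi M (Suc p) c = x"
proof -
 let ?S = "{xs :: 'n list. length xs = Suc p}"
 obtain M a where Ma: "\<forall>xs\<in>?S. homogeneous (int M * ydeg (%_. 1) xs + nu) (a xs) &
   x xs = sec (copx xs) (a xs) (yprod xv xs ^ M)"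
 proof (rule uniform_fractions[OF finite_idx, where d = "%_. 1" and y = xv and U = copx and c = x])
  show "homogeneous (ydeg (%_. 1) xs) (yprod xv xs)" for xs :: "'n list"
   using xl_homogeneous[of 1 xs] by (simp add: xl_eq_yprod ydeg_one)
  show "yprod xv xs \<notin> P" if "P \<in> copx xs" for xs P using xl_notin[OF that, of 1] by (simp add: xl_eq_yprod)
  fix xs assume "xs \<in> ?S"
  then have l: "length xs = Suc p" "xs ~= []" by auto
  have xsec: "x xs \<in> Sec F (D (xl xs))"
   using std.chainD[OF std.chain_carrier[OF x] l(1)] copx_D[OF l(2)] by simp
  have h: "homogeneous (int 1 * int (length xs)) (xl xs)" and pos: "int 1 * int (length xs) > 0"
   using xl_homogeneous[of 1 xs] l by simp_all
  obtain N a where "homogeneous (int N * (int 1 * int (length xs)) + nu) a" "x xs = sec (D (xl xs)) a (xl xs ^ N)"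
   using section_fraction[OF h pos xsec] .
  then show "\<exists>N a. homogeneous (int N * ydeg (%_. 1) xs + nu) a & x xs = sec (copx xs) a (yprod xv xs ^ N)"
   using copx_D[OF l(2)] by (auto simp: ydeg_one xl_eq_yprod)
 qed (rule copx_open)
 define c where "c xs = (if length xs = Suc p then a xs else 0)" for xs
 have c: "c \<in> kC nu M (Suc p)"
  unfolding kC_def using Ma by (auto simp: c_def ydeg_one algebra_simps)
 have Mx: "Phi M (Suc p) c = x"
  using Ma by (intro std.cmod_eqI[OF Phi_closed[OF c] x]) (auto simp: Phi_apply c_def xl_eq_yprod std.idx_def)
 have "Phi (N + M) (Suc p) (trn N c) = x" by (simp only: Phi_trn[OF c] Mx)
 then show thesis by (rule that[OF le_add1 kC_trn[OF c]])
qed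

lemma Phi_cocycle_iff:
 assumes c: "c \<in> kC nu N (Suc p)"
 shows "Phi N (Suc p) c \<in> std.cech_cocycles F (Suc p) \<longleftrightarrow> (\<exists>m. trn m (kdiff N c) \<in> valued J)"
proof -
 have k: "kdiff N c \<in> kC nu N (Suc (Suc p))" by (rule kC_kdiff[OF c])
 have "Phi N (Suc p) c \<in> std.cech_cocycles F (Suc p) \<longleftrightarrow>
  (\<forall>xs. length xs = Suc (Suc p) --> Phi N (Suc (Suc p)) (kdiff N c) xs = 0[sections F (copx xs)])"
  using Phi_closed[OF c] std.chain_carrier[OF Phi_closed[OF c]]
  by (simp add: std.cech_cocycles_def cocycle_def Phi_kdiff[OF c] cong: imp_cong)
 also have "... \<longleftrightarrow> Phi N (Suc (Suc p)) (kdiff N c) = Phi N (Suc (Suc p)) 0"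
 proof
  assume "\<forall>xs. length xs = Suc (Suc p) --> Phi N (Suc (Suc p)) (kdiff N c) xs = 0[sections F (copx xs)]"
  then show "Phi N (Suc (Suc p)) (kdiff N c) = Phi N (Suc (Suc p)) 0"
   unfolding Phi_zero
   by (intro std.cmod_eqI[OF Phi_closed[OF k] module_facts(2)[OF std.module_cmod[OF sheaf_presheaf[OF sheaf_twisted]]]])
     (simp add: std.cmod_simps std.idx_def)
 next
  assume "Phi N (Suc (Suc p)) (kdiff N c) = Phi N (Suc (Suc p)) 0"
  then show "\<forall>xs. length xs = Suc (Suc p) --> Phi N (Suc (Suc p)) (kdiff N c) xs = 0[sections F (copx xs)]"
   unfolding Phi_zero by (simp add: std.cmod_simps std.idx_def)
 qed
 also have "... \<longleftrightarrow> (\<exists>m. trn m (kdiff N c) \<in> valued J)" using Phi_eq_iff[OF k kC_zero] by simp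
 finally show ?thesis .
qed

end

definition cochain_module :: "('k, 'n list => ('n, 'k::field) mpol) module"
 where "cochain_module = \<lparr>carrier = UNIV, mult = undefined, one = undefined, zero = 0, add = (+), smult = cscale\<rparr>"

lemma cochain_module_simps [simp]:
 "carrier cochain_module = UNIV" "0[cochain_module] = 0" "x +[cochain_module] y = x + y"
 "a *[cochain_module] x = cscale a x"
 by (simp_all add: cochain_module_def)

lemma module_cochain: "is_module (cochain_module :: ('k::field, 'n::finite list => ('n, 'k) mpol) module)"
proof (rule scalar_moduleI; unfold cochain_module_simps)
 fix x y z :: "'n list => ('n, 'k) mpol" and a b :: 'k
 show "cscale (a + b) x = cscale a x + cscale b x" by (rule cochain.scale_left_distrib)
 show "cscale a (x + y) = cscale a x + cscale a y" by (rule cochain.scale_right_distrib)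
 show "cscale (a * b) x = cscale a (cscale b x)" by (rule cochain.scale_scale[symmetric])
 show "cscale 1 x = x" by (rule cochain.scale_one)
 show "cscale 0 x = 0" by (rule cochain.scale_zero_left)
qed (simp_all add: add.assoc add.commute)

lemma cochain_module_finsum:
 fixes f :: "'i => 'n::finite list => ('n, 'k::field) mpol"
 assumes "finite A" shows "(\<Oplus>\<^bsub>cochain_module\<^esub>j\<in>A. f j) = (\<Sum>j\<in>A. f j)"
proof -
 interpret Module.module scalar_ring "cochain_module :: ('k, 'n list => ('n, 'k) mpol) module" by (rule module_cochain)
 show ?thesis using assms by induction simp_all
qed

text \<open>Independence modulo \<open>B\<close> is uniqueness of the coordinates of 0. Coordinates
  are extensional functions, so restrictions to \<open>{..<d}\<close> appear.\<close>

lemma quotient_has_dim_iff_quot_basis: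
 fixes B Z :: "('n::finite list => ('n, 'k::field) mpol) set"
 assumes B: "cochain.subspace B" and Z: "cochain.subspace Z"
 shows "quotient_has_dim cochain_module Z B d \<longleftrightarrow> (\<exists>b. cochain.quot_basis Z B d b)"
proof -
 have m: "x -[cochain_module] y = x - y" for x y :: "'n list => ('n, 'k) mpol"
 proof -
  have "cscale (- 1) y = - y" by (rule cochain.scale_minus_left[of 1 y, simplified cochain.scale_one])
  then show ?thesis using module_minus_eq[OF module_cochain, of x y] by simp
 qed
 have "((\<forall>j<d. b j \<in> Z) & (\<forall>z\<in>Z. \<exists>!c. c \<in> {..<d} \<rightarrow>\<^sub>E UNIV & z - (\<Sum>j<d. cscale (c j) (b j)) \<in> B)) \<longleftrightarrow>
  cochain.quot_basis Z B d b" for b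
 proof
  assume H: "(\<forall>j<d. b j \<in> Z) & (\<forall>z\<in>Z. \<exists>!c. c \<in> {..<d} \<rightarrow>\<^sub>E UNIV & z - (\<Sum>j<d. cscale (c j) (b j)) \<in> B)"
  show "cochain.quot_basis Z B d b"
   unfolding cochain.quot_basis_def
  proof (intro conjI allI impI ballI)
   show "b j \<in> Z" if "j < d" for j using H that by blast
   show "\<exists>c. z - (\<Sum>j<d. cscale (c j) (b j)) \<in> B" if "z \<in> Z" for z using H that by blast
   fix c j assume c: "(\<Sum>j<d. cscale (c j) (b j)) \<in> B" and j: "j < d"
   \<comment> \<open>Together with \<open>c0\<close>, a second coordinate vector of 0; uniqueness
     makes both equal. The sign comes from the difference in
     \<open>quotient_has_dim\<close>.\<close>
   define c' where "c' = (\<lambda>j\<in>{..<d}. - c j)"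
   define c0 where "c0 = (\<lambda>j\<in>{..<d}. 0 :: 'k)"
   have "(\<Sum>j<d. cscale (c' j) (b j)) = - (\<Sum>j<d. cscale (c j) (b j))"
    unfolding sum_negf[symmetric] c'_def by (intro sum.cong refl) (simp add: cochain.scale_minus_left)
   then have 1: "c' \<in> {..<d} \<rightarrow>\<^sub>E UNIV & 0 - (\<Sum>j<d. cscale (c' j) (b j)) \<in> B" using c by (auto simp: c'_def)
   have "(\<Sum>j<d. cscale (c0 j) (b j)) = 0"
    unfolding c0_def by (intro sum.neutral) (simp add: fun_eq_iff)
   then have 2: "c0 \<in> {..<d} \<rightarrow>\<^sub>E UNIV & 0 - (\<Sum>j<d. cscale (c0 j) (b j)) \<in> B"
    using cochain.subspace_0[OF B] by (auto simp: c0_def)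
   define Q where "Q c \<longleftrightarrow> c \<in> {..<d} \<rightarrow>\<^sub>E UNIV & 0 - (\<Sum>j<d. cscale (c j) (b j)) \<in> B" for c
   have "\<exists>!c. Q c" unfolding Q_def by (rule bspec[OF conjunct2[OF H] cochain.subspace_0[OF Z]])
   moreover have "Q c'" "Q c0" unfolding Q_def by (rule 1, rule 2)
   ultimately have "c' j = c0 j" by metis
   then show "c j = 0" using j by (simp add: c'_def c0_def)
  qed
 next
  assume H: "cochain.quot_basis Z B d b"
  show "(\<forall>j<d. b j \<in> Z) & (\<forall>z\<in>Z. \<exists>!c. c \<in> {..<d} \<rightarrow>\<^sub>E UNIV & z - (\<Sum>j<d. cscale (c j) (b j)) \<in> B)"
  proof (intro conjI ballI)
   show "\<forall>j<d. b j \<in> Z" using H by (simp add: cochain.quot_basis_def)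
   fix z assume "z \<in> Z"
   then obtain c where c: "z - (\<Sum>j<d. cscale (c j) (b j)) \<in> B" using H unfolding cochain.quot_basis_def by blast
   have eq: "(\<Sum>j<d. cscale (restrict c {..<d} j) (b j)) = (\<Sum>j<d. cscale (c j) (b j))" by (intro sum.cong) auto
   show "\<exists>!c. c \<in> {..<d} \<rightarrow>\<^sub>E UNIV & z - (\<Sum>j<d. cscale (c j) (b j)) \<in> B"
   proof (rule ex1I[of _ "restrict c {..<d}"])
    show "restrict c {..<d} \<in> {..<d} \<rightarrow>\<^sub>E UNIV & z - (\<Sum>j<d. cscale (restrict c {..<d} j) (b j)) \<in> B"
     unfolding eq using c by auto
    fix c' assume c': "c' \<in> {..<d} \<rightarrow>\<^sub>E UNIV & z - (\<Sum>j<d. cscale (c' j) (b j)) \<in> B"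
    have "(\<Sum>j<d. cscale (c' j - c j) (b j)) = (z - (\<Sum>j<d. cscale (c j) (b j))) - (z - (\<Sum>j<d. cscale (c' j) (b j)))"
     by (simp only: cochain.scale_left_diff_distrib sum_subtractf) simp
    also have "... \<in> B" by (rule cochain.subspace_diff[OF B c conjunct2[OF c']])
    finally have s: "(\<Sum>j<d. cscale (c' j - c j) (b j)) \<in> B" .
    have "\<forall>c. (\<Sum>j<d. cscale (c j) (b j)) \<in> B --> (\<forall>j<d. c j = 0)"
     using H unfolding cochain.quot_basis_def by (elim conjE)
    from mp[OF spec[OF this, of "%j. c' j - c j"] s] have "\<forall>j<d. c' j - c j = 0" .
    then show "c' = restrict c {..<d}" using c' by (intro extensionalityI[of _ "{..<d}"]) (auto simp: PiE_iff)
   qed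
  qed
 qed
 then show ?thesis unfolding quotient_has_dim_def m cochain_module_finsum[OF finite_lessThan] cochain_module_simps
  by (rule arg_cong[where f = Ex, OF ext])
qed

section \<open>Cech cohomology of the twisted sheaf from a single exponent\<close>

context squarefree_degeneration
begin

abbreviation "BI == kB I nu"
abbreviation "ZI == kZ I nu"

lemma kZ_tr: "z \<in> ZI N i ==> tr z \<in> ZI (Suc N) i"
 by (simp add: kZ_def kC_tr kdiff_tr valued_tr[OF ideal_I])

lemma kZ_trn: "z \<in> ZI N i ==> trn m z \<in> ZI (m + N) i"
 by (induction m) (simp_all add: kZ_tr)

lemma kB_tr_iff:
 assumes N: "large N" and z: "z \<in> ZI N i"
 shows "tr z \<in> BI (Suc N) i \<longleftrightarrow> z \<in> BI N i"
proof -
 have zK: "z \<in> K N (Suc i)" "kdiff N z \<in> valued I" using z by (auto simp: kZ_def)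
 show ?thesis
 proof (cases i)
  case 0
  then show ?thesis
   using zK kC_tr[OF zK(1)] tr_valued_I[OF N _ zK(2)] valued_tr[OF ideal_I, of z] by (auto simp: kB_def)
 next
  case (Suc p)
  have "\<exists>e'\<in>K N (Suc p). z - kdiff N e' \<in> valued I" if "e \<in> K (Suc N) (Suc p)" "tr z - kdiff (Suc N) e \<in> valued I" for e
   using coboundaries_raise[OF N _ zK(2) that] zK(1) Suc by simp
  moreover have "\<exists>e'\<in>K (Suc N) (Suc p). tr z - kdiff (Suc N) e' \<in> valued I" if "e \<in> K N (Suc p)" "z - kdiff N e \<in> valued I" for e
   by (rule bexI[OF _ kC_tr[OF that(1)]])
     (use valued_tr[OF ideal_I that(2)] in \<open>simp only: tr_diff kdiff_tr\<close>)
  ultimately show ?thesis using zK(1) kC_tr[OF zK(1)] Suc by (auto simp: kB_def)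
 qed
qed

lemma large_add: "large N ==> large (m + N)"
 by (induction m) (simp_all add: large_Suc)

lemma kB_trn_iff:
 assumes N: "large N" and z: "z \<in> ZI N i"
 shows "trn m z \<in> BI (m + N) i \<longleftrightarrow> z \<in> BI N i"
 by (induction m) (simp_all add: kB_tr_iff[OF large_add[OF N] kZ_trn[OF z]])

lemma kZ_lower:
 assumes N: "large N" and y: "y \<in> ZI (Suc N) i"
 shows "\<exists>z\<in>ZI N i. y - tr z \<in> BI (Suc N) i"
proof -
 have yK: "y \<in> K (Suc N) (Suc i)" "kdiff (Suc N) y \<in> valued I" using y by (auto simp: kZ_def)
 obtain z e where z: "z \<in> K N (Suc i)" "kdiff N z \<in> valued I"
  and e: "e \<in> K (Suc N) i" "y - tr z - kdiff (Suc N) e \<in> valued I"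
  using cocycles_raise[OF N yK] by blast
 show ?thesis
 proof (cases "i = 0")
  case False
  then show ?thesis
   using z e kC_diff[OF yK(1) kC_tr[OF z(1)]] by (intro bexI[of _ z]) (auto simp: kB_def kZ_def)
 next
  case True
  have eN: "e \<in> K N 0" using e(1) unfolding kC_def True by (simp only: mult_0_right)
  \<comment> \<open>The denominator of the empty list is 1. So the differential of \<open>e\<close>
    comes from the exponent \<open>N\<close> and can be added to \<open>z\<close>, as in degree 0 it
    does not count as a coboundary.\<close>
  have "tr e = e"
  proof
   fix xs :: "'n list" show "tr e xs = e xs" using eN by (cases xs) (auto simp: tr_def kC_def)
  qed
  then have "kdiff (Suc N) e = tr (kdiff N e)" using kdiff_tr[of N e] by simp
  then have "y - tr (z + kdiff N e) \<in> valued I" using e(2) by (simp add: tr_add diff_diff_add)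
  moreover have "z + kdiff N e \<in> ZI N 0"
   using z kC_kdiff[OF eN] True by (simp add: kZ_def kC_add kdiff_add kdiff_kdiff)
  ultimately show ?thesis
   using True yK(1) by (intro bexI[of _ "z + kdiff N e"]) (auto simp: kB_def kZ_def intro!: kC_diff kC_tr)
 qed
qed

lemma kZ_lower_trn:
 assumes N: "large N" and y: "y \<in> ZI (m + N) i"
 shows "\<exists>z\<in>ZI N i. y - trn m z \<in> BI (m + N) i"
 using y
proof (induction m arbitrary: y)
 case 0
 then have y: "y \<in> ZI N i" by (simp only: add_0)
 have "y - trn 0 y = 0" by (simp only: funpow.simps id_apply diff_self)
 then show ?case using cochain.subspace_0[OF subspace_kB[OF ideal_I]]
  by (intro bexI[OF _ y]) (simp only: add_0)
next
 case (Suc m)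
 obtain y' where y': "y' \<in> ZI (m + N) i" "y - tr y' \<in> BI (Suc (m + N)) i"
  using kZ_lower[OF large_add[OF N] Suc.prems[unfolded add_Suc]] by (elim bexE)
 obtain z where z: "z \<in> ZI N i" "y' - trn m z \<in> BI (m + N) i"
  using Suc.IH[OF y'(1)] by blast
 have "y' - trn m z \<in> ZI (m + N) i"
  by (rule cochain.subspace_diff[OF subspace_kZ[OF ideal_I] y'(1) kZ_trn[OF z(1)]])
 then have "tr (y' - trn m z) \<in> BI (Suc (m + N)) i"
  using kB_tr_iff[OF large_add[OF N]] z(2) by blast
 from cochain.subspace_add[OF subspace_kB[OF ideal_I] y'(2) this]
 have "y - trn (Suc m) z \<in> BI (Suc m + N) i" by (simp add: tr_diff)
 then show ?case using z(1) by blast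
qed

sublocale Y: proj_scheme I nu
 by unfold_locales (rule I)

text \<open>A bounding cochain of sections has numerators over some exponent \<open>M\<close> \<ge>
  \<open>N\<close> by \<open>Phi_surj\<close>. It bounds a raised copy of \<open>y\<close>, and
  \<open>kB_trn_iff\<close> brings the conclusion back to \<open>N\<close>.\<close>

lemma Phi_coboundary_iff:
 assumes N: "large N" and y: "y \<in> ZI N i"
 shows "Y.Phi N (Suc i) y \<in> Y.std.cech_coboundaries Y.F i \<longleftrightarrow> y \<in> BI N i"
proof -
 have yK: "y \<in> K N (Suc i)" using y by (simp add: kZ_def)
 note cl = Y.Phi_closed[OF yK]
 show ?thesis
 proof (cases i)
  case 0
  have "Y.Phi N (Suc i) y \<in> Y.std.cech_coboundaries Y.F i \<longleftrightarrow> Y.Phi N (Suc i) y = Y.Phi N (Suc i) 0"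
   using 0 cl by (simp add: Y.std.cech_coboundaries_def Y.Phi_zero)
  also have "... \<longleftrightarrow> (\<exists>m. trn m y \<in> valued I)" using Y.Phi_eq_iff[OF yK kC_zero] by simp
  also have "... \<longleftrightarrow> (\<exists>m. trn m y \<in> BI (m + N) i)"
   using 0 kC_trn[OF yK] by (simp add: kB_def)
  also have "... \<longleftrightarrow> y \<in> BI N i" by (simp add: kB_trn_iff[OF N y])
  finally show ?thesis .
 next
  case (Suc p)
  have kd: "is_cdiff Y.F (proj_points I) Y.DX UNIV i (Y.Phi M i e) (Y.Phi N (Suc i) y) \<longleftrightarrow>
    Y.Phi M (Suc i) (kdiff M e) = Y.Phi N (Suc i) y" if e: "e \<in> K M i" for M e
  proof -
   have "is_cdiff Y.F (proj_points I) Y.DX UNIV i (Y.Phi M i e) (Y.Phi N (Suc i) y) \<longleftrightarrow>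
     (\<forall>xs\<in>Y.std.idx (Suc i). Y.Phi M (Suc i) (kdiff M e) xs = Y.Phi N (Suc i) y xs)"
    using Y.std.chain_carrier[OF Y.Phi_closed[OF e]] Y.Phi_kdiff[OF e] by (auto simp: is_cdiff_def Y.std.idx_def)
   also have "... \<longleftrightarrow> Y.Phi M (Suc i) (kdiff M e) = Y.Phi N (Suc i) y"
    using Y.std.cmod_eqI[OF Y.Phi_closed[OF kC_kdiff[OF e]] cl] by auto
   finally show ?thesis .
  qed
  show ?thesis
  proof
   assume "y \<in> BI N i"
   then obtain e where e: "e \<in> K N i" "trn 0 (y - kdiff N e) \<in> valued I" using Suc by (auto simp: kB_def)
   then have "Y.Phi N (Suc i) y = Y.Phi N (Suc i) (kdiff N e)" using Y.Phi_eq_iff[OF yK kC_kdiff[OF e(1)]] by blast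
   then have "is_cdiff Y.F (proj_points I) Y.DX UNIV i (Y.Phi N i e) (Y.Phi N (Suc i) y)" unfolding kd[OF e(1)] ..
   then show "Y.Phi N (Suc i) y \<in> Y.std.cech_coboundaries Y.F i" using cl Suc by (auto simp: Y.std.cech_coboundaries_def)
  next
   assume "Y.Phi N (Suc i) y \<in> Y.std.cech_coboundaries Y.F i"
   then obtain e' where e': "is_cdiff Y.F (proj_points I) Y.DX UNIV i e' (Y.Phi N (Suc i) y)"
    using Suc by (auto simp: Y.std.cech_coboundaries_def)
   have "restrict e' (Y.std.idx (Suc p)) \<in> carrier (Y.std.cmod Y.F (Suc p))"
    using e' Suc by (intro Y.std.restrict_carrier) (simp add: is_cdiff_def)
   then obtain M e where M: "M \<ge> N" and e: "e \<in> K M (Suc p)" "Y.Phi M (Suc p) e = restrict e' (Y.std.idx (Suc p))"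
    by (rule Y.Phi_surj)
   have ei: "e \<in> K M i" using e Suc by simp
   have "is_cdiff Y.F (proj_points I) Y.DX UNIV i (Y.Phi M i e) (Y.Phi N (Suc i) y)"
    using e' Y.std.cdiff_cong_idx[where F = Y.F, of "Suc p" "restrict e' (Y.std.idx (Suc p))" e']
     Y.std.chain_cong[where F = Y.F, of "Suc p" "restrict e' (Y.std.idx (Suc p))" e']
    unfolding Suc e(2) is_cdiff_def by simp
   then have eq: "Y.Phi M (Suc i) (kdiff M e) = Y.Phi N (Suc i) y" unfolding kd[OF ei] .
   obtain l where l: "M = l + N" using M by (metis add.commute le_Suc_ex)
   have "Y.Phi M (Suc i) (trn l y) = Y.Phi M (Suc i) (kdiff M e)" unfolding eq unfolding l by (rule Y.Phi_trn[OF yK])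
   then obtain m where m: "trn m (trn l y - kdiff M e) \<in> valued I"
    using Y.Phi_eq_iff[of "trn l y" M i "kdiff M e"] kC_trn[OF yK, of l] kC_kdiff[OF ei] l by auto
   have "trn (m + l) y - kdiff (m + M) (trn m e) \<in> valued I"
    using m by (simp only: trn_diff trn_trn kdiff_trn)
   then have "trn (m + l) y \<in> BI (m + l + N) i"
    using Suc kC_trn[OF yK, of "m + l"] kC_trn[OF ei, of m] l by (auto simp: kB_def add.assoc)
   then show "y \<in> BI N i" by (simp add: kB_trn_iff[OF N y])
  qed
 qed
qed

text \<open>Cochains of sections are the union of the complexes of numerators over all exponents.
  For large \<open>N\<close> raising the exponent is bijective on cohomology, by
  \<open>kZ_lower_trn\<close> and \<open>kB_trn_iff\<close>, so one exponent computes
  everything.\<close>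

theorem cech_dim_twisted:
 assumes N: "large N"
 shows "Y.std.cech_dim Y.F i d \<longleftrightarrow>
  d = cochain.dim (kZ J nu N i) - cochain.dim (kB J nu N i)"
proof -
 let ?Z = "ZI N i" and ?B = "BI N i"
 let ?M = "Y.std.cmod Y.F (Suc i)" and ?Z' = "Y.std.cech_cocycles Y.F (Suc i)" and ?B' = "Y.std.cech_coboundaries Y.F i"
 note pre = sheaf_presheaf[OF Y.sheaf_twisted]
 note subB = subspace_kB[OF ideal_I] and subZ = subspace_kZ[OF ideal_I]
 have ZK: "y \<in> K M (Suc i)" if "y \<in> ZI M i" for y M using that by (simp add: kZ_def)
 \<comment> \<open>The cocycle \<open>z'\<close> may have numerators \<open>y\<close> only over a
   larger exponent, and these agree with the raised \<open>z\<close> only up to a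
   coboundary.\<close>
 define R where "R m z z' \<longleftrightarrow> z \<in> ?Z &
  (\<exists>y\<in>ZI (m + N) i. Y.Phi (m + N) (Suc i) y = z' & y - trn m z \<in> BI (m + N) i)" for m z z'
 have RI: "R m z z'" if "z \<in> ?Z" "y \<in> ZI (m + N) i" "Y.Phi (m + N) (Suc i) y = z'"
  "y - trn m z \<in> BI (m + N) i" for m z z' y
  unfolding R_def using that by blast
 \<comment> \<open>Sums of related pairs require a common exponent.\<close>
 have R_raise: "R (l + m) z z'" if Rm: "R m z z'" for l m z z'
 proof -
  obtain y where z: "z \<in> ?Z" and y: "y \<in> ZI (m + N) i" "Y.Phi (m + N) (Suc i) y = z'"
   "y - trn m z \<in> BI (m + N) i" using Rm unfolding R_def by blast
  have yz: "y - trn m z \<in> ZI (m + N) i"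
   by (rule cochain.subspace_diff[OF subZ y(1) kZ_trn[OF z]])
  have "trn l (y - trn m z) \<in> BI (l + (m + N)) i"
   by (rule kB_trn_iff[OF large_add[OF N] yz, THEN iffD2, OF y(3)])
  then have "trn l y - trn (l + m) z \<in> BI (l + m + N) i"
   by (simp only: trn_diff trn_trn add.assoc)
  then show ?thesis
   using z kZ_trn[OF y(1), of l] Y.Phi_trn[OF ZK[OF y(1)], of l] y(2)
   by (intro RI[of z "trn l y"]) (simp_all only: add.assoc)
 qed
 have R_max: "R (max m l) z z'" if "R m z z'" for m l z z'
  using R_raise[OF that, of "max m l - m"] by simp
 have Rmem: "z \<in> ?Z & z' \<in> ?Z'" if Rm: "R m z z'" for m z z'
 proof -
  obtain y where z: "z \<in> ?Z" and y: "y \<in> ZI (m + N) i" "Y.Phi (m + N) (Suc i) y = z'"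
   using Rm unfolding R_def by blast
  have "trn 0 (kdiff (m + N) y) \<in> valued I" using y(1) by (simp add: kZ_def)
  then show ?thesis using z y(2) Y.Phi_cocycle_iff[OF ZK[OF y(1)]] by blast
 qed
 have R0: "R 0 0 0[?M]"
 proof (rule RI)
  show "0 \<in> ?Z" by (rule cochain.subspace_0[OF subZ])
  show "0 \<in> ZI (0 + N) i" by (rule cochain.subspace_0[OF subZ])
  show "0 - trn 0 0 \<in> BI (0 + N) i"
   by (simp only: funpow.simps id_apply diff_self) (rule cochain.subspace_0[OF subB])
 qed (rule Y.Phi_zero)
 have Radd: "R m (x + y) (x' +[?M] y')" if xy: "R m x x'" "R m y y'" for m x y x' y'
 proof -
  obtain u v where u: "x \<in> ?Z" "u \<in> ZI (m + N) i" "Y.Phi (m + N) (Suc i) u = x'"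
   "u - trn m x \<in> BI (m + N) i"
   and v: "y \<in> ?Z" "v \<in> ZI (m + N) i" "Y.Phi (m + N) (Suc i) v = y'"
   "v - trn m y \<in> BI (m + N) i"
   using xy unfolding R_def by blast
  show ?thesis
  proof (rule RI[of _ "u + v"])
   show "x + y \<in> ?Z" "u + v \<in> ZI (m + N) i"
    by (rule cochain.subspace_add[OF subZ u(1) v(1)], rule cochain.subspace_add[OF subZ u(2) v(2)])
   show "Y.Phi (m + N) (Suc i) (u + v) = x' +[?M] y'"
    unfolding Y.Phi_add[OF ZK[OF u(2)] ZK[OF v(2)]] u(3) v(3) ..
   have "trn m (x + y) = trn m x + trn m y" by (rule ext) (simp add: trn_apply distrib_left)
   then have "u + v - trn m (x + y) = (u - trn m x) + (v - trn m y)" by (simp only: add_diff_add)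
   then show "u + v - trn m (x + y) \<in> BI (m + N) i"
    using cochain.subspace_add[OF subB u(4) v(4)] by (simp only:)
  qed
 qed
 have Rsmult: "R m (cscale a x) (a *[?M] x')" if x: "R m x x'" for m a x x'
 proof -
  obtain u where u: "x \<in> ?Z" "u \<in> ZI (m + N) i" "Y.Phi (m + N) (Suc i) u = x'"
   "u - trn m x \<in> BI (m + N) i"
   using x unfolding R_def by blast
  show ?thesis
  proof (rule RI[of _ "cscale a u"])
   show "cscale a x \<in> ?Z" "cscale a u \<in> ZI (m + N) i"
    by (rule cochain.subspace_scale[OF subZ u(1)], rule cochain.subspace_scale[OF subZ u(2)])
   show "Y.Phi (m + N) (Suc i) (cscale a u) = a *[?M] x'"
    unfolding Y.Phi_smult[OF ZK[OF u(2)]] u(3) ..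
   have "cscale a u - trn m (cscale a x) = cscale a (u - trn m x)"
    by (rule ext) (simp add: trn_apply right_diff_distrib mult.left_commute)
   then show "cscale a u - trn m (cscale a x) \<in> BI (m + N) i"
    using cochain.subspace_scale[OF subB u(4), of a] by (simp only:)
  qed
 qed
 have left: "\<exists>z'. R 0 z z'" if z: "z \<in> ?Z" for z
 proof -
  have "z - trn 0 z = 0" by (simp only: funpow.simps id_apply diff_self)
  then have "z - trn 0 z \<in> BI (0 + N) i" using cochain.subspace_0[OF subB] by (simp only:)
  from RI[OF z _ refl this] z show ?thesis unfolding add_0 by blast
 qed
 have right: "\<exists>m z. R m z z'" if z': "z' \<in> ?Z'" for z'
 proof -
  have "z' \<in> carrier ?M" using z' by (simp add: Y.std.cech_cocycles_def)
  then obtain M c where M: "M \<ge> N" and c: "c \<in> K M (Suc i)" "Y.Phi M (Suc i) c = z'" by (rule Y.Phi_surj)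
  then obtain m where m: "trn m (kdiff M c) \<in> valued I" using Y.Phi_cocycle_iff[OF c(1)] z' by blast
  have y: "trn m c \<in> ZI (m + M) i"
   using m kC_trn[OF c(1)] by (simp add: kZ_def kdiff_trn)
  obtain l where "M = l + N" using M by (metis add.commute le_Suc_ex)
  then have l: "m + M = (m + l) + N" by simp
  obtain z where "z \<in> ?Z" "trn m c - trn (m + l) z \<in> BI (m + l + N) i"
   using kZ_lower_trn[OF N y[unfolded l]] by blast
  moreover have "Y.Phi (m + l + N) (Suc i) (trn m c) = z'" unfolding l[symmetric] Y.Phi_trn[OF c(1)] by (rule c(2))
  ultimately show ?thesis using RI y[unfolded l] by blast
 qed
 have B: "z \<in> ?B \<longleftrightarrow> z' \<in> ?B'" if Rm: "R m z z'" for m z z'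
 proof -
  obtain y where z: "z \<in> ?Z" and y: "y \<in> ZI (m + N) i" "Y.Phi (m + N) (Suc i) y = z'"
   "y - trn m z \<in> BI (m + N) i" using Rm unfolding R_def by blast
  have "z \<in> ?B \<longleftrightarrow> trn m z \<in> BI (m + N) i" by (rule kB_trn_iff[OF N z, symmetric])
  also have "... \<longleftrightarrow> y \<in> BI (m + N) i"
   using cochain.subspace_add[OF subB y(3), of "trn m z"] cochain.subspace_diff[OF subB _ y(3), of y] by auto
  also have "... \<longleftrightarrow> z' \<in> ?B'" using Phi_coboundary_iff[OF large_add[OF N] y(1)] y(2) by simp
  finally show ?thesis .
 qed
 have "quotient_has_dim cochain_module ?Z ?B d \<longleftrightarrow> quotient_has_dim ?M ?Z' ?B' d"
 proof (rule quotient_has_dim_iff[OF module_cochain Y.std.module_cmod[OF pre], where R = "%z z'. \<exists>m. R m z z'"])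
  show "?Z' <= carrier ?M" by (auto simp: Y.std.cech_cocycles_def)
  show "\<exists>m. R m 0[cochain_module] 0[?M]" unfolding cochain_module_simps using R0 ..
  fix x x' assume x: "\<exists>m. R m x x'"
  then show "x \<in> ?Z & x' \<in> ?Z'" "x \<in> ?B \<longleftrightarrow> x' \<in> ?B'" using Rmem B by (elim exE, simp)+
  show "\<exists>m. R m (c *[cochain_module] x) (c *[?M] x')" for c
   unfolding cochain_module_simps using x Rsmult by blast
  fix y y' assume "\<exists>m. R m y y'"
  with x obtain m l where "R m x x'" "R l y y'" by blast
  then have "R (max m l) x x'" "R (max m l) y y'" using R_max[of m x x' l] R_max[of l y y' m] by (simp_all add: max.commute)
  from Radd[OF this] show "\<exists>m. R m (x +[cochain_module] y) (x' +[?M] y')" unfolding cochain_module_simps ..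
 next
  show "\<exists>z' m. R m z z'" if "z \<in> ?Z" for z using left[OF that] by blast
  show "\<exists>z m. R m z z'" if "z' \<in> ?Z'" for z' using right[OF that] by blast
 qed simp
 then show ?thesis
  unfolding Y.std.cech_dim_def quotient_has_dim_iff_quot_basis[OF subB subZ] kcohomology_dim[OF N] by simp
qed

end

subsection \<open>Existence of flasque resolutions\<close>

text \<open>Transport of a module along an injection \<open>enc\<close> with left inverse
  \<open>dec\<close>. It keeps all terms of a resolution within one type.\<close>

definition enc_module :: "('a => 'b) => ('b => 'a) => ('k::field, 'a) module => ('k, 'b) module"
 where "enc_module enc dec M = \<lparr>carrier = enc ` carrier M, mult = undefined, one = undefined, zero = enc 0[M],
  add = (%x y. enc (dec x +[M] dec y)), smult = (%c x. enc (c *[M] dec x))\<rparr>"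

lemma enc_module_simps [simp]:
 "carrier (enc_module enc dec M) = enc ` carrier M" "0[enc_module enc dec M] = enc 0[M]"
 "x +[enc_module enc dec M] y = enc (dec x +[M] dec y)" "c *[enc_module enc dec M] x = enc (c *[M] dec x)"
 by (simp_all add: enc_module_def)

lemma module_enc:
 assumes dec: "!!x. dec (enc x) = x" and M: "is_module M"
 shows "is_module (enc_module enc dec M)"
proof (rule scalar_moduleI; unfold enc_module_simps)
 note f = module_facts[OF M]
 fix x y z a b
 show "enc 0[M] \<in> enc ` carrier M" using f(2) by simp
 assume "x \<in> enc ` carrier M"
 then obtain u where u: "u \<in> carrier M" "x = enc u" by blast
 show "enc (a *[M] dec x) \<in> enc ` carrier M" using f(3) u by (simp add: dec)
 show "enc (dec (enc 0[M]) +[M] dec x) = x" "enc (0 *[M] dec x) = enc 0[M]" "enc (1 *[M] dec x) = x"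
  "enc ((a + b) *[M] dec x) = enc (dec (enc (a *[M] dec x)) +[M] dec (enc (b *[M] dec x)))"
  "enc ((a * b) *[M] dec x) = enc (a *[M] dec (enc (b *[M] dec x)))"
  using u by (simp_all add: dec f(6-11))
 assume "y \<in> enc ` carrier M"
 then obtain v where v: "v \<in> carrier M" "y = enc v" by blast
 show "enc (dec x +[M] dec y) \<in> enc ` carrier M" using f(1) u v by (simp add: dec)
 show "enc (dec x +[M] dec y) = enc (dec y +[M] dec x)" using f(5)[OF u(1) v(1)] u(2) v(2) by (simp add: dec)
 show "enc (a *[M] dec (enc (dec x +[M] dec y))) =
   enc (dec (enc (a *[M] dec x)) +[M] dec (enc (a *[M] dec y)))"
  using f(9)[OF u(1) v(1)] u(2) v(2) by (simp add: dec)
 assume "z \<in> enc ` carrier M"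
 then obtain w where "w \<in> carrier M" "z = enc w" by blast
 then show "enc (dec (enc (dec x +[M] dec y)) +[M] dec z) = enc (dec x +[M] dec (enc (dec y +[M] dec z)))"
  using f(4)[OF u(1) v(1)] u(2) v(2) by (simp add: dec)
qed

definition prod_sheaf :: "(('p => 'a) => 'b) => ('b => 'p => 'a) => ('p => ('k::field, 'a) module) => ('p, 'k, 'b) sheaf_data"
 where "prod_sheaf enc dec M =
  \<lparr>sections = (%U. enc_module enc dec (prod_module U M)), restr = (%U V x. enc (restrict (dec x) V))\<rparr>"

lemma prod_sheaf_simps [simp]:
 "sections (prod_sheaf enc dec M) U = enc_module enc dec (prod_module U M)"
 "restr (prod_sheaf enc dec M) U V x = enc (restrict (dec x) V)"
 by (simp_all add: prod_sheaf_def)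

text \<open>Sections are arbitrary families of elements of the \<open>M p\<close>, so they extend by
  0.\<close>

lemma flasque_prod_sheaf:
 fixes M :: "'p => ('k::field, 'a) module"
 assumes dec: "!!x. dec (enc x) = x" and M: "!!p. p \<in> topspace X ==> is_module (M p)"
 shows "flasque X (prod_sheaf enc dec M)"
proof -
 let ?G = "prod_sheaf enc dec M"
 have sub: "U <= topspace X" if "openin X U" for U using openin_subset[OF that] .
 have pre: "presheaf X ?G"
  unfolding presheaf_def
 proof (intro conjI allI impI ballI)
  show "is_module (sections ?G U)" if U: "openin X U" for U
   unfolding prod_sheaf_simps using sub[OF U] by (intro module_enc dec is_module_prod M) auto
  fix U V assume UV: "openin X U & openin X V & V <= U"
  then have "U \<inter> V = V" by blast
  with UV show "linear_hom (sections ?G U) (sections ?G V) (restr ?G U V)"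
   unfolding linear_hom_def
   by (auto simp: dec prod_module_simps intro!: imageI arg_cong[where f = enc] restrict_ext) (auto simp: PiE_iff)
 next
  fix U s assume "openin X U" "s \<in> Sec ?G U"
  then show "restr ?G U U s = s" by (auto simp: dec prod_module_simps PiE_iff intro!: arg_cong[where f = enc] extensional_restrict)
 next
  fix U V W s assume "openin X U & openin X V & openin X W & W <= V & V <= U"
  then show "restr ?G V W (restr ?G U V s) = restr ?G U W s" by (simp add: dec Int_absorb1)
 qed
 have "sheaf X ?G"
  unfolding sheaf_def
 proof (intro conjI pre allI impI)
  fix \<U> s assume H: "(\<forall>V\<in>\<U>. openin X V & s V \<in> Sec ?G V) &
   (\<forall>V\<in>\<U>. \<forall>W\<in>\<U>. restr ?G V (V \<inter> W) (s V) = restr ?G W (V \<inter> W) (s W))"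
  define t where "t V = dec (s V)" for V
  have t: "t V \<in> (\<Pi>\<^sub>E p\<in>V. carrier (M p))" "s V = enc (t V)" if V: "V \<in> \<U>" for V
  proof -
   have "s V \<in> enc ` (\<Pi>\<^sub>E p\<in>V. carrier (M p))" using bspec[OF conjunct1[OF H] V] by (simp add: prod_module_simps)
   then show "t V \<in> (\<Pi>\<^sub>E p\<in>V. carrier (M p))" "s V = enc (t V)" by (elim imageE, simp add: t_def dec)+
  qed
  obtain a where ea: "a \<in> extensional (\<Union>\<U>)" and aV: "!!V. V \<in> \<U> ==> restrict a V = t V"
   and unique: "\<forall>b. b \<in> extensional (\<Union>\<U>) & (\<forall>V\<in>\<U>. restrict b V = t V) --> b = a"
  proof (rule glue_functions[of \<U> t])
   show "t V \<in> extensional V" if "V \<in> \<U>" for V using t(1)[OF that] by (simp add: PiE_iff)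
   fix V W assume "V \<in> \<U>" "W \<in> \<U>"
   then have "enc (restrict (t V) (V \<inter> W)) = enc (restrict (t W) (V \<inter> W))"
    using H unfolding t_def prod_sheaf_simps by blast
   then show "restrict (t V) (V \<inter> W) = restrict (t W) (V \<inter> W)" by (metis dec)
  qed (rule that)
  have "a p \<in> carrier (M p)" if "V \<in> \<U>" "p \<in> V" for V p
   using fun_cong[OF aV[OF that(1)], of p] t(1)[OF that(1)] that(2) by (auto simp: PiE_iff)
  then have a: "a \<in> (\<Pi>\<^sub>E p\<in>\<Union>\<U>. carrier (M p))" using ea by (auto simp: PiE_iff)
  show "\<exists>!a. a \<in> Sec ?G (\<Union>\<U>) & (\<forall>V\<in>\<U>. restr ?G (\<Union>\<U>) V a = s V)"
  proof (rule ex1I[of _ "enc a"])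
   show "enc a \<in> Sec ?G (\<Union>\<U>) & (\<forall>V\<in>\<U>. restr ?G (\<Union>\<U>) V (enc a) = s V)"
    using a aV t(2) by (simp add: dec prod_module_simps)
   fix x assume x: "x \<in> Sec ?G (\<Union>\<U>) & (\<forall>V\<in>\<U>. restr ?G (\<Union>\<U>) V x = s V)"
   then obtain b where b: "b \<in> (\<Pi>\<^sub>E p\<in>\<Union>\<U>. carrier (M p))" "x = enc b" by (auto simp: prod_module_simps)
   have "restrict b V = t V" if "V \<in> \<U>" for V using x t(2)[OF that] that by (metis b(2) dec prod_sheaf_simps(2))
   then have "b = a" using unique b(1) by (simp add: PiE_iff)
   then show "x = enc a" using b(2) by simp
  qed
 qed
 moreover have "restr ?G U V ` Sec ?G U = Sec ?G V" if UV: "openin X U & openin X V & V <= U" for U V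
 proof
  show "restr ?G U V ` Sec ?G U <= Sec ?G V" using psh_restr_closed[OF pre, of U V] UV by blast
  show "Sec ?G V <= restr ?G U V ` Sec ?G U"
  proof
   fix x assume "x \<in> Sec ?G V"
   then obtain b where b: "b \<in> (\<Pi>\<^sub>E p\<in>V. carrier (M p))" "x = enc b" by (auto simp: prod_module_simps)
   define c where "c = (\<lambda>p\<in>U. if p \<in> V then b p else 0[M p])"
   have "c \<in> (\<Pi>\<^sub>E p\<in>U. carrier (M p))"
    unfolding c_def using b(1) sub[of U] UV module_facts(2)[OF M]
    by (intro restrict_PiE_iff[THEN iffD2] ballI) (auto simp: PiE_iff)
   moreover have "restrict c V = b"
    using b(1) UV by (intro ext) (auto simp: c_def restrict_def PiE_iff extensional_def)
   ultimately show "x \<in> restr ?G U V ` Sec ?G U"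
    using b(2) by (intro image_eqI[of _ _ "enc c"]) (simp_all add: dec prod_module_simps)
  qed
 qed
 ultimately show ?thesis unfolding flasque_def by simp
qed

text \<open>The germs of \<open>G\<close> modulo those of the subpresheaf \<open>B\<close>.\<close>

locale germs =
 fixes X :: "'p topology" and G :: "('p, 'k::field, 'w) sheaf_data" and B :: "'p set => 'w set"
 assumes G: "presheaf X G"
  and B_sub: "openin X U ==> B U <= Sec G U"
  and B_zero: "openin X U ==> 0[sections G U] \<in> B U"
  and B_add: "openin X U ==> x \<in> B U ==> y \<in> B U ==> x +[sections G U] y \<in> B U"
  and B_smult: "openin X U ==> x \<in> B U ==> c *[sections G U] x \<in> B U"
  and B_restr: "openin X U ==> openin X V ==> V <= U ==> x \<in> B U ==> restr G U V x \<in> B V"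
begin

abbreviation "S == sections G"

definition nbh :: "'p => 'p set => bool"
 where "nbh p V \<longleftrightarrow> openin X V & p \<in> V"

definition rel :: "'p => 'p set \<times> 'w => 'p set \<times> 'w => bool"
 where "rel p x y \<longleftrightarrow> (\<exists>W. nbh p W & W <= fst x \<inter> fst y &
  restr G (fst x) W (snd x) -[S W] restr G (fst y) W (snd y) \<in> B W)"

definition gpairs :: "'p => ('p set \<times> 'w) set"
 where "gpairs p = {(V, s). nbh p V & s \<in> Sec G V}"

text \<open>A germ is a chosen representative instead of an equivalence class, because the type of
  the resolution has room for a pair of an open set and a section, but not for a set of such
  pairs.\<close>

definition germ :: "'p => 'p set \<times> 'w => 'p set \<times> 'w"
 where "germ p x = (SOME y. y \<in> gpairs p & rel p x y)"

definition stk :: "'p => ('k, 'p set \<times> 'w) module"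
 where "stk p = \<lparr>carrier = germ p ` gpairs p, mult = undefined, one = undefined,
  zero = germ p (topspace X, 0[S (topspace X)]),
  add = (%x y. germ p (fst x \<inter> fst y, restr G (fst x) (fst x \<inter> fst y) (snd x)
   +[S (fst x \<inter> fst y)] restr G (fst y) (fst x \<inter> fst y) (snd y))),
  smult = (%c x. germ p (fst x, c *[S (fst x)] snd x))\<rparr>"

lemma mod: "openin X U ==> is_module (S U)"
 by (rule psh_mod[OF G])

lemma nbhD: "nbh p V ==> openin X V" "nbh p V ==> p \<in> V"
 by (simp_all add: nbh_def)

lemma nbh_Int: "nbh p V ==> nbh p W ==> nbh p (V \<inter> W)"
 by (simp add: nbh_def openin_Int)

lemma restr_in: "nbh p V ==> nbh p W ==> W <= V ==> s \<in> Sec G V ==> restr G V W s \<in> Sec G W"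
 using psh_restr_closed[OF G] nbhD(1) by blast

lemma restr2: "nbh p V ==> nbh p W ==> nbh p Y ==> Y <= W ==> W <= V ==> s \<in> Sec G V ==>
  restr G W Y (restr G V W s) = restr G V Y s"
 by (rule psh_restr_restr[OF G nbhD(1) nbhD(1) nbhD(1)])

lemma B_diff:
 assumes U: "openin X U" and "x \<in> B U" "y \<in> B U" shows "x -[S U] y \<in> B U"
proof -
 have "x \<in> Sec G U" "y \<in> Sec G U" using assms B_sub[OF U] by auto
 from module_minus_eq[OF mod[OF U] this] show ?thesis using B_add[OF U assms(2) B_smult[OF U assms(3)]] by simp
qed

lemma gpairsI: "nbh p V ==> s \<in> Sec G V ==> (V, s) \<in> gpairs p"
 by (simp add: gpairs_def)

text \<open>Quantifying over all smaller neighbourhoods makes it possible to shrink to an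
  intersection when several relations are combined.\<close>

lemma rel_iff:
 assumes "(V, s) \<in> gpairs p" "(V', s') \<in> gpairs p"
 shows "rel p (V, s) (V', s') \<longleftrightarrow> (\<exists>W. nbh p W & (\<forall>Y. nbh p Y & Y <= W --> Y <= V \<inter> V' &
  restr G V Y s -[S Y] restr G V' Y s' \<in> B Y))"
proof
 assume "rel p (V, s) (V', s')"
 then obtain W where W: "nbh p W" "W <= V \<inter> V'" "restr G V W s -[S W] restr G V' W s' \<in> B W"
  by (auto simp: rel_def)
 have "restr G V Y s -[S Y] restr G V' Y s' \<in> B Y" if Y: "nbh p Y" "Y <= W" for Y
 proof -
  have V: "nbh p V" "s \<in> Sec G V" "nbh p V'" "s' \<in> Sec G V'" using assms by (auto simp: gpairs_def)
  have "restr G W Y (restr G V W s -[S W] restr G V' W s') =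
    restr G W Y (restr G V W s) -[S Y] restr G W Y (restr G V' W s')"
   by (rule linear_hom_diff(2)[OF psh_restr_hom[OF G nbhD(1)[OF W(1)] nbhD(1)[OF Y(1)] Y(2)] mod mod])
     (use W Y V restr_in nbhD in auto)
  also have "... = restr G V Y s -[S Y] restr G V' Y s'"
   using restr2[OF V(1) W(1) Y(1,2) _ V(2)] restr2[OF V(3) W(1) Y(1,2) _ V(4)] W(2) by simp
  finally show ?thesis using B_restr[OF nbhD(1)[OF W(1)] nbhD(1)[OF Y(1)] Y(2) W(3)] by simp
 qed
 then show "\<exists>W. nbh p W & (\<forall>Y. nbh p Y & Y <= W --> Y <= V \<inter> V' &
  restr G V Y s -[S Y] restr G V' Y s' \<in> B Y)" using W by (intro exI[of _ W]) auto
next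
 assume "\<exists>W. nbh p W & (\<forall>Y. nbh p Y & Y <= W --> Y <= V \<inter> V' &
  restr G V Y s -[S Y] restr G V' Y s' \<in> B Y)"
 then show "rel p (V, s) (V', s')" unfolding rel_def fst_conv snd_conv by blast
qed

lemma rel_refl: "x \<in> gpairs p ==> rel p x x"
proof -
 assume x: "x \<in> gpairs p"
 obtain V s where V: "x = (V, s)" "nbh p V" "s \<in> Sec G V" using x by (auto simp: gpairs_def)
 have "restr G V V s -[S V] restr G V V s = 0[S V]"
  by (rule module_diff_self[OF mod[OF nbhD(1)[OF V(2)]] restr_in[OF V(2) V(2) _ V(3)]]) simp
 then show ?thesis using V(2) B_zero[OF nbhD(1)[OF V(2)]] unfolding rel_def V(1) by auto
qed

text \<open>Together with reflexivity this one law yields symmetry and transitivity.\<close>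

lemma rel_trans_sym:
 assumes x: "x \<in> gpairs p" and y: "y \<in> gpairs p" and z: "z \<in> gpairs p" and xz: "rel p x z" and yz: "rel p y z"
 shows "rel p x y"
proof -
 obtain V s V' s' V'' s'' where e: "x = (V, s)" "y = (V', s')" "z = (V'', s'')" by (metis surj_pair)
 have V: "nbh p V" "s \<in> Sec G V" "nbh p V'" "s' \<in> Sec G V'" "nbh p V''" "s'' \<in> Sec G V''"
  using x y z unfolding e by (auto simp: gpairs_def)
 obtain W where W: "nbh p W" "\<forall>Y. nbh p Y & Y <= W --> Y <= V \<inter> V'' &
  restr G V Y s -[S Y] restr G V'' Y s'' \<in> B Y"
  using xz x z unfolding e by (subst (asm) rel_iff) auto
 obtain W' where W': "nbh p W'" "\<forall>Y. nbh p Y & Y <= W' --> Y <= V' \<inter> V'' &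
  restr G V' Y s' -[S Y] restr G V'' Y s'' \<in> B Y"
  using yz y z unfolding e by (subst (asm) rel_iff) auto
 let ?Y = "W \<inter> W'"
 have Y: "nbh p ?Y" by (rule nbh_Int[OF W(1) W'(1)])
 have sub: "?Y <= V \<inter> V''" "?Y <= V' \<inter> V''"
  and b: "restr G V ?Y s -[S ?Y] restr G V'' ?Y s'' \<in> B ?Y" "restr G V' ?Y s' -[S ?Y] restr G V'' ?Y s'' \<in> B ?Y"
  using W(2) W'(2) Y by auto
 have o: "openin X ?Y" by (rule nbhD(1)[OF Y])
 have c: "restr G V ?Y s \<in> Sec G ?Y" "restr G V' ?Y s' \<in> Sec G ?Y" "restr G V'' ?Y s'' \<in> Sec G ?Y"
  using V Y sub by (auto intro: restr_in)
 have "restr G V ?Y s -[S ?Y] restr G V' ?Y s' =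
   (restr G V ?Y s -[S ?Y] restr G V'' ?Y s'') -[S ?Y] (restr G V' ?Y s' -[S ?Y] restr G V'' ?Y s'')"
  using module_diff_diff[OF mod[OF o] c(1,3,2,3)] module_diff_self[OF mod[OF o] c(3)]
   module_diff_zero[OF mod[OF o] module_diff_closed[OF mod[OF o] c(1,2)]] by simp
 then have "restr G V ?Y s -[S ?Y] restr G V' ?Y s' \<in> B ?Y" using B_diff[OF o b] by simp
 then show ?thesis unfolding e rel_def fst_conv snd_conv using Y sub by blast
qed

lemma germ:
 assumes x: "x \<in> gpairs p"
 shows germ_in: "germ p x \<in> gpairs p" and rel_germ: "rel p x (germ p x)"
 using someI[of "%y. y \<in> gpairs p & rel p x y" x] x rel_refl[OF x] unfolding germ_def by blast+

lemma germ_eq_iff: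
 assumes x: "x \<in> gpairs p" and y: "y \<in> gpairs p"
 shows "germ p x = germ p y \<longleftrightarrow> rel p x y"
proof
 assume "germ p x = germ p y"
 then show "rel p x y" using rel_trans_sym[OF x y germ_in[OF y]] rel_germ[OF x] rel_germ[OF y] by simp
next
 assume xy: "rel p x y"
 have "rel p x z \<longleftrightarrow> rel p y z" if z: "z \<in> gpairs p" for z
  using rel_trans_sym[OF y z x] rel_trans_sym[OF x z y] rel_trans_sym[OF y x y _ xy] rel_refl y xy
   rel_trans_sym[OF z y z] rel_trans_sym[OF z x z] rel_trans_sym[OF y z y] rel_trans_sym[OF x z x]
   rel_trans_sym[OF z x y] rel_trans_sym[OF z y x] x z by metis
 then have "(%z. z \<in> gpairs p & rel p x z) = (%z. z \<in> gpairs p & rel p y z)" by blast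
 then show "germ p x = germ p y" unfolding germ_def by simp
qed

lemma germ_restr:
 assumes "nbh p V" "s \<in> Sec G V" "nbh p W" "W <= V"
 shows "germ p (W, restr G V W s) = germ p (V, s)"
proof -
 note r = restr_in[OF assms(1,3,4,2)]
 have "restr G W W (restr G V W s) -[S W] restr G V W s = 0[S W]"
  unfolding restr2[OF assms(1,3,3) order_refl assms(4,2)] by (rule module_diff_self[OF mod[OF nbhD(1)[OF assms(3)]] r])
 then have "rel p (W, restr G V W s) (V, s)"
  unfolding rel_def fst_conv snd_conv using assms B_zero[OF nbhD(1)[OF assms(3)]] by (intro exI[of _ W]) auto
 then show ?thesis using germ_eq_iff[OF gpairsI[OF assms(3) r] gpairsI[OF assms(1,2)]] by simp
qed

lemma stk_simps: "carrier (stk p) = germ p ` gpairs p" "0[stk p] = germ p (topspace X, 0[S (topspace X)])"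
 by (simp_all add: stk_def)

lemma germ_add:
 assumes V: "nbh p V" and s: "s \<in> Sec G V" and t: "t \<in> Sec G V"
 shows "germ p (V, s) +[stk p] germ p (V, t) = germ p (V, s +[S V] t)"
proof -
 note oV = nbhD(1)[OF V]
 obtain V1 s1 V2 t2 where e: "germ p (V, s) = (V1, s1)" "germ p (V, t) = (V2, t2)" by (metis surj_pair)
 have gs: "(V1, s1) \<in> gpairs p" "rel p (V, s) (V1, s1)" using germ[OF gpairsI[OF V s]] e by simp_all
 have gt: "(V2, t2) \<in> gpairs p" "rel p (V, t) (V2, t2)" using germ[OF gpairsI[OF V t]] e by simp_all
 have V12: "nbh p V1" "s1 \<in> Sec G V1" "nbh p V2" "t2 \<in> Sec G V2" using gs gt by (auto simp: gpairs_def)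
 let ?V = "V1 \<inter> V2"
 have nV: "nbh p ?V" by (rule nbh_Int[OF V12(1,3)])
 have r: "restr G V1 ?V s1 \<in> Sec G ?V" "restr G V2 ?V t2 \<in> Sec G ?V" using V12 nV by (auto intro: restr_in)
 obtain W where W: "nbh p W" "\<forall>Y. nbh p Y & Y <= W --> Y <= V \<inter> V1 &
  restr G V Y s -[S Y] restr G V1 Y s1 \<in> B Y"
  using gs by (subst (asm) rel_iff[OF gpairsI[OF V s] gs(1)]) auto
 obtain W' where W': "nbh p W'" "\<forall>Y. nbh p Y & Y <= W' --> Y <= V \<inter> V2 &
  restr G V Y t -[S Y] restr G V2 Y t2 \<in> B Y"
  using gt by (subst (asm) rel_iff[OF gpairsI[OF V t] gt(1)]) auto
 let ?Y = "W \<inter> W'"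
 have Y: "nbh p ?Y" by (rule nbh_Int[OF W(1) W'(1)])
 have sub: "?Y <= V" "?Y <= V1" "?Y <= V2" "?Y <= ?V"
  and b: "restr G V ?Y s -[S ?Y] restr G V1 ?Y s1 \<in> B ?Y" "restr G V ?Y t -[S ?Y] restr G V2 ?Y t2 \<in> B ?Y"
  using W(2) W'(2) Y by auto
 note oY = nbhD(1)[OF Y]
 have c: "restr G V ?Y s \<in> Sec G ?Y" "restr G V ?Y t \<in> Sec G ?Y" "restr G V1 ?Y s1 \<in> Sec G ?Y" "restr G V2 ?Y t2 \<in> Sec G ?Y"
  using V V12 Y sub s t by (auto intro: restr_in)
 have "restr G V ?Y (s +[S V] t) -[S ?Y]
   restr G ?V ?Y (restr G V1 ?V s1 +[S ?V] restr G V2 ?V t2) =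
   (restr G V ?Y s -[S ?Y] restr G V1 ?Y s1) +[S ?Y] (restr G V ?Y t -[S ?Y] restr G V2 ?Y t2)"
  unfolding linear_homD(2)[OF psh_restr_hom[OF G oV oY sub(1)] s t]
   linear_homD(2)[OF psh_restr_hom[OF G nbhD(1)[OF nV] oY sub(4)] r]
   restr2[OF V12(1) nV Y sub(4) Int_lower1 V12(2)] restr2[OF V12(3) nV Y sub(4) Int_lower2 V12(4)]
  by (rule module_add_diff[OF mod[OF oY] c])
 then have "restr G V ?Y (s +[S V] t) -[S ?Y]
   restr G ?V ?Y (restr G V1 ?V s1 +[S ?V] restr G V2 ?V t2) \<in> B ?Y"
  using B_add[OF oY b] by simp
 then have "rel p (V, s +[S V] t) (?V, restr G V1 ?V s1 +[S ?V] restr G V2 ?V t2)"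
  unfolding rel_def fst_conv snd_conv using Y sub by blast
 then have "germ p (V, s +[S V] t) = germ p (?V, restr G V1 ?V s1 +[S ?V] restr G V2 ?V t2)"
  using germ_eq_iff[OF gpairsI[OF V module_facts(1)[OF mod[OF oV] s t]]
   gpairsI[OF nV module_facts(1)[OF mod[OF nbhD(1)[OF nV]] r]]] by simp
 then show ?thesis by (simp add: stk_def e)
qed

lemma germ_smult:
 assumes V: "nbh p V" and s: "s \<in> Sec G V"
 shows "c *[stk p] germ p (V, s) = germ p (V, c *[S V] s)"
proof -
 note oV = nbhD(1)[OF V]
 obtain V1 s1 where e: "germ p (V, s) = (V1, s1)" by (metis surj_pair)
 have gs: "(V1, s1) \<in> gpairs p" "rel p (V, s) (V1, s1)" using germ[OF gpairsI[OF V s]] e by simp_all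
 have V1: "nbh p V1" "s1 \<in> Sec G V1" using gs by (auto simp: gpairs_def)
 obtain Y where Y: "nbh p Y" "Y <= V" "Y <= V1" "restr G V Y s -[S Y] restr G V1 Y s1 \<in> B Y"
  using gs(2) by (auto simp: rel_def)
 note oY = nbhD(1)[OF Y(1)]
 have "restr G V Y (c *[S V] s) -[S Y] restr G V1 Y (c *[S V1] s1) =
   c *[S Y] (restr G V Y s -[S Y] restr G V1 Y s1)"
  unfolding linear_homD(3)[OF psh_restr_hom[OF G oV oY Y(2)] s]
   linear_homD(3)[OF psh_restr_hom[OF G nbhD(1)[OF V1(1)] oY Y(3)] V1(2)]
  by (rule module_smult_diff[OF mod[OF oY], symmetric])
    (use restr_in[OF V Y(1,2) s] restr_in[OF V1(1) Y(1,3) V1(2)] in auto)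
 then have "rel p (V, c *[S V] s) (V1, c *[S V1] s1)"
  unfolding rel_def fst_conv snd_conv using Y B_smult[OF oY Y(4), of c] by auto
 then have "germ p (V, c *[S V] s) = germ p (V1, c *[S V1] s1)"
  using germ_eq_iff[OF gpairsI[OF V module_facts(3)[OF mod[OF oV] s]]
   gpairsI[OF V1(1) module_facts(3)[OF mod[OF nbhD(1)[OF V1(1)]] V1(2)]]] by simp
 then show ?thesis by (simp add: stk_def e)
qed

lemma germ_zero:
 assumes V: "nbh p V" shows "germ p (V, 0[S V]) = 0[stk p]"
proof -
 have T: "nbh p (topspace X)" "V <= topspace X" using V openin_subset by (auto simp: nbh_def)
 have "restr G (topspace X) V 0[S (topspace X)] = 0[S V]"
  by (rule linear_hom_zero[OF psh_restr_hom[OF G] mod mod]) (use V T nbhD in auto)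
 then show ?thesis
  using germ_restr[OF T(1) module_facts(2)[OF mod[OF nbhD(1)[OF T(1)]]] V T(2)] by (simp add: stk_simps)
qed

lemma common:
 assumes "x \<in> carrier (stk p)" "y \<in> carrier (stk p)" "z \<in> carrier (stk p)"
 obtains V s t u where "nbh p V" "s \<in> Sec G V" "t \<in> Sec G V" "u \<in> Sec G V"
  "x = germ p (V, s)" "y = germ p (V, t)" "z = germ p (V, u)"
proof -
 obtain V1 s1 V2 s2 V3 s3 where e: "x = germ p (V1, s1)" "y = germ p (V2, s2)" "z = germ p (V3, s3)"
  and g: "nbh p V1" "s1 \<in> Sec G V1" "nbh p V2" "s2 \<in> Sec G V2" "nbh p V3" "s3 \<in> Sec G V3"
  using assms unfolding stk_simps by (auto simp: gpairs_def)
 let ?V = "V1 \<inter> V2 \<inter> V3"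
 have V: "nbh p ?V" by (intro nbh_Int g)
 have sub: "?V <= V1" "?V <= V2" "?V <= V3" by auto
 show thesis
  by (rule that[OF V restr_in[OF g(1) V sub(1) g(2)] restr_in[OF g(3) V sub(2) g(4)] restr_in[OF g(5) V sub(3) g(6)]])
    (use germ_restr[OF g(1,2) V sub(1)] germ_restr[OF g(3,4) V sub(2)] germ_restr[OF g(5,6) V sub(3)] e in simp_all)
qed

lemma module_stk:
 assumes p: "p \<in> topspace X" shows "is_module (stk p)"
proof (rule scalar_moduleI)
 have T: "nbh p (topspace X)" using p by (simp add: nbh_def)
 have germ_mem: "germ p (V, s) \<in> carrier (stk p)" if "nbh p V" "s \<in> Sec G V" for V s
  using gpairsI[OF that] by (auto simp: stk_simps)
 fix x y z a b
 show z0: "0[stk p] \<in> carrier (stk p)"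
  unfolding germ_zero[OF T, symmetric] by (rule germ_mem[OF T module_facts(2)[OF mod[OF nbhD(1)[OF T]]]])
 assume x: "x \<in> carrier (stk p)"
 obtain V s where V: "nbh p V" "s \<in> Sec G V" "x = germ p (V, s)" using common[OF x x x] by metis
 note f = module_facts[OF mod[OF nbhD(1)[OF V(1)]]]
 note g = germ_smult[OF V(1)] germ_add[OF V(1)] germ_mem[OF V(1)]
 show "a *[stk p] x \<in> carrier (stk p)" "1 *[stk p] x = x" "(a * b) *[stk p] x = a *[stk p] (b *[stk p] x)"
  "(a + b) *[stk p] x = a *[stk p] x +[stk p] b *[stk p] x"
  using V f by (simp_all add: g)
 show "0[stk p] +[stk p] x = x" "0 *[stk p] x = 0[stk p]"
  unfolding germ_zero[OF V(1), symmetric] using V f by (simp_all add: g)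
 assume y: "y \<in> carrier (stk p)"
 obtain V s t where V: "nbh p V" "s \<in> Sec G V" "t \<in> Sec G V" "x = germ p (V, s)" "y = germ p (V, t)"
  using common[OF x y y] by metis
 note f = module_facts[OF mod[OF nbhD(1)[OF V(1)]]]
 note g = germ_smult[OF V(1)] germ_add[OF V(1)] germ_mem[OF V(1)]
 show "x +[stk p] y \<in> carrier (stk p)" "a *[stk p] (x +[stk p] y) = a *[stk p] x +[stk p] a *[stk p] y"
  using V f by (simp_all add: g)
 show "x +[stk p] y = y +[stk p] x" using V f(5)[OF V(2,3)] by (simp add: g)
 assume z: "z \<in> carrier (stk p)"
 obtain V s t u where V: "nbh p V" "s \<in> Sec G V" "t \<in> Sec G V" "u \<in> Sec G V"
  "x = germ p (V, s)" "y = germ p (V, t)" "z = germ p (V, u)" using common[OF x y z] by metis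
 note f = module_facts[OF mod[OF nbhD(1)[OF V(1)]]]
 note g = germ_smult[OF V(1)] germ_add[OF V(1)] germ_mem[OF V(1)]
 show "x +[stk p] y +[stk p] z = x +[stk p] (y +[stk p] z)" using V f by (simp add: g)
qed

definition gmap :: "(('p => 'p set \<times> 'w) => 'b) => 'p set => 'w => 'b"
 where "gmap enc U s = enc (\<lambda>p\<in>U. germ p (U, s))"

lemma gmap_hom:
 assumes dec: "!!x. dec (enc x) = x"
 shows "sheaf_hom X G (prod_sheaf enc dec stk) (gmap enc)"
 unfolding sheaf_hom_def
proof (intro conjI allI impI ballI)
 fix U assume U: "openin X U"
 have n: "nbh p U" if "p \<in> U" for p using U that by (simp add: nbh_def)
 show "linear_hom (S U) (sections (prod_sheaf enc dec stk) U) (gmap enc U)"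
  unfolding linear_hom_def gmap_def
  by (auto simp: dec prod_module_simps stk_simps germ_add[OF n] germ_smult[OF n]
    intro!: imageI gpairsI[OF n] arg_cong[where f = enc] restrict_ext)
next
 fix U V s assume UV: "openin X U & openin X V & V <= U" and s: "s \<in> Sec G U"
 have "germ p (V, restr G U V s) = germ p (U, s)" if "p \<in> V" for p
  by (rule germ_restr[OF _ s]) (use UV that in \<open>auto simp: nbh_def\<close>)
 then show "gmap enc V (restr G U V s) = restr (prod_sheaf enc dec stk) U V (gmap enc U s)"
  using UV by (auto simp: gmap_def dec Int_absorb1 intro!: arg_cong[where f = enc] restrict_ext)
qed

lemma gmap_eq_iff:
 assumes dec: "!!x. dec (enc x) = x" and U: "openin X U" and s: "s \<in> Sec G U" "t \<in> Sec G U"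
 shows "gmap enc U s = gmap enc U t \<longleftrightarrow>
  (\<forall>p\<in>U. \<exists>V. openin X V & p \<in> V & V <= U & restr G U V s -[S V] restr G U V t \<in> B V)"
proof -
 have "gmap enc U s = gmap enc U t \<longleftrightarrow> (\<lambda>p\<in>U. germ p (U, s)) = (\<lambda>p\<in>U. germ p (U, t))"
  unfolding gmap_def by (metis dec)
 also have "... \<longleftrightarrow> (\<forall>p\<in>U. germ p (U, s) = germ p (U, t))" by (auto simp: fun_eq_iff restrict_def)
 also have "... \<longleftrightarrow> (\<forall>p\<in>U. rel p (U, s) (U, t))"
  using U s by (intro ball_cong refl germ_eq_iff gpairsI) (auto simp: nbh_def)
 finally show ?thesis by (auto simp: rel_def nbh_def)
qed

text \<open>A section has zero germs modulo \<open>B\<close> at all points if it lies in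
  \<open>B\<close> locally. With \<open>B\<close> the image of the preceding map this is exactness
  of the resolution.\<close>

lemma gmap_eq_zero_iff:
 assumes dec: "!!x. dec (enc x) = x" and U: "openin X U" and s: "s \<in> Sec G U"
 shows "gmap enc U s = 0[sections (prod_sheaf enc dec stk) U] \<longleftrightarrow>
  (\<forall>p\<in>U. \<exists>V. openin X V & p \<in> V & V <= U & restr G U V s \<in> B V)"
proof -
 note z = module_facts(2)[OF mod[OF U]]
 have "gmap enc U 0[S U] = 0[sections (prod_sheaf enc dec stk) U]"
  unfolding gmap_def prod_sheaf_simps enc_module_simps prod_module_simps
  by (intro arg_cong[where f = enc] restrict_ext germ_zero) (simp add: nbh_def U)
 moreover have "restr G U V s -[S V] restr G U V 0[S U] = restr G U V s" if V: "openin X V" "V <= U" for V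
  unfolding linear_hom_zero[OF psh_restr_hom[OF G U V] mod[OF U] mod[OF V(1)]]
  by (rule module_diff_zero[OF mod[OF V(1)] psh_restr_closed[OF G U V s]])
 ultimately show ?thesis using gmap_eq_iff[OF dec U s z] by (metis (no_types, lifting))
qed

end

section \<open>The Godement resolution\<close>

lemma germs_image:
 assumes G: "presheaf X G" and H: "presheaf X H" and phi: "sheaf_hom X G H phi"
 shows "germs X H (%U. phi U ` Sec G U)"
proof
 fix U assume U: "openin X U"
 note h = sheaf_homD(1)[OF phi U] and M = psh_mod[OF G U] and N = psh_mod[OF H U]
 show "phi U ` Sec G U <= Sec H U" using linear_homD(1)[OF h] by blast
 show "0[sections H U] \<in> phi U ` Sec G U"
  using linear_hom_zero[OF h M N] module_facts(2)[OF M] by (metis imageI)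
 show "x +[sections H U] y \<in> phi U ` Sec G U" if "x \<in> phi U ` Sec G U" "y \<in> phi U ` Sec G U" for x y
  using that linear_homD(2)[OF h, symmetric] module_facts(1)[OF M] by auto
 show "c *[sections H U] x \<in> phi U ` Sec G U" if "x \<in> phi U ` Sec G U" for c x
  using that linear_homD(3)[OF h, symmetric] module_facts(3)[OF M] by auto
 show "restr H U V x \<in> phi V ` Sec G V" if "openin X V" "V <= U" "x \<in> phi U ` Sec G U" for V x
  using that sheaf_homD(2)[OF phi U that(1,2), symmetric] psh_restr_closed[OF G U that(1,2)] by auto
qed (rule H)

text \<open>
 All terms of a resolution must have sections of the same type. A germ of a function on lists is a pair of
 an open set, stored by \<open>enc1\<close> at \<open>[p]\<close>, and a function, stored at the lists \<open>p # p # l\<close>.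
\<close>

definition enc0 :: "('p => 'a) => 'p list => 'a"
 where "enc0 g l = g (hd l)"

definition dec0 :: "('p list => 'a) => 'p => 'a"
 where "dec0 f p = f [p]"

definition enc1 :: "('p => 'a \<times> ('p list => 'a \<times> 'v)) => 'p list => 'a \<times> 'v"
 where "enc1 g l = (if length l = 1 then (fst (g (hd l)), undefined) else snd (g (hd l)) (tl (tl l)))"

definition dec1 :: "('p list => 'a \<times> 'v) => 'p => 'a \<times> ('p list => 'a \<times> 'v)"
 where "dec1 f p = (fst (f [p]), %l. f (p # p # l))"

lemma dec_enc: "dec0 (enc0 g) = g" "dec1 (enc1 h) = h"
 by (simp_all add: fun_eq_iff dec0_def enc0_def dec1_def enc1_def)

text \<open>Each term carries along the presheaf image of the preceding map, for the first one the
  zero presheaf. The next term is the sheaf of discontinuous sections of the cokernel; germs of the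
  presheaf image determine its stalks, so no cokernel sheaf is formed.\<close>

primrec godement :: "'p topology => ('p, 'k::field, 'v) sheaf_data => nat =>
  ('p, 'k, 'p list => 'p set \<times> 'v) sheaf_data \<times> ('p set => ('p list => 'p set \<times> 'v) set)"
 where
  "godement X F 0 = (let B = (%U. {0[sections F U]}) in
   (prod_sheaf enc0 dec0 (germs.stk X F B), %U. germs.gmap X F B enc0 U ` Sec F U))"
 | "godement X F (Suc n) = (case godement X F n of (G, B) =>
   (prod_sheaf enc1 dec1 (germs.stk X G B), %U. germs.gmap X G B enc1 U ` Sec G U))"

theorem flasque_resolution_exists:
 fixes F :: "('p, 'k::field, 'v) sheaf_data"
 assumes F: "sheaf X F"
 shows "\<exists>\<epsilon> (I :: nat => ('p, 'k, 'p list => 'p set \<times> 'v) sheaf_data) \<delta>. flasque_resolution X F \<epsilon> I \<delta>"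
proof -
 let ?B0 = "%U. {0[sections F U]}"
 note pF = sheaf_presheaf[OF F]
 have g0: "germs X F ?B0"
 proof
  fix U assume U: "openin X U"
  note m = psh_mod[OF pF U]
  show "x +[sections F U] y \<in> ?B0 U" if "x \<in> ?B0 U" "y \<in> ?B0 U" for x y
   using that module_facts(2,6)[OF m] by simp
  show "c *[sections F U] x \<in> ?B0 U" if "x \<in> ?B0 U" for x c
   using that module_facts(10)[OF m, of x c 0] module_facts(2,7)[OF m] by simp
  show "restr F U V x \<in> ?B0 V" if V: "openin X V" "V <= U" "x \<in> ?B0 U" for V x
   using V(3) linear_hom_zero[OF psh_restr_hom[OF pF U V(1,2)] m psh_mod[OF pF V(1)]] by simp
 qed (use pF module_facts(2)[OF psh_mod[OF pF]] in auto)
 define I where "I n = fst (godement X F n)" for n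
 define B where "B n = snd (godement X F n)" for n
 define \<epsilon> where "\<epsilon> = germs.gmap X F ?B0 (enc0 :: ('p => 'p set \<times> 'v) => _)"
 define \<delta> where "\<delta> n = germs.gmap X (I n) (B n) enc1" for n
 have I0: "I 0 = prod_sheaf enc0 dec0 (germs.stk X F ?B0)" and B0: "B 0 = (%U. \<epsilon> U ` Sec F U)"
  by (simp_all add: I_def B_def \<epsilon>_def Let_def)
 have I1: "I (Suc n) = prod_sheaf enc1 dec1 (germs.stk X (I n) (B n))" and B1: "B (Suc n) = (%U. \<delta> n U ` Sec (I n) U)" for n
  by (simp_all add: I_def B_def \<delta>_def split: prod.split)
 have \<epsilon>: "sheaf_hom X F (I 0) \<epsilon>" unfolding I0 \<epsilon>_def by (rule germs.gmap_hom[OF g0]) (simp add: dec_enc)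
 have fl0: "flasque X (I 0)" unfolding I0 by (rule flasque_prod_sheaf) (simp_all add: dec_enc germs.module_stk[OF g0])
 have fl1: "flasque X (I (Suc n))" if "germs X (I n) (B n)" for n
  unfolding I1 by (rule flasque_prod_sheaf) (simp_all add: dec_enc germs.module_stk[OF that])
 have \<delta>1: "sheaf_hom X (I n) (I (Suc n)) (\<delta> n)" if "germs X (I n) (B n)" for n
  unfolding I1 \<delta>_def by (rule germs.gmap_hom[OF that]) (simp add: dec_enc)
 have germs: "germs X (I n) (B n)" and fl: "flasque X (I n)" for n
 proof -
  have "germs X (I n) (B n) & flasque X (I n)"
  proof (induction n)
   case 0
   show ?case using germs_image[OF pF sheaf_presheaf[OF flasque_sheaf[OF fl0]] \<epsilon>] fl0 unfolding B0 by simp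
  next
   case (Suc n)
   have g: "germs X (I n) (B n)" using Suc by simp
   have "germs X (I (Suc n)) (B (Suc n))"
    unfolding B1
    by (rule germs_image[OF germs.G[OF g] sheaf_presheaf[OF flasque_sheaf[OF fl1[OF g]]] \<delta>1[OF g]])
   then show ?case using fl1[OF g] by simp
  qed
  then show "germs X (I n) (B n)" "flasque X (I n)" by simp_all
 qed
 \<comment> \<open>The kernel consists of the sections that lie locally in \<open>B n\<close>, the
   image of the preceding map; both exactness claims are instances.\<close>
 have ker: "\<delta> n U s = 0[sections (I (Suc n)) U] \<longleftrightarrow>
   (\<forall>x\<in>U. \<exists>V. openin X V & x \<in> V & V <= U & restr (I n) U V s \<in> B n V)"
  if "openin X U" "s \<in> Sec (I n) U" for n U s
  unfolding I1 \<delta>_def by (rule germs.gmap_eq_zero_iff[OF germs _ that]) (simp add: dec_enc)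
 have "flasque_resolution X F \<epsilon> I \<delta>"
  unfolding flasque_resolution_def
 proof (intro conjI allI impI F fl \<epsilon> \<delta>1[OF germs])
  fix U assume U: "openin X U"
  show "inj_on (\<epsilon> U) (Sec F U)"
  proof (rule inj_onI)
   fix s t assume s: "s \<in> Sec F U" and t: "t \<in> Sec F U" and eq: "\<epsilon> U s = \<epsilon> U t"
   have "\<exists>V. openin X V & p \<in> V & V <= U & restr F U V s = restr F U V t" if p: "p \<in> U" for p
   proof -
    have "\<forall>p\<in>U. \<exists>V. openin X V & p \<in> V & V <= U & restr F U V s -[sections F V] restr F U V t \<in> ?B0 V"
     by (rule iffD1[OF germs.gmap_eq_iff[OF g0 _ U s t] eq[unfolded \<epsilon>_def]]) (rule dec_enc(1))
    then obtain V where V: "openin X V" "p \<in> V" "V <= U" "restr F U V s -[sections F V] restr F U V t \<in> ?B0 V"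
     using p by blast
    then have "restr F U V s = restr F U V t"
     using module_diff_eq_0[OF psh_mod[OF pF V(1)]] psh_restr_closed[OF pF U V(1,3)] s t by simp
    then show ?thesis using V by blast
   qed
   then obtain V where V: "!!p. p \<in> U ==> openin X (V p)" "!!p. p \<in> U ==> p \<in> V p" "!!p. p \<in> U ==> V p <= U"
    "!!p. p \<in> U ==> restr F U (V p) s = restr F U (V p) t" by metis
   show "s = t" by (rule sheaf_locality[OF F V(1) _ s t V(4)]) (use V(2,3) in blast)+
  qed
 next
  show "sheaf_exact X F \<epsilon> (I 0) (\<delta> 0) (I 1)"
   unfolding sheaf_exact_def using ker[of _ _ 0] unfolding B0 by (auto simp: image_iff Bex_def eq_commute)
  show "sheaf_exact X (I n) (\<delta> n) (I (Suc n)) (\<delta> (Suc n)) (I (Suc (Suc n)))" for n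
   unfolding sheaf_exact_def using ker[of _ _ "Suc n"] unfolding B1 by (auto simp: image_iff Bex_def eq_commute)
 qed
 then show ?thesis by blast
qed

section \<open>Sheaf cohomology in terms of the initial ideal alone\<close>

context squarefree_degeneration
begin

text \<open>Every flasque resolution gives the Cech dimension, and Godement's shows that there is
  one. The right-hand side does not mention \<open>I\<close>, and for a given large \<open>N\<close>
  it leaves exactly one \<open>d\<close>.\<close>

theorem has_cohomology_dim_twisted:
 assumes N: "large N"
 shows "has_cohomology_dim (proj_top I) (twisted_sheaf I nu) i d \<longleftrightarrow>
  d = cochain.dim (kZ J nu N i) - cochain.dim (kB J nu N i)"
proof -
 have basis: "Y.DX j \<in> Y.\<B>" for j
  unfolding Y.\<B>_def using homog_xv[of j] zero_less_one by blast
 have "topspace (proj_top I) = (\<Union>j\<in>UNIV. Y.DX j)"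
  unfolding topspace_proj_top by (rule Y.pts_cover)
 from flasque_resolution_cohomology[OF Y.basis_twisted _ Y.cech_acyclic_twisted finite this basis]
 have "quotient_has_dim (sections (G i) (topspace (proj_top I))) (cocycles (proj_top I) G \<delta> i)
   (coboundaries (proj_top I) G \<delta> i) d \<longleftrightarrow> Y.std.cech_dim Y.F i d"
  if "flasque_resolution (proj_top I) Y.F \<epsilon> G \<delta>"
  for \<epsilon> and G :: "nat => (('n, 'k) proj_point, 'k, ('n, 'k) proj_point list => ('n, 'k) proj_point set \<times> ('n, 'k) proj_section) sheaf_data" and \<delta>
  using that unfolding topspace_proj_top by blast
 then show ?thesis
  using flasque_resolution_exists[OF Y.sheaf_twisted] cech_dim_twisted[OF N]
  unfolding has_cohomology_dim_def by blast
qed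

end

theorem corollary8p4:
  fixes I :: "('n::finite, 'k::field) mpol set"
    and mle :: "'n mon \<Rightarrow> 'n mon \<Rightarrow> bool"
    and \<omega> :: "'n \<Rightarrow> nat"
    and h :: "nat \<Rightarrow> int \<Rightarrow> nat"
  assumes "monomial_order mle"
    and "homogeneous_ideal I"
    and "squarefree_monomial_ideal (initial_ideal mle I)"
    and "weight_initial_ideal \<omega> I = initial_ideal mle I"
    and "\<And>i \<nu>. i < CARD('n) \<Longrightarrow> h i \<nu> = cohomology_dim (proj_top I) (twisted_sheaf I \<nu>) i"
  shows "\<forall>\<alpha>. fiber_ideal \<omega> I \<alpha> \<in> fiber_full_points h"
proof
 fix \<alpha> :: 'k
 let ?J = "initial_ideal mle I"
 have hom: "homogeneous_ideal (fiber_ideal \<omega> I \<alpha>)" by (rule homog_fiber_ideal[OF assms(2)])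
 have "has_cohomology_dim (proj_top (fiber_ideal \<omega> I \<alpha>)) (twisted_sheaf (fiber_ideal \<omega> I \<alpha>) nu) i (h i nu)"
  if i: "i < CARD('n)" for i nu
 proof -
  interpret general: squarefree_degeneration I ?J \<omega> nu
   by unfold_locales (use assms in auto)
  interpret fiber: squarefree_degeneration "fiber_ideal \<omega> I \<alpha>" ?J \<omega> nu
   by (rule squarefree_degeneration.intro[OF hom weight_initial_ideal_fiber_ideal[OF assms(2-4)] assms(3)])
  \<comment> \<open>The bound involves only \<omega> and \<open>nu\<close>, so this \<open>N\<close>
    is large for the fiber as well.\<close>
  obtain N where N: "general.large N" by (auto simp: general.large_def)
  note dim = general.has_cohomology_dim_twisted[OF N, of i]
  \<comment> \<open>The description in \<open>cohomology_dim\<close> is proper, because the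
    dimension is attained by exactly one number.\<close>
  have "h i nu = cochain.dim (kZ ?J nu N i) - cochain.dim (kB ?J nu N i)"
   unfolding assms(5)[OF i] cohomology_dim_def dim by simp
  then show ?thesis using fiber.has_cohomology_dim_twisted[of N i "h i nu"] N by simp
 qed
 then show "fiber_ideal \<omega> I \<alpha> \<in> fiber_full_points h" using hom by (simp add: fiber_full_points_def)
qed

end
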